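(* Let $f(x)=f(x_1,\ldots,x_n)$ be a nonzero polynomial in $\mathbf{C}[x_1,\ldots,x_n]$ satisfying $f(0)=0$. Suppose that $f$ is non-degenerated over $\mathbf{C}$ with respect to all the compact faces of its Newton polyhedron $\Gamma_f$. For a compact face $\tau$ of $\Gamma_f$ put $P_\tau=\{\rho\in\{1,\ldots,n\}\mid\tau\subseteq\{x_\rho=0\}\}$. Then the local motivic zeta function of $f$ is given by $$Z^{\mathrm{mot},0}_f(T)=\sum_{\tau:\,P_\tau=\emptyset}L_\tau S(\Delta_\tau)+\sum_{\tau:\,P_\tau\neq\emptyset}L'_\tau S(\Delta_\tau)'\in\mathcal{M}_{\mathbf{C}}[[T]],$$ where both sums are over compact faces $\tau$ of $\Gamma_f$ and the terms are as follows. (a) If $P_\tau=\emptyset$ (i.e. $\tau$ is not contained in any coordinate hyperplane), then $$L_\tau=(1-\mathbb{L}^{-1})^n-\mathbb{L}^{-n}[\mathcal{X}_\tau]\frac{1-T}{1-\mathbb{L}^{-1}T},\qquad\mathcal{X}_\tau=\{x\in(\mathbf{C}^\times)^n\mid f_\tau(x)=0\},$$ $$S(\Delta_\tau)=\sum_{k\in\mathbf{Z}^n\cap\Delta_\tau}\mathbb{L}^{-\sigma(k)}T^{m(k)}=\sum_{i\in I}\frac{\tilde\Sigma(\delta_i)}{\prod_{j\in J_i}\bigl(1-\mathbb{L}^{-\sigma(v_j)}T^{m(v_j)}\bigr)},\qquad\tilde\Sigma(\delta_i)=\sum_h\mathbb{L}^{-\sigma(h)}T^{m(h)}\in\mathcal{M}_{\mathbf{C}}[T],$$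 where $\{\delta_i\}_{i\in I}$ is any chosen decomposition of the cone $\Delta_\tau$ into simplicial cones without introducing new rays, $\delta_i$ is strictly positively spanned by the linearly independent primitive vectors $v_j\in\mathbf{Z}_{\geqslant0}^n\setminus\{0\}$, $j\in J_i$, and $h$ runs through $\mathbf{Z}^n\cap\{\sum_{j\in J_i}h_jv_j\mid h_j\in(0,1]\text{ for all }j\in J_i\}$. (b) If $P_\tau\neq\emptyset$, then $f_\tau$ only depends on the variables $x_\rho$, $\rho\notin P_\tau$, and $$L'_\tau=(1-\mathbb{L}^{-1})^{n-|P_\tau|}-\mathbb{L}^{-(n-|P_\tau|)}[\mathcal{X}'_\tau]\frac{1-T}{1-\mathbb{L}^{-1}T},\qquad\mathcal{X}'_\tau=\{(x_\rho)_{\rho\notin P_\tau}\in(\mathbf{C}^\times)^{n-|P_\tau|}\mid f_\tau((x_\rho)_{\rho\notin P_\tau})=0\}.$$ With $(e_\rho)_{1\leqslant\rho\leqslant n}$ the standard basis of $\mathbf{R}^n$, the cone $\Delta_\tau$ is strictly positively spanned by the vectors $e_\rho$, $\rho\in P_\tau$, and one or more other primitive vectors $v_j\in\mathbf{Z}_{\geqslant0}^n\setminus\{0\}$, $j\in J_\tau$. Choose any decomposition $\{\delta_i\}_{i\in I}$ of $\Delta_\tau$ into simplicial cones without introducing new rays, $\delta_i$ being strictly positively spanned by the linearly independent vectors $e_\rho$ ($\rho\in P_i$), $v_j$ ($j\in J_i$), with $\emptyset\subseteq P_i\subseteq P_\tau$ and $\emptyset\subsetneq J_i\subseteq J_\tau$,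 and put $\delta_i'=\{\sum_{\rho\in P_i}h_\rho e_\rho+\sum_{j\in J_i}\lambda_jv_j\mid h_\rho\in(0,1],\lambda_j\in\mathbf{R}_{>0}\text{ for all }\rho,j\}\subseteq\delta_i$. Then $$S(\Delta_\tau)'=\sum_{i\in I}(1-\mathbb{L}^{-1})^{|P_\tau|-|P_i|}\sum_{k\in\mathbf{Z}^n\cap\delta_i'}\mathbb{L}^{-\sigma(k)}T^{m(k)}=\sum_{i\in I}(1-\mathbb{L}^{-1})^{|P_\tau|-|P_i|}\frac{\tilde\Sigma(\delta_i)}{\prod_{j\in J_i}\bigl(1-\mathbb{L}^{-\sigma(v_j)}T^{m(v_j)}\bigr)},$$ with $\tilde\Sigma(\delta_i)=\sum_h\mathbb{L}^{-\sigma(h)}T^{m(h)}\in\mathcal{M}_{\mathbf{C}}[T]$, where $h$ runs through $\mathbf{Z}^n\cap\{\sum_{\rho\in P_i}h_\rho e_\rho+\sum_{j\in J_i}h_jv_j\mid h_\rho,h_j\in(0,1]\text{ for all }\rho,j\}$. (In both cases all integers $m(v_j)$ occurring in the denominators are positive, so that the fractions are elements of $\mathcal{M}_{\mathbf{C}}[[T]]$ via geometric series expansion.)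
   Context: Newton polyhedron: for a nonzero polynomial $f=\sum_{\omega\in\mathbf{Z}_{\geqslant0}^n}a_\omega x^\omega$ with $f(0)=0$, put $\mathrm{supp}(f)=\{\omega\mid a_\omega\neq0\}$; $\Gamma_f$ is the convex hull of $\bigcup_{\omega\in\mathrm{supp}(f)}(\omega+\mathbf{R}_{\geqslant0}^n)$. Faces of $\Gamma_f$ are $\Gamma_f$ itself and its intersections with supporting hyperplanes. For a face $\tau$, $f_\tau(x)=\sum_{\omega\in\tau}a_\omega x^\omega$. $f$ is non-degenerated over $\mathbf{C}$ with respect to all the compact faces of $\Gamma_f$ if for every compact face $\tau$, $f_\tau$ and all its partial derivatives have no common zero in $(\mathbf{C}^\times)^n$. For $k\in\mathbf{R}_{\geqslant0}^n$: $m(k)=\inf_{x\in\Gamma_f}k\cdot x$, $\sigma(k)=k_1+\cdots+k_n$, and $F(k)=\{x\in\Gamma_f\mid k\cdot x=m(k)\}$. For a face $\tau$, $\Delta_\tau=\{k\in\mathbf{R}_{\geqslant0}^n\mid F(k)=\tau\}$ is the cone associated to $\tau$. For proper $\tau$ it equals the set of all linear combinations with strictly positive coefficients ("strictly positively spanned") of the primitive vectors in $\mathbf{Z}_{\geqslant0}^n\setminus\{0\}$ (integer components with gcd one) perpendicular to the facets of $\Gamma_f$ containing $\tau$. A decomposition of $\Delta_\tau$ into simplicial cones without introducing new rays is a finite partition of $\Delta_\tau$ into cones each strictly positively spanned by an $\mathbf{R}$-linearly independent subset of these primitive vectors. Grothendieck ring: $K_0(Var_{\mathbf{C}})$ is the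 abelian group generated by isomorphism classes $[X]$ of complex algebraic varieties modulo $[X]=[X\setminus Y]+[Y]$ for $Y$ Zariski-closed in $X$, with product $[X]\cdot[Y]=[X\times Y]$; $\mathbb{L}=[\mathbf{A}^1(\mathbf{C})]$ and $\mathcal{M}_{\mathbf{C}}=K_0(Var_{\mathbf{C}})[\mathbb{L}^{-1}]$. Constructible subsets of varieties have well-defined classes by additivity. Local motivic zeta function: for $l\in\mathbf{Z}_{>0}$ put $\mathcal{X}^0_l=\{\varphi+(t^{l+1}\mathbf{C}[t])^n\in(t\mathbf{C}[t]/t^{l+1}\mathbf{C}[t])^n\mid\mathrm{ord}_tf(\varphi)=l\}$ (with $(t\mathbf{C}[t]/t^{l+1}\mathbf{C}[t])^n$ identified with $\mathbf{A}^{nl}(\mathbf{C})$ via coefficients). Then $Z^{\mathrm{mot},0}_f(T)=\mathbb{L}^{-n}\sum_{l\geqslant1}[\mathcal{X}^0_l](\mathbb{L}^{-n}T)^l\in\mathcal{M}_{\mathbf{C}}[[T]]$. *)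

theory Defs
  imports
    "HOL-Analysis.Analysis"
    "HOL-Library.Poly_Mapping"
    "HOL-Library.Multiset"
    "HOL-Computational_Algebra.Computational_Algebra"
begin

section \<open>Polynomials in several variables\<close>

text \<open>
  A polynomial with variables indexed by \<open>'i\<close> is the finitely supported family of its
  coefficients, indexed by the exponents \<open>\<omega> :: 'i \<Rightarrow>\<^sub>0 nat\<close>.
\<close>

type_synonym 'i cpoly = "('i \<Rightarrow>\<^sub>0 nat) \<Rightarrow>\<^sub>0 complex"

text \<open>Evaluation in a commutative \<open>\<complex>\<close>-algebra with structure map \<open>c\<close>.\<close>

definition mpoly_eval_in :: "(complex \<Rightarrow> 'r::comm_ring_1) \<Rightarrow> 'i cpoly \<Rightarrow> ('i \<Rightarrow> 'r) \<Rightarrow> 'r" where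
  "mpoly_eval_in c p x =
     (\<Sum>\<omega>\<in>Poly_Mapping.keys p. c (Poly_Mapping.lookup p \<omega>) *
        (\<Prod>i\<in>Poly_Mapping.keys \<omega>. x i ^ Poly_Mapping.lookup \<omega> i))"

abbreviation mpoly_eval :: "'i cpoly \<Rightarrow> ('i \<Rightarrow> complex) \<Rightarrow> complex" where
  "mpoly_eval \<equiv> mpoly_eval_in (\<lambda>c. c)"

text \<open>If \<open>\<omega> i = 0\<close>, the truncated subtraction is harmless: the coefficient is \<open>0\<close>.\<close>

definition partial_deriv :: "'i \<Rightarrow> 'i cpoly \<Rightarrow> 'i cpoly" where
  "partial_deriv i p =
     (\<Sum>\<omega>\<in>Poly_Mapping.keys p. Poly_Mapping.single (\<omega> - Poly_Mapping.single i 1)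
        (of_nat (Poly_Mapping.lookup \<omega> i) * Poly_Mapping.lookup p \<omega>))"


section \<open>Complex algebraic varieties\<close>

text \<open>
  Varieties (not necessarily irreducible) are taken in the sense of Serre: a set of points with a
  Zariski topology and a sheaf of complex-valued regular functions.  \<open>reg X U\<close> is the set of
  functions that are regular on the open set \<open>U\<close>; only their values on \<open>U\<close> matter.
\<close>

record 'a fspace =
  zar :: "'a topology"
  reg :: "'a set \<Rightarrow> ('a \<Rightarrow> complex) set"

abbreviation points :: "'a fspace \<Rightarrow> 'a set" where
  "points X \<equiv> topspace (zar X)"

definition sheaf_of_functions :: "'a fspace \<Rightarrow> bool" where
  "sheaf_of_functions X \<longleftrightarrow>
     (\<forall>U V g. openin (zar X) U \<and> openin (zar X) V \<and> V \<subseteq> U \<and> g \<in> reg X U \<longrightarrow> g \<in> reg X V) \<and>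
     (\<forall>U g. openin (zar X) U \<and>
        (\<forall>x\<in>U. \<exists>V h. openin (zar X) V \<and> x \<in> V \<and> V \<subseteq> U \<and> h \<in> reg X V \<and> (\<forall>y\<in>V. g y = h y))
        \<longrightarrow> g \<in> reg X U)"

definition morphism :: "'a fspace \<Rightarrow> 'b fspace \<Rightarrow> ('a \<Rightarrow> 'b) \<Rightarrow> bool" where
  "morphism X Y \<phi> \<longleftrightarrow> continuous_map (zar X) (zar Y) \<phi> \<and>
     (\<forall>V. openin (zar Y) V \<longrightarrow>
        (\<forall>g\<in>reg Y V. (\<lambda>x. g (\<phi> x)) \<in> reg X {x \<in> points X. \<phi> x \<in> V}))"

definition isomorphic :: "'a fspace \<Rightarrow> 'b fspace \<Rightarrow> bool" where
  "isomorphic X Y \<longleftrightarrow> (\<exists>\<phi> \<psi>. morphism X Y \<phi> \<and> morphism Y X \<psi> \<and>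
     (\<forall>x\<in>points X. \<psi> (\<phi> x) = x) \<and> (\<forall>y\<in>points Y. \<phi> (\<psi> y) = y))"

text \<open>
  The structure induced on a subset: functions that locally are restrictions of regular functions
  on the ambient space.  For open subsets this is the restricted sheaf, for closed subsets the
  reduced closed structure.
\<close>

definition subspace_of :: "'a fspace \<Rightarrow> 'a set \<Rightarrow> 'a fspace" where
  "subspace_of X S =
     \<lparr>zar = subtopology (zar X) S,
      reg = (\<lambda>U. {g. \<forall>x\<in>U. \<exists>V h. openin (zar X) V \<and> x \<in> V \<and> h \<in> reg X V \<and>
                       (\<forall>y\<in>U \<inter> V. g y = h y)})\<rparr>"

text \<open>
  Affine space with coordinates indexed by a finite set \<open>I\<close>.  Its points are the families
  vanishing outside \<open>I\<close>, the sets \<open>{x. p x \<noteq> 0}\<close> form a base of its topology, and its regular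
  functions are those that are locally quotients of polynomials.
\<close>

definition affine_points :: "'i set \<Rightarrow> ('i \<Rightarrow> complex) set" where
  "affine_points I = {x. \<forall>i. i \<notin> I \<longrightarrow> x i = 0}"

definition zariski :: "'i set \<Rightarrow> ('i \<Rightarrow> complex) topology" where
  "zariski I = topology_generated_by (range (\<lambda>p. {x \<in> affine_points I. mpoly_eval p x \<noteq> 0}))"

definition affine_space :: "'i set \<Rightarrow> ('i \<Rightarrow> complex) fspace" where
  "affine_space I =
     \<lparr>zar = zariski I,
      reg = (\<lambda>U. {g. \<forall>x\<in>U. \<exists>V p q. openin (zariski I) V \<and> x \<in> V \<and>
                       (\<forall>y\<in>U \<inter> V. mpoly_eval q y \<noteq> 0 \<and> g y = mpoly_eval p y / mpoly_eval q y)})\<rparr>"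

definition affine_variety :: "'a fspace \<Rightarrow> bool" where
  "affine_variety X \<longleftrightarrow> (\<exists>m Z. closedin (zariski {..<m::nat}) Z \<and>
     isomorphic X (subspace_of (affine_space {..<m}) Z))"

text \<open>
  The product of two prevarieties: on a product of opens \<open>U \<times> V\<close> one has the functions
  \<open>\<Sum>i<r. u i x * v i y\<close> with \<open>u i\<close> regular on \<open>U\<close> and \<open>v i\<close> regular on \<open>V\<close>; their
  non-vanishing loci form a base of the topology and regular functions are locally quotients of
  such functions.
\<close>

definition tensor_functions ::
  "'a fspace \<Rightarrow> 'b fspace \<Rightarrow> 'a set \<Rightarrow> 'b set \<Rightarrow> ('a \<times> 'b \<Rightarrow> complex) set" where
  "tensor_functions X Y U V =
     {(\<lambda>z. \<Sum>i<r. u i (fst z) * v i (snd z)) |(r::nat) u v.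
        \<forall>i<r. u i \<in> reg X U \<and> v i \<in> reg Y V}"

definition prod_zar :: "'a fspace \<Rightarrow> 'b fspace \<Rightarrow> ('a \<times> 'b) topology" where
  "prod_zar X Y = topology_generated_by
     {{z \<in> U \<times> V. h z \<noteq> 0} |U V h.
        openin (zar X) U \<and> openin (zar Y) V \<and> h \<in> tensor_functions X Y U V}"

definition prod_space :: "'a fspace \<Rightarrow> 'b fspace \<Rightarrow> ('a \<times> 'b) fspace" where
  "prod_space X Y =
     \<lparr>zar = prod_zar X Y,
      reg = (\<lambda>W. {g. \<forall>z\<in>W. \<exists>U V p q. openin (zar X) U \<and> openin (zar Y) V \<and> z \<in> U \<times> V \<and>
                       p \<in> tensor_functions X Y U V \<and> q \<in> tensor_functions X Y U V \<and> q z \<noteq> 0 \<and>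
                       (\<forall>w\<in>W \<inter> U \<times> V. q w \<noteq> 0 \<longrightarrow> g w = p w / q w)})\<rparr>"

definition prevariety :: "'a fspace \<Rightarrow> bool" where
  "prevariety X \<longleftrightarrow> sheaf_of_functions X \<and>
     (\<exists>\<U>. finite \<U> \<and> \<Union>\<U> = points X \<and>
        (\<forall>U\<in>\<U>. openin (zar X) U \<and> affine_variety (subspace_of X U)))"

definition variety :: "'a fspace \<Rightarrow> bool" where
  "variety X \<longleftrightarrow> prevariety X \<and>
     closedin (zar (prod_space X X)) {(x, x) |x. x \<in> points X}"


section \<open>The Grothendieck ring\<close>

text \<open>
  Every variety has at most continuum many points, hence is isomorphic to one whose points are
  taken from \<open>nat \<Rightarrow> complex\<close>.
\<close>

typedef cvar = "{X :: (nat \<Rightarrow> complex) fspace. variety X}"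
proof
  define E :: "(nat \<Rightarrow> complex) fspace" where "E = subspace_of (affine_space {}) {}"
  have pts: "points E = {}"
    by (simp add: E_def subspace_of_def)
  then have "prevariety E"
    unfolding prevariety_def sheaf_of_functions_def
    by (auto simp: E_def subspace_of_def openin_subtopology intro!: exI[of _ "{}"])
  with pts show "E \<in> {X. variety X}"
    by (simp add: variety_def)
qed

text \<open>
  The free commutative ring on all varieties is the monoid ring of the free commutative monoid
  \<open>cvar multiset\<close>.  Dividing out the ideal generated by the relations
  \<open>[X] = [Y]\<close> for \<open>X \<cong> Y\<close>, \<open>[X] = [X \<setminus> Y] + [Y]\<close> for \<open>Y\<close> closed in \<open>X\<close>,
  \<open>[X \<times> Y] = [X] [Y]\<close> and \<open>[point] = 1\<close> yields \<open>K\<^sub>0(Var)\<close>: the last two relations reduce every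
  element to a \<open>\<int>\<close>-linear combination of classes, on which they prescribe the product.
\<close>

type_synonym free_ring = "cvar multiset \<Rightarrow>\<^sub>0 int"

definition gen :: "cvar \<Rightarrow> free_ring" where
  "gen X = Poly_Mapping.single {#X#} 1"

inductive_set k0_ideal :: "free_ring set" where
  zero: "0 \<in> k0_ideal"
| add: "a \<in> k0_ideal \<Longrightarrow> b \<in> k0_ideal \<Longrightarrow> a + b \<in> k0_ideal"
| mult: "a \<in> k0_ideal \<Longrightarrow> r * a \<in> k0_ideal"
| iso: "isomorphic (Rep_cvar X) (Rep_cvar Y) \<Longrightarrow> gen X - gen Y \<in> k0_ideal"
| scissor: "closedin (zar (Rep_cvar X)) S \<Longrightarrow>
    Rep_cvar Y = subspace_of (Rep_cvar X) S \<Longrightarrow>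
    Rep_cvar U = subspace_of (Rep_cvar X) (points (Rep_cvar X) - S) \<Longrightarrow>
    gen X - (gen U + gen Y) \<in> k0_ideal"
| prod: "isomorphic (Rep_cvar W) (prod_space (Rep_cvar X) (Rep_cvar Y)) \<Longrightarrow>
    gen W - gen X * gen Y \<in> k0_ideal"
| point: "isomorphic (Rep_cvar X) (affine_space ({} :: nat set)) \<Longrightarrow> gen X - 1 \<in> k0_ideal"

lemma k0_ideal_uminus: "a \<in> k0_ideal \<Longrightarrow> - a \<in> k0_ideal"
  using k0_ideal.mult[of a "- 1"] by simp

lemma k0_ideal_mult_diff:
  assumes "a - b \<in> k0_ideal" "c - d \<in> k0_ideal"
  shows "a * c - b * d \<in> k0_ideal"
proof -
  have "a * c - b * d = c * (a - b) + b * (c - d)"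
    by (simp add: algebra_simps)
  then show ?thesis
    using assms by (simp add: k0_ideal.add k0_ideal.mult)
qed

quotient_type k0 = free_ring / "\<lambda>a b. a - b \<in> k0_ideal"
proof (rule equivpI)
  show "reflp (\<lambda>a b. a - b \<in> k0_ideal)"
    by (simp add: reflp_def k0_ideal.zero)
  show "symp (\<lambda>a b. a - b \<in> k0_ideal)"
    by (metis (no_types, lifting) k0_ideal_uminus minus_diff_eq sympI)
  show "transp (\<lambda>a b. a - b \<in> k0_ideal)"
  proof (rule transpI)
    fix a b c :: free_ring
    assume "a - b \<in> k0_ideal" "b - c \<in> k0_ideal"
    from k0_ideal.add[OF this] show "a - c \<in> k0_ideal"
      by simp
  qed
qed

text \<open>
  The type class \<open>comm_ring_1\<close> includes \<open>0 \<noteq> 1\<close>, which is not needed here and would require a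
  realisation such as the Euler characteristic; the sort \<open>{comm_ring, comm_monoid_mult}\<close> is that of
  possibly trivial commutative rings with unit.
\<close>

instantiation k0 :: "{comm_ring, comm_monoid_mult}"
begin

lift_definition zero_k0 :: k0 is 0 .
lift_definition one_k0 :: k0 is 1 .
lift_definition plus_k0 :: "k0 \<Rightarrow> k0 \<Rightarrow> k0" is "(+)"
  by (metis (no_types, lifting) add_diff_add k0_ideal.add)
lift_definition uminus_k0 :: "k0 \<Rightarrow> k0" is uminus
  by (metis (no_types, lifting) k0_ideal_uminus minus_diff_eq minus_diff_minus)
lift_definition minus_k0 :: "k0 \<Rightarrow> k0 \<Rightarrow> k0" is "(-)"
proof -
  fix a b c d :: free_ring
  assume "a - b \<in> k0_ideal" "c - d \<in> k0_ideal"
  then have "(a - b) + - (c - d) \<in> k0_ideal"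
    by (intro k0_ideal.add k0_ideal_uminus)
  then show "(a - c) - (b - d) \<in> k0_ideal"
    by (simp add: algebra_simps)
qed
lift_definition times_k0 :: "k0 \<Rightarrow> k0 \<Rightarrow> k0" is "(*)"
  by (rule k0_ideal_mult_diff)

instance
  by standard (transfer; simp add: algebra_simps k0_ideal.zero)+

end

lift_definition k0_gen :: "cvar \<Rightarrow> k0" is gen .

text \<open>
  The class \<open>[X]\<close> of a variety with points in an arbitrary type, through an isomorphic copy in
  \<open>cvar\<close>.  It is only used for varieties.
\<close>

definition k0_class :: "'a fspace \<Rightarrow> k0" where
  "k0_class X = k0_gen (SOME W. isomorphic (Rep_cvar W) X)"

definition lefschetz_k0 :: k0 where
  "lefschetz_k0 = k0_class (affine_space {0::nat})"

text \<open>
  The localisation \<open>K\<^sub>0(Var)[\<L>\<^sup>-\<^sup>1]\<close>: the pair \<open>(a, i)\<close> represents \<open>a / \<L>\<^sup>i\<close>.  As \<open>\<L>\<close> is a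
  zero divisor, fractions are compared after multiplication by a power of \<open>\<L>\<close>.
\<close>

definition frac_eq :: "k0 \<times> nat \<Rightarrow> k0 \<times> nat \<Rightarrow> bool" where
  "frac_eq x y \<longleftrightarrow>
     (\<exists>r. lefschetz_k0 ^ (r + snd y) * fst x = lefschetz_k0 ^ (r + snd x) * fst y)"

lemma frac_eq_iff:
  "frac_eq (a, i) (b, j) \<longleftrightarrow> (\<exists>r. lefschetz_k0 ^ (r + j) * a = lefschetz_k0 ^ (r + i) * b)"
  by (simp add: frac_eq_def)

lemma frac_eq_trans:
  assumes "frac_eq x y" "frac_eq y z"
  shows "frac_eq x z"
proof -
  let ?L = lefschetz_k0
  obtain a i b j c l where xyz: "x = (a, i)" "y = (b, j)" "z = (c, l)"
    by (metis surj_pair)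
  from assms obtain r s where r: "?L ^ (r + j) * a = ?L ^ (r + i) * b"
    and s: "?L ^ (s + l) * b = ?L ^ (s + j) * c"
    by (auto simp: xyz frac_eq_iff)
  have "?L ^ ((r + s + j) + l) * a = ?L ^ (s + l) * (?L ^ (r + j) * a)"
    by (simp add: power_add ac_simps)
  also have "\<dots> = ?L ^ (s + l) * (?L ^ (r + i) * b)"
    by (simp only: r)
  also have "\<dots> = ?L ^ (r + i) * (?L ^ (s + l) * b)"
    by (simp only: mult.left_commute)
  also have "\<dots> = ?L ^ (r + i) * (?L ^ (s + j) * c)"
    by (simp only: s)
  also have "\<dots> = ?L ^ ((r + s + j) + i) * c"
    by (simp add: power_add ac_simps)
  finally show ?thesis
    unfolding xyz frac_eq_iff by blast
qed

quotient_type mot = "k0 \<times> nat" / frac_eq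
proof (rule equivpI)
  show "reflp frac_eq"
    by (simp add: reflp_def frac_eq_def)
  show "symp frac_eq"
    unfolding symp_def frac_eq_def by metis
  show "transp frac_eq"
    using frac_eq_trans by (blast intro: transpI)
qed

instantiation mot :: "{comm_ring, comm_monoid_mult}"
begin

lift_definition zero_mot :: mot is "(0, 0)" .
lift_definition one_mot :: mot is "(1, 0)" .
lift_definition plus_mot :: "mot \<Rightarrow> mot \<Rightarrow> mot" is
  "\<lambda>(a, i) (b, j). (lefschetz_k0 ^ j * a + lefschetz_k0 ^ i * b, i + j)"
proof -
  let ?L = lefschetz_k0
  fix x x' y y' :: "k0 \<times> nat"
  assume *: "frac_eq x x'" "frac_eq y y'"
  obtain a i a' i' b j b' j' where
    xy: "x = (a, i)" "x' = (a', i')" "y = (b, j)" "y' = (b', j')"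
    by (metis surj_pair)
  from * obtain r s where r: "?L ^ (r + i') * a = ?L ^ (r + i) * a'"
    and s: "?L ^ (s + j') * b = ?L ^ (s + j) * b'"
    by (auto simp: xy frac_eq_iff)
  have "?L ^ ((r + s) + (i' + j')) * (?L ^ j * a + ?L ^ i * b) =
      ?L ^ (s + j + j') * (?L ^ (r + i') * a) + ?L ^ (r + i + i') * (?L ^ (s + j') * b)"
    by (simp add: power_add algebra_simps)
  also have "\<dots> =
      ?L ^ (s + j + j') * (?L ^ (r + i) * a') + ?L ^ (r + i + i') * (?L ^ (s + j) * b')"
    by (simp only: r s)
  also have "\<dots> = ?L ^ ((r + s) + (i + j)) * (?L ^ j' * a' + ?L ^ i' * b')"
    by (simp add: power_add algebra_simps)
  finally show "frac_eq
      ((\<lambda>(a, i) (b, j). (?L ^ j * a + ?L ^ i * b, i + j)) x y)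
      ((\<lambda>(a, i) (b, j). (?L ^ j * a + ?L ^ i * b, i + j)) x' y')"
    unfolding xy by (auto simp only: frac_eq_iff prod.case)
qed
lift_definition uminus_mot :: "mot \<Rightarrow> mot" is "\<lambda>(a, i). (- a, i)"
  by (auto simp: frac_eq_iff)
lift_definition times_mot :: "mot \<Rightarrow> mot \<Rightarrow> mot" is "\<lambda>(a, i) (b, j). (a * b, i + j)"
proof -
  let ?L = lefschetz_k0
  fix x x' y y' :: "k0 \<times> nat"
  assume *: "frac_eq x x'" "frac_eq y y'"
  obtain a i a' i' b j b' j' where
    xy: "x = (a, i)" "x' = (a', i')" "y = (b, j)" "y' = (b', j')"
    by (metis surj_pair)
  from * obtain r s where r: "?L ^ (r + i') * a = ?L ^ (r + i) * a'"
    and s: "?L ^ (s + j') * b = ?L ^ (s + j) * b'"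
    by (auto simp: xy frac_eq_iff)
  have "?L ^ ((r + s) + (i' + j')) * (a * b) = (?L ^ (r + i') * a) * (?L ^ (s + j') * b)"
    by (simp add: power_add ac_simps)
  also have "\<dots> = (?L ^ (r + i) * a') * (?L ^ (s + j) * b')"
    by (simp only: r s)
  also have "\<dots> = ?L ^ ((r + s) + (i + j)) * (a' * b')"
    by (simp add: power_add ac_simps)
  finally show "frac_eq
      ((\<lambda>(a, i) (b, j). (a * b, i + j)) x y) ((\<lambda>(a, i) (b, j). (a * b, i + j)) x' y')"
    unfolding xy by (auto simp only: frac_eq_iff prod.case)
qed
definition minus_mot :: "mot \<Rightarrow> mot \<Rightarrow> mot" where
  "minus_mot x y = x + - y"

instance
proof
  show "a + b + c = a + (b + c)" for a b c :: mot
    by transfer (auto simp: frac_eq_iff power_add algebra_simps)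
  show "a + b = b + a" for a b :: mot
    by transfer (auto simp: frac_eq_iff ac_simps)
  show "0 + a = a" for a :: mot
    by transfer (auto simp: frac_eq_iff)
  show "- a + a = 0" for a :: mot
    by transfer (auto simp: frac_eq_iff)
  show "a - b = a + - b" for a b :: mot
    by (simp add: minus_mot_def)
  show "a * b * c = a * (b * c)" for a b c :: mot
    by transfer (auto simp: frac_eq_iff ac_simps)
  show "a * b = b * a" for a b :: mot
    by transfer (auto simp: frac_eq_iff ac_simps)
  show "(a + b) * c = a * c + b * c" for a b c :: mot
    by transfer (auto simp: frac_eq_iff power_add algebra_simps)
  show "1 * a = a" for a :: mot
    by transfer (auto simp: frac_eq_iff)
qed

end

definition mot_of_k0 :: "k0 \<Rightarrow> mot" where
  "mot_of_k0 a = abs_mot (a, 0)"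

definition lefschetz_inv :: mot (\<open>\<L>\<^sup>-\<^sup>1\<close>) where
  "\<L>\<^sup>-\<^sup>1 = abs_mot (1, 1)"

lemma lefschetz_inv_mult: "mot_of_k0 lefschetz_k0 * \<L>\<^sup>-\<^sup>1 = 1"
  by (simp add: mot_of_k0_def lefschetz_inv_def times_mot.abs_eq one_mot.abs_eq mot.abs_eq_iff
      frac_eq_iff ac_simps)

text \<open>The class of a locally closed subset \<open>S\<close> of the affine space with coordinates \<open>I\<close>.\<close>

definition mot_class :: "'i set \<Rightarrow> ('i \<Rightarrow> complex) set \<Rightarrow> mot" where
  "mot_class I S = mot_of_k0 (k0_class (subspace_of (affine_space I) S))"


section \<open>Power series over a possibly trivial ring\<close>

text \<open>The library only makes \<open>fps\<close> a multiplicative monoid over rings with \<open>0 \<noteq> 1\<close>.\<close>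

instance fps :: ("{semiring_0, monoid_mult}") monoid_mult
  by standard
    (simp_all add: fps_ext fps_mult_nth if_distrib[of "\<lambda>x. _ * x"] if_distrib[of "\<lambda>x. x * _"]
      sum.delta sum.delta' cong: if_cong)

instance fps :: ("{comm_semiring_0, comm_monoid_mult}") comm_monoid_mult
  by standard simp

text \<open>
  \<open>1 / (1 - g)\<close> for a series \<open>g\<close> without constant term, by \<open>T\<close>-adic convergence of the geometric
  series.
\<close>

definition geom :: "mot fps \<Rightarrow> mot fps" where
  "geom g = suminf (\<lambda>j. g ^ j)"


section \<open>Newton polyhedra\<close>

definition nonneg_orthant :: "(real ^ 'n) set" where
  "nonneg_orthant = {k. \<forall>i. 0 \<le> k $ i}"

definition integer_points :: "(real ^ 'n) set" where
  "integer_points = {k. \<forall>i. k $ i \<in> \<int>}"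

definition exponent_vec :: "('n::finite \<Rightarrow>\<^sub>0 nat) \<Rightarrow> real ^ 'n" where
  "exponent_vec \<omega> = (\<chi> i. real (Poly_Mapping.lookup \<omega> i))"

definition newton_polyhedron :: "'n::finite cpoly \<Rightarrow> (real ^ 'n) set" where
  "newton_polyhedron f =
     convex hull (\<Union>\<omega>\<in>Poly_Mapping.keys f. (\<lambda>r. exponent_vec \<omega> + r) ` nonneg_orthant)"

text \<open>
  Supporting hyperplanes meet the polyhedron, so the empty set is excluded; the polyhedron is an
  exposed face of itself.
\<close>

definition newton_faces :: "'n::finite cpoly \<Rightarrow> (real ^ 'n) set set" where
  "newton_faces f = {\<tau>. \<tau> \<noteq> {} \<and> \<tau> exposed_face_of newton_polyhedron f}"

definition compact_faces :: "'n::finite cpoly \<Rightarrow> (real ^ 'n) set set" where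
  "compact_faces f = {\<tau> \<in> newton_faces f. compact \<tau>}"

definition face_poly :: "'n::finite cpoly \<Rightarrow> (real ^ 'n) set \<Rightarrow> 'n cpoly" where
  "face_poly f \<tau> =
     (\<Sum>\<omega> | \<omega> \<in> Poly_Mapping.keys f \<and> exponent_vec \<omega> \<in> \<tau>.
        Poly_Mapping.single \<omega> (Poly_Mapping.lookup f \<omega>))"

definition nondegenerate :: "'n::finite cpoly \<Rightarrow> bool" where
  "nondegenerate f \<longleftrightarrow>
     (\<forall>\<tau>\<in>compact_faces f. \<nexists>x. (\<forall>i. x i \<noteq> 0) \<and> mpoly_eval (face_poly f \<tau>) x = 0 \<and>
        (\<forall>i. mpoly_eval (partial_deriv i (face_poly f \<tau>)) x = 0))"

definition newton_m :: "'n::finite cpoly \<Rightarrow> real ^ 'n \<Rightarrow> real" where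
  "newton_m f k = (INF x\<in>newton_polyhedron f. k \<bullet> x)"

definition sigma_sum :: "real ^ 'n::finite \<Rightarrow> real" where
  "sigma_sum k = (\<Sum>i\<in>UNIV. k $ i)"

definition first_meet_locus :: "'n::finite cpoly \<Rightarrow> real ^ 'n \<Rightarrow> (real ^ 'n) set" where
  "first_meet_locus f k = {x \<in> newton_polyhedron f. k \<bullet> x = newton_m f k}"

definition face_cone :: "'n::finite cpoly \<Rightarrow> (real ^ 'n) set \<Rightarrow> (real ^ 'n) set" where
  "face_cone f \<tau> = {k \<in> nonneg_orthant. first_meet_locus f k = \<tau>}"

definition zero_coords :: "(real ^ 'n) set \<Rightarrow> 'n set" where
  "zero_coords \<tau> = {\<rho>. \<forall>x\<in>\<tau>. x $ \<rho> = 0}"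


section \<open>Simplicial decompositions\<close>

definition primitive_vec :: "real ^ 'n \<Rightarrow> bool" where
  "primitive_vec v \<longleftrightarrow> v \<in> integer_points \<inter> nonneg_orthant \<and> v \<noteq> 0 \<and>
     Gcd (range (\<lambda>i. \<lfloor>v $ i\<rfloor>)) = 1"

definition facet_normals :: "'n::finite cpoly \<Rightarrow> (real ^ 'n) set \<Rightarrow> (real ^ 'n) set" where
  "facet_normals f \<tau> = {v. primitive_vec v \<and>
     (\<exists>F. F facet_of newton_polyhedron f \<and> \<tau> \<subseteq> F \<and> (\<forall>x\<in>F. \<forall>y\<in>F. v \<bullet> (x - y) = 0))}"

definition spos_span :: "(real ^ 'n) set \<Rightarrow> (real ^ 'n) set" where
  "spos_span G = {(\<Sum>v\<in>G. c v *\<^sub>R v) |c. \<forall>v\<in>G. 0 < c v}"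

definition half_open_box :: "(real ^ 'n) set \<Rightarrow> (real ^ 'n) set" where
  "half_open_box G = {(\<Sum>v\<in>G. c v *\<^sub>R v) |c. \<forall>v\<in>G. 0 < c v \<and> c v \<le> 1}"

definition truncated_cone :: "(real ^ 'n) set \<Rightarrow> (real ^ 'n) set \<Rightarrow> (real ^ 'n) set" where
  "truncated_cone E J = {(\<Sum>v\<in>E. h v *\<^sub>R v) + (\<Sum>v\<in>J. c v *\<^sub>R v) |h c.
     (\<forall>v\<in>E. 0 < h v \<and> h v \<le> 1) \<and> (\<forall>v\<in>J. 0 < c v)}"

text \<open>
  A decomposition \<open>(\<delta>\<^sub>i)\<^sub>i\<close> of the cone of \<open>\<tau>\<close> into simplicial cones without new rays is given by
  the set \<open>\<D>\<close> of the generating sets of the \<open>\<delta>\<^sub>i\<close>.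
\<close>

definition simplicial_decomposition ::
  "'n::finite cpoly \<Rightarrow> (real ^ 'n) set \<Rightarrow> (real ^ 'n) set set \<Rightarrow> bool" where
  "simplicial_decomposition f \<tau> \<D> \<longleftrightarrow> finite \<D> \<and>
     (\<forall>G\<in>\<D>. G \<subseteq> facet_normals f \<tau> \<and> independent G) \<and>
     (\<forall>G\<in>\<D>. \<forall>H\<in>\<D>. G \<noteq> H \<longrightarrow> spos_span G \<inter> spos_span H = {}) \<and>
     (\<Union>G\<in>\<D>. spos_span G) = face_cone f \<tau>"

text \<open>
  A generating set \<open>G\<close> splits into \<open>G \<inter> unit_gens \<tau>\<close>, the vectors \<open>e\<^sub>\<rho>\<close> with \<open>\<rho> \<in> P\<^sub>i\<close>, and
  \<open>G - unit_gens \<tau>\<close>, the vectors \<open>v\<^sub>j\<close> with \<open>j \<in> J\<^sub>i\<close>.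
\<close>

definition unit_gens :: "(real ^ 'n::finite) set \<Rightarrow> (real ^ 'n) set" where
  "unit_gens \<tau> = (\<lambda>\<rho>. axis \<rho> 1) ` zero_coords \<tau>"


section \<open>The local motivic zeta function and the terms of the formula\<close>

text \<open>
  The arc \<open>\<phi>\<close> modulo \<open>t\<^sup>l\<^sup>+\<^sup>1\<close> with \<open>\<phi>\<^sub>i = \<Sum>j=1..l. a (i, j) t\<^sup>j\<close>, for \<open>a\<close> in the affine space with
  coordinates \<open>UNIV \<times> {1..l}\<close>.
\<close>

definition trunc_arc :: "nat \<Rightarrow> ('n \<times> nat \<Rightarrow> complex) \<Rightarrow> 'n \<Rightarrow> complex poly" where
  "trunc_arc l a i = (\<Sum>j=1..l. monom (a (i, j)) j)"

definition arc_set :: "'n::finite cpoly \<Rightarrow> nat \<Rightarrow> ('n \<times> nat \<Rightarrow> complex) set" where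
  "arc_set f l = {a \<in> affine_points (UNIV \<times> {1..l}).
     mpoly_eval_in (\<lambda>c. [:c:]) f (trunc_arc l a) \<noteq> 0 \<and> order 0 (mpoly_eval_in (\<lambda>c. [:c:]) f (trunc_arc l a)) = l}"

definition zeta_mot :: "'n::finite cpoly \<Rightarrow> mot fps" where
  "zeta_mot f = fps_const (\<L>\<^sup>-\<^sup>1 ^ CARD('n)) *
     Abs_fps (\<lambda>l. if l = 0 then 0
                  else mot_class (UNIV \<times> {1..l}) (arc_set f l) * (\<L>\<^sup>-\<^sup>1 ^ CARD('n)) ^ l)"

definition torus_zeros :: "'i set \<Rightarrow> 'i cpoly \<Rightarrow> ('i \<Rightarrow> complex) set" where
  "torus_zeros I p = {x \<in> affine_points I. (\<forall>i\<in>I. x i \<noteq> 0) \<and> mpoly_eval p x = 0}"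

definition L_term :: "'n::finite cpoly \<Rightarrow> (real ^ 'n) set \<Rightarrow> mot fps" where
  "L_term f \<tau> = fps_const ((1 - \<L>\<^sup>-\<^sup>1) ^ CARD('n)) -
     fps_const (\<L>\<^sup>-\<^sup>1 ^ CARD('n) * mot_class UNIV (torus_zeros UNIV (face_poly f \<tau>))) *
       ((1 - fps_X) * geom (fps_const \<L>\<^sup>-\<^sup>1 * fps_X))"

definition L_term' :: "'n::finite cpoly \<Rightarrow> (real ^ 'n) set \<Rightarrow> mot fps" where
  "L_term' f \<tau> = fps_const ((1 - \<L>\<^sup>-\<^sup>1) ^ (CARD('n) - card (zero_coords \<tau>))) -
     fps_const (\<L>\<^sup>-\<^sup>1 ^ (CARD('n) - card (zero_coords \<tau>)) *
         mot_class (- zero_coords \<tau>) (torus_zeros (- zero_coords \<tau>) (face_poly f \<tau>))) *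
       ((1 - fps_X) * geom (fps_const \<L>\<^sup>-\<^sup>1 * fps_X))"

text \<open>
  The monomial \<open>\<L>\<^bsup>-\<sigma>(k)\<^esup> T\<^bsup>m(k)\<^esup>\<close>.  For \<open>k\<close> in the non-negative orthant with integer coordinates
  \<open>\<sigma>(k)\<close> and \<open>m(k)\<close> are non-negative integers.
\<close>

definition lattice_term :: "'n::finite cpoly \<Rightarrow> real ^ 'n \<Rightarrow> mot fps" where
  "lattice_term f k =
     fps_const (\<L>\<^sup>-\<^sup>1 ^ nat \<lfloor>sigma_sum k\<rfloor>) * fps_X ^ nat \<lfloor>newton_m f k\<rfloor>"

definition S_cone :: "'n::finite cpoly \<Rightarrow> (real ^ 'n) set \<Rightarrow> mot fps" where
  "S_cone f \<tau> = (\<Sum>\<^sub>\<infinity>k\<in>integer_points \<inter> face_cone f \<tau>. lattice_term f k)"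

definition Sigma_box :: "'n::finite cpoly \<Rightarrow> (real ^ 'n) set \<Rightarrow> mot fps" where
  "Sigma_box f G = (\<Sum>h\<in>integer_points \<inter> half_open_box G. lattice_term f h)"

text \<open>The set \<open>\<delta>\<^sub>i'\<close> for the cone \<open>\<delta>\<^sub>i\<close> generated by \<open>G\<close>.\<close>

definition truncated_simplex_cone :: "(real ^ 'n::finite) set \<Rightarrow> (real ^ 'n) set \<Rightarrow> (real ^ 'n) set"
  where "truncated_simplex_cone \<tau> G =
     truncated_cone (G \<inter> unit_gens \<tau>) (G - unit_gens \<tau>)"

definition S_cone' ::
  "'n::finite cpoly \<Rightarrow> (real ^ 'n) set \<Rightarrow> (real ^ 'n) set set \<Rightarrow> mot fps" where
  "S_cone' f \<tau> \<D> =
     (\<Sum>G\<in>\<D>. fps_const ((1 - \<L>\<^sup>-\<^sup>1) ^ (card (zero_coords \<tau>) - card (G \<inter> unit_gens \<tau>))) *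
        (\<Sum>\<^sub>\<infinity>k\<in>integer_points \<inter> truncated_simplex_cone \<tau> G. lattice_term f k))"

end

theory Submission
  imports Defs
begin

text \<open>
  The arcs \<open>\<phi>\<close> with \<open>ord f(\<phi>) = l\<close> are stratified by the vector \<open>k\<close> of the orders of the components
  of \<open>\<phi>\<close>, and \<open>k\<close> lies in the cone of exactly one compact face \<open>\<tau>\<close>.  Orders along the coordinates in
  \<open>P\<^sub>\<tau>\<close> can be unbounded, but they do not influence \<open>f\<^sub>\<tau>\<close>; vectors that differ by a non-negative
  integral combination of the \<open>e\<^sub>\<rho>\<close>, \<open>\<rho> \<in> P\<^sub>i\<close>, are therefore collected into one stratum,
  represented by the vector in the half-open set \<open>\<delta>\<^sub>i'\<close>.  On a stratum \<open>f(\<phi>) = t\<^bsup>m(k)\<^esup> (f\<^sub>\<tau>(u) + \<dots>)\<close> with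
  \<open>u\<close> the leading coefficients.  If \<open>f\<^sub>\<tau>(u) \<noteq> 0\<close> then \<open>l = m(k)\<close>; otherwise some partial derivative
  of \<open>f\<^sub>\<tau>\<close> is non-zero at \<open>u\<close>, each further coefficient of \<open>f(\<phi>)\<close> is an affine function of the next
  coefficients of \<open>\<phi>\<close>, and the stratum is a piecewise trivial fibration over the zeros of \<open>f\<^sub>\<tau>\<close>.
  The sum over the lattice points of a simplicial cone is a geometric series in each generator
  times the sum over the half-open box.

  That every facet has a primitive normal is obtained by simultaneous Diophantine approximation,
  and the description of the cones by these normals from Farkas' lemma.
\<close>

subsection \<open>Polynomial functions\<close>

text \<open>\<open>k0_class\<close> is a choice that means something only for varieties, so every
  set whose class is taken must be shown to be one. All sets are kept in a form that is visibly
  affine (\<open>basic_set\<close>); this form is not stable under unions, so partitions are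
  evaluated through a common refinement. The half-open cones fit the truncation at order l because a
  primitive normal v of a facet containing \<tau> satisfies v_i <= m(v) for all i unless it is some
  e_\<rho> with \<rho> in P_\<tau>. Hence k_i <= m(k) + 1 on the truncated cones, where the extra 1
  occurs only for indices in P_i, and a component that vanishes modulo t^(l+1) can be given the
  order l + 1. On a stratum the leading coefficients are units outside P_i and free inside P_i;
  those with index in P_\<tau> but not in P_i are units that f_\<tau> does not see, and they produce
  the factor with exponent |P_\<tau>| - |P_i|. Solving an equation for a coordinate costs a power of
  L. The identities between classes are multiplied by that power, and L is inverted only when they
  are compared with coefficients of the series.\<close>

definition polyfun :: "(('i \<Rightarrow> complex) \<Rightarrow> complex) \<Rightarrow> bool" where
  "polyfun g \<longleftrightarrow> (\<exists>p. \<forall>x. g x = mpoly_eval p x)"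

lemma polyfun_mpoly_eval: "polyfun (mpoly_eval p)"
  by (auto simp: polyfun_def)

lemma prod_keys_superset:
  fixes x :: "'i \<Rightarrow> 'r::comm_monoid_mult"
  assumes "finite A" "Poly_Mapping.keys \<omega> \<subseteq> A"
  shows "(\<Prod>i\<in>Poly_Mapping.keys \<omega>. x i ^ Poly_Mapping.lookup \<omega> i) =
    (\<Prod>i\<in>A. x i ^ Poly_Mapping.lookup \<omega> i)"
  using assms by (intro prod.mono_neutral_left) (auto simp: in_keys_iff)

lemma mpoly_eval_in_superset:
  assumes "finite A" "Poly_Mapping.keys p \<subseteq> A" "c 0 = 0"
  shows "mpoly_eval_in c p x = (\<Sum>\<omega>\<in>A. c (Poly_Mapping.lookup p \<omega>) *
        (\<Prod>i\<in>Poly_Mapping.keys \<omega>. x i ^ Poly_Mapping.lookup \<omega> i))"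
  unfolding mpoly_eval_in_def
  using assms by (intro sum.mono_neutral_left) (auto simp: in_keys_iff)

lemma mpoly_eval_single:
  "mpoly_eval (Poly_Mapping.single \<omega> a) x =
     a * (\<Prod>i\<in>Poly_Mapping.keys \<omega>. x i ^ Poly_Mapping.lookup \<omega> i)"
  by (subst mpoly_eval_in_superset[of "{\<omega>}"]) auto

lemma mpoly_eval_add: "mpoly_eval (p + q) x = mpoly_eval p x + mpoly_eval q x"
proof -
  let ?A = "Poly_Mapping.keys p \<union> Poly_Mapping.keys q"
  have "mpoly_eval r x = (\<Sum>\<omega>\<in>?A. Poly_Mapping.lookup r \<omega> *
        (\<Prod>i\<in>Poly_Mapping.keys \<omega>. x i ^ Poly_Mapping.lookup \<omega> i))" if "r \<in> {p, q, p + q}" for r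
    using that Poly_Mapping.keys_add[of p q] by (intro mpoly_eval_in_superset) auto
  then show ?thesis
    by (simp add: lookup_add algebra_simps sum.distrib)
qed

lemma polyfun_monomial:
  "polyfun (\<lambda>x. a * (\<Prod>i\<in>Poly_Mapping.keys \<omega>. x i ^ Poly_Mapping.lookup \<omega> i))"
  unfolding polyfun_def using mpoly_eval_single by metis

lemma polyfun_const: "polyfun (\<lambda>_. a)"
  using polyfun_monomial[of a 0] by simp

lemma polyfun_coord: "polyfun (\<lambda>x. x i)"
  using polyfun_monomial[of 1 "Poly_Mapping.single i 1"] by simp

lemma polyfun_add: "polyfun g \<Longrightarrow> polyfun h \<Longrightarrow> polyfun (\<lambda>x. g x + h x)"
  unfolding polyfun_def by (metis mpoly_eval_add)

lemma polyfun_sum: "(\<And>j. j \<in> J \<Longrightarrow> polyfun (g j)) \<Longrightarrow> polyfun (\<lambda>x. \<Sum>j\<in>J. g j x)"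
  by (induction J rule: infinite_finite_induct) (auto intro: polyfun_const polyfun_add)

lemma polyfun_mult:
  assumes "polyfun g" "polyfun h"
  shows "polyfun (\<lambda>x. g x * h x)"
proof -
  obtain p q where p: "\<And>x. g x = mpoly_eval p x" and q: "\<And>x. h x = mpoly_eval q x"
    using assms by (auto simp: polyfun_def)
  \<comment> \<open>Exponents add; all three products are extended to the union of the two supports
    so that their factors can be matched.\<close>
  have mon: "(\<Prod>i\<in>Poly_Mapping.keys (\<omega> + \<omega>'). x i ^ Poly_Mapping.lookup (\<omega> + \<omega>') i) =
      (\<Prod>i\<in>Poly_Mapping.keys \<omega>. x i ^ Poly_Mapping.lookup \<omega> i) *
      (\<Prod>i\<in>Poly_Mapping.keys \<omega>'. x i ^ Poly_Mapping.lookup \<omega>' i)" for x :: "'a \<Rightarrow> complex" and \<omega> \<omega>'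
  proof -
    let ?A = "Poly_Mapping.keys \<omega> \<union> Poly_Mapping.keys \<omega>'"
    have "(\<Prod>i\<in>Poly_Mapping.keys r. x i ^ Poly_Mapping.lookup r i) =
      (\<Prod>i\<in>?A. x i ^ Poly_Mapping.lookup r i)" if "r \<in> {\<omega>, \<omega>', \<omega> + \<omega>'}" for r
      using that Poly_Mapping.keys_add[of \<omega> \<omega>'] by (intro prod_keys_superset) auto
    then show ?thesis
      by (simp add: lookup_add[symmetric] power_add[symmetric] prod.distrib[symmetric])
  qed
  have eq: "(\<lambda>x. g x * h x) = (\<lambda>x. \<Sum>\<omega>\<in>Poly_Mapping.keys p. \<Sum>\<omega>'\<in>Poly_Mapping.keys q.
     (Poly_Mapping.lookup p \<omega> * Poly_Mapping.lookup q \<omega>') *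
     (\<Prod>i\<in>Poly_Mapping.keys (\<omega> + \<omega>'). x i ^ Poly_Mapping.lookup (\<omega> + \<omega>') i))"
    unfolding p q mon mpoly_eval_in_def sum_product by (simp add: ac_simps)
  show ?thesis
    unfolding eq by (intro polyfun_sum polyfun_monomial)
qed

lemma polyfun_minus: "polyfun g \<Longrightarrow> polyfun h \<Longrightarrow> polyfun (\<lambda>x. g x - h x)"
  using polyfun_add[of g "\<lambda>x. -1 * h x"] polyfun_mult[OF polyfun_const, of h "-1"] by simp

lemma polyfun_prod: "(\<And>j. j \<in> J \<Longrightarrow> polyfun (g j)) \<Longrightarrow> polyfun (\<lambda>x. \<Prod>j\<in>J. g j x)"
  by (induction J rule: infinite_finite_induct) (auto intro: polyfun_const polyfun_mult)

lemma polyfun_power: "polyfun g \<Longrightarrow> polyfun (\<lambda>x. g x ^ n)"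
  by (induction n) (auto intro: polyfun_const polyfun_mult)

lemmas polyfun_intros = polyfun_mpoly_eval polyfun_const polyfun_coord polyfun_add polyfun_sum
  polyfun_mult polyfun_minus polyfun_prod polyfun_power

lemma polyfun_mpoly_eval_compose:
  assumes "\<And>i. polyfun (\<lambda>x. \<phi> x i)"
  shows "polyfun (\<lambda>x. mpoly_eval p (\<phi> x))"
  unfolding mpoly_eval_in_def
  by (intro polyfun_sum polyfun_mult polyfun_prod polyfun_power polyfun_const assms)

lemma polyfun_compose:
  assumes "polyfun g" "\<And>i. polyfun (\<lambda>x. \<phi> x i)"
  shows "polyfun (\<lambda>x. g (\<phi> x))"
proof -
  obtain p where "\<And>x. g x = mpoly_eval p x"
    using assms(1) by (auto simp: polyfun_def)
  then show ?thesis
    using polyfun_mpoly_eval_compose[OF assms(2)] by simp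
qed

subsection \<open>Regular functions on subsets of affine space\<close>

text \<open>
  The neighbourhood on which \<open>g\<close> is a quotient is taken to be the principal open set of the
  denominator.
\<close>

definition regat :: "('i \<Rightarrow> complex) set \<Rightarrow> (('i \<Rightarrow> complex) \<Rightarrow> complex) \<Rightarrow> ('i \<Rightarrow> complex) \<Rightarrow> bool" where
  "regat U g x \<longleftrightarrow> (\<exists>p q. polyfun p \<and> polyfun q \<and> q x \<noteq> 0 \<and> (\<forall>y\<in>U. q y \<noteq> 0 \<longrightarrow> g y = p y / q y))"

definition regfun :: "('i \<Rightarrow> complex) set \<Rightarrow> (('i \<Rightarrow> complex) \<Rightarrow> complex) \<Rightarrow> bool" where
  "regfun U g \<longleftrightarrow> (\<forall>x\<in>U. regat U g x)"

lemma regatI: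
  assumes "polyfun p" "polyfun q" "q x \<noteq> 0" "\<And>y. y \<in> U \<Longrightarrow> q y \<noteq> 0 \<Longrightarrow> g y = p y / q y"
  shows "regat U g x"
  using assms unfolding regat_def by blast

lemma regat_local:
  assumes "regat U g x" "regat U r x" "r x \<noteq> 0" "x \<in> U" "\<And>y. y \<in> U \<Longrightarrow> r y \<noteq> 0 \<Longrightarrow> h y = g y"
  shows "regat U h x"
proof -
  obtain p q where pq: "polyfun p" "polyfun q" "q x \<noteq> 0" "\<And>y. y \<in> U \<Longrightarrow> q y \<noteq> 0 \<Longrightarrow> g y = p y / q y"
    using assms(1) unfolding regat_def by blast
  obtain a b where ab: "polyfun a" "polyfun b" "b x \<noteq> 0" "\<And>y. y \<in> U \<Longrightarrow> b y \<noteq> 0 \<Longrightarrow> r y = a y / b y"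
    using assms(2) unfolding regat_def by blast
  have "h y = p y / q y" if "y \<in> U" "q y \<noteq> 0" "a y \<noteq> 0" "b y \<noteq> 0" for y
    using pq(4) ab(4) assms(5) that by auto
  then show ?thesis
    using pq(1-3) ab(1-3) assms(3-4) ab(4)[of x]
    by (intro regatI[of "\<lambda>y. p y * (a y * b y)" "\<lambda>y. q y * (a y * b y)"])
      (auto intro!: polyfun_intros)
qed

lemma regat_subset: "regat U g x \<Longrightarrow> V \<subseteq> U \<Longrightarrow> regat V g x"
  unfolding regat_def by blast

lemma regat_polyfun: "polyfun g \<Longrightarrow> regat U g x"
  by (rule regatI[of g "\<lambda>_. 1"]) (auto intro: polyfun_const)

lemma regat_const: "regat U (\<lambda>_. a) x"
  and regat_coord: "regat U (\<lambda>y. y i) x"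
  by (auto intro: regat_polyfun polyfun_const polyfun_coord)

lemma regat_add:
  assumes "regat U g x" "regat U h x"
  shows "regat U (\<lambda>y. g y + h y) x"
proof -
  obtain p q where pq: "polyfun p" "polyfun q" "q x \<noteq> 0" "\<And>y. y \<in> U \<Longrightarrow> q y \<noteq> 0 \<Longrightarrow> g y = p y / q y"
    using assms(1) unfolding regat_def by blast
  obtain a b where ab: "polyfun a" "polyfun b" "b x \<noteq> 0" "\<And>y. y \<in> U \<Longrightarrow> b y \<noteq> 0 \<Longrightarrow> h y = a y / b y"
    using assms(2) unfolding regat_def by blast
  show ?thesis
    using pq(1-3) ab(1-3)
    by (intro regatI[of "\<lambda>y. p y * b y + a y * q y" "\<lambda>y. q y * b y"])
      (auto simp: pq(4) ab(4) field_simps intro!: polyfun_intros)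
qed

lemma regat_mult:
  assumes "regat U g x" "regat U h x"
  shows "regat U (\<lambda>y. g y * h y) x"
proof -
  obtain p q where pq: "polyfun p" "polyfun q" "q x \<noteq> 0" "\<And>y. y \<in> U \<Longrightarrow> q y \<noteq> 0 \<Longrightarrow> g y = p y / q y"
    using assms(1) unfolding regat_def by blast
  obtain a b where ab: "polyfun a" "polyfun b" "b x \<noteq> 0" "\<And>y. y \<in> U \<Longrightarrow> b y \<noteq> 0 \<Longrightarrow> h y = a y / b y"
    using assms(2) unfolding regat_def by blast
  show ?thesis
    using pq(1-3) ab(1-3)
    by (intro regatI[of "\<lambda>y. p y * a y" "\<lambda>y. q y * b y"]) (auto simp: pq(4) ab(4) field_simps intro!: polyfun_intros)
qed

lemma regat_divide:
  assumes "regat U g x" "regat U h x" "h x \<noteq> 0" "x \<in> U"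
  shows "regat U (\<lambda>y. g y / h y) x"
proof -
  obtain p q where pq: "polyfun p" "polyfun q" "q x \<noteq> 0" "\<And>y. y \<in> U \<Longrightarrow> q y \<noteq> 0 \<Longrightarrow> g y = p y / q y"
    using assms(1) unfolding regat_def by blast
  obtain a b where ab: "polyfun a" "polyfun b" "b x \<noteq> 0" "\<And>y. y \<in> U \<Longrightarrow> b y \<noteq> 0 \<Longrightarrow> h y = a y / b y"
    using assms(2) unfolding regat_def by blast
  \<comment> \<open>Dividing p/q by a/b gives pb over qa. The extra factor b in both excludes the
    points where the fraction for \<open>h\<close> is not valid.\<close>
  show ?thesis
    using pq(1-3) ab(1-3) assms(3-) ab(4)[of x]
    by (intro regatI[of "\<lambda>y. p y * b y * b y" "\<lambda>y. q y * a y * b y"])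
      (auto simp: pq(4) ab(4) field_simps intro!: polyfun_intros)
qed

lemma regat_sum: "(\<And>j. j \<in> J \<Longrightarrow> regat U (g j) x) \<Longrightarrow> regat U (\<lambda>y. \<Sum>j\<in>J. g j y) x"
  by (induction J rule: infinite_finite_induct) (auto intro: regat_const regat_add)

lemma regat_prod: "(\<And>j. j \<in> J \<Longrightarrow> regat U (g j) x) \<Longrightarrow> regat U (\<lambda>y. \<Prod>j\<in>J. g j y) x"
  by (induction J rule: infinite_finite_induct) (auto intro: regat_const regat_mult)

lemma regat_power: "regat U g x \<Longrightarrow> regat U (\<lambda>y. g y ^ n) x"
  by (induction n) (auto intro: regat_const regat_mult)

lemma regat_mpoly_eval_compose:
  assumes "\<And>i. regat U (\<lambda>y. \<phi> y i) x"
  shows "regat U (\<lambda>y. mpoly_eval p (\<phi> y)) x"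
  unfolding mpoly_eval_in_def
  using assms by (intro regat_sum regat_mult regat_prod regat_power regat_const)

lemma regat_polyfun_compose:
  assumes "polyfun g" "\<And>i. regat U (\<lambda>y. \<phi> y i) x"
  shows "regat U (\<lambda>y. g (\<phi> y)) x"
proof -
  obtain p where "\<And>x. g x = mpoly_eval p x"
    using assms(1) by (auto simp: polyfun_def)
  then show ?thesis
    using regat_mpoly_eval_compose[OF assms(2)] by simp
qed

text \<open>The local fraction p/q of \<open>g\<close> pulls back to a fraction of functions regular
  at x. It is valid only where q(\<phi> y) is non-zero, which is itself the non-vanishing of a
  regular function, so \<open>regat_local\<close> applies with that function as
  \<open>r\<close>.\<close>

lemma regat_compose:
  assumes "regat V g (\<phi> x)" "\<And>i. regat U (\<lambda>y. \<phi> y i) x" "\<And>y. y \<in> U \<Longrightarrow> \<phi> y \<in> V" "x \<in> U"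
  shows "regat U (\<lambda>y. g (\<phi> y)) x"
proof -
  obtain p q where pq: "polyfun p" "polyfun q" "q (\<phi> x) \<noteq> 0"
    "\<And>y. y \<in> V \<Longrightarrow> q y \<noteq> 0 \<Longrightarrow> g y = p y / q y"
    using assms(1) unfolding regat_def by blast
  have *: "regat U (\<lambda>y. p (\<phi> y)) x" "regat U (\<lambda>y. q (\<phi> y)) x"
    using regat_polyfun_compose[OF pq(1) assms(2)] regat_polyfun_compose[OF pq(2) assms(2)] by auto
  show ?thesis
    by (rule regat_local[OF regat_divide[OF *] *(2)]) (use pq assms in auto)
qed

subsection \<open>The Zariski topology\<close>

lemma topspace_zariski [simp]: "topspace (zariski I) = affine_points I"
proof -
  have "affine_points I = {x \<in> affine_points I. mpoly_eval (Poly_Mapping.single 0 1) x \<noteq> 0}"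
    by (simp add: mpoly_eval_single del: single_one)
  then show ?thesis
    unfolding zariski_def topology_generated_by_topspace by blast
qed

lemma openin_zariski_principal:
  assumes "polyfun p"
  shows "openin (zariski I) {x \<in> affine_points I. p x \<noteq> 0}"
proof -
  obtain P where "\<And>x. p x = mpoly_eval P x"
    using assms by (auto simp: polyfun_def)
  then show ?thesis
    unfolding zariski_def by (intro topology_generated_by_Basis) auto
qed

lemma openin_zariski_base:
  assumes "openin (zariski I) V" "x \<in> V"
  shows "\<exists>r. polyfun r \<and> r x \<noteq> 0 \<and> {y \<in> affine_points I. r y \<noteq> 0} \<subseteq> V"
proof -
  have "generate_topology_on (range (\<lambda>p. {x \<in> affine_points I. mpoly_eval p x \<noteq> 0})) V"
    using assms(1) by (simp add: zariski_def openin_topology_generated_by_iff)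
  then show ?thesis
    using assms(2)
  proof (induction)
    case (Int a b)
    then obtain r s where "polyfun r" "r x \<noteq> 0" "{y \<in> affine_points I. r y \<noteq> 0} \<subseteq> a"
      "polyfun s" "s x \<noteq> 0" "{y \<in> affine_points I. s y \<noteq> 0} \<subseteq> b"
      by blast
    then show ?case
      by (intro exI[of _ "\<lambda>y. r y * s y"]) (auto intro!: polyfun_intros)
  next
    case (Basis s)
    then show ?case
      using polyfun_mpoly_eval by blast
  qed blast+
qed

lemma openin_zariski_sub_iff:
  assumes "S \<subseteq> affine_points I"
  shows "openin (subtopology (zariski I) S) U \<longleftrightarrow>
    U \<subseteq> S \<and> (\<forall>x\<in>U. \<exists>r. polyfun r \<and> r x \<noteq> 0 \<and> {y \<in> S. r y \<noteq> 0} \<subseteq> U)" (is "?L \<longleftrightarrow> ?R")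
proof
  assume ?L
  then obtain V where V: "openin (zariski I) V" "U = V \<inter> S"
    by (auto simp: openin_subtopology)
  show ?R
    using openin_zariski_base[OF V(1)] V(2) assms by blast
next
  assume R: ?R
  show ?L
  proof (subst openin_subopen, intro ballI)
    fix x assume "x \<in> U"
    with R obtain r where r: "polyfun r" "r x \<noteq> 0" "{y \<in> S. r y \<noteq> 0} \<subseteq> U"
      by blast
    have "openin (subtopology (zariski I) S) {y \<in> S. r y \<noteq> 0}"
      unfolding openin_subtopology
      using assms by (intro exI[of _ "{x \<in> affine_points I. r x \<noteq> 0}"] conjI openin_zariski_principal r) auto
    then show "\<exists>T. openin (subtopology (zariski I) S) T \<and> x \<in> T \<and> T \<subseteq> U"
      using r R \<open>x \<in> U\<close> by blast
  qed
qed

lemma openin_regfun_nonzero: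
  assumes "S \<subseteq> affine_points I" "openin (subtopology (zariski I) S) U" "regfun U g"
  shows "openin (subtopology (zariski I) S) {x \<in> U. g x \<noteq> 0}"
  unfolding openin_zariski_sub_iff[OF assms(1)]
proof (intro conjI ballI)
  show "{x \<in> U. g x \<noteq> 0} \<subseteq> S"
    using assms(2) openin_zariski_sub_iff[OF assms(1)] by blast
  fix x assume x: "x \<in> {x \<in> U. g x \<noteq> 0}"
  obtain p q where pq: "polyfun p" "polyfun q" "q x \<noteq> 0" "\<And>y. y \<in> U \<Longrightarrow> q y \<noteq> 0 \<Longrightarrow> g y = p y / q y"
    using assms(3) x unfolding regfun_def regat_def by blast
  obtain r where r: "polyfun r" "r x \<noteq> 0" "{y \<in> S. r y \<noteq> 0} \<subseteq> U"
    using assms(2) openin_zariski_sub_iff[OF assms(1)] x by blast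
  \<comment> \<open>Of the three factors in the witness, \<open>r\<close> keeps the neighbourhood
    inside \<open>U\<close>, \<open>q\<close> makes the fraction valid there, and \<open>p\<close>
    makes its value non-zero.\<close>
  show "\<exists>r. polyfun r \<and> r x \<noteq> 0 \<and> {y \<in> S. r y \<noteq> 0} \<subseteq> {x \<in> U. g x \<noteq> 0}"
    using pq r x pq(4)[of x] by (intro exI[of _ "\<lambda>y. r y * (p y * q y)"]) (auto intro!: polyfun_intros)
qed

lemma openin_regfun_preimage:
  assumes S: "S \<subseteq> affine_points I" and T: "T \<subseteq> affine_points J"
    and V: "openin (subtopology (zariski J) T) V"
    and \<phi>: "\<And>x. x \<in> S \<Longrightarrow> \<phi> x \<in> T" "\<And>i. regfun S (\<lambda>x. \<phi> x i)"
  shows "openin (subtopology (zariski I) S) {x \<in> S. \<phi> x \<in> V}"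
proof (subst openin_subopen, intro ballI)
  fix x assume x: "x \<in> {x \<in> S. \<phi> x \<in> V}"
  then obtain r where r: "polyfun r" "r (\<phi> x) \<noteq> 0" "{y \<in> T. r y \<noteq> 0} \<subseteq> V"
    using V openin_zariski_sub_iff[OF T] by blast
  have "openin (subtopology (zariski I) S) {x \<in> S. r (\<phi> x) \<noteq> 0}"
  proof (rule openin_regfun_nonzero[OF S])
    show "openin (subtopology (zariski I) S) S"
      using S by (simp add: openin_subtopology_refl)
    show "regfun S (\<lambda>x. r (\<phi> x))"
      unfolding regfun_def
    proof
      fix z assume "z \<in> S"
      then show "regat S (\<lambda>x. r (\<phi> x)) z"
        using \<phi>(2) by (intro regat_polyfun_compose[OF r(1)]) (auto simp: regfun_def)
    qed
  qed
  moreover have "x \<in> {x \<in> S. r (\<phi> x) \<noteq> 0}" "{x \<in> S. r (\<phi> x) \<noteq> 0} \<subseteq> {x \<in> S. \<phi> x \<in> V}"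
    using x r(2,3) \<phi>(1) by blast+
  ultimately show "\<exists>T. openin (subtopology (zariski I) S) T \<and> x \<in> T \<and> T \<subseteq> {x \<in> S. \<phi> x \<in> V}"
    by blast
qed

subsection \<open>Function spaces modelled on a subset of affine space\<close>

text \<open>Nested and direct subspaces of affine space are different records, and their
  \<open>reg\<close> is comparable only on open sets. Looking just at the topology and at the
  functions on open sets lets all of them be treated as copies of \<open>S\<close>.\<close>

definition models :: "('i \<Rightarrow> complex) fspace \<Rightarrow> 'i set \<Rightarrow> ('i \<Rightarrow> complex) set \<Rightarrow> bool" where
  "models X I S \<longleftrightarrow> S \<subseteq> affine_points I \<and> zar X = subtopology (zariski I) S \<and>
     (\<forall>U g. openin (zar X) U \<longrightarrow> (g \<in> reg X U \<longleftrightarrow> regfun U g))"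

lemma models_points: "models X I S \<Longrightarrow> points X = S"
  by (auto simp: models_def)

lemma models_affine_space: "models (affine_space I) I (affine_points I)"
  unfolding models_def
proof (intro conjI allI impI)
  show "zar (affine_space I) = subtopology (zariski I) (affine_points I)"
    by (simp add: affine_space_def) (metis subtopology_topspace topspace_zariski)
  fix U g assume U: "openin (zar (affine_space I)) U"
  then have U: "openin (zariski I) U"
    by (simp add: affine_space_def)
  then have UI: "U \<subseteq> affine_points I"
    by (metis openin_subset topspace_zariski)
  show "g \<in> reg (affine_space I) U \<longleftrightarrow> regfun U g"
  proof
    assume "g \<in> reg (affine_space I) U"
    then have *: "\<forall>x\<in>U. \<exists>V p q. openin (zariski I) V \<and> x \<in> V \<and>
       (\<forall>y\<in>U \<inter> V. mpoly_eval q y \<noteq> 0 \<and> g y = mpoly_eval p y / mpoly_eval q y)"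
      by (simp add: affine_space_def)
    show "regfun U g"
      unfolding regfun_def
    proof
      fix x assume x: "x \<in> U"
      then obtain V p q where V: "openin (zariski I) V" "x \<in> V"
         "\<forall>y\<in>U \<inter> V. mpoly_eval q y \<noteq> 0 \<and> g y = mpoly_eval p y / mpoly_eval q y"
        using * by blast
      \<comment> \<open>\<open>regat\<close> knows only the locus of the denominator, so
        \<open>V\<close> is shrunk to a principal open set and recorded by the factor
        \<open>r\<close> in numerator and denominator.\<close>
      obtain r where r: "polyfun r" "r x \<noteq> 0" "{y \<in> affine_points I. r y \<noteq> 0} \<subseteq> V"
        using openin_zariski_base[OF V(1,2)] by blast
      have "mpoly_eval q x \<noteq> 0"
        using V x by blast
      moreover have "g y = mpoly_eval p y / mpoly_eval q y" if "y \<in> U" "r y \<noteq> 0" for y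
        using that V(3) r(3) UI by blast
      ultimately show "regat U g x"
        using r(1,2)
        by (intro regatI[of "\<lambda>y. mpoly_eval p y * r y" "\<lambda>y. mpoly_eval q y * r y"]) (auto intro!: polyfun_intros)
    qed
  next
    assume *: "regfun U g"
    have "\<exists>V p q. openin (zariski I) V \<and> x \<in> V \<and>
       (\<forall>y\<in>U \<inter> V. mpoly_eval q y \<noteq> 0 \<and> g y = mpoly_eval p y / mpoly_eval q y)" if x: "x \<in> U" for x
    proof -
      obtain p q where pq: "polyfun p" "polyfun q" "q x \<noteq> 0" "\<And>y. y \<in> U \<Longrightarrow> q y \<noteq> 0 \<Longrightarrow> g y = p y / q y"
        using * x unfolding regfun_def regat_def by blast
      obtain P Q where PQ: "\<And>y. p y = mpoly_eval P y" "\<And>y. q y = mpoly_eval Q y"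
        using pq(1,2) unfolding polyfun_def by blast
      show ?thesis
      proof (intro exI conjI)
        show "openin (zariski I) {x \<in> affine_points I. q x \<noteq> 0}"
          by (rule openin_zariski_principal[OF pq(2)])
        show "x \<in> {x \<in> affine_points I. q x \<noteq> 0}"
          using pq(3) x UI by auto
        show "\<forall>y\<in>U \<inter> {x \<in> affine_points I. q x \<noteq> 0}.
            mpoly_eval Q y \<noteq> 0 \<and> g y = mpoly_eval P y / mpoly_eval Q y"
          using pq(4) PQ by auto
      qed
    qed
    then show "g \<in> reg (affine_space I) U"
      by (simp add: affine_space_def)
  qed
qed auto

lemma models_subspace_of:
  assumes X: "models X I S" and Z: "Z \<subseteq> S"
  shows "models (subspace_of X Z) I Z"
  unfolding models_def
proof (intro conjI allI impI)
  have S: "S \<subseteq> affine_points I" and zX: "zar X = subtopology (zariski I) S"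
    and rX: "\<And>U g. openin (zar X) U \<Longrightarrow> g \<in> reg X U \<longleftrightarrow> regfun U g"
    using X by (auto simp: models_def)
  show ZI: "Z \<subseteq> affine_points I"
    using S Z by blast
  show z: "zar (subspace_of X Z) = subtopology (zariski I) Z"
    using Z by (simp add: subspace_of_def zX subtopology_subtopology Int_absorb1)
  fix U g assume U: "openin (zar (subspace_of X Z)) U"
  then have UZ: "U \<subseteq> Z"
    unfolding z openin_zariski_sub_iff[OF ZI] by blast
  show "g \<in> reg (subspace_of X Z) U \<longleftrightarrow> regfun U g"
  proof
    assume "g \<in> reg (subspace_of X Z) U"
    then have *: "\<forall>x\<in>U. \<exists>V h. openin (zar X) V \<and> x \<in> V \<and> h \<in> reg X V \<and> (\<forall>y\<in>U \<inter> V. g y = h y)"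
      by (simp add: subspace_of_def)
    show "regfun U g"
      unfolding regfun_def
    proof
      fix x assume x: "x \<in> U"
      then obtain V h where V: "openin (zar X) V" "x \<in> V" "h \<in> reg X V" "\<forall>y\<in>U \<inter> V. g y = h y"
        using * by blast
      obtain r where r: "polyfun r" "r x \<noteq> 0" "{y \<in> S. r y \<noteq> 0} \<subseteq> V"
        using V openin_zariski_sub_iff[OF S] by (auto simp: zX)
      have "regat V h x"
        using V rX by (auto simp: regfun_def)
      then obtain p q where pq: "polyfun p" "polyfun q" "q x \<noteq> 0"
        "\<And>y. y \<in> V \<Longrightarrow> q y \<noteq> 0 \<Longrightarrow> h y = p y / q y"
        unfolding regat_def by blast
      have "g y = p y / q y" if "y \<in> U" "r y \<noteq> 0" "q y \<noteq> 0" for y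
      proof -
        have "y \<in> V"
          using that r(3) UZ Z by blast
        then show ?thesis
          using that V(4) pq(4) by auto
      qed
      with pq(1-3) r(1,2) show "regat U g x"
        by (intro regatI[of "\<lambda>y. p y * r y" "\<lambda>y. q y * r y"]) (auto intro!: polyfun_intros)
    qed
  next
    assume *: "regfun U g"
    have "\<exists>V h. openin (zar X) V \<and> x \<in> V \<and> h \<in> reg X V \<and> (\<forall>y\<in>U \<inter> V. g y = h y)" if x: "x \<in> U" for x
    proof -
      obtain p q where pq: "polyfun p" "polyfun q" "q x \<noteq> 0" "\<And>y. y \<in> U \<Longrightarrow> q y \<noteq> 0 \<Longrightarrow> g y = p y / q y"
        using * x unfolding regfun_def regat_def by blast
      let ?V = "{x \<in> S. q x \<noteq> 0}"
      have V: "openin (zar X) ?V"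
        using S pq(2) unfolding zX
        by (intro openin_regfun_nonzero) (auto simp: regfun_def openin_subtopology_refl intro: regat_polyfun)
      moreover have "regfun ?V (\<lambda>y. p y / q y)"
        using regat_divide[OF regat_polyfun[OF pq(1)] regat_polyfun[OF pq(2)]] by (auto simp: regfun_def)
      ultimately have "(\<lambda>y. p y / q y) \<in> reg X ?V"
        using rX[OF V] by simp
      moreover have "x \<in> ?V" "\<forall>y\<in>U \<inter> ?V. g y = p y / q y"
        using pq(3,4) x UZ Z by auto
      ultimately show ?thesis
        using V by blast
    qed
    then show "g \<in> reg (subspace_of X Z) U"
      by (simp add: subspace_of_def)
  qed
qed

lemma morphism_models:
  assumes X: "models X I S" and Y: "models Y J T"
    and \<phi>: "\<And>x. x \<in> S \<Longrightarrow> \<phi> x \<in> T" "\<And>i. regfun S (\<lambda>x. \<phi> x i)"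
  shows "morphism X Y \<phi>"
proof -
  have S: "S \<subseteq> affine_points I" and zX: "zar X = subtopology (zariski I) S"
    and rX: "\<And>U g. openin (zar X) U \<Longrightarrow> g \<in> reg X U \<longleftrightarrow> regfun U g"
    using X by (auto simp: models_def)
  have T: "T \<subseteq> affine_points J" and zY: "zar Y = subtopology (zariski J) T"
    and rY: "\<And>U g. openin (zar Y) U \<Longrightarrow> g \<in> reg Y U \<longleftrightarrow> regfun U g"
    using Y by (auto simp: models_def)
  have op: "openin (zar X) {x \<in> points X. \<phi> x \<in> V}" if "openin (zar Y) V" for V
    unfolding models_points[OF X] unfolding zX
    using that zY by (intro openin_regfun_preimage[OF S T _ \<phi>]) auto
  show ?thesis
    unfolding morphism_def
  proof (intro conjI allI impI ballI)
    show "continuous_map (zar X) (zar Y) \<phi>"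
      using op \<phi>(1) by (auto simp: continuous_map_def models_points[OF X] models_points[OF Y])
    fix V g assume V: "openin (zar Y) V" and g: "g \<in> reg Y V"
    have "regfun V g"
      using rY V g by blast
    have "regfun {x \<in> S. \<phi> x \<in> V} (\<lambda>x. g (\<phi> x))"
      unfolding regfun_def
    proof
      fix x assume x: "x \<in> {x \<in> S. \<phi> x \<in> V}"
      show "regat {x \<in> S. \<phi> x \<in> V} (\<lambda>x. g (\<phi> x)) x"
      proof (rule regat_compose[where V = V and g = g and \<phi> = \<phi>])
        show "regat V g (\<phi> x)"
          using x \<open>regfun V g\<close> by (auto simp: regfun_def)
        fix i show "regat {x \<in> S. \<phi> x \<in> V} (\<lambda>y. \<phi> y i) x"
          using x \<phi>(2)[of i] unfolding regfun_def by (auto intro: regat_subset[of S])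
      qed (use x in auto)
    qed
    then show "(\<lambda>x. g (\<phi> x)) \<in> reg X {x \<in> points X. \<phi> x \<in> V}"
      using rX op[OF V] by (simp add: models_points[OF X])
  qed
qed

lemma isomorphic_models:
  assumes X: "models X I S" and Y: "models Y J T"
    and \<phi>: "\<And>x. x \<in> S \<Longrightarrow> \<phi> x \<in> T" "\<And>i. regfun S (\<lambda>x. \<phi> x i)"
    and \<psi>: "\<And>x. x \<in> T \<Longrightarrow> \<psi> x \<in> S" "\<And>i. regfun T (\<lambda>x. \<psi> x i)"
    and inv: "\<And>x. x \<in> S \<Longrightarrow> \<psi> (\<phi> x) = x" "\<And>x. x \<in> T \<Longrightarrow> \<phi> (\<psi> x) = x"
  shows "isomorphic X Y"
  unfolding isomorphic_def models_points[OF X] models_points[OF Y]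
  using inv
  by (intro exI[of _ \<phi>] exI[of _ \<psi>] conjI morphism_models[OF X Y \<phi>] morphism_models[OF Y X \<psi>]) auto

lemma isomorphic_models_same:
  assumes "models X I S" "models Y J S"
  shows "isomorphic X Y"
  by (rule isomorphic_models[OF assms, of "\<lambda>x. x" "\<lambda>x. x"]) (auto simp: regfun_def intro: regat_coord)

lemma regfun_subset: "regfun U g \<Longrightarrow> V \<subseteq> U \<Longrightarrow> regfun V g"
  unfolding regfun_def by (blast intro: regat_subset)

lemma regfun_polyfun: "polyfun g \<Longrightarrow> regfun U g"
  unfolding regfun_def by (blast intro: regat_polyfun)

lemma regfun_const: "regfun U (\<lambda>_. a)"
  and regfun_coord: "regfun U (\<lambda>x. x i)"
  by (auto intro: regfun_polyfun polyfun_const polyfun_coord)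

lemma regfun_mult: "regfun U g \<Longrightarrow> regfun U h \<Longrightarrow> regfun U (\<lambda>x. g x * h x)"
  unfolding regfun_def by (blast intro: regat_mult)

lemma regfun_sum: "(\<And>j. j \<in> J \<Longrightarrow> regfun U (g j)) \<Longrightarrow> regfun U (\<lambda>x. \<Sum>j\<in>J. g j x)"
  unfolding regfun_def by (blast intro: regat_sum)

lemma regfun_divide:
  assumes "regfun U g" "regfun U h" "\<And>x. x \<in> U \<Longrightarrow> h x \<noteq> 0"
  shows "regfun U (\<lambda>x. g x / h x)"
  using assms unfolding regfun_def by (blast intro: regat_divide)

lemma regfun_compose:
  assumes g: "regfun V g" and \<phi>: "\<And>i. regfun U (\<lambda>x. \<phi> x i)" "\<And>x. x \<in> U \<Longrightarrow> \<phi> x \<in> V"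
  shows "regfun U (\<lambda>x. g (\<phi> x))"
  unfolding regfun_def
proof
  fix x assume x: "x \<in> U"
  show "regat U (\<lambda>x. g (\<phi> x)) x"
  proof (rule regat_compose[where V = V and g = g and \<phi> = \<phi>])
    show "regat V g (\<phi> x)"
      using x g \<phi>(2) by (auto simp: regfun_def)
    fix i show "regat U (\<lambda>y. \<phi> y i) x"
      using x \<phi>(1)[of i] unfolding regfun_def by blast
  qed (use x \<phi>(2) in auto)
qed

subsection \<open>Basic locally closed sets\<close>

text \<open>Sets of this form are affine varieties, which an arbitrary locally closed set need not
  be, so their classes are meaningful. The finite list of defining functions is also what lets a
  family of such sets be cut into common cells.\<close>

definition basic_set :: "'i set \<Rightarrow> ('i \<Rightarrow> complex) set \<Rightarrow> bool" where
  "basic_set I S \<longleftrightarrow> (\<exists>A q. finite A \<and> (\<forall>p\<in>A. polyfun p) \<and> polyfun q \<and>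
     S = {x \<in> affine_points I. (\<forall>p\<in>A. p x = 0) \<and> q x \<noteq> 0})"

lemma basic_setE:
  assumes "basic_set I S"
  obtains A q where "finite A" "\<And>p. p \<in> A \<Longrightarrow> polyfun p" "polyfun q"
    "S = {x \<in> affine_points I. (\<forall>p\<in>A. p x = 0) \<and> q x \<noteq> 0}"
  using assms unfolding basic_set_def by blast

lemma basic_set_subset: "basic_set I S \<Longrightarrow> S \<subseteq> affine_points I"
  unfolding basic_set_def by blast

lemma basic_set_affine: "basic_set I (affine_points I)"
  unfolding basic_set_def
  by (intro exI[of _ "{}"] exI[of _ "\<lambda>_. 1"]) (auto intro: polyfun_const)

lemma basic_set_zero:
  assumes "basic_set I S" "polyfun g"
  shows "basic_set I {x \<in> S. g x = 0}"
proof -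
  obtain A q where "finite A" "\<And>p. p \<in> A \<Longrightarrow> polyfun p" "polyfun q"
    "S = {x \<in> affine_points I. (\<forall>p\<in>A. p x = 0) \<and> q x \<noteq> 0}"
    using assms(1) by (rule basic_setE) blast
  then show ?thesis
    unfolding basic_set_def using assms(2)
    by (intro exI[of _ "insert g A"] exI[of _ q]) auto
qed

lemma basic_set_nonzero:
  assumes "basic_set I S" "polyfun g"
  shows "basic_set I {x \<in> S. g x \<noteq> 0}"
proof -
  obtain A q where "finite A" "\<And>p. p \<in> A \<Longrightarrow> polyfun p" "polyfun q"
    "S = {x \<in> affine_points I. (\<forall>p\<in>A. p x = 0) \<and> q x \<noteq> 0}"
    using assms(1) by (rule basic_setE) blast
  then show ?thesis
    unfolding basic_set_def using assms(2)
    by (intro exI[of _ A] exI[of _ "\<lambda>x. q x * g x"]) (auto intro: polyfun_mult)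
qed

lemma basic_set_all_zero:
  "finite J \<Longrightarrow> basic_set I S \<Longrightarrow> (\<And>j. j \<in> J \<Longrightarrow> polyfun (g j)) \<Longrightarrow>
    basic_set I {x \<in> S. \<forall>j\<in>J. g j x = 0}"
proof (induction J rule: finite_induct)
  case (insert j J)
  then have "basic_set I {x \<in> {x \<in> S. \<forall>j\<in>J. g j x = 0}. g j x = 0}"
    by (intro basic_set_zero) auto
  moreover have "{x \<in> {x \<in> S. \<forall>j\<in>J. g j x = 0}. g j x = 0} = {x \<in> S. \<forall>j\<in>insert j J. g j x = 0}"
    by auto
  ultimately show ?case by simp
qed simp

lemma basic_set_all_nonzero:
  "finite J \<Longrightarrow> basic_set I S \<Longrightarrow> (\<And>j. j \<in> J \<Longrightarrow> polyfun (g j)) \<Longrightarrow>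
    basic_set I {x \<in> S. \<forall>j\<in>J. g j x \<noteq> 0}"
proof (induction J rule: finite_induct)
  case (insert j J)
  then have "basic_set I {x \<in> {x \<in> S. \<forall>j\<in>J. g j x \<noteq> 0}. g j x \<noteq> 0}"
    by (intro basic_set_nonzero) auto
  moreover have "{x \<in> {x \<in> S. \<forall>j\<in>J. g j x \<noteq> 0}. g j x \<noteq> 0} = {x \<in> S. \<forall>j\<in>insert j J. g j x \<noteq> 0}"
    by auto
  ultimately show ?case by simp
qed simp

lemma basic_set_preimage:
  assumes "basic_set I S" "\<And>i. polyfun (\<lambda>y. \<phi> y i)" "\<And>y. y \<in> affine_points J \<Longrightarrow> \<phi> y \<in> affine_points I"
  shows "basic_set J {y \<in> affine_points J. \<phi> y \<in> S}"
proof -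
  obtain A q where A: "finite A" "\<And>p. p \<in> A \<Longrightarrow> polyfun p" "polyfun q"
    "S = {x \<in> affine_points I. (\<forall>p\<in>A. p x = 0) \<and> q x \<noteq> 0}"
    using assms(1) by (rule basic_setE) blast
  show ?thesis
    unfolding basic_set_def
  proof (intro exI conjI)
    show "finite ((\<lambda>p y. p (\<phi> y)) ` A)"
      using A by simp
    show "\<forall>p\<in>(\<lambda>p y. p (\<phi> y)) ` A. polyfun p"
      using polyfun_compose[where \<phi> = \<phi>, OF A(2) assms(2)] by auto
    show "polyfun (\<lambda>y. q (\<phi> y))"
      by (rule polyfun_compose[where \<phi> = \<phi>, OF A(3) assms(2)])
    show "{y \<in> affine_points J. \<phi> y \<in> S} =
        {x \<in> affine_points J. (\<forall>p\<in>(\<lambda>p y. p (\<phi> y)) ` A. p x = 0) \<and> q (\<phi> x) \<noteq> 0}"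
      using assms(3) A(4) by auto
  qed
qed

lemma closedin_zariski_zero_set:
  assumes "\<And>p. p \<in> A \<Longrightarrow> polyfun p"
  shows "closedin (zariski I) {x \<in> affine_points I. \<forall>p\<in>A. p x = 0}"
proof -
  have "openin (zariski I) (\<Union>p\<in>A. {x \<in> affine_points I. p x \<noteq> 0})"
    using assms by (intro openin_Union) (auto intro: openin_zariski_principal)
  moreover have "affine_points I - {x \<in> affine_points I. \<forall>p\<in>A. p x = 0} =
     (\<Union>p\<in>A. {x \<in> affine_points I. p x \<noteq> 0})"
    by auto
  ultimately show ?thesis
    by (auto simp: closedin_def)
qed

subsection \<open>Functions on products\<close>

lemma models_reg: "models X I S \<Longrightarrow> openin (zar X) U \<Longrightarrow> g \<in> reg X U \<longleftrightarrow> regfun U g"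
  by (auto simp: models_def)

lemma models_openin_whole: "models X I S \<Longrightarrow> openin (zar X) S"
  by (auto simp: models_def openin_subtopology_refl)

lemma tensor_functionsI:
  assumes "finite K" "\<And>k. k \<in> K \<Longrightarrow> u k \<in> reg X U" "\<And>k. k \<in> K \<Longrightarrow> v k \<in> reg Y V"
  shows "(\<lambda>z. \<Sum>k\<in>K. u k (fst z) * v k (snd z)) \<in> tensor_functions X Y U V"
proof -
  obtain e where e: "bij_betw e {0..<card K} K"
    using ex_bij_betw_nat_finite[OF assms(1)] by blast
  have "(\<lambda>z. \<Sum>k\<in>K. u k (fst z) * v k (snd z)) = (\<lambda>z. \<Sum>i<card K. u (e i) (fst z) * v (e i) (snd z))"
    using e by (intro ext sum.reindex_bij_betw[symmetric]) (simp add: atLeast0LessThan)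
  moreover have "e i \<in> K" if "i < card K" for i
    using e that by (auto simp: bij_betw_def)
  ultimately show ?thesis
    unfolding tensor_functions_def using assms(2,3)
    by (intro CollectI exI[of _ "card K"] exI[of _ "\<lambda>i. u (e i)"] exI[of _ "\<lambda>i. v (e i)"]) auto
qed

context
  fixes X :: "('i \<Rightarrow> complex) fspace" and I S and Y :: "('j \<Rightarrow> complex) fspace" and J T
  assumes X: "models X I S" and Y: "models Y J T"
begin

lemma tensor_fst_snd:
  assumes "openin (zar X) U" "openin (zar Y) V" "regfun U u" "regfun V v"
  shows "(\<lambda>z. u (fst z) * v (snd z)) \<in> tensor_functions X Y U V"
  using tensor_functionsI[of "{()}" "\<lambda>_. u" X U "\<lambda>_. v" Y V] assms
  by (simp add: models_reg[OF X] models_reg[OF Y])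

lemma tensor_const:
  assumes "openin (zar X) U" "openin (zar Y) V"
  shows "(\<lambda>z. a) \<in> tensor_functions X Y U V"
  using tensor_fst_snd[OF assms regfun_const[of U a] regfun_const[of V 1]] by simp

lemma tensor_add:
  assumes "g \<in> tensor_functions X Y U V" "h \<in> tensor_functions X Y U V"
  shows "(\<lambda>z. g z + h z) \<in> tensor_functions X Y U V"
proof -
  obtain r :: nat and u v where g: "g = (\<lambda>z. \<Sum>i<r. u i (fst z) * v i (snd z))"
      "\<forall>i<r. u i \<in> reg X U \<and> v i \<in> reg Y V"
    using assms(1) unfolding tensor_functions_def by auto
  obtain r' :: nat and u' v' where h: "h = (\<lambda>z. \<Sum>i<r'. u' i (fst z) * v' i (snd z))"
      "\<forall>i<r'. u' i \<in> reg X U \<and> v' i \<in> reg Y V"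
    using assms(2) unfolding tensor_functions_def by auto
  have "(\<lambda>z. g z + h z) = (\<lambda>z. \<Sum>k\<in>{..<r} <+> {..<r'}. case_sum u u' k (fst z) * case_sum v v' k (snd z))"
    by (simp add: g h sum.Plus)
  also have "\<dots> \<in> tensor_functions X Y U V"
    using g(2) h(2) by (intro tensor_functionsI) auto
  finally show ?thesis .
qed

lemma tensor_mult:
  assumes UV: "openin (zar X) U" "openin (zar Y) V"
    and "g \<in> tensor_functions X Y U V" "h \<in> tensor_functions X Y U V"
  shows "(\<lambda>z. g z * h z) \<in> tensor_functions X Y U V"
proof -
  obtain r :: nat and u v where g: "g = (\<lambda>z. \<Sum>i<r. u i (fst z) * v i (snd z))"
      "\<forall>i<r. u i \<in> reg X U \<and> v i \<in> reg Y V"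
    using assms(3) unfolding tensor_functions_def by auto
  obtain r' :: nat and u' v' where h: "h = (\<lambda>z. \<Sum>i<r'. u' i (fst z) * v' i (snd z))"
      "\<forall>i<r'. u' i \<in> reg X U \<and> v' i \<in> reg Y V"
    using assms(4) unfolding tensor_functions_def by auto
  have eq: "(\<lambda>z. g z * h z) = (\<lambda>z. \<Sum>k\<in>{..<r} \<times> {..<r'}. (\<lambda>x. u (fst k) x * u' (snd k) x) (fst z) *
      (\<lambda>y. v (fst k) y * v' (snd k) y) (snd z))"
    by (simp add: g h sum_product sum.cartesian_product case_prod_unfold mult.assoc mult.left_commute)
  show ?thesis
    unfolding eq using g(2) h(2)
    by (intro tensor_functionsI) (auto simp: models_reg[OF X] models_reg[OF Y] UV intro: regfun_mult)
qed

lemma tensor_polyfun: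
  assumes UV: "openin (zar X) U" "openin (zar Y) V"
    and \<psi>: "\<And>k. (\<lambda>z. \<psi> z k) \<in> tensor_functions X Y U V" and p: "polyfun p"
  shows "(\<lambda>z. p (\<psi> z)) \<in> tensor_functions X Y U V"
proof -
  have sum: "(\<lambda>z. \<Sum>j\<in>F. g j z) \<in> tensor_functions X Y U V"
    if "\<And>j. j \<in> F \<Longrightarrow> g j \<in> tensor_functions X Y U V" for F and g :: "'c \<Rightarrow> _"
    using that by (induction F rule: infinite_finite_induct) (auto intro: tensor_const UV tensor_add)
  have prod: "(\<lambda>z. \<Prod>j\<in>F. g j z) \<in> tensor_functions X Y U V"
    if "\<And>j. j \<in> F \<Longrightarrow> g j \<in> tensor_functions X Y U V" for F and g :: "'c \<Rightarrow> _"
    using that by (induction F rule: infinite_finite_induct) (auto intro: tensor_const UV tensor_mult)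
  have pow: "(\<lambda>z. g z ^ n) \<in> tensor_functions X Y U V"
    if "g \<in> tensor_functions X Y U V" for g n
    using that by (induction n) (auto intro: tensor_const UV tensor_mult)
  obtain P where P: "\<And>x. p x = mpoly_eval P x"
    using p by (auto simp: polyfun_def)
  show ?thesis
    unfolding P mpoly_eval_in_def by (intro sum tensor_mult[OF UV] tensor_const[OF UV] prod pow \<psi>)
qed

lemma prod_zar_points: "topspace (prod_zar X Y) = S \<times> T"
proof
  have "U \<subseteq> S" if "openin (zar X) U" for U
    using openin_subset[OF that] models_points[OF X] by simp
  moreover have "V \<subseteq> T" if "openin (zar Y) V" for V
    using openin_subset[OF that] models_points[OF Y] by simp
  ultimately show "topspace (prod_zar X Y) \<subseteq> S \<times> T"
    unfolding prod_zar_def topology_generated_by_topspace by blast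
  have "{z \<in> S \<times> T. (1::complex) \<noteq> 0} \<in> {{z \<in> U \<times> V. h z \<noteq> 0} |U V h.
        openin (zar X) U \<and> openin (zar Y) V \<and> h \<in> tensor_functions X Y U V}"
    by (intro CollectI exI[of _ S] exI[of _ T] exI[of _ "\<lambda>_. 1"] conjI refl models_openin_whole[OF X]
        models_openin_whole[OF Y] tensor_const)
  then show "S \<times> T \<subseteq> topspace (prod_zar X Y)"
    unfolding prod_zar_def topology_generated_by_topspace by auto
qed

lemma openin_prod_zar:
  assumes "openin (zar X) U" "openin (zar Y) V" "h \<in> tensor_functions X Y U V"
  shows "openin (prod_zar X Y) {z \<in> U \<times> V. h z \<noteq> 0}"
  unfolding prod_zar_def using assms by (intro topology_generated_by_Basis) blast

text \<open>Topology and regular functions of a product are defined by tensor functions. A map into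
  the product is therefore tested by pulling these back, which only needs \<open>f\<close> and
  \<open>g\<close> to be regular; a map \<psi> out of it is tested on its coordinates, because
  tensor functions are closed under polynomial operations.\<close>

lemma isomorphic_prod_space:
  assumes W: "models W K R"
    and f: "\<And>w. w \<in> R \<Longrightarrow> f w \<in> S" "\<And>i. regfun R (\<lambda>w. f w i)"
    and g: "\<And>w. w \<in> R \<Longrightarrow> g w \<in> T" "\<And>j. regfun R (\<lambda>w. g w j)"
    and \<psi>: "\<And>z. z \<in> S \<times> T \<Longrightarrow> \<psi> z \<in> R" "\<And>k. (\<lambda>z. \<psi> z k) \<in> tensor_functions X Y S T"
    and inv: "\<And>w. w \<in> R \<Longrightarrow> \<psi> (f w, g w) = w" "\<And>z. z \<in> S \<times> T \<Longrightarrow> (f (\<psi> z), g (\<psi> z)) = z"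
  shows "isomorphic W (prod_space X Y)"
proof -
  let ?\<phi> = "\<lambda>w. (f w, g w)"
  have R: "R \<subseteq> affine_points K" and zW: "zar W = subtopology (zariski K) R"
    using W by (auto simp: models_def)
  have SI: "S \<subseteq> affine_points I" and zX: "zar X = subtopology (zariski I) S"
    using X by (auto simp: models_def)
  have TJ: "T \<subseteq> affine_points J" and zY: "zar Y = subtopology (zariski J) T"
    using Y by (auto simp: models_def)
  have pW: "points W = R"
    using W by (rule models_points)
  have pP: "points (prod_space X Y) = S \<times> T"
    by (simp add: prod_space_def prod_zar_points)
  have openP: "openin (zar W) {w \<in> R. f w \<in> U \<and> g w \<in> V}"
    if "openin (zar X) U" "openin (zar Y) V" for U V
  proof -
    have "openin (zar W) {w \<in> R. f w \<in> U}" "openin (zar W) {w \<in> R. g w \<in> V}"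
      unfolding zW using that zX zY by (auto intro!: openin_regfun_preimage[OF R SI _ f] openin_regfun_preimage[OF R TJ _ g])
    then have "openin (zar W) ({w \<in> R. f w \<in> U} \<inter> {w \<in> R. g w \<in> V})"
      by (rule openin_Int)
    then show ?thesis
      by (simp add: Collect_conj_eq Int_ac)
  qed
  have reg_tensor: "regfun {w \<in> R. f w \<in> U \<and> g w \<in> V} (\<lambda>w. h (f w, g w))"
    if UV: "openin (zar X) U" "openin (zar Y) V" and h: "h \<in> tensor_functions X Y U V" for U V h
  proof -
    obtain r :: nat and u v where h: "h = (\<lambda>z. \<Sum>i<r. u i (fst z) * v i (snd z))"
      "\<forall>i<r. u i \<in> reg X U \<and> v i \<in> reg Y V"
      using h unfolding tensor_functions_def by auto
    show ?thesis
      unfolding h(1) fst_conv snd_conv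
    proof (intro regfun_sum regfun_mult)
      fix i assume "i \<in> {..<r}"
      then have u: "regfun U (u i)" "regfun V (v i)"
        using h(2) models_reg[OF X UV(1)] models_reg[OF Y UV(2)] by auto
      show "regfun {w \<in> R. f w \<in> U \<and> g w \<in> V} (\<lambda>w. u i (f w))"
        by (rule regfun_compose[OF u(1)]) (auto intro: regfun_subset[OF f(2)])
      show "regfun {w \<in> R. f w \<in> U \<and> g w \<in> V} (\<lambda>w. v i (g w))"
        by (rule regfun_compose[OF u(2)]) (auto intro: regfun_subset[OF g(2)])
    qed
  qed
  have cont: "continuous_map (zar W) (zar (prod_space X Y)) ?\<phi>"
    unfolding prod_space_def fspace.simps prod_zar_def continuous_on_generated_topo_iff
  proof (intro conjI allI impI)
    fix N assume "N \<in> {{z \<in> U \<times> V. h z \<noteq> 0} |U V h.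
        openin (zar X) U \<and> openin (zar Y) V \<and> h \<in> tensor_functions X Y U V}"
    then obtain U V h where N: "N = {z \<in> U \<times> V. h z \<noteq> 0}"
      and UV: "openin (zar X) U" "openin (zar Y) V" and h: "h \<in> tensor_functions X Y U V"
      by blast
    have "openin (zar W) {w \<in> {w \<in> R. f w \<in> U \<and> g w \<in> V}. h (f w, g w) \<noteq> 0}"
      using openP[OF UV] unfolding zW by (intro openin_regfun_nonzero[OF R] reg_tensor[OF UV h]) auto
    then show "openin (zar W) (?\<phi> -` N \<inter> topspace (zar W))"
      by (rule back_subst[of "openin (zar W)"]) (auto simp: N pW)
  next
    show "?\<phi> ` topspace (zar W) \<subseteq> \<Union> {{z \<in> U \<times> V. h z \<noteq> 0} |U V h.
        openin (zar X) U \<and> openin (zar Y) V \<and> h \<in> tensor_functions X Y U V}"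
      using prod_zar_points f(1) g(1) unfolding pW prod_zar_def topology_generated_by_topspace by auto
  qed
  have mor1: "morphism W (prod_space X Y) ?\<phi>"
    unfolding morphism_def
  proof (intro conjI allI impI ballI cont)
    fix N k assume N: "openin (zar (prod_space X Y)) N" and k: "k \<in> reg (prod_space X Y) N"
    let ?M = "{w \<in> points W. ?\<phi> w \<in> N}"
    have M: "openin (zar W) ?M"
      using cont N by (auto simp: continuous_map_def)
    have "regfun ?M (\<lambda>w. k (?\<phi> w))"
      unfolding regfun_def
    proof
      fix w assume w: "w \<in> ?M"
      then obtain U V p q where UV: "openin (zar X) U" "openin (zar Y) V" and wU: "?\<phi> w \<in> U \<times> V"
        and p: "p \<in> tensor_functions X Y U V" and q: "q \<in> tensor_functions X Y U V" and qw: "q (?\<phi> w) \<noteq> 0"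
        and eq: "\<forall>z\<in>N \<inter> U \<times> V. q z \<noteq> 0 \<longrightarrow> k z = p z / q z"
        using k unfolding prod_space_def fspace.simps by blast
      let ?P = "{w \<in> R. f w \<in> U \<and> g w \<in> V}"
      have wP: "w \<in> ?P"
        using w wU by (simp add: pW)
      obtain s where s: "polyfun s" "s w \<noteq> 0" "{y \<in> R. s y \<noteq> 0} \<subseteq> ?P"
        using openP[OF UV] wP unfolding zW openin_zariski_sub_iff[OF R] by blast
      have "regat ?P (\<lambda>w. p (?\<phi> w)) w" "regat ?P (\<lambda>w. q (?\<phi> w)) w"
        using reg_tensor[OF UV p] reg_tensor[OF UV q] wP by (auto simp: regfun_def)
      then have "regat ?P (\<lambda>w. p (?\<phi> w) / q (?\<phi> w)) w" "regat ?P (\<lambda>w. q (?\<phi> w)) w"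
        using qw wP by (auto intro: regat_divide)
      then have "regat (?P \<inter> ?M) (\<lambda>w. p (?\<phi> w) / q (?\<phi> w)) w" "regat (?P \<inter> ?M) (\<lambda>w. q (?\<phi> w)) w"
        by (auto intro: regat_subset)
      then have "regat (?P \<inter> ?M) (\<lambda>w. k (?\<phi> w)) w"
        by (rule regat_local) (use wP w qw eq in auto)
      then obtain a b where ab: "polyfun a" "polyfun b" "b w \<noteq> 0"
          "\<And>y. y \<in> ?P \<inter> ?M \<Longrightarrow> b y \<noteq> 0 \<Longrightarrow> k (?\<phi> y) = a y / b y"
        unfolding regat_def by blast
      have "k (?\<phi> y) = a y / b y" if "y \<in> ?M" "s y \<noteq> 0" "b y \<noteq> 0" for y
      proof -
        have "y \<in> ?P"
          using that s(3) pW by blast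
        then show ?thesis
          using ab(4) that by blast
      qed
      with ab(1-3) s(1,2) show "regat ?M (\<lambda>w. k (?\<phi> w)) w"
        by (intro regatI[of "\<lambda>y. a y * s y" "\<lambda>y. b y * s y"]) (auto intro!: polyfun_intros)
    qed
    then show "(\<lambda>w. k (?\<phi> w)) \<in> reg W ?M"
      using models_reg[OF W M] by blast
  qed
  have cont2: "continuous_map (zar (prod_space X Y)) (zar W) \<psi>"
    unfolding zW continuous_map_in_subtopology
  proof (intro conjI)
    show "continuous_map (zar (prod_space X Y)) (zariski K) \<psi>"
      unfolding zariski_def continuous_on_generated_topo_iff
    proof (intro conjI allI impI)
      fix N assume "N \<in> range (\<lambda>p. {x \<in> affine_points K. mpoly_eval p x \<noteq> 0})"
      then obtain p where N: "N = {x \<in> affine_points K. mpoly_eval p x \<noteq> 0}"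
        by blast
      have *: "(\<lambda>z. mpoly_eval p (\<psi> z)) \<in> tensor_functions X Y S T"
        by (rule tensor_polyfun[where p = "mpoly_eval p" and \<psi> = \<psi>,
              OF models_openin_whole[OF X] models_openin_whole[OF Y] \<psi>(2) polyfun_mpoly_eval])
      have "openin (prod_zar X Y) {z \<in> S \<times> T. mpoly_eval p (\<psi> z) \<noteq> 0}"
        by (rule openin_prod_zar[OF models_openin_whole[OF X] models_openin_whole[OF Y] *])
      then have "openin (zar (prod_space X Y)) {z \<in> S \<times> T. mpoly_eval p (\<psi> z) \<noteq> 0}"
        by (simp add: prod_space_def)
      then show "openin (zar (prod_space X Y)) (\<psi> -` N \<inter> topspace (zar (prod_space X Y)))"
        by (rule back_subst[of "openin (zar (prod_space X Y))"]) (use \<psi>(1) R in \<open>auto simp: N pP\<close>)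
    next
      have "\<psi> ` topspace (zar (prod_space X Y)) \<subseteq> topspace (zariski K)"
        using \<psi>(1) R by (auto simp: pP)
      then show "\<psi> ` topspace (zar (prod_space X Y)) \<subseteq> \<Union> (range (\<lambda>p. {x \<in> affine_points K. mpoly_eval p x \<noteq> 0}))"
        unfolding zariski_def topology_generated_by_topspace .
    qed
    show "\<psi> \<in> topspace (zar (prod_space X Y)) \<rightarrow> R"
      using \<psi>(1) by (simp add: pP)
  qed
  have mor2: "morphism (prod_space X Y) W \<psi>"
    unfolding morphism_def
  proof (intro conjI allI impI ballI cont2)
    fix N k assume N: "openin (zar W) N" and k: "k \<in> reg W N"
    have kr: "regfun N k"
      using models_reg[OF W N] k by blast
    let ?M = "{z \<in> points (prod_space X Y). \<psi> z \<in> N}"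
    have "\<exists>U V p q. openin (zar X) U \<and> openin (zar Y) V \<and> z \<in> U \<times> V \<and>
        p \<in> tensor_functions X Y U V \<and> q \<in> tensor_functions X Y U V \<and> q z \<noteq> 0 \<and>
        (\<forall>w\<in>?M \<inter> U \<times> V. q w \<noteq> 0 \<longrightarrow> k (\<psi> w) = p w / q w)" if z: "z \<in> ?M" for z
    proof -
      obtain a b where ab: "polyfun a" "polyfun b" "b (\<psi> z) \<noteq> 0"
          "\<And>y. y \<in> N \<Longrightarrow> b y \<noteq> 0 \<Longrightarrow> k y = a y / b y"
        using kr z unfolding regfun_def regat_def by blast
      show ?thesis
      proof (intro exI conjI)
        \<comment> \<open>The full product serves as the open box: polynomials in the coordinates of
          \<psi> are tensor functions on all of it, and the locus where \<open>b\<close> vanishes is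
          excluded by the condition on the denominator.\<close>
        show "openin (zar X) S" "openin (zar Y) T"
          using models_openin_whole X Y by blast+
        then show "(\<lambda>z. a (\<psi> z)) \<in> tensor_functions X Y S T" "(\<lambda>z. b (\<psi> z)) \<in> tensor_functions X Y S T"
          using tensor_polyfun[where p = a and \<psi> = \<psi>, OF _ _ \<psi>(2) ab(1)]
            tensor_polyfun[where p = b and \<psi> = \<psi>, OF _ _ \<psi>(2) ab(2)] by auto
        show "z \<in> S \<times> T" "b (\<psi> z) \<noteq> 0"
          using z ab(3) by (auto simp: pP)
        show "\<forall>w\<in>?M \<inter> S \<times> T. b (\<psi> w) \<noteq> 0 \<longrightarrow> k (\<psi> w) = a (\<psi> w) / b (\<psi> w)"
          using ab(4) by auto
      qed
    qed
    then show "(\<lambda>z. k (\<psi> z)) \<in> reg (prod_space X Y) ?M"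
      unfolding prod_space_def fspace.simps by blast
  qed
  show ?thesis
    unfolding isomorphic_def
    using inv by (intro exI[of _ ?\<phi>] exI[of _ \<psi>] conjI mor1 mor2) (auto simp: pW pP)
qed

end

lemma sheaf_models:
  assumes X: "models X I S"
  shows "sheaf_of_functions X"
  unfolding sheaf_of_functions_def
proof (intro conjI allI impI)
  have S: "S \<subseteq> affine_points I" and zX: "zar X = subtopology (zariski I) S"
    using X by (auto simp: models_def)
  show "g \<in> reg X V" if "openin (zar X) U \<and> openin (zar X) V \<and> V \<subseteq> U \<and> g \<in> reg X U" for U V g
    using that models_reg[OF X] regfun_subset by metis
  fix U g assume *: "openin (zar X) U \<and>
        (\<forall>x\<in>U. \<exists>V h. openin (zar X) V \<and> x \<in> V \<and> V \<subseteq> U \<and> h \<in> reg X V \<and> (\<forall>y\<in>V. g y = h y))"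
  have "regfun U g"
    unfolding regfun_def
  proof
    fix x assume x: "x \<in> U"
    then obtain V h where V: "openin (zar X) V" "x \<in> V" "V \<subseteq> U" "h \<in> reg X V" "\<forall>y\<in>V. g y = h y"
      using * by blast
    have "regfun V h"
      using V models_reg[OF X] by blast
    then obtain p q where pq: "polyfun p" "polyfun q" "q x \<noteq> 0" "\<And>y. y \<in> V \<Longrightarrow> q y \<noteq> 0 \<Longrightarrow> h y = p y / q y"
      using V unfolding regfun_def regat_def by blast
    obtain s where s: "polyfun s" "s x \<noteq> 0" "{y \<in> S. s y \<noteq> 0} \<subseteq> V"
      using V(1,2) unfolding zX openin_zariski_sub_iff[OF S] by blast
    have US: "U \<subseteq> S"
      using * unfolding zX openin_zariski_sub_iff[OF S] by blast
    have "g y = p y / q y" if "y \<in> U" "s y \<noteq> 0" "q y \<noteq> 0" for y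
    proof -
      have "y \<in> V"
        using that s(3) US by blast
      then show ?thesis
        using that V(5) pq(4) by auto
    qed
    with pq(1-3) s(1,2) show "regat U g x"
      by (intro regatI[of "\<lambda>y. p y * s y" "\<lambda>y. q y * s y"]) (auto intro!: polyfun_intros)
  qed
  with * show "g \<in> reg X U"
    using models_reg[OF X] by blast
qed

text \<open>The trick of Rabinowitsch: the inverse of the denominator becomes an additional coordinate.\<close>

lemma affine_variety_models:
  assumes X: "models X I S" and S: "basic_set I S" and I: "finite I"
  shows "affine_variety X"
proof -
  obtain A q where A: "finite A" "\<And>p. p \<in> A \<Longrightarrow> polyfun p" "polyfun q"
    and SA: "S = {x \<in> affine_points I. (\<forall>p\<in>A. p x = 0) \<and> q x \<noteq> 0}"
    using S by (rule basic_setE) blast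
  obtain e where e: "bij_betw e I {0..<card I}"
    using ex_bij_betw_finite_nat[OF I] by blast
  define n where "n = card I"
  have en: "e i < n" if "i \<in> I" for i
    using e that by (auto simp: bij_betw_def n_def)
  define \<psi> where "\<psi> = (\<lambda>(z::nat \<Rightarrow> complex) i. if i \<in> I then z (e i) else 0)"
  define \<phi> where "\<phi> = (\<lambda>x k. if k < n then x (inv_into I e k) else if k = n then 1 / q x else (0::complex))"
  define B where "B = insert (\<lambda>z. z n * q (\<psi> z) - 1) ((\<lambda>p z. p (\<psi> z)) ` A)"
  define Z where "Z = {z \<in> affine_points {..<Suc n}. \<forall>p\<in>B. p z = 0}"
  have \<psi>p: "polyfun (\<lambda>z. \<psi> z i)" for i
    by (cases "i \<in> I") (auto simp: \<psi>_def intro: polyfun_intros)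
  have B: "polyfun p" if "p \<in> B" for p
  proof -
    have c: "polyfun (\<lambda>z. r (\<psi> z))" if "polyfun r" for r
      using polyfun_compose[where \<phi> = \<psi>, OF that \<psi>p] .
    show ?thesis
      using that A(2) unfolding B_def
      by (auto intro!: polyfun_minus polyfun_mult polyfun_coord polyfun_const c A(3))
  qed
  have Z: "closedin (zariski {..<Suc n}) Z"
    unfolding Z_def by (rule closedin_zariski_zero_set[OF B])
  have MZ: "models (subspace_of (affine_space {..<Suc n}) Z) {..<Suc n} Z"
    by (rule models_subspace_of[OF models_affine_space]) (auto simp: Z_def)
  have inv_e: "e (inv_into I e k) = k" "inv_into I e k \<in> I" if "k < n" for k
    using e that by (auto simp: bij_betw_def n_def f_inv_into_f inv_into_into)
  have \<psi>\<phi>: "\<psi> (\<phi> x) = x" if "x \<in> affine_points I" for x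
    using that en e by (auto simp: \<psi>_def \<phi>_def fun_eq_iff affine_points_def bij_betw_def)
  have "isomorphic X (subspace_of (affine_space {..<Suc n}) Z)"
  proof (rule isomorphic_models[OF X MZ, of \<phi> \<psi>])
    show "\<phi> x \<in> Z" if "x \<in> S" for x
      using that \<psi>\<phi>[of x] by (auto simp: Z_def B_def SA) (auto simp: \<phi>_def affine_points_def)
    show "regfun S (\<lambda>x. \<phi> x k)" for k
    proof -
      have "regfun S (\<lambda>x. 1 / q x)"
        by (intro regfun_divide regfun_const regfun_polyfun A(3)) (auto simp: SA)
      then show ?thesis
        by (cases "k < n"; cases "k = n") (auto simp: \<phi>_def intro: regfun_const regfun_coord)
    qed
    show "\<psi> z \<in> S" if "z \<in> Z" for z
      using that by (auto simp: Z_def B_def SA \<psi>_def affine_points_def)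
    show "regfun Z (\<lambda>x. \<psi> x i)" for i
      by (rule regfun_polyfun[OF \<psi>p])
    show "\<psi> (\<phi> x) = x" if "x \<in> S" for x
      using that by (intro \<psi>\<phi>) (auto simp: SA)
    show "\<phi> (\<psi> z) = z" if z: "z \<in> Z" for z
    proof
      fix k
      have nz: "z n * q (\<psi> z) = 1"
        using z by (auto simp: Z_def B_def)
      then have "1 / q (\<psi> z) = z n"
        by (metis mult_eq_0_iff nonzero_eq_divide_eq zero_neq_one)
      moreover have "z k = 0" if "k > n"
        using that z by (auto simp: Z_def affine_points_def)
      moreover have "\<psi> z (inv_into I e k) = z k" if "k < n"
        using inv_e[OF that] by (simp add: \<psi>_def)
      ultimately show "\<phi> (\<psi> z) k = z k"
        by (simp add: \<phi>_def)
    qed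
  qed
  then show ?thesis
    unfolding affine_variety_def using Z by (intro exI[of _ "Suc n"] exI[of _ Z] conjI)
qed

lemma variety_models:
  assumes X: "models X I S" and S: "basic_set I S" and I: "finite I"
  shows "variety X"
  unfolding variety_def prevariety_def
proof (intro conjI)
  show "sheaf_of_functions X"
    using X by (rule sheaf_models)
  have "affine_variety (subspace_of X S)"
    using models_subspace_of[OF X order_refl] S I by (rule affine_variety_models)
  then show "\<exists>\<U>. finite \<U> \<and> \<Union>\<U> = points X \<and>
        (\<forall>U\<in>\<U>. openin (zar X) U \<and> affine_variety (subspace_of X U))"
    using models_points[OF X] by (intro exI[of _ "{points X}"]) auto
  let ?D = "{(x, x) |x. x \<in> points X}"
  have op: "openin (zar X) S"
    by (rule models_openin_whole[OF X])
  \<comment> \<open>Two points differ exactly if some coordinate difference is non-zero, so these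
    tensor functions exhibit the complement of the diagonal as open.\<close>
  define h where "h = (\<lambda>i (z :: ('a \<Rightarrow> complex) \<times> ('a \<Rightarrow> complex)). fst z i + (- 1) * snd z i)"
  have h: "h i \<in> tensor_functions X X S S" for i
  proof -
    have a: "(\<lambda>z. fst z i) \<in> tensor_functions X X S S"
      using tensor_fst_snd[OF X X op op regfun_coord[of S i] regfun_const[of S 1]] by simp
    have b: "(\<lambda>z. (- 1) * snd z i) \<in> tensor_functions X X S S"
      using tensor_fst_snd[OF X X op op regfun_const[of S "-1"] regfun_coord[of S i]] by simp
    show ?thesis
      unfolding h_def by (rule tensor_add[OF X X a b])
  qed
  have "openin (prod_zar X X) (\<Union>i. {z \<in> S \<times> S. h i z \<noteq> 0})"
    using openin_prod_zar[OF X X op op h] by (intro openin_Union) auto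
  moreover have "(\<Union>i. {z \<in> S \<times> S. h i z \<noteq> 0}) = S \<times> S - ?D"
  proof (intro set_eqI iffI)
    fix z assume "z \<in> (\<Union>i. {z \<in> S \<times> S. h i z \<noteq> 0})"
    then show "z \<in> S \<times> S - ?D"
      by (auto simp: h_def)
  next
    fix z assume z: "z \<in> S \<times> S - ?D"
    then have "fst z \<noteq> snd z"
      unfolding models_points[OF X] by (cases z) auto
    then obtain i where "fst z i \<noteq> snd z i"
      by (meson ext)
    then have "h i z \<noteq> 0"
      by (simp add: h_def)
    with z show "z \<in> (\<Union>i. {z \<in> S \<times> S. h i z \<noteq> 0})"
      by blast
  qed
  ultimately have "openin (prod_zar X X) (S \<times> S - ?D)"
    by metis
  moreover have "?D \<subseteq> S \<times> S"
    unfolding models_points[OF X] by blast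
  moreover have "zar (prod_space X X) = prod_zar X X"
    by (simp add: prod_space_def)
  ultimately show "closedin (zar (prod_space X X)) ?D"
    unfolding closedin_def prod_zar_points[OF X X] by (simp only: prod_zar_points[OF X X])
qed

subsection \<open>Classes in the Grothendieck ring\<close>

lemma morphism_pullback:
  "morphism X Y \<phi> \<Longrightarrow> openin (zar Y) V \<Longrightarrow> g \<in> reg Y V \<Longrightarrow>
    (\<lambda>x. g (\<phi> x)) \<in> reg X {x \<in> points X. \<phi> x \<in> V}"
  by (simp add: morphism_def)

lemma morphism_compose:
  assumes "morphism X Y \<phi>" "morphism Y Z \<psi>"
  shows "morphism X Z (\<lambda>x. \<psi> (\<phi> x))"
  unfolding morphism_def
proof (intro conjI allI impI ballI)
  have c: "continuous_map (zar X) (zar Y) \<phi>" "continuous_map (zar Y) (zar Z) \<psi>"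
    using assms by (auto simp: morphism_def)
  show "continuous_map (zar X) (zar Z) (\<lambda>x. \<psi> (\<phi> x))"
    using continuous_map_compose[OF c] by (simp add: o_def)
  fix V g assume V: "openin (zar Z) V" and g: "g \<in> reg Z V"
  let ?M = "{y \<in> points Y. \<psi> y \<in> V}"
  have "openin (zar Y) ?M"
    using c(2) V by (auto simp: continuous_map_def)
  moreover have "(\<lambda>y. g (\<psi> y)) \<in> reg Y ?M"
    by (rule morphism_pullback[OF assms(2) V g])
  ultimately have "(\<lambda>x. g (\<psi> (\<phi> x))) \<in> reg X {x \<in> points X. \<phi> x \<in> ?M}"
    by (rule morphism_pullback[OF assms(1)])
  moreover have "{x \<in> points X. \<phi> x \<in> ?M} = {x \<in> points X. \<psi> (\<phi> x) \<in> V}"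
    using c(1) by (auto simp: continuous_map_def)
  ultimately show "(\<lambda>x. g (\<psi> (\<phi> x))) \<in> reg X {x \<in> points X. \<psi> (\<phi> x) \<in> V}"
    by simp
qed

lemma isomorphic_sym: "isomorphic X Y \<Longrightarrow> isomorphic Y X"
  unfolding isomorphic_def by blast

lemma isomorphic_trans:
  assumes "isomorphic X Y" "isomorphic Y Z"
  shows "isomorphic X Z"
proof -
  obtain \<phi> \<psi> where 1: "morphism X Y \<phi>" "morphism Y X \<psi>"
     "\<forall>x\<in>points X. \<psi> (\<phi> x) = x" "\<forall>y\<in>points Y. \<phi> (\<psi> y) = y"
    using assms(1) unfolding isomorphic_def by blast
  obtain \<phi>' \<psi>' where 2: "morphism Y Z \<phi>'" "morphism Z Y \<psi>'"
     "\<forall>x\<in>points Y. \<psi>' (\<phi>' x) = x" "\<forall>y\<in>points Z. \<phi>' (\<psi>' y) = y"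
    using assms(2) unfolding isomorphic_def by blast
  have pY: "\<phi> x \<in> points Y" if "x \<in> points X" for x
    using 1(1) that by (auto simp: morphism_def continuous_map_def)
  have pY': "\<psi>' x \<in> points Y" if "x \<in> points Z" for x
    using 2(2) that by (auto simp: morphism_def continuous_map_def)
  have "\<psi> (\<psi>' (\<phi>' (\<phi> x))) = x" if "x \<in> points X" for x
    using 2(3)[rule_format, OF pY[OF that]] 1(3)[rule_format, OF that] by simp
  moreover have "\<phi>' (\<phi> (\<psi> (\<psi>' z))) = z" if "z \<in> points Z" for z
    using 1(4)[rule_format, OF pY'[OF that]] 2(4)[rule_format, OF that] by simp
  ultimately have "\<forall>x\<in>points X. \<psi> (\<psi>' (\<phi>' (\<phi> x))) = x" "\<forall>z\<in>points Z. \<phi>' (\<phi> (\<psi> (\<psi>' z))) = z"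
    by blast+
  moreover have "morphism X Z (\<lambda>x. \<phi>' (\<phi> x))" "morphism Z X (\<lambda>x. \<psi> (\<psi>' x))"
    by (rule morphism_compose[OF 1(1) 2(1)], rule morphism_compose[OF 2(2) 1(2)])
  ultimately show ?thesis
    unfolding isomorphic_def by meson
qed

lemma k0_gen_abs: "k0_gen X = abs_k0 (gen X)"
  by (simp add: k0_gen_def)

lemma k0_gen_iso: "isomorphic (Rep_cvar X) (Rep_cvar Y) \<Longrightarrow> k0_gen X = k0_gen Y"
  unfolding k0_gen_abs k0.abs_eq_iff by (rule k0_ideal.iso)

text \<open>Isomorphic spaces have the same isomorphic copies in \<open>cvar\<close>, so both
  choices are made from the same predicate.\<close>

lemma k0_class_iso:
  assumes "isomorphic X Y"
  shows "k0_class X = k0_class Y"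
proof -
  have "(\<lambda>W. isomorphic (Rep_cvar W) X) = (\<lambda>W. isomorphic (Rep_cvar W) Y)"
  proof (intro ext iffI)
    show "isomorphic (Rep_cvar W) Y" if "isomorphic (Rep_cvar W) X" for W
      using isomorphic_trans[OF that assms] .
    show "isomorphic (Rep_cvar W) X" if "isomorphic (Rep_cvar W) Y" for W
      using isomorphic_trans[OF that isomorphic_sym[OF assms]] .
  qed
  then show ?thesis
    unfolding k0_class_def by (rule arg_cong)
qed

lemma k0_class_eq_gen:
  assumes "isomorphic (Rep_cvar W) X"
  shows "k0_class X = k0_gen W"
proof -
  have "isomorphic (Rep_cvar (SOME W. isomorphic (Rep_cvar W) X)) X"
    using assms by (rule someI)
  then show ?thesis
    unfolding k0_class_def by (rule k0_gen_iso[OF isomorphic_trans[OF _ isomorphic_sym[OF assms]]])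
qed

abbreviation affine_subset :: "'i set \<Rightarrow> ('i \<Rightarrow> complex) set \<Rightarrow> ('i \<Rightarrow> complex) fspace" where
  "affine_subset I S \<equiv> subspace_of (affine_space I) S"

lemma models_affine_subset: "S \<subseteq> affine_points I \<Longrightarrow> models (affine_subset I S) I S"
  by (rule models_subspace_of[OF models_affine_space])

lemma k0_class_models:
  assumes X: "models X I S" and Y: "models Y J T"
    and \<phi>: "\<And>x. x \<in> S \<Longrightarrow> \<phi> x \<in> T" "\<And>i. regfun S (\<lambda>x. \<phi> x i)"
    and \<psi>: "\<And>x. x \<in> T \<Longrightarrow> \<psi> x \<in> S" "\<And>i. regfun T (\<lambda>x. \<psi> x i)"
    and inv: "\<And>x. x \<in> S \<Longrightarrow> \<psi> (\<phi> x) = x" "\<And>x. x \<in> T \<Longrightarrow> \<phi> (\<psi> x) = x"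
  shows "k0_class X = k0_class Y"
  by (rule k0_class_iso[OF isomorphic_models[OF X Y, of \<phi> \<psi>]]) (use assms in auto)

lemma isomorphic_refl_models: "models X I S \<Longrightarrow> isomorphic X X"
  by (rule isomorphic_models_same)

lemma Rep_cvar_models:
  fixes I :: "nat set"
  assumes "models X I S" "basic_set I S" "finite I"
  shows "Rep_cvar (Abs_cvar X) = X"
  using variety_models[OF assms] by (simp add: Abs_cvar_inverse)

lemma k0_class_nat:
  fixes I :: "nat set"
  assumes "models X I S" "basic_set I S" "finite I"
  shows "k0_class X = k0_gen (Abs_cvar X)"
  by (rule k0_class_eq_gen) (simp add: Rep_cvar_models[OF assms] isomorphic_refl_models[OF assms(1)])

text \<open>\<open>cvar\<close> holds only spaces with points in
  \<open>nat \<Rightarrow> complex\<close>, so the relations of \<open>k0_ideal\<close> become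
  usable after a finite index set has been renamed by naturals. The value 0 outside \<open>I\<close>
  is what \<open>affine_points\<close> demands.\<close>

definition relabel :: "('i \<Rightarrow> 'j) \<Rightarrow> 'i set \<Rightarrow> ('j \<Rightarrow> complex) \<Rightarrow> 'i \<Rightarrow> complex" where
  "relabel e I y = (\<lambda>i. if i \<in> I then y (e i) else 0)"

lemma polyfun_relabel: "polyfun (\<lambda>y. relabel e I y i)"
  by (cases "i \<in> I") (auto simp: relabel_def intro: polyfun_const polyfun_coord)

lemma relabel_affine: "relabel e I y \<in> affine_points I"
  by (auto simp: relabel_def affine_points_def)

lemma polyfun_compose_relabel: "polyfun p \<Longrightarrow> polyfun (\<lambda>y. p (relabel e I y))"
  using polyfun_compose[where \<phi> = "relabel e I", OF _ polyfun_relabel] .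

lemma basic_set_relabel:
  "basic_set I S \<Longrightarrow> basic_set J {y \<in> affine_points J. relabel e I y \<in> S}"
  by (rule basic_set_preimage[where \<phi> = "relabel e I", OF _ polyfun_relabel relabel_affine])

lemma k0_class_relabel:
  assumes e: "bij_betw e I J" and S: "S \<subseteq> affine_points I"
  shows "k0_class (affine_subset J {y \<in> affine_points J. relabel e I y \<in> S}) = k0_class (affine_subset I S)"
proof (rule k0_class_models[OF models_affine_subset models_affine_subset[OF S],
      where \<phi> = "relabel e I" and \<psi> = "relabel (inv_into I e) J"])
  have 1: "e (inv_into I e k) = k" "inv_into I e k \<in> I" if "k \<in> J" for k
    using e that by (auto simp: bij_betw_def f_inv_into_f inv_into_into)
  have 2: "inv_into I e (e k) = k" "e k \<in> J" if "k \<in> I" for k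
    using e that by (auto simp: bij_betw_def)
  have r1: "relabel e I (relabel (inv_into I e) J x) = x" if "x \<in> affine_points I" for x
    using that 2 by (auto simp: relabel_def affine_points_def fun_eq_iff)
  have r2: "relabel (inv_into I e) J (relabel e I x) = x" if "x \<in> affine_points J" for x
    using that 1 by (auto simp: relabel_def affine_points_def fun_eq_iff)
  show "relabel e I x \<in> S" if "x \<in> {y \<in> affine_points J. relabel e I y \<in> S}" for x
    using that by simp
  show "relabel (inv_into I e) J x \<in> {y \<in> affine_points J. relabel e I y \<in> S}" if "x \<in> S" for x
    using that r1[of x] S by (auto simp: relabel_affine)
  show "relabel (inv_into I e) J (relabel e I x) = x" if "x \<in> {y \<in> affine_points J. relabel e I y \<in> S}" for x
    using that r2 by auto
  show "relabel e I (relabel (inv_into I e) J x) = x" if "x \<in> S" for x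
    using that r1 S by auto
qed (auto intro: regfun_polyfun polyfun_relabel)

lemma k0_class_scissor_nat:
  fixes I :: "nat set"
  assumes S: "basic_set I S" and I: "finite I" and p: "polyfun p"
  shows "k0_class (affine_subset I S) =
    k0_class (affine_subset I {x \<in> S. p x \<noteq> 0}) + k0_class (affine_subset I {x \<in> S. p x = 0})"
proof -
  let ?X = "affine_subset I S"
  have SI: "S \<subseteq> affine_points I"
    using S by (rule basic_set_subset)
  have X: "models ?X I S"
    by (rule models_affine_subset[OF SI])
  let ?Z = "{x \<in> S. p x = 0}" and ?U = "{x \<in> S. p x \<noteq> 0}"
  have Z: "models (subspace_of ?X ?Z) I ?Z" and U: "models (subspace_of ?X ?U) I ?U"
    by (auto intro: models_subspace_of[OF X])
  have Zb: "basic_set I ?Z" and Ub: "basic_set I ?U"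
    using S p by (auto intro: basic_set_zero basic_set_nonzero)
  have zX: "zar ?X = subtopology (zariski I) S"
    using X by (auto simp: models_def)
  have "openin (subtopology (zariski I) S) ?U"
    using SI models_openin_whole[OF X] unfolding zX
    by (intro openin_regfun_nonzero) (auto intro: regfun_polyfun p)
  moreover have "S - ?Z = ?U"
    by auto
  ultimately have cl: "closedin (zar ?X) ?Z"
    using models_points[OF X] unfolding closedin_def by (auto simp: zX)
  have "k0_gen (Abs_cvar ?X) = k0_gen (Abs_cvar (subspace_of ?X ?U)) + k0_gen (Abs_cvar (subspace_of ?X ?Z))"
  proof -
    have *: "gen A - (gen B + gen C) \<in> k0_ideal \<Longrightarrow> k0_gen A = k0_gen B + k0_gen C" for A B C
      unfolding k0_gen_abs plus_k0.abs_eq k0.abs_eq_iff .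
    have "S - ?Z = ?U"
      by auto
    then show ?thesis
      using cl models_points[OF X]
      by (intro * k0_ideal.scissor[where S = ?Z])
        (simp_all add: Rep_cvar_models[OF X S I] Rep_cvar_models[OF Z Zb I] Rep_cvar_models[OF U Ub I])
  qed
  \<comment> \<open>The scissor relation produces subspaces of \<open>?X\<close>; they are exchanged
    for subspaces of affine space because both model the same set.\<close>
  moreover have "k0_class (subspace_of ?X ?U) = k0_class (affine_subset I ?U)"
    using SI by (intro k0_class_iso isomorphic_models_same[OF U models_affine_subset]) auto
  moreover have "k0_class (subspace_of ?X ?Z) = k0_class (affine_subset I ?Z)"
    using SI by (intro k0_class_iso isomorphic_models_same[OF Z models_affine_subset]) auto
  ultimately show ?thesis
    using k0_class_nat[OF X S I] k0_class_nat[OF Z Zb I] k0_class_nat[OF U Ub I] by simp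
qed

lemma k0_class_scissor:
  assumes S: "basic_set I S" and I: "finite I" and p: "polyfun p"
  shows "k0_class (affine_subset I S) =
    k0_class (affine_subset I {x \<in> S. p x \<noteq> 0}) + k0_class (affine_subset I {x \<in> S. p x = 0})"
proof -
  obtain e where e: "bij_betw e I {0..<card I}"
    using ex_bij_betw_finite_nat[OF I] by blast
  let ?J = "{0..<card I}"
  let ?R = "\<lambda>S. {y \<in> affine_points ?J. relabel e I y \<in> S}"
  have SI: "S \<subseteq> affine_points I"
    using S by (rule basic_set_subset)
  have R: "k0_class (affine_subset ?J (?R T)) = k0_class (affine_subset I T)" if "T \<subseteq> S" for T
    using that SI by (intro k0_class_relabel[OF e]) auto
  have 1: "?R {x \<in> S. p x \<noteq> 0} = {y \<in> ?R S. p (relabel e I y) \<noteq> 0}"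
    "?R {x \<in> S. p x = 0} = {y \<in> ?R S. p (relabel e I y) = 0}"
    by auto
  have "k0_class (affine_subset ?J (?R S)) =
    k0_class (affine_subset ?J {y \<in> ?R S. p (relabel e I y) \<noteq> 0}) +
    k0_class (affine_subset ?J {y \<in> ?R S. p (relabel e I y) = 0})"
    using S p by (intro k0_class_scissor_nat basic_set_relabel polyfun_compose_relabel) auto
  then show ?thesis
    unfolding 1[symmetric] by (subst (asm) (1 2 3) R) auto
qed

text \<open>Points of the affine space over \<open>I\<close> vanish at \<open>j\<close>, so
  \<open>y(j := 0)\<close> is the projection that forgets coordinate \<open>j\<close>, and the
  cylinder is the product of \<open>S\<close> with a line. The product relation needs all three
  spaces with natural indices, hence the copies \<open>C'\<close>, \<open>S'\<close> and the line
  with coordinate 0.\<close>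

lemma k0_class_cylinder:
  assumes S: "basic_set I S" and I: "finite I" and j: "j \<notin> I"
  shows "k0_class (affine_subset (insert j I) {y \<in> affine_points (insert j I). y(j := 0) \<in> S}) =
    k0_class (affine_subset I S) * lefschetz_k0"
proof -
  obtain e where e: "bij_betw e I {0..<card I}"
    using ex_bij_betw_finite_nat[OF I] by blast
  obtain e' where e': "bij_betw e' (insert j I) {0..<card (insert j I)}"
    using ex_bij_betw_finite_nat[of "insert j I"] I by blast
  let ?J = "{0..<card I}" and ?J' = "{0..<card (insert j I)}"
  define C where "C = {y \<in> affine_points (insert j I). y(j := 0) \<in> S}"
  define S' where "S' = {y \<in> affine_points ?J. relabel e I y \<in> S}"
  define C' where "C' = {y \<in> affine_points ?J'. relabel e' (insert j I) y \<in> C}"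
  let ?P = "affine_points {0::nat}"
  have SI: "S \<subseteq> affine_points I"
    using S by (rule basic_set_subset)
  have Cb: "basic_set (insert j I) C"
    unfolding C_def
  proof (rule basic_set_preimage[OF S, where \<phi> = "\<lambda>y. y(j := 0)"])
    show "polyfun (\<lambda>y. (y(j := 0)) i)" for i
      by (cases "i = j") (auto intro: polyfun_coord polyfun_const)
  qed (auto simp: affine_points_def)
  have S'b: "basic_set ?J S'" and C'b: "basic_set ?J' C'"
    unfolding S'_def C'_def by (intro basic_set_relabel S Cb)+
  note XC = models_affine_subset[OF basic_set_subset[OF Cb]]
  note XS' = models_affine_subset[OF basic_set_subset[OF S'b]]
  note XC' = models_affine_subset[OF basic_set_subset[OF C'b]]
  note XP = models_affine_subset[OF order_refl, of "{0::nat}"]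
  have 1: "e (inv_into I e k) = k" "inv_into I e k \<in> I" "inv_into I e k \<noteq> j" if "k < card I" for k
    using e that j inv_into_into[of k e I] by (auto simp: bij_betw_def f_inv_into_f)
  have 2: "inv_into I e (e k) = k" "e k < card I" if "k \<in> I" for k
    using e that by (auto simp: bij_betw_def)
  let ?X = "affine_subset ?J S'" and ?Y = "affine_subset {0} ?P"
  have iso: "isomorphic (affine_subset (insert j I) C) (prod_space ?X ?Y)"
  proof (rule isomorphic_prod_space[OF XS' XP XC, where
        f = "\<lambda>w k. if k < card I then w (inv_into I e k) else 0" and
        g = "\<lambda>w k. if k = 0 then w j else 0" and
        \<psi> = "\<lambda>z i. if i = j then snd z 0 else if i \<in> I then fst z (e i) else 0"])
    fix w assume w: "w \<in> C"
    have "relabel e I (\<lambda>k. if k < card I then w (inv_into I e k) else 0) = w(j := 0)"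
      using 2 j w by (auto simp: relabel_def fun_eq_iff C_def affine_points_def)
    then show "(\<lambda>k. if k < card I then w (inv_into I e k) else 0) \<in> S'"
      using w by (auto simp: S'_def C_def affine_points_def)
    show "(\<lambda>k. if k = 0 then w j else 0) \<in> ?P"
      by (auto simp: affine_points_def)
    show "(\<lambda>i. if i = j then snd (\<lambda>k. if k < card I then w (inv_into I e k) else 0, \<lambda>k::nat. if k = 0 then w j else 0) 0
       else if i \<in> I then fst (\<lambda>k. if k < card I then w (inv_into I e k) else 0, \<lambda>k::nat. if k = 0 then w j else 0) (e i) else 0) = w"
      using 2 w by (auto simp: fun_eq_iff C_def affine_points_def)
  next
    fix z assume z: "z \<in> S' \<times> ?P"
    have "(\<lambda>i. if i = j then snd z 0 else if i \<in> I then fst z (e i) else 0)(j := 0) = relabel e I (fst z)"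
      using j by (auto simp: relabel_def fun_eq_iff)
    then show "(\<lambda>i. if i = j then snd z 0 else if i \<in> I then fst z (e i) else 0) \<in> C"
      using z by (auto simp: C_def S'_def affine_points_def)
    show "(\<lambda>k. if k < card I then (\<lambda>i. if i = j then snd z 0 else if i \<in> I then fst z (e i) else 0) (inv_into I e k) else 0,
         \<lambda>k. if k = 0 then if j = j then snd z 0 else if j \<in> I then fst z (e j) else 0 else 0) = z"
      using z 1 by (auto simp: fun_eq_iff prod_eq_iff S'_def affine_points_def)
  next
    fix i
    show "regfun C (\<lambda>w. if i < card I then w (inv_into I e i) else 0)"
      by (cases "i < card I") (auto intro: regfun_const regfun_coord)
    show "regfun C (\<lambda>w. if i = 0 then w j else 0)"
      by (cases "i = 0") (auto intro: regfun_const regfun_coord)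
  next
    fix i
    note op = models_openin_whole[OF XS'] models_openin_whole[OF XP]
    have "(\<lambda>z. fst z (e i)) \<in> tensor_functions ?X ?Y S' ?P"
      using tensor_fst_snd[OF XS' XP op regfun_coord[of _ "e i"] regfun_const[of _ 1]] by simp
    moreover have "(\<lambda>z. snd z 0) \<in> tensor_functions ?X ?Y S' ?P"
      using tensor_fst_snd[OF XS' XP op regfun_const[of _ 1] regfun_coord[of _ 0]] by simp
    moreover have "(\<lambda>z. 0) \<in> tensor_functions ?X ?Y S' ?P"
      using tensor_const[OF XS' XP op] .
    ultimately show "(\<lambda>z. if i = j then snd z 0 else if i \<in> I then fst z (e i) else 0) \<in> tensor_functions ?X ?Y S' ?P"
      by (cases "i = j"; cases "i \<in> I") auto
  qed
  have Pb: "basic_set {0::nat} ?P"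
    by (rule basic_set_affine)
  have C: "k0_class (affine_subset ?J' C') = k0_class (affine_subset (insert j I) C)"
    unfolding C'_def by (rule k0_class_relabel[OF e' basic_set_subset[OF Cb]])
  have S': "k0_class ?X = k0_class (affine_subset I S)"
    unfolding S'_def by (rule k0_class_relabel[OF e SI])
  have P: "k0_class ?Y = lefschetz_k0"
    unfolding lefschetz_k0_def
    by (intro k0_class_iso isomorphic_models_same[OF XP models_affine_space])
  have "k0_gen (Abs_cvar (affine_subset ?J' C')) = k0_gen (Abs_cvar ?X) * k0_gen (Abs_cvar ?Y)"
  proof -
    have *: "gen A - gen B * gen C \<in> k0_ideal \<Longrightarrow> k0_gen A = k0_gen B * k0_gen C" for A B C
      unfolding k0_gen_abs times_k0.abs_eq k0.abs_eq_iff .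
    have "isomorphic (affine_subset ?J' C') (affine_subset (insert j I) C)"
    proof -
      have b1: "e' (inv_into (insert j I) e' k) = k" "inv_into (insert j I) e' k \<in> insert j I" if "k \<in> ?J'" for k
        by (rule bij_betw_inv_into_right[OF e' that], rule bspec[OF bij_betwE[OF bij_betw_inv_into[OF e']] that])
      have b2: "inv_into (insert j I) e' (e' k) = k" "e' k \<in> ?J'" if "k \<in> insert j I" for k
        by (rule bij_betw_inv_into_left[OF e' that], rule bspec[OF bij_betwE[OF e'] that])
      show ?thesis
      proof (rule isomorphic_models[OF XC' XC, of "relabel e' (insert j I)" "relabel (inv_into (insert j I) e') ?J'"])
        have r1: "relabel e' (insert j I) (relabel (inv_into (insert j I) e') ?J' x) = x" if "x \<in> affine_points (insert j I)" for x
        proof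
          fix i show "relabel e' (insert j I) (relabel (inv_into (insert j I) e') ?J' x) i = x i"
            using that b2[of i] unfolding relabel_def affine_points_def by (cases "i \<in> insert j I") auto
        qed
        have r2: "relabel (inv_into (insert j I) e') ?J' (relabel e' (insert j I) x) = x" if "x \<in> affine_points ?J'" for x
        proof
          fix i show "relabel (inv_into (insert j I) e') ?J' (relabel e' (insert j I) x) i = x i"
            using that b1[of i] unfolding relabel_def affine_points_def by (cases "i \<in> ?J'") auto
        qed
        show "relabel e' (insert j I) x \<in> C" if "x \<in> C'" for x
          using that by (simp add: C'_def)
        show "relabel (inv_into (insert j I) e') ?J' x \<in> C'" if "x \<in> C" for x
          using that r1[of x] basic_set_subset[OF Cb] by (auto simp: relabel_affine C'_def)
        show "relabel (inv_into (insert j I) e') ?J' (relabel e' (insert j I) x) = x" if "x \<in> C'" for x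
          using that r2 basic_set_subset[OF C'b] by auto
        show "relabel e' (insert j I) (relabel (inv_into (insert j I) e') ?J' x) = x" if "x \<in> C" for x
          using that r1 basic_set_subset[OF Cb] by auto
      qed (auto intro: regfun_polyfun polyfun_relabel)
    qed
    from isomorphic_trans[OF this iso] show ?thesis
      by (intro * k0_ideal.prod)
        (simp add: Rep_cvar_models[OF XC' C'b] Rep_cvar_models[OF XS' S'b] Rep_cvar_models[OF XP Pb])
  qed
  then show ?thesis
    unfolding C_def[symmetric] using C S' P k0_class_nat[OF XC' C'b] k0_class_nat[OF XS' S'b] k0_class_nat[OF XP Pb]
    by simp
qed

lemma k0_class_point: "k0_class (affine_subset {} (affine_points {} :: ('i \<Rightarrow> complex) set)) = 1"
proof -
  let ?P = "affine_points {} :: (nat \<Rightarrow> complex) set"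
  note XP = models_affine_subset[OF order_refl, of "{} :: nat set"]
  have "k0_class (affine_subset {} (affine_points {} :: ('i \<Rightarrow> complex) set)) = k0_class (affine_subset {} ?P)"
    by (rule k0_class_models[OF models_affine_subset XP, where \<phi> = "\<lambda>_ _. 0" and \<psi> = "\<lambda>_ _. 0"])
      (auto simp: affine_points_def intro: regfun_const)
  also have "\<dots> = k0_gen (Abs_cvar (affine_subset {} ?P))"
    by (rule k0_class_nat[OF XP basic_set_affine]) simp
  also have "\<dots> = 1"
  proof -
    have *: "gen A - 1 \<in> k0_ideal \<Longrightarrow> k0_gen A = 1" for A
      unfolding k0_gen_abs one_k0.abs_eq k0.abs_eq_iff .
    show ?thesis
      using isomorphic_models_same[OF XP models_affine_space]
      by (intro * k0_ideal.point) (simp add: Rep_cvar_models[OF XP basic_set_affine])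
  qed
  finally show ?thesis .
qed

subsection \<open>Motivic classes of basic sets\<close>

definition LL :: mot where "LL = mot_of_k0 lefschetz_k0"

lemma Linv_LL: "\<L>\<^sup>-\<^sup>1 * LL = 1"
  using lefschetz_inv_mult by (simp add: LL_def mult.commute)

lemma mot_of_k0_add: "mot_of_k0 (a + b) = mot_of_k0 a + mot_of_k0 b"
  by (simp add: mot_of_k0_def plus_mot.abs_eq)

lemma mot_of_k0_mult: "mot_of_k0 (a * b) = mot_of_k0 a * mot_of_k0 b"
  by (simp add: mot_of_k0_def times_mot.abs_eq)

lemma mot_of_k0_one: "mot_of_k0 1 = 1"
  by (simp add: mot_of_k0_def one_mot.abs_eq)

lemma mot_class_iso:
  assumes "S \<subseteq> affine_points I" "T \<subseteq> affine_points J"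
    and "\<And>x. x \<in> S \<Longrightarrow> \<phi> x \<in> T" "\<And>i. regfun S (\<lambda>x. \<phi> x i)"
    and "\<And>x. x \<in> T \<Longrightarrow> \<psi> x \<in> S" "\<And>i. regfun T (\<lambda>x. \<psi> x i)"
    and "\<And>x. x \<in> S \<Longrightarrow> \<psi> (\<phi> x) = x" "\<And>x. x \<in> T \<Longrightarrow> \<phi> (\<psi> x) = x"
  shows "mot_class I S = mot_class J T"
  unfolding mot_class_def using assms
  by (subst k0_class_models[OF models_affine_subset models_affine_subset, of S I T J \<phi> \<psi>]) auto

text \<open>The identity is regular in both directions: coordinates outside either index set vanish
  on \<open>S\<close>, so the ambient space can be exchanged.\<close>

lemma mot_class_mono:
  assumes "S \<subseteq> affine_points I" "S \<subseteq> affine_points J"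
  shows "mot_class I S = mot_class J S"
  using assms by (intro mot_class_iso[of S I S J "\<lambda>x. x" "\<lambda>x. x"]) (auto intro: regfun_coord)

lemma mot_class_scissor:
  assumes "finite I" "basic_set I S" "polyfun p"
  shows "mot_class I S = mot_class I {x \<in> S. p x \<noteq> 0} + mot_class I {x \<in> S. p x = 0}"
  unfolding mot_class_def using k0_class_scissor[of I S p] assms by (simp add: mot_of_k0_add)

lemma basic_set_empty: "basic_set I {}"
  using basic_set_nonzero[OF basic_set_affine polyfun_const[of 0]] by simp

text \<open>Cutting the empty set along the zero polynomial writes its class as a sum of two copies
  of itself.\<close>

lemma mot_class_empty: "finite I \<Longrightarrow> mot_class I {} = 0"
  using mot_class_scissor[OF _ basic_set_empty polyfun_const[of 0], of I] by simp

lemma mot_class_point: "mot_class (I :: 'i set) {\<lambda>_. 0} = 1"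
proof -
  have "mot_class I {\<lambda>_. 0} = mot_class {} {\<lambda>_ :: 'i. 0 :: complex}"
    by (rule mot_class_mono) (auto simp: affine_points_def)
  also have "\<dots> = 1"
  proof -
    have "{\<lambda>_ :: 'i. 0 :: complex} = affine_points {}"
      by (auto simp: affine_points_def)
    then show ?thesis
      by (simp add: mot_class_def k0_class_point mot_of_k0_one)
  qed
  finally show ?thesis .
qed

lemma affine_points_upd: "j \<in> I \<Longrightarrow> y(j := c) \<in> affine_points I \<longleftrightarrow> y \<in> affine_points I"
  unfolding affine_points_def by (auto simp: fun_upd_apply)

text \<open>Within one ambient space, a set that is independent of coordinate \<open>j\<close> is
  represented by its section at \<open>y j = 0\<close>. Dropping \<open>j\<close> from the index set
  of the section reduces to the cylinder over a smaller affine space.\<close>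

lemma mot_class_cylinder:
  assumes I: "finite I" "j \<in> I" and S: "basic_set I S" "\<And>x. x \<in> S \<Longrightarrow> x j = 0"
  shows "mot_class I {y. y(j := 0) \<in> S} = LL * mot_class I S"
proof -
  let ?K = "I - {j}"
  have SI: "S \<subseteq> affine_points I"
    using S by (simp add: basic_set_subset)
  have SK: "S \<subseteq> affine_points ?K"
    using SI S(2) by (auto simp: affine_points_def subset_iff)
  have "{y \<in> affine_points ?K. (\<lambda>y. y) y \<in> S} = S"
    using SK by auto
  then have b: "basic_set ?K S"
    using basic_set_preimage[OF S(1), where \<phi> = "\<lambda>y. y" and J = ?K]
    by (auto simp: affine_points_def intro: polyfun_coord)
  have "{y \<in> affine_points (insert j ?K). y(j := 0) \<in> S} = {y. y(j := 0) \<in> S}"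
    using I SI affine_points_upd[of j I _ 0] by (auto simp: insert_absorb)
  then have "mot_class (insert j ?K) {y. y(j := 0) \<in> S} = LL * mot_class ?K S"
    using k0_class_cylinder[OF b, of j] I by (simp add: mot_class_def LL_def mot_of_k0_mult mult.commute)
  moreover have "mot_class ?K S = mot_class I S"
    using SI SK by (intro mot_class_mono)
  ultimately show ?thesis
    using I by (simp add: insert_absorb)
qed

text \<open>Projection along \<open>j\<close> is an isomorphism from the graph to its base, with the
  insertion of the value of \<gamma> as inverse. Regularity of \<gamma> on \<open>S\<close>
  suffices, so the solution of a linear equation with invertible slope is allowed.\<close>

lemma mot_class_graph:
  assumes I: "j \<in> I" and S: "S \<subseteq> affine_points I" "\<And>x. x \<in> S \<Longrightarrow> x j = 0" and \<gamma>: "regfun S \<gamma>"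
  shows "mot_class I {y. y(j := 0) \<in> S \<and> y j = \<gamma> (y(j := 0))} = mot_class I S"
proof (rule mot_class_iso[OF _ S(1), where \<phi> = "\<lambda>y. y(j := 0)" and \<psi> = "\<lambda>x. x(j := \<gamma> x)"])
  show "{y. y(j := 0) \<in> S \<and> y j = \<gamma> (y(j := 0))} \<subseteq> affine_points I"
    using S(1) affine_points_upd[OF I, of _ 0] by blast
  have z: "x(j := 0) = x" if "x \<in> S" for x
    using S(2)[OF that] by (metis fun_upd_triv)
  show "x(j := \<gamma> x) \<in> {y. y(j := 0) \<in> S \<and> y j = \<gamma> (y(j := 0))}" if "x \<in> S" for x
    using that z by simp
  show "regfun {y. y(j := 0) \<in> S \<and> y j = \<gamma> (y(j := 0))} (\<lambda>y. (y(j := 0)) i)" for i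
    by (cases "i = j") (auto intro: regfun_const regfun_coord)
  show "regfun S (\<lambda>x. (x(j := \<gamma> x)) i)" for i
    using \<gamma> by (cases "i = j") (auto intro: regfun_coord)
  show "(x(j := 0))(j := \<gamma> (x(j := 0))) = x" if "x \<in> {y. y(j := 0) \<in> S \<and> y j = \<gamma> (y(j := 0))}" for x
    using that by auto
  show "(x(j := \<gamma> x))(j := 0) = x" if "x \<in> S" for x
    using that z by simp
qed simp

text \<open>Scissor relations for the members of \<open>F\<close>, one after another;
  \<open>E\<close> records which of them vanish on a cell.\<close>

lemma mot_class_atoms:
  assumes I: "finite I"
  shows "finite F \<Longrightarrow> (\<And>p. p \<in> F \<Longrightarrow> polyfun p) \<Longrightarrow> basic_set I S \<Longrightarrow>
    mot_class I S = (\<Sum>E\<in>Pow F. mot_class I {x \<in> S. \<forall>p\<in>F. p x = 0 \<longleftrightarrow> p \<in> E})"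
proof (induction F arbitrary: S rule: finite_induct)
  case (insert p F)
  have p: "polyfun p"
    using insert.prems by auto
  have b: "basic_set I {x \<in> S. p x \<noteq> 0}" "basic_set I {x \<in> S. p x = 0}"
    using insert.prems(2) p by (auto intro: basic_set_zero basic_set_nonzero)
  have F: "finite (Pow F)" "Pow F \<inter> insert p ` Pow F = {}" "inj_on (insert p) (Pow F)"
    using insert.hyps by (auto simp: inj_on_def)
  have e1: "{x \<in> {x \<in> S. p x \<noteq> 0}. \<forall>p\<in>F. p x = 0 \<longleftrightarrow> p \<in> E} =
      {x \<in> S. \<forall>q\<in>insert p F. q x = 0 \<longleftrightarrow> q \<in> E}"
    and e2: "{x \<in> {x \<in> S. p x = 0}. \<forall>p\<in>F. p x = 0 \<longleftrightarrow> p \<in> E} =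
      {x \<in> S. \<forall>q\<in>insert p F. q x = 0 \<longleftrightarrow> q \<in> insert p E}" if "E \<in> Pow F" for E
    using that insert.hyps by (auto simp: subset_iff)
  have "mot_class I S = mot_class I {x \<in> S. p x \<noteq> 0} + mot_class I {x \<in> S. p x = 0}"
    by (rule mot_class_scissor[OF I insert.prems(2) p])
  also have "\<dots> = (\<Sum>E\<in>Pow F. mot_class I {x \<in> S. \<forall>q\<in>insert p F. q x = 0 \<longleftrightarrow> q \<in> E}) +
     (\<Sum>E\<in>Pow F. mot_class I {x \<in> S. \<forall>q\<in>insert p F. q x = 0 \<longleftrightarrow> q \<in> insert p E})"
    using insert.IH[OF _ b(1)] insert.IH[OF _ b(2)] insert.prems(1) e1 e2 by simp
  also have "(\<Sum>E\<in>Pow F. mot_class I {x \<in> S. \<forall>q\<in>insert p F. q x = 0 \<longleftrightarrow> q \<in> insert p E}) =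
     (\<Sum>E\<in>insert p ` Pow F. mot_class I {x \<in> S. \<forall>q\<in>insert p F. q x = 0 \<longleftrightarrow> q \<in> E})"
    using F(3) by (simp only: sum.reindex o_def)
  also have "(\<Sum>E\<in>Pow F. mot_class I {x \<in> S. \<forall>q\<in>insert p F. q x = 0 \<longleftrightarrow> q \<in> E}) + \<dots> =
     (\<Sum>E\<in>Pow (insert p F). mot_class I {x \<in> S. \<forall>q\<in>insert p F. q x = 0 \<longleftrightarrow> q \<in> E})"
    unfolding Pow_insert using F by (intro sum.union_disjoint[symmetric]) auto
  finally show ?case .
qed simp

text \<open>Pieces cannot be removed one at a time, because the union of some of them need not be a
  basic set. Instead everything is cut along all functions that define any piece: a non-empty cell
  of the union, given by a vanishing pattern, lies in exactly one piece, so both sides become sums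
  over the same cells.\<close>

lemma mot_class_partition:
  assumes I: "finite I" and J: "finite J" and S: "\<And>j. j \<in> J \<Longrightarrow> basic_set I (S j)"
    and disj: "\<And>i j x. i \<in> J \<Longrightarrow> j \<in> J \<Longrightarrow> x \<in> S i \<Longrightarrow> x \<in> S j \<Longrightarrow> i = j"
    and U: "basic_set I (\<Union>j\<in>J. S j)"
  shows "mot_class I (\<Union>j\<in>J. S j) = (\<Sum>j\<in>J. mot_class I (S j))"
proof -
  define P where "P = (\<lambda>j (A, q). finite A \<and> (\<forall>p\<in>A. polyfun p) \<and> polyfun q \<and>
     S j = {x \<in> affine_points I. (\<forall>p\<in>A. p x = 0) \<and> q x \<noteq> 0})"
  have "\<forall>j\<in>J. \<exists>Aq. P j Aq"
    using S by (auto simp: basic_set_def P_def)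
  from bchoice[OF this] obtain Aq where Aq: "\<forall>j\<in>J. P j (Aq j)"
    by blast
  define A where "A = (\<lambda>j. fst (Aq j))"
  define q where "q = (\<lambda>j. snd (Aq j))"
  have "P j (A j, q j)" if "j \<in> J" for j
    using Aq that by (simp add: A_def q_def)
  then have A: "\<And>j. j \<in> J \<Longrightarrow> finite (A j)" "\<And>j p. j \<in> J \<Longrightarrow> p \<in> A j \<Longrightarrow> polyfun p"
     "\<And>j. j \<in> J \<Longrightarrow> polyfun (q j)"
     "\<And>j. j \<in> J \<Longrightarrow> S j = {x \<in> affine_points I. (\<forall>p\<in>A j. p x = 0) \<and> q j x \<noteq> 0}"
    unfolding P_def by auto
  define F where "F = (\<Union>j\<in>J. insert (q j) (A j))"
  have F: "finite F" "\<And>p. p \<in> F \<Longrightarrow> polyfun p"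
    using J A by (auto simp: F_def)
  define c where "c = (\<lambda>T E. {x \<in> T. \<forall>p\<in>F. p x = 0 \<longleftrightarrow> p \<in> E})"
  let ?U = "\<Union>j\<in>J. S j"
  \<comment> \<open>All functions defining \<open>S j\<close> belong to \<open>F\<close>, so
    membership in \<open>S j\<close> depends only on the vanishing pattern \<open>E\<close>.\<close>
  have sat: "y \<in> S j" if "x \<in> c (S j) E" "y \<in> c ?U E" "j \<in> J" for x y j E
  proof -
    have "A j \<subseteq> F" "q j \<in> F"
      using that(3) by (auto simp: F_def)
    moreover have "y \<in> affine_points I"
      using that(2) A(4) by (auto simp: c_def)
    ultimately show ?thesis
      using that(1,2) unfolding A(4)[OF that(3)] c_def by auto
  qed
  have cell: "mot_class I (c ?U E) = (\<Sum>j\<in>J. mot_class I (c (S j) E))" for E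
  proof (cases "c ?U E = {}")
    case True
    then have "c (S j) E = {}" if "j \<in> J" for j
      using that by (auto simp: c_def)
    then show ?thesis
      using True I by (simp add: mot_class_empty)
  next
    case False
    then obtain x j where x: "x \<in> c ?U E" "j \<in> J" "x \<in> S j"
      by (auto simp: c_def)
    then have xj: "x \<in> c (S j) E"
      by (auto simp: c_def)
    have 1: "c ?U E = c (S j) E"
      using sat[OF xj _ x(2)] x(2) by (auto simp: c_def)
    have 2: "c (S i) E = {}" if "i \<in> J" "i \<noteq> j" for i
    proof (rule ccontr)
      assume "c (S i) E \<noteq> {}"
      then obtain y where y: "y \<in> c (S i) E"
        by blast
      from sat[OF y x(1) that(1)] x(2,3) that disj show False
        by blast
    qed
    show ?thesis
      unfolding 1 using J x(2) 2 I
      by (subst sum.remove[of _ j]) (auto simp: mot_class_empty)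
  qed
  have "mot_class I ?U = (\<Sum>E\<in>Pow F. mot_class I (c ?U E))"
    unfolding c_def by (rule mot_class_atoms[OF I F U])
  also have "\<dots> = (\<Sum>j\<in>J. \<Sum>E\<in>Pow F. mot_class I (c (S j) E))"
    unfolding cell by (rule sum.swap)
  also have "\<dots> = (\<Sum>j\<in>J. mot_class I (S j))"
    unfolding c_def by (intro sum.cong refl mot_class_atoms[OF I F S, symmetric])
  finally show ?thesis .
qed

subsection \<open>Cones\<close>

text \<open>The non-negative combinations form a convex cone containing \<open>N\<close>, so the
  hull lies inside it.\<close>

lemma convex_cone_hull_finite:
  assumes "finite N" "x \<in> convex_cone hull N"
  shows "\<exists>c. (\<forall>v\<in>N. 0 \<le> c v) \<and> x = (\<Sum>v\<in>N. c v *\<^sub>R v)"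
proof -
  let ?K = "{(\<Sum>v\<in>N. c v *\<^sub>R v) |c. \<forall>v\<in>N. 0 \<le> c v}"
  have "convex_cone ?K"
    unfolding convex_cone_iff
  proof (intro conjI ballI allI impI)
    show "0 \<in> ?K"
      by (intro CollectI exI[of _ "\<lambda>_. 0"]) auto
    show "y + z \<in> ?K" if "y \<in> ?K" "z \<in> ?K" for y z
    proof -
      obtain c d where "y = (\<Sum>v\<in>N. c v *\<^sub>R v)" "\<forall>v\<in>N. 0 \<le> c v" "z = (\<Sum>v\<in>N. d v *\<^sub>R v)" "\<forall>v\<in>N. 0 \<le> d v"
        using \<open>y \<in> ?K\<close> \<open>z \<in> ?K\<close> by auto
      then show ?thesis
        by (intro CollectI exI[of _ "\<lambda>v. c v + d v"]) (auto simp: scaleR_add_left sum.distrib)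
    qed
    show "r *\<^sub>R y \<in> ?K" if "y \<in> ?K" "0 \<le> r" for y r
    proof -
      obtain c where "y = (\<Sum>v\<in>N. c v *\<^sub>R v)" "\<forall>v\<in>N. 0 \<le> c v"
        using \<open>y \<in> ?K\<close> by auto
      then show ?thesis
        using \<open>0 \<le> r\<close> by (intro CollectI exI[of _ "\<lambda>v. r * c v"]) (auto simp: scaleR_sum_right)
    qed
  qed
  moreover have "N \<subseteq> ?K"
  proof
    fix v assume "v \<in> N"
    then have "(\<Sum>w\<in>N. (if w = v then 1 else 0) *\<^sub>R w) = v"
      using assms(1) by (simp add: if_distrib[of "\<lambda>c. c *\<^sub>R _"] sum.delta cong: if_cong)
    then show "v \<in> ?K"
      by (intro CollectI exI[of _ "\<lambda>w. if w = v then 1 else 0"]) auto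
  qed
  ultimately have "convex_cone hull N \<subseteq> ?K"
    by (intro hull_minimal)
  with assms(2) show ?thesis
    by blast
qed

text \<open>If \<open>k\<close> were outside the closed cone generated by \<open>N\<close>, a
  separating functional would be non-negative on \<open>N\<close> and negative on
  \<open>k\<close>.\<close>

lemma farkas:
  fixes k :: "'a::euclidean_space"
  assumes N: "finite N" and k: "\<And>y. (\<And>v. v \<in> N \<Longrightarrow> 0 \<le> v \<bullet> y) \<Longrightarrow> 0 \<le> k \<bullet> y"
  shows "\<exists>c. (\<forall>v\<in>N. 0 \<le> c v) \<and> k = (\<Sum>v\<in>N. c v *\<^sub>R v)"
proof (rule convex_cone_hull_finite[OF N], rule ccontr)
  let ?K = "convex_cone hull N"
  assume "k \<notin> ?K"
  moreover have "closed ?K"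
    using polyhedron_convex_cone_hull[OF N] by (rule polyhedron_imp_closed)
  ultimately obtain a b where ab: "a \<bullet> k < b" "\<forall>x\<in>?K. a \<bullet> x > b"
    using separating_hyperplane_closed_point[OF convex_convex_cone_hull] by blast
  have b: "b < 0"
    using ab(2) convex_cone_hull_contains_0[of N] by (metis inner_zero_right)
  have "0 \<le> v \<bullet> a" if v: "v \<in> N" for v
  proof (rule ccontr)
    assume *: "\<not> 0 \<le> v \<bullet> a"
    \<comment> \<open>Both \<open>a \<bullet> v\<close> and \<open>b\<close> are negative, so this
      is a positive multiple of \<open>v\<close> and stays in the cone; yet \<open>a\<close> takes
      exactly the value \<open>b\<close> on it, against strict separation.\<close>
    have "(b / (a \<bullet> v)) *\<^sub>R v \<in> ?K"
      using v * b by (intro convex_cone_hull_mul hull_inc) (auto simp: inner_commute divide_nonpos_neg)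
    then have "b < a \<bullet> ((b / (a \<bullet> v)) *\<^sub>R v)"
      using ab(2) by blast
    then show False
      using * by (simp add: inner_commute)
  qed
  then have "0 \<le> k \<bullet> a"
    by (rule k)
  with ab(1) b show False
    by (simp add: inner_commute)
qed

subsection \<open>The Newton polyhedron\<close>

lemma inner_orthant: "k \<in> nonneg_orthant \<Longrightarrow> r \<in> nonneg_orthant \<Longrightarrow> 0 \<le> k \<bullet> r"
  for k r :: "real ^ 'n"
  by (auto simp: inner_vec_def nonneg_orthant_def intro!: sum_nonneg)

lemma axis_orthant: "axis i 1 \<in> nonneg_orthant" "axis i (1::real) \<in> integer_points"
  by (auto simp: nonneg_orthant_def integer_points_def axis_def)

lemma exponent_vec_orthant: "exponent_vec \<omega> \<in> nonneg_orthant"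
  by (auto simp: nonneg_orthant_def exponent_vec_def)

lemma orthant_add: "x \<in> nonneg_orthant \<Longrightarrow> y \<in> nonneg_orthant \<Longrightarrow> x + y \<in> nonneg_orthant"
  and orthant_scale: "0 \<le> c \<Longrightarrow> x \<in> nonneg_orthant \<Longrightarrow> c *\<^sub>R x \<in> nonneg_orthant"
  and orthant_sum: "(\<And>j. j \<in> J \<Longrightarrow> g j \<in> nonneg_orthant) \<Longrightarrow> sum g J \<in> nonneg_orthant"
  by (auto simp: nonneg_orthant_def sum_nonneg)

lemma convex_orthant: "convex nonneg_orthant"
  unfolding convex_def by (auto simp: nonneg_orthant_def)

lemma inner_axis_one: "axis i (1::real) \<bullet> x = x $ i" "x \<bullet> axis i (1::real) = x $ i"
  by (simp_all add: inner_axis inner_axis')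

locale newton =
  fixes f :: "'n::finite cpoly"
  assumes f0: "f \<noteq> 0" and f_origin: "0 \<notin> Poly_Mapping.keys f"
begin

abbreviation "\<Gamma> \<equiv> newton_polyhedron f"
abbreviation "F \<equiv> first_meet_locus f"
abbreviation "m \<equiv> newton_m f"
abbreviation "V \<equiv> exponent_vec ` Poly_Mapping.keys f"

lemma keys_nonempty: "Poly_Mapping.keys f \<noteq> {}"
  using f0 by simp

lemma exponent_in: "\<omega> \<in> Poly_Mapping.keys f \<Longrightarrow> exponent_vec \<omega> \<in> \<Gamma>"
  unfolding newton_polyhedron_def
  by (rule hull_inc) (auto simp: image_iff nonneg_orthant_def intro!: bexI[of _ \<omega>] exI[of _ 0])

lemma polyhedron_subset_sum: "x \<in> \<Gamma> \<Longrightarrow> \<exists>w r. w \<in> convex hull V \<and> r \<in> nonneg_orthant \<and> x = w + r"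
proof -
  let ?S = "\<Union>w\<in>convex hull V. \<Union>r\<in>nonneg_orthant. {w + r}"
  have "\<Gamma> \<subseteq> ?S"
    unfolding newton_polyhedron_def
  proof (rule hull_minimal)
    show "convex ?S"
      by (intro convex_sums convex_convex_hull convex_orthant)
    show "(\<Union>\<omega>\<in>Poly_Mapping.keys f. (+) (exponent_vec \<omega>) ` nonneg_orthant) \<subseteq> ?S"
      using hull_inc[of _ V convex] by blast
  qed
  then show "x \<in> \<Gamma> \<Longrightarrow> \<exists>w r. w \<in> convex hull V \<and> r \<in> nonneg_orthant \<and> x = w + r"
    by blast
qed

lemma polyhedron_add:
  assumes "x \<in> \<Gamma>" "r \<in> nonneg_orthant"
  shows "x + r \<in> \<Gamma>"
proof -
  let ?U = "\<Union>\<omega>\<in>Poly_Mapping.keys f. (+) (exponent_vec \<omega>) ` nonneg_orthant"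
  have "(+) r ` ?U \<subseteq> ?U"
  proof clarify
    fix \<omega> and r' :: "real ^ 'n" assume \<omega>: "\<omega> \<in> Poly_Mapping.keys f" "r' \<in> nonneg_orthant"
    have "r + (exponent_vec \<omega> + r') = exponent_vec \<omega> + (r + r')"
      by simp
    then show "r + (exponent_vec \<omega> + r') \<in> ?U"
      using \<omega> orthant_add[OF assms(2) \<omega>(2)] by blast
  qed
  then have "convex hull ((+) r ` ?U) \<subseteq> convex hull ?U"
    by (rule hull_mono)
  then show ?thesis
    using assms(1) unfolding newton_polyhedron_def convex_hull_translation by (auto simp: add.commute)
qed

lemma convex_polyhedron: "convex \<Gamma>"
  by (simp add: newton_polyhedron_def)

lemma polyhedron_convex_hull_subset: "convex hull V \<subseteq> \<Gamma>"
  using exponent_in by (intro hull_minimal convex_polyhedron) auto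

lemma polyhedron_orthant: "\<Gamma> \<subseteq> nonneg_orthant"
  unfolding newton_polyhedron_def
  by (intro hull_minimal convex_orthant) (auto intro: orthant_add exponent_vec_orthant)

text \<open>Adding vectors of the orthant does not decrease the functional, so the half space at the
  minimum over the finitely many exponents contains \<Gamma>. That the minimum is taken at an
  exponent also makes \<open>m\<close> integral at lattice points.\<close>

lemma newton_m_attained:
  assumes k: "k \<in> nonneg_orthant"
  shows "\<exists>\<omega>\<in>Poly_Mapping.keys f. k \<bullet> exponent_vec \<omega> = m k"
    and "x \<in> \<Gamma> \<Longrightarrow> m k \<le> k \<bullet> x"
proof -
  let ?M = "(\<lambda>\<omega>. k \<bullet> exponent_vec \<omega>) ` Poly_Mapping.keys f"
  have fin: "finite ?M" "?M \<noteq> {}"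
    using keys_nonempty by auto
  then have "Min ?M \<in> ?M"
    by (rule Min_in)
  then obtain \<omega> where \<omega>: "\<omega> \<in> Poly_Mapping.keys f" "k \<bullet> exponent_vec \<omega> = Min ?M"
    by auto
  have "\<Gamma> \<subseteq> {x. k \<bullet> x \<ge> Min ?M}"
    unfolding newton_polyhedron_def
  proof (intro hull_minimal convex_halfspace_ge UN_least image_subsetI CollectI)
    fix \<omega>' and r :: "real ^ 'n" assume "\<omega>' \<in> Poly_Mapping.keys f" "r \<in> nonneg_orthant"
    then have "Min ?M \<le> k \<bullet> exponent_vec \<omega>'" "0 \<le> k \<bullet> r"
      using fin k by (auto intro: inner_orthant)
    then show "Min ?M \<le> k \<bullet> (exponent_vec \<omega>' + r)"
      by (simp add: inner_add_right)
  qed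
  moreover from this have "m k = Min ?M"
    unfolding newton_m_def using exponent_in[OF \<omega>(1)] \<omega>(2)
    by (intro cInf_eq_minimum) (auto intro: rev_image_eqI)
  ultimately show "\<exists>\<omega>\<in>Poly_Mapping.keys f. k \<bullet> exponent_vec \<omega> = m k" "x \<in> \<Gamma> \<Longrightarrow> m k \<le> k \<bullet> x"
    using \<omega> by auto
qed

lemma newton_m_nonneg: "k \<in> nonneg_orthant \<Longrightarrow> 0 \<le> m k"
  using newton_m_attained(1) inner_orthant[OF _ exponent_vec_orthant] by metis

lemma newton_m_eq:
  assumes "x \<in> \<Gamma>" "\<And>y. y \<in> \<Gamma> \<Longrightarrow> k \<bullet> x \<le> k \<bullet> y"
  shows "m k = k \<bullet> x"
  unfolding newton_m_def using assms by (intro cInf_eq_minimum) auto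

lemma in_first_meet_locus: "x \<in> F k \<longleftrightarrow> x \<in> \<Gamma> \<and> k \<bullet> x = m k"
  by (simp add: first_meet_locus_def)

lemma first_meet_locus_nonempty: "k \<in> nonneg_orthant \<Longrightarrow> F k \<noteq> {}"
  using newton_m_attained(1) exponent_in in_first_meet_locus by blast

lemma newton_m_Int: "k \<in> nonneg_orthant \<Longrightarrow> k \<in> integer_points \<Longrightarrow> m k \<in> \<int>"
proof -
  assume k: "k \<in> nonneg_orthant" "k \<in> integer_points"
  then obtain \<omega> where "k \<bullet> exponent_vec \<omega> = m k"
    using newton_m_attained(1) by blast
  moreover have "k \<bullet> exponent_vec \<omega> \<in> \<int>"
    using k by (auto simp: inner_vec_def exponent_vec_def integer_points_def intro!: Ints_sum Ints_mult)
  ultimately show ?thesis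
    by simp
qed

text \<open>Write x in \<open>F k\<close> as a convex combination of exponents plus a vector
  \<open>r\<close> of the orthant. Minimality admits only exponents of minimal weight and forces r_i
  = 0 wherever k_i is non-zero. Conditions on all of \<open>F k\<close> thus reduce to conditions on
  finitely many exponents and on the zeros of \<open>k\<close>.\<close>

lemma linear_on_first_meet_locus:
  fixes p :: "real ^ 'n"
  assumes k: "k \<in> nonneg_orthant" and x: "x \<in> F k"
    and p: "\<And>\<omega>. \<omega> \<in> Poly_Mapping.keys f \<Longrightarrow> k \<bullet> exponent_vec \<omega> = m k \<Longrightarrow> p \<bullet> exponent_vec \<omega> = c"
      "\<And>i. k $ i = 0 \<Longrightarrow> p $ i = 0"
  shows "p \<bullet> x = c"
proof -
  have x: "x \<in> \<Gamma>" "k \<bullet> x = m k"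
    using x by (auto simp: in_first_meet_locus)
  obtain w r where w: "w \<in> convex hull V" and r: "r \<in> nonneg_orthant" and xw: "x = w + r"
    using polyhedron_subset_sum[OF x(1)] by blast
  have "m k \<le> k \<bullet> w" "0 \<le> k \<bullet> r"
    using newton_m_attained(2)[OF k] w polyhedron_convex_hull_subset inner_orthant[OF k r] by auto
  then have kw: "k \<bullet> w = m k" and kr: "k \<bullet> r = 0"
    using x(2) by (auto simp: xw inner_add_right)
  have "k $ i * r $ i = 0" for i
    using kr k r sum_nonneg_eq_0_iff[of UNIV "\<lambda>i. k $ i * r $ i"]
    by (auto simp: inner_vec_def nonneg_orthant_def)
  then have "p $ i * r $ i = 0" for i
    using p(2)[of i] by (metis mult_eq_0_iff)
  then have pr: "p \<bullet> r = 0"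
    unfolding inner_vec_def inner_real_def by (intro sum.neutral) blast
  obtain u where u: "\<And>v. v \<in> V \<Longrightarrow> 0 \<le> u v" "sum u V = 1" "w = (\<Sum>v\<in>V. u v *\<^sub>R v)"
    using w by (auto simp: convex_hull_finite)
  have "(\<Sum>v\<in>V. u v * (k \<bullet> v - m k)) = 0"
  proof -
    have "(\<Sum>v\<in>V. u v * (k \<bullet> v - m k)) = k \<bullet> w - m k * sum u V"
      by (simp add: u(3) inner_sum_right algebra_simps sum_subtractf sum_distrib_left)
    then show ?thesis
      using u(2) kw by simp
  qed
  moreover have "0 \<le> u v * (k \<bullet> v - m k)" if "v \<in> V" for v
    using u(1)[OF that] newton_m_attained(2)[OF k, of v] that exponent_in by auto
  ultimately have z: "u v * (k \<bullet> v - m k) = 0" if "v \<in> V" for v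
    using that sum_nonneg_eq_0_iff[of V "\<lambda>v. u v * (k \<bullet> v - m k)"] by auto
  have uc: "u v * (p \<bullet> v) = u v * c" if "v \<in> V" for v
    using z[OF that] p(1) that by auto
  have "p \<bullet> w = (\<Sum>v\<in>V. u v * (p \<bullet> v))"
    by (simp add: u(3) inner_sum_right)
  also have "\<dots> = (\<Sum>v\<in>V. u v * c)"
    by (intro sum.cong refl uc)
  also have "\<dots> = c"
    using u(2) by (simp add: sum_distrib_right[symmetric])
  finally show ?thesis
    using pr by (simp add: xw inner_add_right)
qed

text \<open>An exponent involving the variable \<open>i\<close> has weight at least k_i, which is
  too large to be minimal.\<close>

lemma first_meet_locus_coordinate:
  fixes x :: "real ^ 'n"
  assumes k: "k \<in> nonneg_orthant" and i: "m k < k $ i" and x: "x \<in> F k"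
  shows "x $ i = 0"
proof -
  have "axis i 1 \<bullet> x = 0"
  proof (rule linear_on_first_meet_locus[OF k x])
    fix \<omega> assume \<omega>: "\<omega> \<in> Poly_Mapping.keys f" "k \<bullet> exponent_vec \<omega> = m k"
    have "k $ i * exponent_vec \<omega> $ i \<le> k \<bullet> exponent_vec \<omega>"
      unfolding inner_vec_def inner_real_def using k exponent_vec_orthant[of \<omega>]
      by (intro member_le_sum) (auto simp: nonneg_orthant_def)
    then have "k $ i * real (Poly_Mapping.lookup \<omega> i) < k $ i"
      using i \<omega> by (simp add: exponent_vec_def)
    moreover have "0 < k $ i"
      using i newton_m_nonneg[OF k] by simp
    ultimately have "real (Poly_Mapping.lookup \<omega> i) < 1"
      by (metis mult.right_neutral mult_less_cancel_left_pos)
    then show "axis i 1 \<bullet> exponent_vec \<omega> = 0"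
      by (simp add: inner_axis_one exponent_vec_def)
  next
    fix j assume "k $ j = 0"
    then show "axis i (1::real) $ j = 0"
      using i newton_m_nonneg[OF k] by (auto simp: axis_def)
  qed
  then show ?thesis
    by (simp add: inner_axis_one)
qed

text \<open>\<Gamma> is the slice at height 1 of the cone generated by the points (v, 1), v an
  exponent, and the directions (e_i, 0). Finitely generated cones are polyhedral, and so are their
  slices.\<close>

lemma polyhedron_newton: "polyhedron \<Gamma>"
proof -
  define G :: "((real ^ 'n) \<times> real) set" where "G = (\<lambda>v. (v, 1)) ` V \<union> (\<lambda>i. (axis i 1, 0)) ` UNIV"
  let ?C = "convex_cone hull G"
  have "finite G"
    by (simp add: G_def)
  then have "polyhedron ?C"
    by (rule polyhedron_convex_cone_hull)
  then obtain H where H: "finite H" "?C = \<Inter>H" "\<forall>h\<in>H. \<exists>a b. a \<noteq> 0 \<and> h = {x. a \<bullet> x \<le> b}"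
    unfolding polyhedron_def by blast
  have slice: "\<Gamma> = {x. (x, 1) \<in> ?C}"
  proof
    have conv: "convex {x. (x, 1) \<in> ?C}"
    proof (rule convexI)
      fix x y :: "real ^ 'n" and u v :: real
      assume *: "x \<in> {x. (x, 1) \<in> ?C}" "y \<in> {x. (x, 1) \<in> ?C}" "0 \<le> u" "0 \<le> v" "u + v = 1"
      then have "u *\<^sub>R (x, 1) + v *\<^sub>R (y, 1) \<in> ?C"
        by (intro convexD[OF convex_convex_cone_hull]) auto
      then show "u *\<^sub>R x + v *\<^sub>R y \<in> {x. (x, 1) \<in> ?C}"
        using *(5) by simp
    qed
    show "\<Gamma> \<subseteq> {x. (x, 1) \<in> ?C}"
      unfolding newton_polyhedron_def
    proof (rule hull_minimal[where S = convex], clarify)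
      fix \<omega> and r :: "real ^ 'n" assume \<omega>: "\<omega> \<in> Poly_Mapping.keys f" and r: "r \<in> nonneg_orthant"
      have 1: "(exponent_vec \<omega>, 1) \<in> ?C"
        using \<omega> by (intro hull_inc) (auto simp: G_def)
      have cc: "convex_cone ?C"
        by (rule convex_cone_convex_cone_hull)
      have s: "(\<Sum>i\<in>J. r $ i *\<^sub>R (axis i (1::real), 0::real)) \<in> ?C" for J
      proof (induction J rule: infinite_finite_induct)
        case (insert i J)
        have "r $ i *\<^sub>R (axis i (1::real), 0::real) \<in> ?C"
          using r by (intro convex_cone_scaleR[OF cc] hull_inc) (auto simp: G_def nonneg_orthant_def)
        then show ?case
          using insert by (simp del: scaleR_Pair add: convex_cone_add[OF cc])
      qed (auto intro: convex_cone_contains_0[OF cc] simp: zero_prod_def[symmetric])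
      have "(\<Sum>i\<in>UNIV. r $ i *\<^sub>R axis i (1::real)) = r"
        using basis_expansion[of r] by (simp add: scalar_mult_eq_scaleR)
      then have "(\<Sum>i\<in>UNIV. r $ i *\<^sub>R (axis i (1::real), 0::real)) = (r, 0)"
        by (simp add: prod_eq_iff fst_sum snd_sum)
      with s[of UNIV] have "(exponent_vec \<omega>, 1) + (r, 0) \<in> ?C"
        using 1 by (intro convex_cone_add[OF cc]) auto
      then show "(exponent_vec \<omega> + r, 1) \<in> ?C"
        by simp
    qed (rule conv)
  next
    \<comment> \<open>The homogenization of \<Gamma> in explicit form: t\<Gamma> at height t > 0,
      and the recession directions, which form the orthant, at height 0.\<close>
    let ?K = "{(x, t). t = 0 \<and> x \<in> nonneg_orthant \<or> 0 < t \<and> (1 / t) *\<^sub>R x \<in> \<Gamma>}"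
    have "?C \<subseteq> ?K"
    proof (rule hull_minimal)
      show "G \<subseteq> ?K"
        using exponent_in by (auto simp: G_def axis_orthant)
      have add: "a + b \<in> ?K" if "a \<in> ?K" "b \<in> ?K" for a b
      proof -
        obtain x t y s where ab: "a = (x, t)" "b = (y, s)"
          by (cases a, cases b) auto
        have mix: "(1 / s) *\<^sub>R (x + y) \<in> \<Gamma>" if "x \<in> nonneg_orthant" "0 < s" "(1 / s) *\<^sub>R y \<in> \<Gamma>" for x y s
          using polyhedron_add[OF that(3) orthant_scale[of "1 / s", OF _ that(1)]] that(2)
          by (simp add: scaleR_add_right add.commute)
        consider "t = 0" "s = 0" | "t = 0" "0 < s" | "0 < t" "s = 0" | "0 < t" "0 < s"
          using \<open>a \<in> ?K\<close> \<open>b \<in> ?K\<close> by (auto simp: ab)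
        then show ?thesis
        proof cases
          case 4
          have "(t / (t + s)) *\<^sub>R ((1 / t) *\<^sub>R x) + (s / (t + s)) *\<^sub>R ((1 / s) *\<^sub>R y) \<in> \<Gamma>"
            using 4 that by (intro convexD[OF convex_polyhedron]) (auto simp: ab add_divide_distrib[symmetric])
          then show ?thesis
            using 4 by (simp add: ab scaleR_add_right)
        qed (use that mix[of x s y] mix[of y t x] in \<open>auto simp: ab add.commute intro: orthant_add\<close>)
      qed
      have scale: "c *\<^sub>R a \<in> ?K" if "a \<in> ?K" "0 \<le> c" for a c
      proof (cases "c = 0")
        case True
        then show ?thesis
          by (cases a) (auto simp: nonneg_orthant_def)
      next
        case False
        then show ?thesis
          using that by (cases a) (auto intro: orthant_scale)
      qed
      show "convex_cone ?K"
        unfolding convex_cone_iff using add scale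
        by (intro conjI ballI allI impI) (auto simp: zero_prod_def nonneg_orthant_def)
    qed
    then show "{x. (x, 1) \<in> ?C} \<subseteq> \<Gamma>"
      by auto
  qed
  have "polyhedron ((\<lambda>x. (x, 1)) -` h)" if h: "h \<in> H" for h
  proof -
    obtain a b where "h = {x. a \<bullet> x \<le> b}"
      using H(3) h by blast
    then have "(\<lambda>x. (x, 1)) -` h = {x. fst a \<bullet> x \<le> b - snd a}"
      by (cases a) (auto simp: algebra_simps)
    then show ?thesis
      by (simp add: polyhedron_halfspace_le)
  qed
  then have "polyhedron (\<Inter>((\<lambda>h. (\<lambda>x. (x, 1)) -` h) ` H))"
    using H(1) by (intro polyhedron_Inter) auto
  moreover have "\<Gamma> = \<Inter>((\<lambda>h. (\<lambda>x. (x, 1)) -` h) ` H)"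
    unfolding slice H(2) by auto
  ultimately show ?thesis
    by simp
qed

section \<open>Dimension and supporting hyperplanes of the Newton polyhedron\<close>

lemma interior_newton: "interior \<Gamma> \<noteq> {}"
proof -
  obtain \<omega> where \<omega>: "\<omega> \<in> Poly_Mapping.keys f"
    using keys_nonempty by blast
  \<comment> \<open>The all-one shift leaves room 1 in every coordinate, so the unit ball stays in
    the orthant translated to the exponent.\<close>
  let ?x = "exponent_vec \<omega> + (\<chi> i. 1)"
  have "ball ?x 1 \<subseteq> \<Gamma>"
  proof
    fix y assume "y \<in> ball ?x 1"
    then have y: "norm (y - ?x) < 1"
      by (simp add: dist_norm norm_minus_commute)
    have "0 \<le> (y - exponent_vec \<omega>) $ i" for i
      using component_le_norm_cart[of "y - ?x" i] y by simp
    then have "exponent_vec \<omega> + (y - exponent_vec \<omega>) \<in> \<Gamma>"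
      by (intro polyhedron_add exponent_in[OF \<omega>]) (auto simp: nonneg_orthant_def)
    then show "y \<in> \<Gamma>"
      by simp
  qed
  then have "?x \<in> interior \<Gamma>"
    by (meson centre_in_ball interior_maximal open_ball subsetD zero_less_one)
  then show ?thesis
    by blast
qed

lemma aff_dim_newton: "aff_dim \<Gamma> = CARD('n)"
  using aff_dim_nonempty_interior[OF interior_newton] by simp

lemma affine_hull_newton: "affine hull \<Gamma> = UNIV"
  using affine_hull_nonempty_interior[OF interior_newton] .

lemma bounded_below_orthant:
  fixes k :: "real ^ 'n"
  assumes "\<And>x. x \<in> \<Gamma> \<Longrightarrow> b \<le> k \<bullet> x"
  shows "k \<in> nonneg_orthant"
proof -
  obtain \<omega> where \<omega>: "\<omega> \<in> Poly_Mapping.keys f"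
    using keys_nonempty by blast
  have "0 \<le> k $ i" for i
  proof (rule ccontr)
    assume neg: "\<not> 0 \<le> k $ i"
    \<comment> \<open>For this \<open>t\<close> the functional is at most \<open>b - 1\<close> at
      the shifted point; the maximum with 0 keeps the shift in the orthant.\<close>
    define t where "t = max 0 ((b - 1 - k \<bullet> exponent_vec \<omega>) / k $ i)"
    have "exponent_vec \<omega> + t *\<^sub>R axis i 1 \<in> \<Gamma>"
      by (intro polyhedron_add exponent_in \<omega> orthant_scale axis_orthant) (simp add: t_def)
    then have "b \<le> k \<bullet> (exponent_vec \<omega> + t *\<^sub>R axis i 1)"
      by (rule assms)
    also have "\<dots> = k \<bullet> exponent_vec \<omega> + t * k $ i"
      by (simp add: inner_add_right inner_axis_one)
    also have "t * k $ i \<le> ((b - 1 - k \<bullet> exponent_vec \<omega>) / k $ i) * k $ i"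
      using neg by (intro mult_right_mono_neg) (auto simp: t_def)
    finally show False
      using neg by simp
  qed
  then show ?thesis
    by (simp add: nonneg_orthant_def)
qed

text \<open>The normal of a supporting hyperplane is bounded above on \<Gamma>, so its negative is
  bounded below and therefore lies in the orthant.\<close>

lemma exposed_first_meet_locus:
  assumes \<tau>: "\<tau> exposed_face_of \<Gamma>" "\<tau> \<noteq> {}"
  shows "\<exists>k\<in>nonneg_orthant. \<tau> = F k"
proof -
  obtain a b where ab: "\<Gamma> \<subseteq> {x. a \<bullet> x \<le> b}" "\<tau> = \<Gamma> \<inter> {x. a \<bullet> x = b}"
    using \<tau>(1) by (auto simp: exposed_face_of_def)
  obtain x where x: "x \<in> \<tau>"
    using \<tau>(2) by blast
  have "- a \<in> nonneg_orthant"
    using ab(1) by (intro bounded_below_orthant[of "- b"]) auto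
  moreover have "m (- a) = - b"
    using ab x newton_m_eq[of x "- a"] by auto
  then have "\<tau> = F (- a)"
    using ab(2) by (auto simp: in_first_meet_locus)
  ultimately show ?thesis
    by blast
qed

lemma first_meet_locus_exposed: "k \<in> nonneg_orthant \<Longrightarrow> F k exposed_face_of \<Gamma>"
proof -
  assume k: "k \<in> nonneg_orthant"
  have "F k = \<Gamma> \<inter> {x. k \<bullet> x = m k}"
    by (auto simp: in_first_meet_locus)
  then show ?thesis
    using exposed_face_of_Int_supporting_hyperplane_ge[OF convex_polyhedron newton_m_attained(2)[OF k]] by simp
qed

lemma first_meet_locus_face: "k \<in> nonneg_orthant \<Longrightarrow> F k face_of \<Gamma>"
  using first_meet_locus_exposed exposed_face_of_def by blast

lemma facet_first_meet_locus:
  assumes "T facet_of \<Gamma>"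
  shows "\<exists>k\<in>nonneg_orthant. T = F k \<and> k \<noteq> 0"
proof -
  have T: "T face_of \<Gamma>" "T \<noteq> {}" "aff_dim T = CARD('n) - 1"
    using assms by (auto simp: facet_of_def aff_dim_newton)
  then obtain k where k: "k \<in> nonneg_orthant" "T = F k"
    using exposed_first_meet_locus exposed_face_of_polyhedron[OF polyhedron_newton] by blast
  have "k \<noteq> 0"
  proof
    assume "k = 0"
    then have "m k = 0"
      using newton_m_attained(1)[OF k(1)] by auto
    then have "F k = \<Gamma>"
      using \<open>k = 0\<close> by (auto simp: in_first_meet_locus)
    then show False
      using T(3) k(2) aff_dim_newton by simp
  qed
  with k show ?thesis
    by blast
qed

lemma first_meet_locus_scale:
  assumes k: "k \<in> nonneg_orthant" and c: "0 < c"
  shows "F (c *\<^sub>R k) = F k" "m (c *\<^sub>R k) = c * m k"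
proof -
  obtain x where x: "x \<in> F k"
    using first_meet_locus_nonempty[OF k] by blast
  show mc: "m (c *\<^sub>R k) = c * m k"
    using x newton_m_attained(2)[OF k] c newton_m_eq[of x "c *\<^sub>R k"] by (auto simp: in_first_meet_locus)
  show "F (c *\<^sub>R k) = F k"
    using c by (auto simp: in_first_meet_locus mc)
qed

text \<open>A facet spans its supporting hyperplane, so \<open>v\<close> is constant on that
  hyperplane. The component of \<open>v\<close> orthogonal to \<open>k\<close> is a direction of the
  hyperplane, so \<open>v\<close> vanishes on it; hence this component is orthogonal to
  itself.\<close>

lemma constant_on_facet:
  assumes k: "k \<noteq> 0" and F: "F k facet_of \<Gamma>" and v: "\<And>x y. x \<in> F k \<Longrightarrow> y \<in> F k \<Longrightarrow> v \<bullet> (x - y) = 0"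
  shows "\<exists>c. v = c *\<^sub>R k"
proof -
  let ?H = "{x. k \<bullet> x = m k}"
  obtain x0 where x0: "x0 \<in> F k"
    using F by (auto simp: facet_of_def)
  have "aff_dim (F k) = aff_dim ?H"
    using F k by (simp add: facet_of_def aff_dim_newton)
  moreover have "F k \<subseteq> ?H"
    by (auto simp: in_first_meet_locus)
  ultimately have "affine hull (F k) = ?H"
    using aff_dim_eq_full_gen[of "F k" ?H] affine_hyperplane[of k "m k"] by (simp add: affine_hull_eq)
  moreover have "affine hull (F k) \<subseteq> {x. v \<bullet> x = v \<bullet> x0}"
    using v[OF _ x0] by (intro hull_minimal affine_hyperplane) (auto simp: inner_diff_right)
  ultimately have H: "v \<bullet> x = v \<bullet> x0" if "k \<bullet> x = m k" for x
    using that by blast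
  define c where "c = (v \<bullet> k) / (k \<bullet> k)"
  let ?y = "v - c *\<^sub>R k"
  have ky: "k \<bullet> ?y = 0"
    using k by (simp add: c_def inner_diff_right inner_commute)
  have "k \<bullet> (x0 + ?y) = m k"
    using x0 ky by (simp add: inner_add_right in_first_meet_locus)
  from H[OF this] have "v \<bullet> ?y = 0"
    by (simp add: inner_add_right)
  then have "?y \<bullet> ?y = 0"
    using ky by (simp add: inner_diff_left)
  then show ?thesis
    by (intro exI[of _ c]) simp
qed

end

subsection \<open>Primitive facet normals\<close>

lemma primitive_vecD:
  assumes "primitive_vec v"
  shows "v \<in> nonneg_orthant" "v \<in> integer_points" "v \<noteq> 0"
  using assms by (auto simp: primitive_vec_def)

text \<open>Proportionality gives a_j b_i = b_j a_i for all i. Taking gcds over i, which are one for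
  both vectors, yields a_j = b_j at a coordinate where b_j is non-zero, so \<open>c\<close> is
  1.\<close>

lemma primitive_vec_unique:
  fixes v w :: "real ^ 'n::finite"
  assumes v: "primitive_vec v" and w: "primitive_vec w" and c: "v = c *\<^sub>R w"
  shows "v = w"
proof -
  define a where "a = (\<lambda>i. \<lfloor>v $ i\<rfloor>)"
  define b where "b = (\<lambda>i. \<lfloor>w $ i\<rfloor>)"
  have ab: "v $ i = of_int (a i)" "w $ i = of_int (b i)" for i
    using primitive_vecD(2)[OF v] primitive_vecD(2)[OF w] by (auto simp: integer_points_def a_def b_def)
  have G: "Gcd (range a) = 1" "Gcd (range b) = 1"
    using v w by (simp_all add: primitive_vec_def ab)
  have nn: "0 \<le> a i" "0 \<le> b i" for i
    using primitive_vecD(1)[OF v] primitive_vecD(1)[OF w] by (simp_all add: nonneg_orthant_def ab)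
  obtain j where j: "b j \<noteq> 0"
    using primitive_vecD(3)[OF w] by (auto simp: vec_eq_iff ab)
  have cb: "real_of_int (a i) = c * real_of_int (b i)" for i
    using arg_cong[OF c, of "\<lambda>x. x $ i"] by (simp add: ab)
  have "real_of_int (a j * b i) = real_of_int (b j * a i)" for i
    by (simp add: cb)
  then have "a j * b i = b j * a i" for i
    using of_int_eq_iff by blast
  then have "(*) (a j) ` range b = (*) (b j) ` range a"
    by (simp add: image_image)
  then have "normalize (a j) = normalize (b j)"
    using Gcd_mult[of "a j" "range b"] Gcd_mult[of "b j" "range a"] G by simp
  then have "a j = b j"
    using nn[of j] by simp
  then have "c = 1"
    using cb[of j] j by simp
  with c show ?thesis
    by simp
qed

lemma primitive_axis: "primitive_vec (axis i 1 :: real ^ 'n::finite)"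
proof -
  have "1 \<in> range (\<lambda>j. \<lfloor>(axis i 1 :: real ^ 'n) $ j\<rfloor>)"
    by (intro range_eqI[of _ _ i]) (simp add: axis_def)
  then have "Gcd (range (\<lambda>j. \<lfloor>(axis i 1 :: real ^ 'n) $ j\<rfloor>)) = 1"
    by (intro Gcd_eq_1_I[of 1]) simp_all
  then show ?thesis
    by (simp add: primitive_vec_def axis_orthant axis_eq_0_iff)
qed

context newton
begin

text \<open>
  The normal direction of a facet is the solution of a homogeneous system with integer
  coefficients.  A simultaneous approximation of a real solution by rationals with a common
  denominator is again a solution, because the error in each equation is an integer of absolute
  value less than \<open>1\<close>.
\<close>

lemma primitive_normal:
  assumes k: "k \<in> nonneg_orthant" "k \<noteq> 0" and facet: "F k facet_of \<Gamma>"
  shows "\<exists>v c. primitive_vec v \<and> 0 < c \<and> v = c *\<^sub>R k"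
proof -
  obtain i0 where "k $ i0 \<noteq> 0"
    using k(2) by (auto simp: vec_eq_iff)
  then have i0: "0 < k $ i0"
    using k(1) by (auto simp: nonneg_orthant_def order_less_le)
  obtain e where e: "bij_betw e {0..<CARD('n)} (UNIV :: 'n set)"
    using ex_bij_betw_nat_finite[of "UNIV :: 'n set"] by auto
  define B where "B = (\<Sum>\<omega>\<in>Poly_Mapping.keys f. \<Sum>i\<in>UNIV. Poly_Mapping.lookup \<omega> i)"
  \<comment> \<open>The absolute values of the entries of a difference of two exponents add up to at
    most 2B, so errors below 1/N in each coordinate amount to less than 1 in total.\<close>
  define N where "N = 2 * B + 1"
  \<comment> \<open>Division by \<open>k $ i0\<close> makes coordinate \<open>i0\<close> equal to 1;
    its approximation is then exactly the common denominator \<open>q\<close>, which is positive and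
    later fixes the sign of the solution.\<close>
  obtain q p where q: "0 < q" and p: "\<And>j. j < CARD('n) \<Longrightarrow>
      \<bar>of_int q * (k $ e j / k $ i0) - of_int (p j)\<bar> < 1 / real N"
    by (rule Dirichlet_approx_simult[where N = N and n = "CARD('n)" and \<theta> = "\<lambda>j. k $ e j / k $ i0"])
      (simp add: N_def, rule that)
  define P where "P = (\<lambda>i. p (inv_into {0..<CARD('n)} e i))"
  have P: "\<bar>of_int q * (k $ i / k $ i0) - of_int (P i)\<bar> < 1 / real N" for i
  proof -
    have "inv_into {0..<CARD('n)} e i \<in> {0..<CARD('n)}"
      using bij_betwE[OF bij_betw_inv_into[OF e]] by blast
    moreover have "e (inv_into {0..<CARD('n)} e i) = i"
      using bij_betw_inv_into_right[OF e] by simp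
    ultimately show ?thesis
      using p[of "inv_into {0..<CARD('n)} e i"] by (simp add: P_def)
  qed
  have N1: "1 / real N \<le> 1"
    by (simp add: N_def)
  have P1: "\<bar>of_int q * (k $ i / k $ i0) - of_int (P i)\<bar> < 1" for i
    using P[of i] N1 by linarith
  \<comment> \<open>Errors below 1 keep the zeros of \<open>k\<close>, as
    \<open>linear_on_first_meet_locus\<close> requires.\<close>
  have Pz: "P i = 0" if "k $ i = 0" for i
    using P1[of i] that by simp
  have Pq: "P i0 = q"
    using P1[of i0] i0 by simp
  have Pn: "0 \<le> P i" for i
  proof -
    have "0 \<le> of_int q * (k $ i / k $ i0)"
      using q k(1) i0 by (simp add: nonneg_orthant_def)
    then have "- 1 < real_of_int (P i)"
      using P1[of i] by linarith
    then show ?thesis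
      by simp
  qed
  define pv :: "real ^ 'n" where "pv = (\<chi> i. of_int (P i))"
  have diff: "pv \<bullet> exponent_vec \<omega> = pv \<bullet> exponent_vec \<omega>'"
    if \<omega>: "\<omega> \<in> Poly_Mapping.keys f" "k \<bullet> exponent_vec \<omega> = m k"
      and \<omega>': "\<omega>' \<in> Poly_Mapping.keys f" "k \<bullet> exponent_vec \<omega>' = m k" for \<omega> \<omega>'
  proof -
    define w where "w = (\<lambda>i. int (Poly_Mapping.lookup \<omega> i) - int (Poly_Mapping.lookup \<omega>' i))"
    define z where "z = (\<Sum>i\<in>UNIV. P i * w i)"
    have kw: "(\<Sum>i\<in>UNIV. k $ i * of_int (w i)) = 0"
      using \<omega>(2) \<omega>'(2) by (simp add: inner_vec_def exponent_vec_def w_def algebra_simps sum_subtractf)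
    have sz: "pv \<bullet> exponent_vec \<omega> - pv \<bullet> exponent_vec \<omega>' = of_int z"
      by (simp add: inner_vec_def exponent_vec_def pv_def w_def z_def algebra_simps sum_subtractf)
    \<comment> \<open>The exact solution \<open>k\<close> annihilates \<open>w\<close>, so
      subtracting the multiple q / k_i0 of it leaves only the approximation errors.\<close>
    have "of_int z = (\<Sum>i\<in>UNIV. (of_int (P i) - of_int q * (k $ i / k $ i0)) * of_int (w i)) +
        of_int q / k $ i0 * (\<Sum>i\<in>UNIV. k $ i * of_int (w i))"
      by (simp add: z_def sum_distrib_left algebra_simps sum.distrib[symmetric] sum_subtractf)
    then have "\<bar>real_of_int z\<bar> \<le> (\<Sum>i\<in>UNIV. \<bar>(of_int (P i) - of_int q * (k $ i / k $ i0)) * of_int (w i)\<bar>)"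
      unfolding kw by (simp only: mult_zero_right add_0_right sum_abs)
    also have "\<dots> \<le> (\<Sum>i\<in>UNIV. 1 / real N * \<bar>of_int (w i)\<bar>)"
    proof (rule sum_mono)
      fix i
      have "\<bar>of_int (P i) - of_int q * (k $ i / k $ i0)\<bar> \<le> 1 / real N"
        using P[of i] by linarith
      then show "\<bar>(of_int (P i) - of_int q * (k $ i / k $ i0)) * of_int (w i)\<bar> \<le> 1 / real N * \<bar>of_int (w i)\<bar>"
        unfolding abs_mult by (intro mult_right_mono) auto
    qed
    also have "\<dots> = 1 / real N * (\<Sum>i\<in>UNIV. \<bar>of_int (w i)\<bar>)"
      by (simp only: sum_distrib_left)
    also have "(\<Sum>i\<in>UNIV. \<bar>real_of_int (w i)\<bar>) \<le>
        (\<Sum>i\<in>UNIV. real (Poly_Mapping.lookup \<omega> i) + real (Poly_Mapping.lookup \<omega>' i))"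
      by (intro sum_mono) (auto simp: w_def)
    also have "\<dots> \<le> real B + real B"
    proof -
      have "(\<Sum>i\<in>UNIV. Poly_Mapping.lookup \<eta> i) \<le> B" if "\<eta> \<in> Poly_Mapping.keys f" for \<eta>
        unfolding B_def using that by (intro member_le_sum) auto
      from this[OF \<omega>(1)] this[OF \<omega>'(1)] show ?thesis
        unfolding sum.distrib of_nat_sum[symmetric] by linarith
    qed
    finally have "\<bar>real_of_int z\<bar> \<le> 1 / real N * (real B + real B)"
      by (simp add: divide_right_mono)
    also have "\<dots> < 1"
      by (simp add: N_def)
    finally have "z = 0"
      by linarith
    with sz show ?thesis
      by simp
  qed
  obtain \<omega>0 where \<omega>0: "\<omega>0 \<in> Poly_Mapping.keys f" "k \<bullet> exponent_vec \<omega>0 = m k"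
    using newton_m_attained(1)[OF k(1)] by blast
  have "pv \<bullet> x = pv \<bullet> exponent_vec \<omega>0" if "x \<in> F k" for x
  proof (rule linear_on_first_meet_locus[OF k(1) that])
    show "pv \<bullet> exponent_vec \<omega> = pv \<bullet> exponent_vec \<omega>0"
      if "\<omega> \<in> Poly_Mapping.keys f" "k \<bullet> exponent_vec \<omega> = m k" for \<omega>
      by (rule diff[OF that \<omega>0])
    show "pv $ i = 0" if "k $ i = 0" for i
      using that by (simp add: pv_def Pz)
  qed
  then have "pv \<bullet> (x - y) = 0" if "x \<in> F k" "y \<in> F k" for x y
    using that by (simp add: inner_diff_right)
  then obtain c where c: "pv = c *\<^sub>R k"
    using constant_on_facet[OF k(2) facet] by blast
  have "of_int q = c * k $ i0"
    using arg_cong[OF c, of "\<lambda>x. x $ i0"] by (simp add: pv_def Pq)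
  then have c0: "0 < c"
    using q i0 by (metis of_int_0_less_iff zero_less_mult_pos2)
  define g where "g = Gcd (range P)"
  have "g \<noteq> 0"
    using Pq q rangeI[of P i0] by (auto simp: g_def Gcd_0_iff simp del: rangeI)
  then have g: "0 < g"
    using Gcd_int_greater_eq_0[of "range P"] unfolding g_def by linarith
  have gd: "g * (P i div g) = P i" for i
    by (simp add: g_def)
  have "range P = (*) g ` range (\<lambda>i. P i div g)"
    by (simp add: image_image gd)
  then have "g = normalize (g * Gcd (range (\<lambda>i. P i div g)))"
    using Gcd_mult[of g "range (\<lambda>i. P i div g)"] unfolding g_def by metis
  then have "g * 1 = g * Gcd (range (\<lambda>i. P i div g))"
    using g by (simp add: abs_mult)
  then have G1: "Gcd (range (\<lambda>i. P i div g)) = 1"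
    using g by (metis less_irrefl mult_cancel_left)
  define v :: "real ^ 'n" where "v = (\<chi> i. of_int (P i div g))"
  have vpv: "v = (1 / of_int g) *\<^sub>R pv"
  proof -
    have "of_int (P i div g) = (1 / of_int g) * real_of_int (P i)" for i
    proof -
      have "real_of_int (P i) = of_int g * of_int (P i div g)"
        using gd[of i] by (metis of_int_mult)
      then show ?thesis
        using g by simp
    qed
    then show ?thesis
      by (simp add: v_def pv_def vec_eq_iff)
  qed
  have "primitive_vec v"
    unfolding primitive_vec_def
  proof (intro conjI IntI)
    show "v \<in> integer_points" "v \<in> nonneg_orthant"
      using Pn g by (auto simp: v_def integer_points_def nonneg_orthant_def pos_imp_zdiv_nonneg_iff)
    show "Gcd (range (\<lambda>i. \<lfloor>v $ i\<rfloor>)) = 1"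
      using G1 by (simp add: v_def)
    show "v \<noteq> 0"
      using vpv c c0 g k(2) by simp
  qed
  moreover have "v = (c / of_int g) *\<^sub>R k"
    by (simp add: vpv c)
  moreover have "0 < c / of_int g"
    using c0 g by simp
  ultimately show ?thesis
    by blast
qed

section \<open>Primitive facet normals as a finite set describing the polyhedron\<close>

definition normals :: "(real ^ 'n) set" where
  "normals = {v. primitive_vec v \<and> F v facet_of \<Gamma>}"

lemma normalsD:
  assumes "v \<in> normals"
  shows "v \<in> nonneg_orthant" "v \<in> integer_points" "v \<noteq> 0" "primitive_vec v" "F v facet_of \<Gamma>"
  using assms primitive_vecD[of v] by (auto simp: normals_def)

lemma normals_unique:
  assumes v: "v \<in> normals" and w: "primitive_vec w"
    and c: "\<And>x y. x \<in> F v \<Longrightarrow> y \<in> F v \<Longrightarrow> w \<bullet> (x - y) = 0"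
  shows "w = v"
proof -
  obtain r where "w = r *\<^sub>R v"
    using constant_on_facet[OF normalsD(3,5)[OF v] c] by blast
  then show ?thesis
    using primitive_vec_unique w normalsD(4)[OF v] by blast
qed

text \<open>Every facet is \<open>F k\<close> for some \<open>k\<close>, and a primitive vector
  constant on it is the primitive positive multiple of \<open>k\<close>. Facets can therefore be
  replaced by their normals.\<close>

lemma facet_normals_eq: "facet_normals f \<tau> = {v \<in> normals. \<tau> \<subseteq> F v}"
proof (intro set_eqI iffI)
  fix v assume "v \<in> facet_normals f \<tau>"
  then obtain T where v: "primitive_vec v" and T: "T facet_of \<Gamma>" "\<tau> \<subseteq> T"
    and c: "\<And>x y. x \<in> T \<Longrightarrow> y \<in> T \<Longrightarrow> v \<bullet> (x - y) = 0"
    unfolding facet_normals_def by blast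
  obtain k where k: "k \<in> nonneg_orthant" "T = F k" "k \<noteq> 0"
    using facet_first_meet_locus[OF T(1)] by blast
  obtain w r where w: "primitive_vec w" "0 < r" "w = r *\<^sub>R k"
    using primitive_normal[OF k(1,3)] T(1) k(2) by blast
  have Fw: "F w = F k"
    using first_meet_locus_scale[OF k(1) w(2)] w(3) by simp
  then have "w \<in> normals"
    using w T k by (simp add: normals_def)
  moreover from this have "v = w"
    using c Fw k(2) by (intro normals_unique[OF _ v]) auto
  ultimately show "v \<in> {v \<in> normals. \<tau> \<subseteq> F v}"
    using T k Fw by auto
next
  fix v assume v: "v \<in> {v \<in> normals. \<tau> \<subseteq> F v}"
  have "v \<bullet> (x - y) = 0" if "x \<in> F v" "y \<in> F v" for x y
    using that by (simp add: inner_diff_right in_first_meet_locus)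
  with v show "v \<in> facet_normals f \<tau>"
    unfolding facet_normals_def normals_def by blast
qed

lemma finite_normals: "finite normals"
proof (rule finite_imageD)
  have "F ` normals \<subseteq> {T. T facet_of \<Gamma>}"
    by (auto simp: normals_def)
  then show "finite (F ` normals)"
    using finite_polyhedron_facets[OF polyhedron_newton] by (rule finite_subset)
  show "inj_on F normals"
  proof (rule inj_onI)
    fix v w assume vw: "v \<in> normals" "w \<in> normals" "F v = F w"
    have "w \<bullet> (x - y) = 0" if "x \<in> F w" "y \<in> F w" for x y
      using that by (simp add: inner_diff_right in_first_meet_locus)
    then show "v = w"
      using normals_unique[OF vw(1) normalsD(4)[OF vw(2)]] vw(3) by auto
  qed
qed

lemma finite_facet_normals: "finite (facet_normals f \<tau>)"
  using finite_normals by (simp add: facet_normals_eq)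

text \<open>Each half space of an irredundant description of \<Gamma> cuts out a facet, and its
  inner normal is proportional to a primitive one.\<close>

lemma polyhedron_eq_normals: "\<Gamma> = {x. \<forall>v\<in>normals. m v \<le> v \<bullet> x}"
proof
  show "\<Gamma> \<subseteq> {x. \<forall>v\<in>normals. m v \<le> v \<bullet> x}"
    using newton_m_attained(2) normalsD(1) by blast
  obtain H where H: "finite H" "\<Gamma> = affine hull \<Gamma> \<inter> \<Inter>H"
      "\<forall>h\<in>H. \<exists>a b. a \<noteq> 0 \<and> h = {x. a \<bullet> x \<le> b}"
      "\<And>F'. F' \<subset> H \<Longrightarrow> \<Gamma> \<subset> affine hull \<Gamma> \<inter> \<Inter>F'"
    using polyhedron_Int_affine_minimal[of \<Gamma>] polyhedron_newton by auto
  obtain a b where ab: "\<And>h. h \<in> H \<Longrightarrow> a h \<noteq> 0 \<and> h = {x. a h \<bullet> x \<le> b h}"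
    using H(3) by metis
  show "{x. \<forall>v\<in>normals. m v \<le> v \<bullet> x} \<subseteq> \<Gamma>"
  proof
    fix x assume x: "x \<in> {x. \<forall>v\<in>normals. m v \<le> v \<bullet> x}"
    have "x \<in> h" if h: "h \<in> H" for h
    proof -
      let ?T = "\<Gamma> \<inter> {x. a h \<bullet> x = b h}"
      have T: "?T facet_of \<Gamma>"
        using facet_of_polyhedron_explicit[OF H(1,2) ab H(4)] h by blast
      have sub: "a h \<bullet> y \<le> b h" if "y \<in> \<Gamma>" for y
        using H(2) h ab[OF h] that by blast
      have k: "- a h \<in> nonneg_orthant"
        using sub by (intro bounded_below_orthant[of "- b h"]) auto
      obtain y where y: "y \<in> ?T"
        using T by (auto simp: facet_of_def)
      have mk: "m (- a h) = - b h"
        using newton_m_eq[of y "- a h"] y sub by auto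
      then have Fk: "F (- a h) = ?T"
        by (auto simp: in_first_meet_locus)
      obtain v c where v: "primitive_vec v" "0 < c" "v = c *\<^sub>R (- a h)"
        using primitive_normal[OF k] ab[OF h] T Fk by auto
      then have "v \<in> normals" and mv: "m v = c * m (- a h)"
        using first_meet_locus_scale[OF k v(2)] T Fk by (auto simp: normals_def)
      then have "m v \<le> v \<bullet> x"
        using x by blast
      then have "c * (a h \<bullet> x) \<le> c * b h"
        unfolding mv mk by (simp add: v(3))
      then have "a h \<bullet> x \<le> b h"
        using v(2) by simp
      then show ?thesis
        using ab[OF h] by blast
    qed
    then show "x \<in> \<Gamma>"
      using H(2) affine_hull_newton by auto
  qed
qed

text \<open>The cone of directions at a point of \<open>F k\<close> lying on no further facet.\<close>

lemma local_cone:
  assumes k: "k \<in> nonneg_orthant" and y: "\<And>v. v \<in> facet_normals f (F k) \<Longrightarrow> 0 \<le> v \<bullet> y"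
  shows "0 \<le> k \<bullet> y" "k \<bullet> y = 0 \<Longrightarrow> v \<in> facet_normals f (F k) \<Longrightarrow> v \<bullet> y = 0"
proof -
  let ?N = "facet_normals f (F k)" and ?M = "normals - facet_normals f (F k)"
  obtain z where z: "z \<in> F k"
    using first_meet_locus_nonempty[OF k] by blast
  have "\<forall>v\<in>?M. \<exists>x\<in>F k. m v < v \<bullet> x"
  proof
    fix v assume v: "v \<in> ?M"
    then obtain x where "x \<in> F k" "x \<notin> F v"
      by (auto simp: facet_normals_eq)
    then show "\<exists>x\<in>F k. m v < v \<bullet> x"
      using newton_m_attained(2)[OF normalsD(1)[of v]] v
      by (intro bexI[of _ x]) (auto simp: in_first_meet_locus order_less_le)
  qed
  then obtain X where X: "\<And>v. v \<in> ?M \<Longrightarrow> X v \<in> F k" "\<And>v. v \<in> ?M \<Longrightarrow> m v < v \<bullet> X v"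
    by metis
  have ge: "m v \<le> v \<bullet> x" if "v \<in> normals" "x \<in> F k" for v x
    using that newton_m_attained(2) normalsD(1) by (auto simp: in_first_meet_locus)
  have cF: "convex (F k)"
    using first_meet_locus_face[OF k] by (rule face_of_imp_convex)
  \<comment> \<open>Repeated midpoints with the points \<open>X v\<close> yield a single point of
    \<open>F k\<close> that lies on none of the facets not containing \<open>F k\<close>.\<close>
  have "\<exists>x0\<in>F k. \<forall>v\<in>M. m v < v \<bullet> x0" if "finite M" "M \<subseteq> ?M" for M
    using that
  proof (induction M rule: finite_induct)
    case (insert v M)
    then obtain x0 where x0: "x0 \<in> F k" "\<forall>v\<in>M. m v < v \<bullet> x0"
      by auto
    let ?x = "(1 / 2) *\<^sub>R x0 + (1 / 2) *\<^sub>R X v"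
    have "?x \<in> F k"
      using x0 X(1) insert.prems by (intro convexD[OF cF]) auto
    moreover have "m w < w \<bullet> ?x" if "w \<in> insert v M" for w
    proof -
      have w: "w \<in> normals"
        using that insert.prems by auto
      have "m w \<le> w \<bullet> x0" "m w \<le> w \<bullet> X v"
        using ge[OF w] x0 X(1) insert.prems by auto
      moreover have "m w < w \<bullet> x0 \<or> m w < w \<bullet> X v"
        using that x0 X(2) insert.prems by auto
      ultimately show ?thesis
        by (auto simp: inner_add_right)
    qed
    ultimately show ?case
      by blast
  qed (use z in auto)
  from this[OF finite_Diff[OF finite_normals] order_refl]
  obtain x0 where x0: "x0 \<in> F k" "\<And>v. v \<in> ?M \<Longrightarrow> m v < v \<bullet> x0"
    by blast
  \<comment> \<open>Normals in \<open>?N\<close> do not decrease along \<open>y\<close>, and the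
    finitely many others have slack at \<open>x0\<close>, so a short step from \<open>x0\<close>
    along \<open>y\<close> stays in \<Gamma>.\<close>
  have "\<exists>e>0. \<forall>v\<in>M. m v \<le> v \<bullet> (x0 + e *\<^sub>R y)" if "finite M" "M \<subseteq> normals" for M
    using that
  proof (induction M rule: finite_induct)
    case (insert v M)
    then obtain e where e: "0 < e" "\<forall>v\<in>M. m v \<le> v \<bullet> (x0 + e *\<^sub>R y)"
      by auto
    have v: "v \<in> normals" "m v \<le> v \<bullet> x0"
      using insert.prems ge x0(1) by auto
    obtain d where d: "0 < d" "d \<le> e" "m v \<le> v \<bullet> (x0 + d *\<^sub>R y)"
    proof (cases "0 \<le> v \<bullet> y")
      case True
      then show ?thesis
        using v e by (intro that[of e]) (auto simp: inner_add_right add_increasing2)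
    next
      case False
      then have "v \<in> ?M"
        using y v by auto
      then have g: "0 < v \<bullet> x0 - m v"
        using x0(2) by auto
      define d where "d = min e ((v \<bullet> x0 - m v) / (- (v \<bullet> y)))"
      have "0 < d" "d \<le> e" "d \<le> (v \<bullet> x0 - m v) / (- (v \<bullet> y))"
        using g False e by (auto simp: d_def divide_pos_neg)
      moreover from this have "d * (- (v \<bullet> y)) \<le> v \<bullet> x0 - m v"
        using False by (subst (asm) pos_le_divide_eq) auto
      ultimately show ?thesis
        by (intro that[of d]) (auto simp: inner_add_right)
    qed
    have "m w \<le> w \<bullet> (x0 + d *\<^sub>R y)" if w: "w \<in> M" for w
    proof -
      have "m w \<le> w \<bullet> x0"
        using insert.prems w ge x0(1) by auto
      moreover have "m w \<le> w \<bullet> x0 + e * (w \<bullet> y)"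
        using e(2) w by (auto simp: inner_add_right)
      \<comment> \<open>The point for \<open>d\<close> lies on the segment between \<open>x0\<close>
        and the point for \<open>e\<close>, so the inequalities already obtained survive the
        shrinking of the step.\<close>
      moreover have "w \<bullet> x0 + d * (w \<bullet> y) = (1 - d / e) * (w \<bullet> x0) + d / e * (w \<bullet> x0 + e * (w \<bullet> y))"
        using e(1) by (simp add: field_simps)
      moreover have "(1 - d / e) * m w + d / e * m w = m w"
        by (simp add: algebra_simps)
      moreover have "0 \<le> 1 - d / e" "0 \<le> d / e"
        using d e(1) by auto
      ultimately show ?thesis
        by (smt (verit) inner_add_right inner_scaleR_right mult_left_mono)
    qed
    with d show ?case
      by (intro exI[of _ d]) auto
  next
    case empty
    show ?case
      by (intro exI[of _ 1]) auto
  qed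
  from this[OF finite_normals order_refl] obtain e where e: "0 < e" "x0 + e *\<^sub>R y \<in> \<Gamma>"
    unfolding polyhedron_eq_normals by blast
  have kx0: "k \<bullet> x0 = m k"
    using x0(1) by (simp add: in_first_meet_locus)
  have "m k \<le> k \<bullet> (x0 + e *\<^sub>R y)"
    using newton_m_attained(2)[OF k e(2)] .
  then show "0 \<le> k \<bullet> y"
    using e(1) kx0 by (simp add: inner_add_right zero_le_mult_iff)
  assume "k \<bullet> y = 0" and v: "v \<in> ?N"
  then have "x0 + e *\<^sub>R y \<in> F k"
    using e(2) kx0 by (simp add: in_first_meet_locus inner_add_right)
  then have "v \<bullet> (x0 + e *\<^sub>R y) = m v" "v \<bullet> x0 = m v"
    using v x0(1) by (auto simp: facet_normals_eq in_first_meet_locus)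
  then show "v \<bullet> y = 0"
    using e(1) by (simp add: inner_add_right)
qed

text \<open>All \<open>F v\<close> with v in \<open>N\<close> contain the same point x of \<tau>, so
  all minima are attained there at once. This makes \<open>m\<close> linear on the cones used
  below.\<close>

lemma newton_m_nonneg_comb:
  assumes N: "N \<subseteq> facet_normals f \<tau>" and x: "x \<in> \<tau>" "x \<in> \<Gamma>" and c: "\<And>v. v \<in> N \<Longrightarrow> 0 \<le> c v"
  shows "(\<Sum>v\<in>N. c v *\<^sub>R v) \<in> nonneg_orthant" "x \<in> F (\<Sum>v\<in>N. c v *\<^sub>R v)"
    "m (\<Sum>v\<in>N. c v *\<^sub>R v) = (\<Sum>v\<in>N. c v * m v)"
proof -
  let ?k = "\<Sum>v\<in>N. c v *\<^sub>R v"
  have N: "v \<in> nonneg_orthant" "x \<in> F v" if "v \<in> N" for v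
    using that N x normalsD(1) by (auto simp: facet_normals_eq)
  show "?k \<in> nonneg_orthant"
    using N c by (intro orthant_sum orthant_scale) auto
  have kx: "?k \<bullet> x = (\<Sum>v\<in>N. c v * m v)"
    using N by (simp add: inner_sum_left in_first_meet_locus)
  have "m ?k = ?k \<bullet> x"
  proof (rule newton_m_eq[OF x(2)])
    fix y assume y: "y \<in> \<Gamma>"
    have "(\<Sum>v\<in>N. c v * m v) \<le> (\<Sum>v\<in>N. c v * (v \<bullet> y))"
      using N c newton_m_attained(2)[OF _ y] by (intro sum_mono mult_left_mono) auto
    then show "?k \<bullet> x \<le> ?k \<bullet> y"
      unfolding kx by (simp add: inner_sum_left)
  qed
  then show "x \<in> F ?k" "m ?k = (\<Sum>v\<in>N. c v * m v)"
    using x(2) kx by (auto simp: in_first_meet_locus)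
qed

end

subsection \<open>Compact faces and their cones\<close>

context newton
begin

text \<open>If k_i were 0, \<open>F k\<close> would be stable under adding non-negative multiples of
  e_i and hence unbounded.\<close>

lemma compact_locus_pos:
  fixes k :: "real ^ 'n"
  assumes k: "k \<in> nonneg_orthant" and c: "compact (F k)"
  shows "0 < k $ i"
proof (rule ccontr)
  assume "\<not> 0 < k $ i"
  then have ki: "k $ i = 0"
    using k by (auto simp: nonneg_orthant_def order_less_le)
  obtain x where x: "x \<in> F k"
    using first_meet_locus_nonempty[OF k] by blast
  obtain B where B: "\<And>y. y \<in> F k \<Longrightarrow> norm y \<le> B"
    using compact_imp_bounded[OF c] unfolding bounded_iff by blast
  define t where "t = \<bar>B\<bar> + 1"
  have "x + t *\<^sub>R axis i 1 \<in> F k"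
    using x ki polyhedron_add[of x "t *\<^sub>R axis i 1"] orthant_scale[OF _ axis_orthant(1), of t i]
    by (auto simp: in_first_meet_locus inner_add_right inner_axis_one t_def)
  then have "norm (x + t *\<^sub>R axis i 1) \<le> B"
    by (rule B)
  then have "\<bar>(x + t *\<^sub>R axis i 1) $ i\<bar> \<le> B"
    using component_le_norm_cart order_trans by blast
  moreover have "0 \<le> x $ i"
    using x polyhedron_orthant by (auto simp: in_first_meet_locus nonneg_orthant_def)
  ultimately show False
    by (simp add: t_def axis_def)
qed

lemma compact_faceE:
  assumes "\<tau> \<in> compact_faces f"
  obtains k :: "real ^ 'n" where "k \<in> nonneg_orthant" "\<tau> = F k" "\<And>i. 0 < k $ i"
proof -
  have \<tau>: "\<tau> exposed_face_of \<Gamma>" "\<tau> \<noteq> {}" "compact \<tau>"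
    using assms by (auto simp: compact_faces_def newton_faces_def)
  then obtain k where "k \<in> nonneg_orthant" "\<tau> = F k"
    using exposed_first_meet_locus by blast
  then show thesis
    using compact_locus_pos \<tau>(3) by (intro that) auto
qed

lemma compact_face_subset: "\<tau> \<in> compact_faces f \<Longrightarrow> \<tau> \<subseteq> \<Gamma>"
  by (erule compact_faceE) (auto simp: in_first_meet_locus)

lemma compact_face_nonempty: "\<tau> \<in> compact_faces f \<Longrightarrow> \<tau> \<noteq> {}"
  by (simp add: compact_faces_def newton_faces_def)

lemma face_coneD: "k \<in> face_cone f \<tau> \<Longrightarrow> k \<in> nonneg_orthant" "k \<in> face_cone f \<tau> \<Longrightarrow> F k = \<tau>"
  by (auto simp: face_cone_def)

lemma finite_compact_faces: "finite (compact_faces f)"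
  by (rule finite_subset[OF _ finite_polyhedron_exposed_faces[OF polyhedron_newton]])
    (auto simp: compact_faces_def newton_faces_def)

lemma face_cone_pos:
  fixes k :: "real ^ 'n"
  assumes "k \<in> face_cone f \<tau>" "\<tau> \<in> compact_faces f"
  shows "0 < k $ i"
  using assms compact_locus_pos[of k i] by (auto simp: face_cone_def compact_faces_def)

text \<open>The zero exponent does not occur in f, so every exponent has positive weight.\<close>

lemma newton_m_pos:
  fixes k :: "real ^ 'n"
  assumes k: "k \<in> nonneg_orthant" "\<And>i. 0 < k $ i"
  shows "0 < m k"
proof -
  obtain \<omega> where \<omega>: "\<omega> \<in> Poly_Mapping.keys f" "k \<bullet> exponent_vec \<omega> = m k"
    using newton_m_attained(1)[OF k(1)] by blast
  then have "\<omega> \<noteq> 0"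
    using f_origin by auto
  then obtain i where "Poly_Mapping.lookup \<omega> i \<noteq> 0"
    by (auto simp: poly_mapping_eq_iff fun_eq_iff)
  then have "0 < k $ i * exponent_vec \<omega> $ i"
    using k(2) by (simp add: exponent_vec_def)
  also have "\<dots> \<le> k \<bullet> exponent_vec \<omega>"
    unfolding inner_vec_def inner_real_def using k(1) exponent_vec_orthant[of \<omega>]
    by (intro member_le_sum) (auto simp: nonneg_orthant_def)
  finally show ?thesis
    using \<omega>(2) by simp
qed

text \<open>A point x minimizing a combination with positive coefficients minimizes every summand,
  so x and any x0 in \<open>F k\<close> agree on all the normals. Both x - x0 and x0 - x then
  satisfy the hypotheses of \<open>local_cone\<close>, so \<open>k\<close> agrees on x and x0
  too.\<close>

lemma first_meet_locus_comb:
  assumes k: "k \<in> nonneg_orthant" and c: "\<And>v. v \<in> facet_normals f (F k) \<Longrightarrow> 0 < c v"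
  shows "F (\<Sum>v\<in>facet_normals f (F k). c v *\<^sub>R v) = F k"
proof
  let ?N = "facet_normals f (F k)"
  let ?s = "\<Sum>v\<in>?N. c v *\<^sub>R v"
  have c': "0 \<le> c v" if "v \<in> ?N" for v
    using c[OF that] by simp
  note comb = newton_m_nonneg_comb[OF order_refl, of _ "F k" c, OF _ _ c']
  have in\<Gamma>: "x \<in> F k \<Longrightarrow> x \<in> \<Gamma>" for x
    by (simp add: in_first_meet_locus)
  show "F k \<subseteq> F ?s"
    using comb(2) in\<Gamma> by blast
  obtain x0 where x0: "x0 \<in> F k"
    using first_meet_locus_nonempty[OF k] by blast
  show "F ?s \<subseteq> F k"
  proof
    fix x assume x: "x \<in> F ?s"
    then have x\<Gamma>: "x \<in> \<Gamma>" and "?s \<bullet> x = m ?s"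
      by (auto simp: in_first_meet_locus)
    then have "(\<Sum>v\<in>?N. c v * (v \<bullet> x - m v)) = 0"
      using comb(3)[OF x0 in\<Gamma>[OF x0]]
      by (simp add: inner_sum_left right_diff_distrib sum_subtractf)
    moreover have "0 \<le> c v * (v \<bullet> x - m v)" if "v \<in> ?N" for v
      using c'[OF that] newton_m_attained(2)[OF _ x\<Gamma>, of v] normalsD(1)[of v] that
      by (auto simp: facet_normals_eq)
    ultimately have "\<forall>v\<in>?N. c v * (v \<bullet> x - m v) = 0"
      using sum_nonneg_eq_0_iff[OF finite_facet_normals, of "F k" "\<lambda>v. c v * (v \<bullet> x - m v)"] by blast
    then have vx: "v \<bullet> x = m v" if "v \<in> ?N" for v
      using c[OF that] that by (auto dest!: bspec)
    have vx0: "v \<bullet> x0 = m v" if "v \<in> ?N" for v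
      using x0 that by (auto simp: facet_normals_eq in_first_meet_locus)
    have "0 \<le> k \<bullet> (x - x0)" "0 \<le> k \<bullet> (x0 - x)"
      by (rule local_cone(1)[OF k]; simp add: inner_diff_right vx vx0)+
    then have "k \<bullet> x = k \<bullet> x0"
      by (simp add: inner_diff_right)
    then show "x \<in> F k"
      using x0 x\<Gamma> by (auto simp: in_first_meet_locus)
  qed
qed

text \<open>If k \<bullet> y <= 0 while all normals are non-negative on y, then
  \<open>local_cone\<close> gives k \<bullet> y = 0 and next w \<bullet> y = 0. By Farkas, -w is a
  non-negative combination of -k and the normals; solving for \<open>k\<close> gives
  \<open>w\<close> a positive coefficient.\<close>

lemma face_cone_positive_coefficient:
  assumes k: "k \<in> nonneg_orthant" and w: "w \<in> facet_normals f (F k)"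
  shows "\<exists>d. (\<forall>v\<in>facet_normals f (F k). 0 \<le> d v) \<and> 0 < d w \<and> k = (\<Sum>v\<in>facet_normals f (F k). d v *\<^sub>R v)"
proof -
  let ?N = "facet_normals f (F k)"
  have N: "v \<in> nonneg_orthant" "v \<noteq> 0" if "v \<in> ?N" for v
    using that normalsD by (auto simp: facet_normals_eq)
  have fin: "finite ?N"
    by (rule finite_facet_normals)
  have kN: "- k \<notin> ?N"
  proof
    assume "- k \<in> ?N"
    from N[OF this] have "- k \<in> nonneg_orthant" "k \<noteq> 0"
      by auto
    then have nn: "0 \<le> (- k) $ i" "0 \<le> k $ i" for i
      using k by (simp_all only: nonneg_orthant_def mem_Collect_eq)
    have "k $ i = 0" for i
      using nn(1)[of i] nn(2)[of i] by simp
    with \<open>k \<noteq> 0\<close> show False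
      by (simp add: vec_eq_iff)
  qed
  have "\<exists>c. (\<forall>v\<in>insert (- k) ?N. 0 \<le> c v) \<and> - w = (\<Sum>v\<in>insert (- k) ?N. c v *\<^sub>R v)"
  proof (rule farkas)
    fix y assume *: "\<And>v. v \<in> insert (- k) ?N \<Longrightarrow> 0 \<le> v \<bullet> y"
    have "0 \<le> k \<bullet> y"
      by (rule local_cone(1)[OF k]) (rule *, simp)
    moreover have "k \<bullet> y \<le> 0"
      using *[of "- k"] by simp
    ultimately have "k \<bullet> y = 0"
      by simp
    then have "w \<bullet> y = 0"
      using * by (intro local_cone(2)[OF k _ _ w, of y]) auto
    then show "0 \<le> - w \<bullet> y"
      by simp
  qed (use fin in simp)
  then obtain c where c: "\<And>v. v \<in> ?N \<Longrightarrow> 0 \<le> c v" "0 \<le> c (- k)"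
     and eq: "- w = (\<Sum>v\<in>insert (- k) ?N. c v *\<^sub>R v)"
    by auto
  define l where "l = c (- k)"
  have lk: "l *\<^sub>R k = w + (\<Sum>v\<in>?N. c v *\<^sub>R v)"
    using eq fin kN by (simp add: l_def algebra_simps)
  \<comment> \<open>Otherwise the non-zero vector \<open>w\<close> of the orthant would cancel
    against other vectors of the orthant.\<close>
  have "l \<noteq> 0"
  proof
    assume "l = 0"
    then have z: "w $ i + (\<Sum>v\<in>?N. c v * v $ i) = 0" for i
      using arg_cong[OF lk, of "\<lambda>x. x $ i"] by simp
    have "0 \<le> w $ i" "0 \<le> (\<Sum>v\<in>?N. c v * v $ i)" for i
      using c N w by (auto simp: nonneg_orthant_def intro!: sum_nonneg)
    then have "w $ i = 0" for i
      using z[of i] by (simp add: add_nonneg_eq_0_iff)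
    then show False
      using N(2)[OF w] by (simp add: vec_eq_iff)
  qed
  then have l: "0 < l"
    using c(2) by (simp add: l_def)
  define d where "d = (\<lambda>v. (c v + (if v = w then 1 else 0)) / l)"
  have "(\<Sum>v\<in>?N. (c v + (if v = w then 1 else 0)) *\<^sub>R v) = l *\<^sub>R k"
    unfolding lk using fin w by (simp add: scaleR_add_left sum.distrib if_distrib[of "\<lambda>c. c *\<^sub>R _"] sum.delta cong: if_cong)
  then have "k = (1 / l) *\<^sub>R (\<Sum>v\<in>?N. (c v + (if v = w then 1 else 0)) *\<^sub>R v)"
    using l by simp
  also have "\<dots> = (\<Sum>v\<in>?N. d v *\<^sub>R v)"
    by (simp add: scaleR_sum_right d_def)
  finally show ?thesis
    using c(1) l w by (intro exI[of _ d]) (auto simp: d_def add_nonneg_pos)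
qed

text \<open>
  The coefficients can all be made positive at once by averaging over \<open>w\<close> representations with
  positive coefficient at \<open>w\<close>.
\<close>

lemma face_cone_eq_spos_span:
  assumes k0: "k0 \<in> nonneg_orthant"
  shows "face_cone f (F k0) = spos_span (facet_normals f (F k0))"
proof
  let ?N = "facet_normals f (F k0)"
  have fin: "finite ?N"
    by (rule finite_facet_normals)
  show "face_cone f (F k0) \<subseteq> spos_span ?N"
  proof
    fix k assume "k \<in> face_cone f (F k0)"
    then have k: "k \<in> nonneg_orthant" and Fk: "F k = F k0"
      by (auto dest: face_coneD)
    show "k \<in> spos_span ?N"
    proof (cases "?N = {}")
      \<comment> \<open>With no normals there is nothing to average over; Farkas for the empty set
        shows that \<open>k\<close> is the empty combination.\<close>
      case True
      have "\<exists>c. (\<forall>v\<in>?N. 0 \<le> c v) \<and> k = (\<Sum>v\<in>?N. c v *\<^sub>R v)"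
        using local_cone(1)[OF k] Fk by (intro farkas fin) auto
      then show ?thesis
        using True by (simp add: spos_span_def)
    next
      case False
      have "\<forall>w\<in>?N. \<exists>d. (\<forall>v\<in>?N. 0 \<le> d v) \<and> 0 < d w \<and> k = (\<Sum>v\<in>?N. d v *\<^sub>R v)"
        using face_cone_positive_coefficient[OF k] unfolding Fk by blast
      from bchoice[OF this] obtain D where D:
         "\<And>w v. w \<in> ?N \<Longrightarrow> v \<in> ?N \<Longrightarrow> 0 \<le> D w v" "\<And>w. w \<in> ?N \<Longrightarrow> 0 < D w w"
         "\<And>w. w \<in> ?N \<Longrightarrow> k = (\<Sum>v\<in>?N. D w v *\<^sub>R v)"
        by blast
      define e where "e = (\<lambda>v. (1 / card ?N) * (\<Sum>w\<in>?N. D w v))"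
      have cN: "0 < card ?N"
        using False fin by (simp add: card_gt_0_iff)
      have "real (card ?N) *\<^sub>R k = (\<Sum>w\<in>?N. k)"
        by (simp only: sum_constant_scaleR)
      also have "\<dots> = (\<Sum>w\<in>?N. \<Sum>v\<in>?N. D w v *\<^sub>R v)"
        using D(3) by (intro sum.cong) auto
      also have "\<dots> = (\<Sum>v\<in>?N. (\<Sum>w\<in>?N. D w v) *\<^sub>R v)"
        by (subst sum.swap) (simp add: scaleR_sum_left)
      finally have "(1 / card ?N) *\<^sub>R (real (card ?N) *\<^sub>R k) = (\<Sum>v\<in>?N. e v *\<^sub>R v)"
        by (simp add: e_def scaleR_sum_right)
      then have "k = (\<Sum>v\<in>?N. e v *\<^sub>R v)"
        using cN by simp
      moreover have "0 < e v" if v: "v \<in> ?N" for v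
      proof -
        have "D v v \<le> (\<Sum>w\<in>?N. D w v)"
          using D(1) v fin by (intro member_le_sum[where f = "\<lambda>w. D w v"]) auto
        then have "0 < (\<Sum>w\<in>?N. D w v)"
          using D(2)[OF v] by linarith
        then show ?thesis
          using cN by (simp add: e_def)
      qed
      ultimately show ?thesis
        unfolding spos_span_def by blast
    qed
  qed
  show "spos_span ?N \<subseteq> face_cone f (F k0)"
  proof
    fix k assume "k \<in> spos_span ?N"
    then obtain c where c: "k = (\<Sum>v\<in>?N. c v *\<^sub>R v)" "\<forall>v\<in>?N. 0 < c v"
      by (auto simp: spos_span_def)
    have "k \<in> nonneg_orthant"
      unfolding c(1) using c(2) normalsD(1)
      by (intro orthant_sum orthant_scale) (auto simp: facet_normals_eq less_imp_le)
    moreover have "F k = F k0"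
      unfolding c(1) using c(2) by (intro first_meet_locus_comb[OF k0]) auto
    ultimately show "k \<in> face_cone f (F k0)"
      by (simp add: face_cone_def)
  qed
qed

text \<open>For x0 in \<tau>, the points x0 and x0 + e_i with i other than \<rho> all lie in
  \<Gamma> and on x_\<rho> = 0, so this coordinate hyperplane cuts out a face of dimension n -
  1.\<close>

lemma axis_in_facet_normals:
  assumes \<tau>: "\<tau> \<noteq> {}" "\<tau> \<subseteq> \<Gamma>" and \<rho>: "\<rho> \<in> zero_coords \<tau>"
  shows "axis \<rho> 1 \<in> facet_normals f \<tau>" "m (axis \<rho> 1) = 0"
proof -
  let ?e = "axis \<rho> 1 :: real ^ 'n"
  obtain x0 where x0: "x0 \<in> \<tau>"
    using \<tau>(1) by blast
  have nn: "0 \<le> y $ i" if "y \<in> \<Gamma>" for y :: "real ^ 'n" and i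
    using that polyhedron_orthant by (auto simp: nonneg_orthant_def)
  have x00: "x0 $ \<rho> = 0" "x0 \<in> \<Gamma>"
    using x0 \<rho> \<tau>(2) by (auto simp: zero_coords_def)
  show m0: "m ?e = 0"
    using newton_m_eq[of x0 ?e] x00 nn by (simp add: inner_axis_one)
  have Fe: "F ?e = {x \<in> \<Gamma>. x $ \<rho> = 0}"
    by (auto simp: in_first_meet_locus m0 inner_axis_one)
  have sub: "\<tau> \<subseteq> F ?e"
    using \<tau>(2) \<rho> by (auto simp: Fe zero_coords_def)
  have "aff_dim (F ?e) = CARD('n) - 1"
  proof (rule order_antisym)
    have "aff_dim (F ?e) \<le> aff_dim {x. ?e \<bullet> x = 0}"
      by (intro aff_dim_subset) (auto simp: Fe inner_axis_one)
    then show "aff_dim (F ?e) \<le> int (CARD('n) - 1)"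
      using aff_dim_hyperplane[of ?e 0] by (simp add: axis_eq_0_iff of_nat_diff)
    let ?B = "(\<lambda>i. axis i (1::real)) ` (UNIV - {\<rho>}) :: (real ^ 'n) set"
    have inj: "inj_on (\<lambda>i. axis i (1::real) :: real ^ 'n) (UNIV - {\<rho>})"
      by (auto simp: inj_on_def axis_eq_axis)
    have "?B \<subseteq> (+) (- x0) ` F ?e"
    proof (rule image_subsetI)
      fix i assume i: "i \<in> UNIV - {\<rho>}"
      have "(x0 + axis i 1) $ \<rho> = 0"
        using i x00 by (simp add: axis_def)
      then have "x0 + axis i 1 \<in> F ?e"
        using polyhedron_add[OF x00(2) axis_orthant(1)] unfolding Fe by blast
      then show "axis i 1 \<in> (+) (- x0) ` F ?e"
        by (intro rev_image_eqI[of "x0 + axis i 1"]) auto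
    qed
    moreover have "?B \<subseteq> Basis"
      by (auto simp: Basis_vec_def)
    then have "independent ?B"
      using independent_Basis independent_mono by blast
    ultimately have "card ?B \<le> dim ((+) (- x0) ` F ?e)"
      by (rule independent_card_le_dim)
    then have "CARD('n) - 1 \<le> dim ((+) (- x0) ` F ?e)"
      by (simp add: card_image[OF inj])
    moreover have "aff_dim (F ?e) = int (dim ((+) (- x0) ` F ?e))"
      using x0 sub by (intro aff_dim_eq_dim hull_inc) auto
    ultimately show "int (CARD('n) - 1) \<le> aff_dim (F ?e)"
      by simp
  qed
  then have "F ?e facet_of \<Gamma>"
    unfolding facet_of_def using first_meet_locus_face[OF axis_orthant(1)] first_meet_locus_nonempty[OF axis_orthant(1)]
    by (auto simp: aff_dim_newton of_nat_diff)
  then show "?e \<in> facet_normals f \<tau>"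
    using sub by (simp add: facet_normals_eq normals_def primitive_axis)
qed

text \<open>If v_i exceeded m(v), the facet \<open>F v\<close> would lie in x_i = 0, and
  \<open>v\<close> would be e_i with i in \<open>zero_coords \<tau>\<close>. Positivity of m(v)
  follows since some v_i is positive.\<close>

lemma facet_normal_le:
  fixes v :: "real ^ 'n"
  assumes v: "v \<in> facet_normals f \<tau>" "v \<notin> unit_gens \<tau>"
  shows "v $ i \<le> m v" "0 < m v"
proof -
  have vn: "v \<in> normals" "\<tau> \<subseteq> F v"
    using v(1) by (auto simp: facet_normals_eq)
  show le: "v $ i \<le> m v" for i
  proof (rule ccontr)
    assume "\<not> v $ i \<le> m v"
    then have z: "x $ i = 0" if "x \<in> F v" for x
      using first_meet_locus_coordinate[OF normalsD(1)[OF vn(1)] _ that] by simp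
    have "axis i 1 = v"
      using z by (intro normals_unique[OF vn(1) primitive_axis]) (simp add: inner_axis_one)
    moreover have "i \<in> zero_coords \<tau>"
      using z vn(2) by (auto simp: zero_coords_def)
    ultimately show False
      using v(2) by (auto simp: unit_gens_def)
  qed
  obtain j where "v $ j \<noteq> 0"
    using normalsD(3)[OF vn(1)] by (auto simp: vec_eq_iff)
  then have "0 < v $ j"
    using normalsD(1)[OF vn(1)] by (auto simp: nonneg_orthant_def order_less_le)
  then show "0 < m v"
    using le[of j] by simp
qed

text \<open>The functional \<open>r\<close> vanishes on \<tau> and is non-negative on \<Gamma>, so
  adding it changes neither the minimum nor the set where it is attained.\<close>

lemma face_cone_shift:
  fixes k r :: "real ^ 'n"
  assumes k: "k \<in> face_cone f \<tau>" and r: "r \<in> nonneg_orthant" "\<And>i. i \<notin> zero_coords \<tau> \<Longrightarrow> r $ i = 0"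
  shows "k + r \<in> face_cone f \<tau>" "m (k + r) = m k"
proof -
  have ko: "k \<in> nonneg_orthant" and Fk: "F k = \<tau>"
    using k by (auto dest: face_coneD)
  have rx: "r \<bullet> x = 0" if "x \<in> \<tau>" for x
  proof -
    have "r $ i * x $ i = 0" for i
      using r(2)[of i] that by (cases "i \<in> zero_coords \<tau>") (auto simp: zero_coords_def)
    then show ?thesis
      unfolding inner_vec_def inner_real_def by (intro sum.neutral) blast
  qed
  obtain x where x: "x \<in> \<tau>"
    using first_meet_locus_nonempty[OF ko] Fk by blast
  then have xk: "x \<in> \<Gamma>" "k \<bullet> x = m k"
    using Fk by (auto simp: in_first_meet_locus)
  have rn: "0 \<le> r \<bullet> y" if "y \<in> \<Gamma>" for y
    using inner_orthant[OF r(1)] that polyhedron_orthant by auto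
  show mk: "m (k + r) = m k"
    using newton_m_eq[of x "k + r"] xk rx[OF x] rn newton_m_attained(2)[OF ko]
    by (simp add: inner_add_left add_increasing2)
  have "F (k + r) = \<tau>"
  proof (intro set_eqI iffI)
    fix y assume "y \<in> F (k + r)"
    then have "y \<in> \<Gamma>" "k \<bullet> y + r \<bullet> y = m k"
      by (auto simp: in_first_meet_locus mk inner_add_left)
    then show "y \<in> \<tau>"
      using rn[of y] newton_m_attained(2)[OF ko, of y] by (auto simp: Fk[symmetric] in_first_meet_locus)
  next
    fix y assume "y \<in> \<tau>"
    then show "y \<in> F (k + r)"
      using rx[of y] Fk by (auto simp: in_first_meet_locus mk inner_add_left)
  qed
  then show "k + r \<in> face_cone f \<tau>"
    using ko r(1) by (simp add: face_cone_def orthant_add)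
qed

lemma face_cone_coordinate:
  fixes k :: "real ^ 'n"
  assumes k: "k \<in> face_cone f \<tau>" and i: "m k < k $ i"
  shows "i \<in> zero_coords \<tau>"
  using first_meet_locus_coordinate[OF face_coneD(1)[OF k] i] face_coneD(2)[OF k]
  by (auto simp: zero_coords_def)

lemma unit_gens_subset: "\<tau> \<in> compact_faces f \<Longrightarrow> unit_gens \<tau> \<subseteq> facet_normals f \<tau>"
  using axis_in_facet_normals(1)[OF compact_face_nonempty compact_face_subset] by (auto simp: unit_gens_def)

end

subsection \<open>Power series\<close>

lemma fps_nth_eq_imp_dist_less:
  fixes a b :: "'a::ab_group_add fps"
  assumes "\<And>i. i \<le> n \<Longrightarrow> fps_nth a i = fps_nth b i"
  shows "dist a b < inverse (2 ^ n)"
proof (cases "a = b")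
  case False
  have "n < subdegree (a - b)"
    using assms False by (intro subdegree_greaterI) auto
  then show ?thesis
    using False by (simp add: dist_fps_def power_strict_increasing)
qed simp

text \<open>Each coefficient receives finitely many contributions, and closeness in the T-adic
  metric is agreement of initial coefficients.\<close>

lemma fps_has_sumI:
  fixes t :: "'k \<Rightarrow> 'a::ab_group_add fps"
  assumes fin: "\<And>n. finite {k \<in> A. fps_nth (t k) n \<noteq> 0}"
  shows "(t has_sum Abs_fps (\<lambda>n. \<Sum>k\<in>{k \<in> A. fps_nth (t k) n \<noteq> 0}. fps_nth (t k) n)) A"
    (is "(t has_sum ?S) A")
  unfolding has_sum_def tendsto_iff
proof (intro allI impI)
  fix e :: real assume "0 < e"
  then obtain n where n: "inverse (2 ^ n) < e"
    using real_arch_pow_inv[of e "1 / 2"] by (auto simp: power_one_over inverse_eq_divide)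
  \<comment> \<open>A finite partial sum containing these indices already has the final coefficients
    up to \<open>n\<close>.\<close>
  let ?X = "\<Union>i\<le>n. {k \<in> A. fps_nth (t k) i \<noteq> 0}"
  show "\<forall>\<^sub>F X in finite_subsets_at_top A. dist (sum t X) ?S < e"
    unfolding eventually_finite_subsets_at_top
  proof (intro exI[of _ ?X] conjI allI impI)
    show "finite ?X"
      using fin by auto
    fix Y assume Y: "finite Y \<and> ?X \<subseteq> Y \<and> Y \<subseteq> A"
    have eq: "fps_nth (sum t Y) i = fps_nth ?S i" if "i \<le> n" for i
    proof -
      have "(\<Sum>k\<in>{k \<in> A. fps_nth (t k) i \<noteq> 0}. fps_nth (t k) i) = (\<Sum>k\<in>Y. fps_nth (t k) i)"
        using Y that by (intro sum.mono_neutral_left) auto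
      then show ?thesis
        by (simp add: fps_sum_nth)
    qed
    show "dist (sum t Y) ?S < e"
      using fps_nth_eq_imp_dist_less[OF eq] n by (rule less_trans)
  qed auto
qed

lemma fps_infsum_nth:
  fixes t :: "'k \<Rightarrow> 'a::ab_group_add fps"
  assumes "\<And>n. finite {k \<in> A. fps_nth (t k) n \<noteq> 0}"
  shows "fps_nth (infsum t A) n = (\<Sum>k\<in>{k \<in> A. fps_nth (t k) n \<noteq> 0}. fps_nth (t k) n)"
  using infsumI[OF fps_has_sumI[OF assms]] by simp

lemma fps_X_power_times_nth:
  fixes h :: "'a::{comm_ring,comm_monoid_mult} fps"
  shows "fps_nth (fps_X ^ d * h) n = (if n < d then 0 else fps_nth h (n - d))"
proof (induction d arbitrary: n)
  case (Suc d)
  have "fps_X ^ Suc d * h = fps_X * (fps_X ^ d * h)"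
    by (simp add: mult.assoc)
  then show ?case
    using Suc by auto
qed simp

lemma fps_power_nth_eq_0:
  fixes g :: "'a::{comm_ring,comm_monoid_mult} fps"
  assumes "fps_nth g 0 = 0" "n < j"
  shows "fps_nth (g ^ j) n = 0"
  using assms(2)
proof (induction j arbitrary: n)
  case (Suc j)
  have "fps_nth g i * fps_nth (g ^ j) (n - i) = 0" if "i \<le> n" for i
    using that Suc assms(1) by (cases "i = 0") auto
  then show ?case
    by (simp add: fps_mult_nth)
qed simp

lemma geom_nth:
  assumes g: "fps_nth g 0 = 0"
  shows "fps_nth (geom g) n = (\<Sum>j\<le>n. fps_nth (g ^ j) n)"
proof -
  let ?S = "Abs_fps (\<lambda>n. \<Sum>j\<le>n. fps_nth (g ^ j) n)"
  have part: "(\<Sum>j<N. fps_nth (g ^ j) i) = (\<Sum>j\<le>i. fps_nth (g ^ j) i)" if "i < N" for N i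
    using that g by (intro sum.mono_neutral_right) (auto simp: fps_power_nth_eq_0)
  have "(\<lambda>j. g ^ j) sums ?S"
    unfolding sums_def tendsto_iff
  proof (intro allI impI)
    fix e :: real assume "0 < e"
    then obtain n where n: "inverse (2 ^ n) < e"
      using real_arch_pow_inv[of e "1 / 2"] by (auto simp: power_one_over inverse_eq_divide)
    have "dist (\<Sum>j<N. g ^ j) ?S < e" if "n < N" for N
    proof -
      have eq: "fps_nth (\<Sum>j<N. g ^ j) i = fps_nth ?S i" if "i \<le> n" for i
        using part[of i N] that \<open>n < N\<close> by (simp add: fps_sum_nth)
      show ?thesis
        using fps_nth_eq_imp_dist_less[OF eq] n by (rule less_trans)
    qed
    then show "\<forall>\<^sub>F N in sequentially. dist (\<Sum>j<N. g ^ j) ?S < e"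
      by (rule eventually_sequentiallyI[of "Suc n"]) auto
  qed
  then have "geom g = ?S"
    unfolding geom_def by (rule sums_unique[symmetric])
  then show ?thesis
    by simp
qed

lemma geom_rec:
  assumes g: "fps_nth g 0 = 0"
  shows "geom g = 1 + g * geom g"
proof (rule fps_ext)
  fix n
  have part: "fps_nth (geom g) i = fps_nth (\<Sum>j\<le>n. g ^ j) i" if "i \<le> n" for i
    unfolding geom_nth[OF g] fps_sum_nth
    using that g by (intro sum.mono_neutral_left) (auto simp: fps_power_nth_eq_0)
  have "fps_nth (g * geom g) n = fps_nth (g * (\<Sum>j\<le>n. g ^ j)) n"
    unfolding fps_mult_nth using part by (intro sum.cong) auto
  also have "g * (\<Sum>j\<le>n. g ^ j) = (\<Sum>j\<le>n. g ^ Suc j)"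
    by (simp add: sum_distrib_left)
  finally have "fps_nth (1 + g * geom g) n = fps_nth (g ^ 0) n + (\<Sum>j\<le>n. fps_nth (g ^ Suc j) n)"
    by (simp only: fps_add_nth fps_sum_nth power_0)
  also have "\<dots> = (\<Sum>j\<le>Suc n. fps_nth (g ^ j) n)"
    by (simp only: sum.atMost_Suc_shift)
  also have "\<dots> = fps_nth (geom g) n"
    using g by (simp add: geom_nth fps_power_nth_eq_0 del: power_Suc)
  finally show "fps_nth (geom g) n = fps_nth (1 + g * geom g) n"
    by simp
qed

text \<open>By \<open>geom_rec\<close>, \<open>geom g\<close> is inverse to \<open>1 - g\<close>, so
  the recursion for \<open>x\<close> can be solved. This is how geometric series enter the lattice
  sums.\<close>

lemma geom_unique:
  assumes g: "fps_nth g 0 = 0" and x: "x = y + g * x"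
  shows "x = y * geom g"
proof -
  have "x = x * (geom g - g * geom g)"
    using geom_rec[OF g] by (metis add_diff_cancel_right' mult.right_neutral)
  also have "\<dots> = (x - g * x) * geom g"
    by (simp add: algebra_simps)
  also have "x - g * x = y"
    using x by (metis add_diff_cancel_right')
  finally show ?thesis .
qed

lemma geom_linear_nth: "fps_nth (geom (fps_const c * fps_X)) n = c ^ n"
proof -
  let ?g = "fps_const c * fps_X :: mot fps"
  have g0: "fps_nth ?g 0 = 0"
    by (simp add: fps_X_def)
  have "?g * geom ?g = fps_const c * (fps_X * geom ?g)"
    by (simp add: mult.assoc)
  then have rec: "fps_nth (geom ?g) k = fps_nth 1 k + c * fps_nth (fps_X * geom ?g) k" for k
    using geom_rec[OF g0] by (metis fps_add_nth fps_mult_left_const_nth)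
  show ?thesis
    by (induction n; subst rec) simp_all
qed

text \<open>This is (1 - T)/(1 - cT), the difference of a geometric series and its shift; the shift
  has no constant term, hence the separate case.\<close>

lemma one_minus_X_geom_nth:
  "fps_nth ((1 - fps_X) * geom (fps_const c * fps_X)) n = (if n = 0 then 1 else c ^ n - c ^ (n - 1))"
  by (simp add: left_diff_distrib geom_linear_nth)

subsection \<open>Sums over lattice points\<close>

lemma finite_bounded_integer_points:
  fixes b :: real
  shows "finite {k \<in> integer_points. \<forall>i. 0 \<le> k $ i \<and> k $ i \<le> b :: bool}" (is "finite ?S")
proof -
  have sub: "?S \<subseteq> vec_lambda ` (UNIV \<rightarrow> real_of_int ` {0..\<lfloor>b\<rfloor>})"
  proof
    fix k :: "real ^ 'a" assume k: "k \<in> ?S"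
    have "k $ i \<in> real_of_int ` {0..\<lfloor>b\<rfloor>}" for i
    proof -
      have "k $ i = of_int \<lfloor>k $ i\<rfloor>" "0 \<le> k $ i" "k $ i \<le> b"
        using k by (auto simp: integer_points_def)
      then show ?thesis
        by (intro image_eqI[of _ _ "\<lfloor>k $ i\<rfloor>"]) (auto simp: floor_mono)
    qed
    then have "(\<lambda>i. k $ i) \<in> UNIV \<rightarrow> real_of_int ` {0..\<lfloor>b\<rfloor>}"
      by auto
    then show "k \<in> vec_lambda ` (UNIV \<rightarrow> real_of_int ` {0..\<lfloor>b\<rfloor>})"
      by (rule rev_image_eqI) simp
  qed
  have "finite ((UNIV :: 'a set) \<rightarrow> real_of_int ` {0..\<lfloor>b\<rfloor>})"
    using finite_PiE[of "UNIV :: 'a set" "\<lambda>_. real_of_int ` {0..\<lfloor>b\<rfloor>}"] by (simp add: PiE_UNIV_domain)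
  then show ?thesis
    by (rule finite_subset[OF sub finite_imageI])
qed

text \<open>\<open>J\<close> selects the generators whose coefficients are unbounded. The definition
  interpolates between the half-open box (\<open>J\<close> empty), the truncated cone and the open
  cone (\<open>J = G\<close>), which allows induction on \<open>J\<close>.\<close>

definition simplex_cone :: "(real ^ 'n) set \<Rightarrow> (real ^ 'n) set \<Rightarrow> (real ^ 'n) set" where
  "simplex_cone G J = {(\<Sum>v\<in>G. c v *\<^sub>R v) |c. \<forall>v\<in>G. 0 < c v \<and> (v \<notin> J \<longrightarrow> c v \<le> 1)}"

lemma simplex_coneE:
  assumes "k \<in> simplex_cone G J"
  obtains c where "k = (\<Sum>v\<in>G. c v *\<^sub>R v)" "\<And>v. v \<in> G \<Longrightarrow> 0 < c v" "\<And>v. v \<in> G \<Longrightarrow> v \<notin> J \<Longrightarrow> c v \<le> 1"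
  using assms unfolding simplex_cone_def by blast

lemma spos_span_eq: "spos_span G = simplex_cone G G"
  by (auto simp: spos_span_def simplex_cone_def)

lemma half_open_box_eq: "half_open_box G = simplex_cone G {}"
  by (auto simp: half_open_box_def simplex_cone_def)

lemma simplex_cone_mono: "J \<subseteq> J' \<Longrightarrow> simplex_cone G J \<subseteq> simplex_cone G J'"
  unfolding simplex_cone_def by blast

lemma truncated_cone_eq:
  assumes "finite G"
  shows "truncated_cone (G \<inter> U) (G - U) = simplex_cone G (G - U)"
proof (intro set_eqI iffI)
  fix k assume "k \<in> truncated_cone (G \<inter> U) (G - U)"
  then obtain h c where k: "k = (\<Sum>v\<in>G \<inter> U. h v *\<^sub>R v) + (\<Sum>v\<in>G - U. c v *\<^sub>R v)"
     "\<forall>v\<in>G \<inter> U. 0 < h v \<and> h v \<le> 1" "\<forall>v\<in>G - U. 0 < c v"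
    unfolding truncated_cone_def by blast
  let ?d = "\<lambda>v. if v \<in> U then h v else c v"
  have "(\<Sum>v\<in>G. ?d v *\<^sub>R v) = (\<Sum>v\<in>G \<inter> U. ?d v *\<^sub>R v) + (\<Sum>v\<in>G - U. ?d v *\<^sub>R v)"
    by (rule sum.Int_Diff[OF assms])
  also have "\<dots> = k"
    unfolding k(1) by (intro arg_cong2[where f = "(+)"] sum.cong) auto
  finally show "k \<in> simplex_cone G (G - U)"
    unfolding simplex_cone_def using k(2,3) by (intro CollectI exI[of _ ?d]) auto
next
  fix k assume "k \<in> simplex_cone G (G - U)"
  then obtain c where c: "k = (\<Sum>v\<in>G. c v *\<^sub>R v)" "\<And>v. v \<in> G \<Longrightarrow> 0 < c v"
      "\<And>v. v \<in> G \<Longrightarrow> v \<notin> G - U \<Longrightarrow> c v \<le> 1"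
    by (rule simplex_coneE) blast
  have "k = (\<Sum>v\<in>G \<inter> U. c v *\<^sub>R v) + (\<Sum>v\<in>G - U. c v *\<^sub>R v)"
    unfolding c(1) by (rule sum.Int_Diff[OF assms])
  then show "k \<in> truncated_cone (G \<inter> U) (G - U)"
    unfolding truncated_cone_def using c(2,3)
    by (intro CollectI exI[of _ c] exI[of _ c]) auto
qed

lemma independent_coefficients:
  assumes "independent G" "finite G" "(\<Sum>v\<in>G. c v *\<^sub>R v) = (\<Sum>v\<in>G. d v *\<^sub>R v)" "v \<in> G"
  shows "c v = d v"
proof -
  have "(\<Sum>v\<in>G. (c v - d v) *\<^sub>R v) = 0"
    using assms(3) by (simp add: scaleR_diff_left sum_subtractf)
  then have "c v - d v = 0"
    using independentD[OF assms(1,2) order_refl _ assms(4), of "\<lambda>v. c v - d v"] by blast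
  then show ?thesis
    by simp
qed

context newton
begin

definition m_nat :: "real ^ 'n \<Rightarrow> nat" where "m_nat k = nat \<lfloor>m k\<rfloor>"
definition s_nat :: "real ^ 'n \<Rightarrow> nat" where "s_nat k = nat \<lfloor>sigma_sum k\<rfloor>"

lemma lattice_term_eq: "lattice_term f k = fps_const (\<L>\<^sup>-\<^sup>1 ^ s_nat k) * fps_X ^ m_nat k"
  by (simp add: lattice_term_def m_nat_def s_nat_def)

lemma lattice_term_times_nth:
  "fps_nth (lattice_term f k * h) n = (if n < m_nat k then 0 else \<L>\<^sup>-\<^sup>1 ^ s_nat k * fps_nth h (n - m_nat k))"
  by (simp add: lattice_term_eq mult.assoc fps_X_power_times_nth)

lemma lattice_term_nth: "fps_nth (lattice_term f k) n = (if n = m_nat k then \<L>\<^sup>-\<^sup>1 ^ s_nat k else 0)"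
  using lattice_term_times_nth[of k 1 n] by auto

text \<open>The condition for T-adic summability of the lattice terms: each power of T is hit
  finitely often.\<close>

definition locally_finite :: "(real ^ 'n) set \<Rightarrow> bool" where
  "locally_finite A \<longleftrightarrow> (\<forall>n. finite {k \<in> A. m_nat k = n})"

lemma locally_finite_subset: "locally_finite A \<Longrightarrow> B \<subseteq> A \<Longrightarrow> locally_finite B"
proof -
  assume A: "locally_finite A" and B: "B \<subseteq> A"
  show ?thesis
    unfolding locally_finite_def
  proof
    fix n
    have "finite {k \<in> A. m_nat k = n}"
      using A by (simp add: locally_finite_def)
    then show "finite {k \<in> B. m_nat k = n}"
      by (rule rev_finite_subset) (use B in auto)
  qed
qed

lemma locally_finite_support:
  assumes "locally_finite A"
  shows "finite {k \<in> A. fps_nth (lattice_term f k) n \<noteq> 0}"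
  using assms unfolding locally_finite_def
  by (rule_tac finite_subset[of _ "{k \<in> A. m_nat k = n}"]) (auto simp: lattice_term_nth split: if_splits)

lemma lattice_sum_summable: "locally_finite A \<Longrightarrow> lattice_term f summable_on A"
  using fps_has_sumI[of A "lattice_term f"] locally_finite_support has_sum_imp_summable by blast

lemma lattice_sum_nth:
  assumes "locally_finite A"
  shows "fps_nth (infsum (lattice_term f) A) n = (\<Sum>k\<in>{k \<in> A. m_nat k = n}. \<L>\<^sup>-\<^sup>1 ^ s_nat k)"
proof -
  have "(\<Sum>k\<in>{k \<in> A. fps_nth (lattice_term f k) n \<noteq> 0}. fps_nth (lattice_term f k) n) =
      (\<Sum>k\<in>{k \<in> A. m_nat k = n}. fps_nth (lattice_term f k) n)"
    using assms unfolding locally_finite_def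
    by (intro sum.mono_neutral_left) (auto simp: lattice_term_nth split: if_splits)
  also have "\<dots> = (\<Sum>k\<in>{k \<in> A. m_nat k = n}. \<L>\<^sup>-\<^sup>1 ^ s_nat k)"
    by (intro sum.cong) (auto simp: lattice_term_nth)
  finally show ?thesis
    using fps_infsum_nth[of A "lattice_term f" n] locally_finite_support[OF assms] by simp
qed

lemma m_nat: "k \<in> nonneg_orthant \<Longrightarrow> k \<in> integer_points \<Longrightarrow> real (m_nat k) = m k"
  using newton_m_nonneg newton_m_Int unfolding m_nat_def by (simp add: of_nat_nat)

lemma sigma_sum_nonneg: "k \<in> nonneg_orthant \<Longrightarrow> 0 \<le> sigma_sum k"
  by (auto simp: sigma_sum_def nonneg_orthant_def intro: sum_nonneg)

lemma s_nat: "k \<in> nonneg_orthant \<Longrightarrow> k \<in> integer_points \<Longrightarrow> real (s_nat k) = sigma_sum k"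
proof -
  assume k: "k \<in> nonneg_orthant" "k \<in> integer_points"
  have "sigma_sum k \<in> \<int>"
    using k(2) unfolding sigma_sum_def integer_points_def by (intro Ints_sum) auto
  then show ?thesis
    using sigma_sum_nonneg[OF k(1)] by (simp add: s_nat_def of_nat_nat)
qed

lemma integer_points_add: "x \<in> integer_points \<Longrightarrow> y \<in> integer_points \<Longrightarrow> x + y \<in> integer_points"
  and integer_points_diff: "x \<in> integer_points \<Longrightarrow> y \<in> integer_points \<Longrightarrow> x - y \<in> integer_points"
  by (auto simp: integer_points_def)

context
  fixes \<tau> G :: "(real ^ 'n) set"
  assumes \<tau>: "\<tau> \<noteq> {}" "\<tau> \<subseteq> \<Gamma>" and G: "G \<subseteq> facet_normals f \<tau>" "independent G"
begin

lemma G_finite: "finite G"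
  using finite_subset[OF G(1) finite_facet_normals] .

lemma G_normal: "v \<in> G \<Longrightarrow> v \<in> nonneg_orthant" "v \<in> G \<Longrightarrow> v \<in> integer_points"
  using G(1) normalsD unfolding facet_normals_eq by blast+

lemma G_comb:
  assumes "\<And>v. v \<in> G \<Longrightarrow> 0 \<le> c v"
  shows "(\<Sum>v\<in>G. c v *\<^sub>R v) \<in> nonneg_orthant" "m (\<Sum>v\<in>G. c v *\<^sub>R v) = (\<Sum>v\<in>G. c v * m v)"
proof -
  obtain x where "x \<in> \<tau>" "x \<in> \<Gamma>"
    using \<tau> by blast
  then show "(\<Sum>v\<in>G. c v *\<^sub>R v) \<in> nonneg_orthant" "m (\<Sum>v\<in>G. c v *\<^sub>R v) = (\<Sum>v\<in>G. c v * m v)"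
    using newton_m_nonneg_comb[OF G(1)] assms by blast+
qed

lemma simplex_cone_orthant: "k \<in> simplex_cone G J \<Longrightarrow> k \<in> nonneg_orthant"
  by (elim simplex_coneE) (use G_comb(1) less_imp_le in blast)

text \<open>m(k) is the sum of the terms c_v m(v), so m(v) >= 1 bounds the coefficient of a
  generator in \<open>J\<close> by m(k); the other coefficients are at most 1. The factor
  \<open>b + 1\<close> covers both cases.\<close>

lemma simplex_cone_bounded:
  assumes J: "\<And>v. v \<in> J \<Longrightarrow> v \<in> G \<Longrightarrow> 1 \<le> m v" and k: "k \<in> simplex_cone G J" and n: "m k \<le> b" "0 \<le> b"
  shows "k $ i \<le> (\<Sum>v\<in>G. (b + 1) * v $ i)"
proof -
  obtain c where c: "k = (\<Sum>v\<in>G. c v *\<^sub>R v)" "\<And>v. v \<in> G \<Longrightarrow> 0 < c v" "\<And>v. v \<in> G \<Longrightarrow> v \<notin> J \<Longrightarrow> c v \<le> 1"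
    using k by (rule simplex_coneE) blast
  have mk: "m k = (\<Sum>v\<in>G. c v * m v)"
    unfolding c(1) using c(2) by (intro G_comb) (simp add: less_imp_le)
  have "c v \<le> b + 1" if v: "v \<in> G" for v
  proof (cases "v \<in> J")
    case True
    have "c v * m v \<le> m k"
      unfolding mk using v G_finite c(2) newton_m_nonneg G_normal(1)
      by (intro member_le_sum[where f = "\<lambda>v. c v * m v"]) (auto simp: less_imp_le)
    moreover have "c v * 1 \<le> c v * m v"
      using J[OF True v] c(2)[OF v] by (intro mult_left_mono) auto
    ultimately show ?thesis
      using n by simp
  next
    case False
    then show ?thesis
      using c(3)[OF v] n by simp
  qed
  then have "c v * v $ i \<le> (b + 1) * v $ i" if "v \<in> G" for v
    using that G_normal(1)[OF that] by (intro mult_right_mono) (auto simp: nonneg_orthant_def)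
  then show ?thesis
    unfolding c(1) by (simp add: sum_mono)
qed

lemma locally_finite_simplex_cone:
  assumes J: "\<And>v. v \<in> J \<Longrightarrow> v \<in> G \<Longrightarrow> 1 \<le> m v"
  shows "locally_finite (integer_points \<inter> simplex_cone G J)"
  unfolding locally_finite_def
proof
  fix n
  define b where "b = Max (range (\<lambda>i. \<Sum>v\<in>G. (real n + 1) * v $ i))"
  have "{k \<in> integer_points \<inter> simplex_cone G J. m_nat k = n} \<subseteq>
      {k \<in> integer_points. \<forall>i. 0 \<le> k $ i \<and> k $ i \<le> b}"
  proof
    fix k assume k: "k \<in> {k \<in> integer_points \<inter> simplex_cone G J. m_nat k = n}"
    then have ko: "k \<in> nonneg_orthant"
      using simplex_cone_orthant by blast
    then have "m k \<le> real n"
      using m_nat[OF ko] k by auto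
    then have "k $ i \<le> (\<Sum>v\<in>G. (real n + 1) * v $ i)" for i
      using simplex_cone_bounded[OF J] k by auto
    also have "\<dots>i \<le> b" for i
      unfolding b_def by (intro Max_ge) auto
    finally show "k \<in> {k \<in> integer_points. \<forall>i. 0 \<le> k $ i \<and> k $ i \<le> b}"
      using k ko by (auto simp: nonneg_orthant_def)
  qed
  then show "finite {k \<in> integer_points \<inter> simplex_cone G J. m_nat k = n}"
    by (rule finite_subset[OF _ finite_bounded_integer_points])
qed

lemma finite_half_open_box: "finite (integer_points \<inter> half_open_box G)"
proof -
  define b where "b = Max (range (\<lambda>i. \<Sum>v\<in>G. v $ i))"
  have "integer_points \<inter> half_open_box G \<subseteq> {k \<in> integer_points. \<forall>i. 0 \<le> k $ i \<and> k $ i \<le> b}"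
  proof
    fix k assume k: "k \<in> integer_points \<inter> half_open_box G"
    then have ko: "k \<in> nonneg_orthant"
      using simplex_cone_orthant by (auto simp: half_open_box_eq)
    obtain c where c: "k = (\<Sum>v\<in>G. c v *\<^sub>R v)" "\<forall>v\<in>G. 0 < c v \<and> c v \<le> 1"
      using k by (auto simp: half_open_box_def)
    have "k $ i \<le> b" for i
    proof -
      have "c v * v $ i \<le> v $ i" if "v \<in> G" for v
        using c(2) that G_normal(1)[OF that] by (intro mult_left_le_one_le) (auto simp: nonneg_orthant_def)
      then have "k $ i \<le> (\<Sum>v\<in>G. v $ i)"
        unfolding c(1) by (simp add: sum_mono)
      also have "\<dots> \<le> b"
        unfolding b_def by (intro Max_ge) auto
      finally show ?thesis .
    qed
    then show "k \<in> {k \<in> integer_points. \<forall>i. 0 \<le> k $ i \<and> k $ i \<le> b}"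
      using k ko by (auto simp: nonneg_orthant_def)
  qed
  then show ?thesis
    by (rule finite_subset[OF _ finite_bounded_integer_points])
qed

text \<open>Either the coefficient of \<open>w\<close> is at most 1, or \<open>w\<close> can be
  subtracted without leaving the larger cone. Uniqueness of the coefficients makes the two cases
  exclusive.\<close>

lemma simplex_cone_insert:
  assumes w: "w \<in> G" "w \<notin> J"
  shows "integer_points \<inter> simplex_cone G (insert w J) =
      (integer_points \<inter> simplex_cone G J) \<union> (+) w ` (integer_points \<inter> simplex_cone G (insert w J))"
    and "(integer_points \<inter> simplex_cone G J) \<inter> (+) w ` (integer_points \<inter> simplex_cone G (insert w J)) = {}"
proof -
  have wsum: "(\<Sum>v\<in>G. (if v = w then a else 0) *\<^sub>R v) = a *\<^sub>R w" for a
    using w(1) G_finite by (simp add: if_distrib[of "\<lambda>c. c *\<^sub>R _"] sum.delta cong: if_cong)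
  have shift: "w + (\<Sum>v\<in>G. c v *\<^sub>R v) = (\<Sum>v\<in>G. (c v + (if v = w then 1 else 0)) *\<^sub>R v)" for c
    using wsum[of 1] by (simp only: scaleR_add_left sum.distrib scaleR_one add.commute)
  show "(integer_points \<inter> simplex_cone G J) \<inter> (+) w ` (integer_points \<inter> simplex_cone G (insert w J)) = {}"
  proof (rule ccontr)
    assume "\<not> ?thesis"
    then obtain k k' where k: "k \<in> simplex_cone G J" "k' \<in> simplex_cone G (insert w J)" "k = w + k'"
      by blast
    obtain c where c: "k = (\<Sum>v\<in>G. c v *\<^sub>R v)" "\<And>v. v \<in> G \<Longrightarrow> v \<notin> J \<Longrightarrow> c v \<le> 1"
      using k(1) by (rule simplex_coneE) blast
    obtain d where d: "k' = (\<Sum>v\<in>G. d v *\<^sub>R v)" "\<And>v. v \<in> G \<Longrightarrow> 0 < d v"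
      using k(2) by (rule simplex_coneE) blast
    have "c w = d w + (if w = w then 1 else 0)"
      using k(3) w(1) unfolding c(1) d(1) shift by (rule independent_coefficients[OF G(2) G_finite])
    then show False
      using c(2)[OF w] d(2)[OF w(1)] by simp
  qed
  show "integer_points \<inter> simplex_cone G (insert w J) =
      (integer_points \<inter> simplex_cone G J) \<union> (+) w ` (integer_points \<inter> simplex_cone G (insert w J))"
  proof (intro set_eqI iffI)
    fix k assume k: "k \<in> integer_points \<inter> simplex_cone G (insert w J)"
    then obtain c where c: "k = (\<Sum>v\<in>G. c v *\<^sub>R v)" "\<And>v. v \<in> G \<Longrightarrow> 0 < c v"
       "\<And>v. v \<in> G \<Longrightarrow> v \<notin> insert w J \<Longrightarrow> c v \<le> 1"
      by (auto elim: simplex_coneE)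
    show "k \<in> (integer_points \<inter> simplex_cone G J) \<union> (+) w ` (integer_points \<inter> simplex_cone G (insert w J))"
    proof (cases "c w \<le> 1")
      case True
      then have "k \<in> simplex_cone G J"
        unfolding simplex_cone_def using c by blast
      then show ?thesis
        using k by blast
    next
      case False
      let ?d = "\<lambda>v. c v - (if v = w then 1 else 0)"
      have "w + (\<Sum>v\<in>G. ?d v *\<^sub>R v) = k"
        unfolding shift c(1) by (intro sum.cong) auto
      moreover have "(\<Sum>v\<in>G. ?d v *\<^sub>R v) \<in> simplex_cone G (insert w J)"
        unfolding simplex_cone_def using c False by (intro CollectI exI[of _ ?d]) auto
      moreover have "k - w \<in> integer_points"
        using k G_normal(2)[OF w(1)] by (intro integer_points_diff) auto
      moreover have "(\<Sum>v\<in>G. ?d v *\<^sub>R v) = k - w"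
        using calculation(1) by (simp add: algebra_simps)
      ultimately show ?thesis
        by (metis IntI UnI2 image_eqI)
    qed
  next
    fix k assume "k \<in> (integer_points \<inter> simplex_cone G J) \<union> (+) w ` (integer_points \<inter> simplex_cone G (insert w J))"
    then show "k \<in> integer_points \<inter> simplex_cone G (insert w J)"
    proof
      assume "k \<in> integer_points \<inter> simplex_cone G J"
      then show ?thesis
        using simplex_cone_mono[of J "insert w J" G] by blast
    next
      assume "k \<in> (+) w ` (integer_points \<inter> simplex_cone G (insert w J))"
      then obtain k' where k': "k = w + k'" "k' \<in> integer_points" "k' \<in> simplex_cone G (insert w J)"
        by blast
      obtain d where d: "k' = (\<Sum>v\<in>G. d v *\<^sub>R v)" "\<And>v. v \<in> G \<Longrightarrow> 0 < d v"
         "\<And>v. v \<in> G \<Longrightarrow> v \<notin> insert w J \<Longrightarrow> d v \<le> 1"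
        using k'(3) by (rule simplex_coneE) blast
      have "k \<in> simplex_cone G (insert w J)"
        unfolding k'(1) d(1) shift simplex_cone_def using d(2,3)
        by (intro CollectI exI[of _ "\<lambda>v. d v + (if v = w then 1 else 0)"]) (auto simp: add_pos_nonneg)
      then show ?thesis
        using k' integer_points_add G_normal(2)[OF w(1)] by blast
    qed
  qed
qed

text \<open>Adding \<open>w\<close> to \<open>J\<close> gives a sum S that satisfies S = S_J + (term
  of w) S by \<open>simplex_cone_insert\<close>; solving this multiplies S_J by the geometric series
  of that term. The induction starts at the finite sum over the box.\<close>

lemma lattice_sum_simplex_cone:
  assumes "finite J" "J \<subseteq> G" "\<And>v. v \<in> J \<Longrightarrow> 1 \<le> m v"
  shows "infsum (lattice_term f) (integer_points \<inter> simplex_cone G J) =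
    Sigma_box f G * (\<Prod>v\<in>J. geom (lattice_term f v))"
  using assms
proof (induction J rule: finite_induct)
  case empty
  then show ?case
    using finite_half_open_box by (simp add: Sigma_box_def half_open_box_eq)
next
  case (insert w J)
  let ?A = "integer_points \<inter> simplex_cone G J" and ?B = "integer_points \<inter> simplex_cone G (insert w J)"
  have w: "w \<in> G" "w \<notin> J" "1 \<le> m w"
    using insert by auto
  have wn: "w \<in> nonneg_orthant" "w \<in> integer_points"
    using G_normal w(1) by auto
  have lf: "locally_finite ?A" "locally_finite ?B"
    using insert.prems by (auto intro!: locally_finite_simplex_cone)
  \<comment> \<open>All points of the cone share a minimizing point of \<Gamma>, so \<open>m\<close>
    is linear here, and translation by \<open>w\<close> multiplies lattice terms by the term of
    \<open>w\<close>.\<close>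
  have add: "m_nat (w + k) = m_nat w + m_nat k" "s_nat (w + k) = s_nat w + s_nat k" if k: "k \<in> ?B" for k
  proof -
    have ko: "k \<in> nonneg_orthant" "k \<in> integer_points"
      using k simplex_cone_orthant by blast+
    obtain c where c: "k = (\<Sum>v\<in>G. c v *\<^sub>R v)" "\<And>v. v \<in> G \<Longrightarrow> 0 < c v"
      using k by (auto elim: simplex_coneE)
    have sw: "w + k = (\<Sum>v\<in>G. (c v + (if v = w then 1 else 0)) *\<^sub>R v)"
      using w(1) G_finite
      by (simp add: c(1) scaleR_add_left sum.distrib if_distrib[of "\<lambda>c. c *\<^sub>R _"] sum.delta add.commute cong: if_cong)
    have "m (w + k) = (\<Sum>v\<in>G. (c v + (if v = w then 1 else 0)) * m v)"
      unfolding sw using c(2) by (intro G_comb(2)) (auto simp: less_imp_le add_nonneg_nonneg)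
    also have "\<dots> = (\<Sum>v\<in>G. c v * m v) + m w"
      using w(1) G_finite by (simp add: distrib_right sum.distrib if_distrib[of "\<lambda>c. c * _"] sum.delta cong: if_cong)
    also have "(\<Sum>v\<in>G. c v * m v) = m k"
      unfolding c(1) using c(2) by (intro G_comb(2)[symmetric]) (simp add: less_imp_le)
    finally have "real (m_nat (w + k)) = real (m_nat w + m_nat k)"
      using m_nat[OF orthant_add[OF wn(1) ko(1)] integer_points_add[OF wn(2) ko(2)]] m_nat[OF wn] m_nat[OF ko] by simp
    then show "m_nat (w + k) = m_nat w + m_nat k"
      by linarith
    have "real (s_nat (w + k)) = real (s_nat w + s_nat k)"
      using s_nat[OF orthant_add[OF wn(1) ko(1)] integer_points_add[OF wn(2) ko(2)]] s_nat[OF wn] s_nat[OF ko]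
      by (simp add: sigma_sum_def sum.distrib)
    then show "s_nat (w + k) = s_nat w + s_nat k"
      by linarith
  qed
  have rec: "infsum (lattice_term f) ?B = infsum (lattice_term f) ?A + lattice_term f w * infsum (lattice_term f) ?B"
  proof (rule fps_ext)
    fix n
    let ?n = "\<lambda>A n. {k \<in> A. m_nat k = n}"
    have split: "?n ?B n = ?n ?A n \<union> ?n ((+) w ` ?B) n"
      using simplex_cone_insert(1)[OF w(1,2)] by auto
    have fin: "finite (?n ?B n)"
      using lf(2) by (simp add: locally_finite_def)
    have "(\<Sum>k\<in>?n ?B n. \<L>\<^sup>-\<^sup>1 ^ s_nat k) = (\<Sum>k\<in>?n ?A n. \<L>\<^sup>-\<^sup>1 ^ s_nat k) + (\<Sum>k\<in>?n ((+) w ` ?B) n. \<L>\<^sup>-\<^sup>1 ^ s_nat k)"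
      unfolding split
    proof (rule sum.union_disjoint)
      show "finite (?n ?A n)" "finite (?n ((+) w ` ?B) n)"
        using fin unfolding split by auto
      show "?n ?A n \<inter> ?n ((+) w ` ?B) n = {}"
        using simplex_cone_insert(2)[OF w(1,2)] by blast
    qed
    also have "(\<Sum>k\<in>?n ((+) w ` ?B) n. \<L>\<^sup>-\<^sup>1 ^ s_nat k) =
        fps_nth (lattice_term f w * infsum (lattice_term f) ?B) n"
    proof (cases "n < m_nat w")
      case True
      have e: "?n ((+) w ` ?B) n = {}"
        using add(1) True by auto
      show ?thesis
        unfolding e using True by (simp add: lattice_term_times_nth)
    next
      case False
      have im: "?n ((+) w ` ?B) n = (+) w ` ?n ?B (n - m_nat w)"
        using add(1) False by (auto simp: image_iff)
      have "(\<Sum>k\<in>?n ((+) w ` ?B) n. \<L>\<^sup>-\<^sup>1 ^ s_nat k) = (\<Sum>k\<in>?n ?B (n - m_nat w). \<L>\<^sup>-\<^sup>1 ^ s_nat (w + k))"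
        unfolding im by (simp add: sum.reindex)
      also have "\<dots> = (\<Sum>k\<in>?n ?B (n - m_nat w). \<L>\<^sup>-\<^sup>1 ^ s_nat w * \<L>\<^sup>-\<^sup>1 ^ s_nat k)"
        by (intro sum.cong refl) (auto simp: add(2) power_add)
      finally show ?thesis
        using False lf(2) by (simp add: lattice_term_times_nth lattice_sum_nth sum_distrib_left)
    qed
    finally show "fps_nth (infsum (lattice_term f) ?B) n =
        fps_nth (infsum (lattice_term f) ?A + lattice_term f w * infsum (lattice_term f) ?B) n"
      by (simp add: lattice_sum_nth lf)
  qed
  have "m_nat w \<noteq> 0"
    using m_nat[OF wn] w(3) by auto
  then have "fps_nth (lattice_term f w) 0 = 0"
    by (simp add: lattice_term_nth)
  from geom_unique[OF this rec] insert show ?case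
    by (simp add: ac_simps)
qed

end

end

subsection \<open>Substituting arcs into a polynomial\<close>

definition weight :: "('n::finite \<Rightarrow> nat) \<Rightarrow> ('n \<Rightarrow>\<^sub>0 nat) \<Rightarrow> nat" where
  "weight k \<omega> = (\<Sum>i\<in>UNIV. k i * Poly_Mapping.lookup \<omega> i)"

text \<open>This is f(t^k_1 U_1, ..., t^k_n U_n) divided by t^d, written termwise; the subtraction
  in the exponent is a true one when all weights are at least \<open>d\<close>.\<close>

definition scaled_eval :: "'n::finite cpoly \<Rightarrow> ('n \<Rightarrow> nat) \<Rightarrow> nat \<Rightarrow> ('n \<Rightarrow> complex poly) \<Rightarrow> complex poly" where
  "scaled_eval f k d U = (\<Sum>\<omega>\<in>Poly_Mapping.keys f. [:Poly_Mapping.lookup f \<omega>:] *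
     (monom 1 (weight k \<omega> - d) * (\<Prod>i\<in>UNIV. U i ^ Poly_Mapping.lookup \<omega> i)))"

lemma mpoly_eval_in_UNIV:
  fixes x :: "'n::finite \<Rightarrow> 'r::comm_ring_1"
  shows "mpoly_eval_in c p x = (\<Sum>\<omega>\<in>Poly_Mapping.keys p. c (Poly_Mapping.lookup p \<omega>) *
     (\<Prod>i\<in>UNIV. x i ^ Poly_Mapping.lookup \<omega> i))"
  unfolding mpoly_eval_in_def
  by (intro sum.cong refl arg_cong2[where f = "(*)"] prod_keys_superset) auto

lemma prod_monom: "finite A \<Longrightarrow> (\<Prod>i\<in>A. monom (1::'a::comm_semiring_1) (e i)) = monom 1 (\<Sum>i\<in>A. e i)"
  by (induction A rule: finite_induct) (auto simp: mult_monom monom_0)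

lemma mpoly_eval_scaled:
  assumes "\<And>\<omega>. \<omega> \<in> Poly_Mapping.keys f \<Longrightarrow> d \<le> weight k \<omega>"
  shows "mpoly_eval_in (\<lambda>c. [:c:]) f (\<lambda>i. monom 1 (k i) * U i) = monom 1 d * scaled_eval f k d U"
proof -
  have "[:Poly_Mapping.lookup f \<omega>:] * (\<Prod>i\<in>UNIV. (monom 1 (k i) * U i) ^ Poly_Mapping.lookup \<omega> i) =
      monom 1 d * ([:Poly_Mapping.lookup f \<omega>:] *
     (monom 1 (weight k \<omega> - d) * (\<Prod>i\<in>UNIV. U i ^ Poly_Mapping.lookup \<omega> i)))"
    if "\<omega> \<in> Poly_Mapping.keys f" for \<omega>
  proof -
    have "(\<Prod>i\<in>UNIV. (monom 1 (k i) * U i) ^ Poly_Mapping.lookup \<omega> i) =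
        monom 1 (weight k \<omega>) * (\<Prod>i\<in>UNIV. U i ^ Poly_Mapping.lookup \<omega> i)"
      by (simp add: power_mult_distrib prod.distrib monom_power prod_monom weight_def)
    also have "monom (1::complex) (weight k \<omega>) = monom 1 d * monom 1 (weight k \<omega> - d)"
      using assms[OF that] by (simp add: mult_monom)
    finally show ?thesis
      by (simp only: ac_simps)
  qed
  then show ?thesis
    unfolding mpoly_eval_in_UNIV scaled_eval_def sum_distrib_left by (intro sum.cong) auto
qed

lemma mpoly_eval_sum: "finite A \<Longrightarrow> mpoly_eval (\<Sum>j\<in>A. g j) x = (\<Sum>j\<in>A. mpoly_eval (g j) x)"
  by (induction A rule: finite_induct) (auto simp: mpoly_eval_add, simp add: mpoly_eval_in_def)

lemma mpoly_eval_single_UNIV: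
  fixes x :: "'n::finite \<Rightarrow> complex"
  shows "mpoly_eval (Poly_Mapping.single \<omega> a) x = a * (\<Prod>i\<in>UNIV. x i ^ Poly_Mapping.lookup \<omega> i)"
  unfolding mpoly_eval_single by (subst prod_keys_superset[of UNIV]) auto

lemma mpoly_eval_partial_deriv:
  fixes x :: "'n::finite \<Rightarrow> complex"
  shows "mpoly_eval (partial_deriv i p) x = (\<Sum>\<omega>\<in>Poly_Mapping.keys p.
    of_nat (Poly_Mapping.lookup \<omega> i) * Poly_Mapping.lookup p \<omega> *
    (x i ^ (Poly_Mapping.lookup \<omega> i - 1) * (\<Prod>j\<in>UNIV - {i}. x j ^ Poly_Mapping.lookup \<omega> j)))"
proof -
  have "(\<Prod>j\<in>UNIV. x j ^ Poly_Mapping.lookup (\<omega> - Poly_Mapping.single i 1) j) =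
     x i ^ (Poly_Mapping.lookup \<omega> i - 1) * (\<Prod>j\<in>UNIV - {i}. x j ^ Poly_Mapping.lookup \<omega> j)" for \<omega>
    by (subst prod.remove[of _ i]) (auto simp: lookup_minus lookup_single intro!: prod.cong arg_cong2[where f = "(*)"])
  then show ?thesis
    unfolding partial_deriv_def by (simp add: mpoly_eval_sum mpoly_eval_single_UNIV)
qed

definition restrict_poly :: "'n cpoly \<Rightarrow> ('n \<Rightarrow>\<^sub>0 nat) set \<Rightarrow> 'n cpoly" where
  "restrict_poly f A = (\<Sum>\<omega>\<in>A. Poly_Mapping.single \<omega> (Poly_Mapping.lookup f \<omega>))"

lemma lookup_restrict_poly:
  "finite A \<Longrightarrow> Poly_Mapping.lookup (restrict_poly f A) \<omega> = (if \<omega> \<in> A then Poly_Mapping.lookup f \<omega> else 0)"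
  by (simp add: restrict_poly_def lookup_sum lookup_single when_def sum.delta)

lemma keys_restrict_poly: "finite A \<Longrightarrow> A \<subseteq> Poly_Mapping.keys f \<Longrightarrow> Poly_Mapping.keys (restrict_poly f A) = A"
  by (auto simp: in_keys_iff lookup_restrict_poly split: if_splits)

text \<open>A monomial of weight larger than \<open>d\<close> keeps a positive power of t and
  disappears at t = 0.\<close>

lemma coeff_0_scaled_eval:
  fixes f :: "'n::finite cpoly"
  assumes d: "\<And>\<omega>. \<omega> \<in> Poly_Mapping.keys f \<Longrightarrow> d \<le> weight k \<omega>"
  shows "coeff (scaled_eval f k d U) 0 =
    mpoly_eval (restrict_poly f {\<omega> \<in> Poly_Mapping.keys f. weight k \<omega> = d}) (\<lambda>i. coeff (U i) 0)"
proof -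
  let ?A = "{\<omega> \<in> Poly_Mapping.keys f. weight k \<omega> = d}"
  have "coeff (scaled_eval f k d U) 0 = (\<Sum>\<omega>\<in>Poly_Mapping.keys f. Poly_Mapping.lookup f \<omega> *
     ((if weight k \<omega> = d then 1 else 0) * (\<Prod>i\<in>UNIV. coeff (U i) 0 ^ Poly_Mapping.lookup \<omega> i)))"
    unfolding scaled_eval_def poly_0_coeff_0[symmetric] poly_sum poly_mult poly_prod poly_power
  proof (intro sum.cong refl)
    fix \<omega> assume "\<omega> \<in> Poly_Mapping.keys f"
    then have "d \<le> weight k \<omega>"
      by (rule d)
    then show "poly [:Poly_Mapping.lookup f \<omega>:] 0 * (poly (monom 1 (weight k \<omega> - d)) 0 *
        (\<Prod>i\<in>UNIV. poly (U i) 0 ^ Poly_Mapping.lookup \<omega> i)) =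
      Poly_Mapping.lookup f \<omega> * ((if weight k \<omega> = d then 1 else 0) *
        (\<Prod>i\<in>UNIV. poly (U i) 0 ^ Poly_Mapping.lookup \<omega> i))"
      by (cases "weight k \<omega> = d") (simp_all add: poly_monom zero_power)
  qed
  also have "\<dots> = (\<Sum>\<omega>\<in>?A. Poly_Mapping.lookup f \<omega> * (\<Prod>i\<in>UNIV. coeff (U i) 0 ^ Poly_Mapping.lookup \<omega> i))"
    by (intro sum.mono_neutral_cong_right) auto
  also have "\<dots> = mpoly_eval (restrict_poly f ?A) (\<lambda>i. coeff (U i) 0)"
    unfolding mpoly_eval_in_UNIV by (subst keys_restrict_poly) (auto simp: lookup_restrict_poly intro!: sum.cong)
  finally show ?thesis .
qed

lemma coeff_monom_mult_times:
  fixes p q :: "complex poly"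
  shows "coeff (p * (monom c s * q)) s = c * (coeff p 0 * coeff q 0)"
proof -
  have eq: "p * (monom c s * q) = monom c s * (p * q)"
    by (simp only: ac_simps)
  have "coeff (p * q) 0 = coeff p 0 * coeff q 0"
    by (simp add: coeff_mult)
  then show ?thesis
    unfolding eq by (simp add: coeff_monom_mult)
qed

text \<open>
  A non-vanishing partial derivative lets the equation of order \<open>s\<close> be solved for one of the
  coefficients of order \<open>s\<close>.
\<close>

lemma coeff_scaled_eval_perturb:
  fixes f :: "'n::finite cpoly"
  assumes d: "\<And>\<omega>. \<omega> \<in> Poly_Mapping.keys f \<Longrightarrow> d \<le> weight k \<omega>" and s: "0 < s"
  shows "coeff (scaled_eval f k d (U(i := U i + monom c s))) s = coeff (scaled_eval f k d U) s +
    c * mpoly_eval (partial_deriv i (restrict_poly f {\<omega> \<in> Poly_Mapping.keys f. weight k \<omega> = d})) (\<lambda>j. coeff (U j) 0)"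
proof -
  let ?A = "{\<omega> \<in> Poly_Mapping.keys f. weight k \<omega> = d}"
  let ?u = "\<lambda>j. coeff (U j) 0"
  let ?l = "Poly_Mapping.lookup"
  let ?U = "U(i := U i + monom c s)"
  let ?R = "\<lambda>\<omega>. \<Prod>j\<in>UNIV - {i}. U j ^ ?l \<omega> j"
  let ?C = "\<lambda>\<omega>. [:?l f \<omega>:] * (monom 1 (weight k \<omega> - d) * ?R \<omega>)"
  let ?S = "\<lambda>n. \<Sum>j<n. U i ^ (n - Suc j) * (U i + monom c s) ^ j"
  have split: "(\<Prod>j\<in>UNIV. X j ^ ?l \<omega> j) = X i ^ ?l \<omega> i * (\<Prod>j\<in>UNIV - {i}. X j ^ ?l \<omega> j)" for X :: "'n \<Rightarrow> complex poly" and \<omega>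
    by (rule prod.remove) auto
  have R: "(\<Prod>j\<in>UNIV - {i}. ?U j ^ ?l \<omega> j) = ?R \<omega>" for \<omega>
    by (intro prod.cong) auto
  have diff: "[:?l f \<omega>:] * (monom 1 (weight k \<omega> - d) * (\<Prod>j\<in>UNIV. ?U j ^ ?l \<omega> j)) -
      [:?l f \<omega>:] * (monom 1 (weight k \<omega> - d) * (\<Prod>j\<in>UNIV. U j ^ ?l \<omega> j)) =
      ?C \<omega> * (monom c s * ?S (?l \<omega> i))" for \<omega>
  proof -
    have "(U i + monom c s) ^ ?l \<omega> i - U i ^ ?l \<omega> i = monom c s * ?S (?l \<omega> i)"
      by (subst power_diff_sumr2) simp
    moreover have "[:?l f \<omega>:] * (monom 1 (weight k \<omega> - d) * (\<Prod>j\<in>UNIV. ?U j ^ ?l \<omega> j)) -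
      [:?l f \<omega>:] * (monom 1 (weight k \<omega> - d) * (\<Prod>j\<in>UNIV. U j ^ ?l \<omega> j)) =
      ?C \<omega> * ((U i + monom c s) ^ ?l \<omega> i - U i ^ ?l \<omega> i)"
      unfolding split R by (simp only: fun_upd_same right_diff_distrib mult.assoc mult.commute[of "?R \<omega>"])
    ultimately show ?thesis
      by simp
  qed
  \<comment> \<open>\<open>?S n\<close> is the cofactor of \<open>monom c s\<close> in the
    difference of the n-th powers. Since s > 0, both arguments agree at t = 0, and the cofactor
    becomes the derivative n u_i^(n-1).\<close>
  have S0: "coeff (?S n) 0 = of_nat n * ?u i ^ (n - 1)" for n
  proof -
    have "coeff (?S n) 0 = (\<Sum>j<n. ?u i ^ (n - 1))"
      unfolding poly_0_coeff_0[symmetric] poly_sum poly_mult poly_power poly_add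
    proof (intro sum.cong refl)
      fix j assume "j \<in> {..<n}"
      then have "n - Suc j + j = n - 1"
        by auto
      then show "poly (U i) 0 ^ (n - Suc j) * (poly (U i) 0 + poly (monom c s) 0) ^ j = poly (U i) 0 ^ (n - 1)"
        using s by (simp add: poly_monom zero_power power_add[symmetric])
    qed
    then show ?thesis
      by simp
  qed
  have C0: "coeff (?C \<omega>) 0 = (if \<omega> \<in> ?A then ?l f \<omega> * (\<Prod>j\<in>UNIV - {i}. ?u j ^ ?l \<omega> j) else 0)"
    if "\<omega> \<in> Poly_Mapping.keys f" for \<omega>
    unfolding poly_0_coeff_0[symmetric] poly_mult poly_prod poly_power
    using d[OF that] that by (cases "weight k \<omega> = d") (simp_all add: poly_monom zero_power)
  have "coeff (scaled_eval f k d ?U) s - coeff (scaled_eval f k d U) s =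
     (\<Sum>\<omega>\<in>Poly_Mapping.keys f. coeff (?C \<omega> * (monom c s * ?S (?l \<omega> i))) s)"
    unfolding scaled_eval_def coeff_diff[symmetric] sum_subtractf[symmetric] diff coeff_sum ..
  also have "\<dots> = (\<Sum>\<omega>\<in>Poly_Mapping.keys f. c * (coeff (?C \<omega>) 0 * (of_nat (?l \<omega> i) * ?u i ^ (?l \<omega> i - 1))))"
    unfolding coeff_monom_mult_times S0 ..
  also have "\<dots> = (\<Sum>\<omega>\<in>Poly_Mapping.keys f. c * ((if \<omega> \<in> ?A then ?l f \<omega> *
      (\<Prod>j\<in>UNIV - {i}. ?u j ^ ?l \<omega> j) else 0) * (of_nat (?l \<omega> i) * ?u i ^ (?l \<omega> i - 1))))"
    by (intro sum.cong refl) (simp only: C0)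
  also have "\<dots> = (\<Sum>\<omega>\<in>?A. c * (?l f \<omega> * (\<Prod>j\<in>UNIV - {i}. ?u j ^ ?l \<omega> j) * (of_nat (?l \<omega> i) * ?u i ^ (?l \<omega> i - 1))))"
    by (intro sum.mono_neutral_cong_right) auto
  also have "\<dots> = c * mpoly_eval (partial_deriv i (restrict_poly f ?A)) ?u"
    unfolding mpoly_eval_partial_deriv sum_distrib_left
    by (subst keys_restrict_poly) (auto simp: lookup_restrict_poly intro!: sum.cong)
  finally show ?thesis
    by (simp add: algebra_simps)
qed

section \<open>Polynomial dependence of coefficients, and congruences modulo powers of t\<close>

definition coeff_polyfun :: "(('i \<Rightarrow> complex) \<Rightarrow> complex poly) \<Rightarrow> bool" where
  "coeff_polyfun p \<longleftrightarrow> (\<forall>j. polyfun (\<lambda>x. coeff (p x) j))"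

lemma coeff_polyfun_const: "coeff_polyfun (\<lambda>_. p)"
  by (auto simp: coeff_polyfun_def intro: polyfun_const)

lemma coeff_polyfun_mult:
  "coeff_polyfun p \<Longrightarrow> coeff_polyfun q \<Longrightarrow> coeff_polyfun (\<lambda>x. p x * q x)"
  unfolding coeff_polyfun_def coeff_mult by (intro allI polyfun_sum polyfun_mult) auto

lemma coeff_polyfun_sum:
  "(\<And>j. j \<in> J \<Longrightarrow> coeff_polyfun (p j)) \<Longrightarrow> coeff_polyfun (\<lambda>x. \<Sum>j\<in>J. p j x)"
  unfolding coeff_polyfun_def coeff_sum by (intro allI polyfun_sum) auto

lemma coeff_polyfun_power: "coeff_polyfun p \<Longrightarrow> coeff_polyfun (\<lambda>x. p x ^ n)"
  by (induction n) (auto intro: coeff_polyfun_const coeff_polyfun_mult)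

lemma coeff_polyfun_prod:
  "(\<And>j. j \<in> J \<Longrightarrow> coeff_polyfun (p j)) \<Longrightarrow> coeff_polyfun (\<lambda>x. \<Prod>j\<in>J. p j x)"
  by (induction J rule: infinite_finite_induct) (auto intro: coeff_polyfun_const coeff_polyfun_mult)

lemma coeff_polyfun_monom:
  assumes "polyfun g"
  shows "coeff_polyfun (\<lambda>x. monom (g x) s)"
  unfolding coeff_polyfun_def
proof
  fix j show "polyfun (\<lambda>x. coeff (monom (g x) s) j)"
    using assms by (cases "s = j") (auto intro: polyfun_const)
qed

lemma coeff_polyfun_scaled_eval:
  "(\<And>i. coeff_polyfun (\<lambda>x. U x i)) \<Longrightarrow> coeff_polyfun (\<lambda>x. scaled_eval f k d (U x))"
  unfolding scaled_eval_def
  by (intro coeff_polyfun_sum coeff_polyfun_mult coeff_polyfun_const coeff_polyfun_prod coeff_polyfun_power)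

text \<open>Congruence modulo t^(r+1), which products respect; it shows that coefficient r of
  \<open>scaled_eval\<close> depends only on coefficients of degree at most r.\<close>

definition coeff_agree :: "nat \<Rightarrow> complex poly \<Rightarrow> complex poly \<Rightarrow> bool" where
  "coeff_agree r p q \<longleftrightarrow> (\<forall>j\<le>r. coeff p j = coeff q j)"

lemma coeff_agree_refl: "coeff_agree r p p"
  by (simp add: coeff_agree_def)

lemma coeff_agree_mult: "coeff_agree r p q \<Longrightarrow> coeff_agree r p' q' \<Longrightarrow> coeff_agree r (p * p') (q * q')"
  unfolding coeff_agree_def coeff_mult by (auto intro!: sum.cong)

lemma coeff_agree_power: "coeff_agree r p q \<Longrightarrow> coeff_agree r (p ^ n) (q ^ n)"
  by (induction n) (auto intro: coeff_agree_refl coeff_agree_mult)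

lemma coeff_agree_prod:
  "(\<And>j. j \<in> J \<Longrightarrow> coeff_agree r (p j) (q j)) \<Longrightarrow> coeff_agree r (\<Prod>j\<in>J. p j) (\<Prod>j\<in>J. q j)"
  by (induction J rule: infinite_finite_induct) (auto intro: coeff_agree_refl coeff_agree_mult)

lemma coeff_agree_scaled_eval:
  assumes "\<And>i. coeff_agree r (U i) (U' i)"
  shows "coeff (scaled_eval f k d U) r = coeff (scaled_eval f k d U') r"
proof -
  have "coeff_agree r ([:c:] * (monom 1 e * (\<Prod>i\<in>UNIV. U i ^ w i))) ([:c:] * (monom 1 e * (\<Prod>i\<in>UNIV. U' i ^ w i)))" for c e w
    using assms by (intro coeff_agree_mult coeff_agree_prod coeff_agree_refl coeff_agree_power)
  then show ?thesis
    unfolding scaled_eval_def coeff_sum by (intro sum.cong) (auto simp: coeff_agree_def)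
qed

lemma order_0_eq_iff:
  fixes p :: "complex poly"
  shows "p \<noteq> 0 \<and> order 0 p = l \<longleftrightarrow> (\<forall>j<l. coeff p j = 0) \<and> coeff p l \<noteq> 0"
proof -
  have dvd: "[:- 0, 1:] ^ j dvd p \<longleftrightarrow> (\<forall>i<j. coeff p i = 0)" for j
  proof -
    have "[:- 0, 1 :: complex:] ^ j = monom 1 j"
      by (simp add: monom_altdef)
    then show ?thesis
      by (simp add: monom_1_dvd_iff')
  qed
  show ?thesis
  proof (cases "p = 0")
    case False
    have "order 0 p = l \<longleftrightarrow> [:- 0, 1:] ^ l dvd p \<and> \<not> [:- 0, 1:] ^ Suc l dvd p"
      using order[OF False, of 0] order_unique_lemma[of 0 l p] by metis
    then show ?thesis
      unfolding dvd using False by (auto simp: less_Suc_eq)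
  qed simp
qed

text \<open>The component of the arc divided by t^(k_i). Summing up to \<open>l\<close> is generous:
  the coordinates (i, k_i + s) beyond the truncation vanish on the affine space of arcs.\<close>

definition arc_factor :: "('n \<Rightarrow> nat) \<Rightarrow> nat \<Rightarrow> ('n \<times> nat \<Rightarrow> complex) \<Rightarrow> 'n \<Rightarrow> complex poly" where
  "arc_factor k l a i = (\<Sum>s\<le>l. monom (a (i, k i + s)) s)"

lemma coeff_arc_factor: "coeff (arc_factor k l a i) s = (if s \<le> l then a (i, k i + s) else 0)"
  by (simp add: arc_factor_def coeff_sum coeff_monom sum.delta)

lemma trunc_arc_factor:
  assumes a: "a \<in> affine_points (UNIV \<times> {1..l})" and z: "\<And>j. j < k i \<Longrightarrow> a (i, j) = 0"
  shows "trunc_arc l a i = monom 1 (k i) * arc_factor k l a i"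
proof (rule poly_eqI)
  fix j
  have out: "a (i, j) = 0" if "j = 0 \<or> l < j" for j
    using a that by (auto simp: affine_points_def)
  have "coeff (trunc_arc l a i) j = (if 1 \<le> j \<and> j \<le> l then a (i, j) else 0)"
    by (auto simp: trunc_arc_def coeff_sum coeff_monom sum.delta)
  also have "\<dots> = a (i, j)"
    using out[of j] by auto
  also have "\<dots> = coeff (monom 1 (k i) * arc_factor k l a i) j"
  proof (cases "j < k i")
    case False
    moreover have "a (i, j) = 0" if "\<not> j - k i \<le> l"
      using that by (intro out) arith
    ultimately show ?thesis
      by (simp add: coeff_monom_mult coeff_arc_factor)
  qed (simp add: z coeff_monom_mult)
  finally show "coeff (trunc_arc l a i) j = coeff (monom 1 (k i) * arc_factor k l a i) j" .
qed

lemma coeff_polyfun_arc_factor: "coeff_polyfun (\<lambda>a. arc_factor k l a i)"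
  unfolding arc_factor_def by (intro coeff_polyfun_sum coeff_polyfun_monom polyfun_coord)

lemma arc_set_iff:
  assumes d: "\<And>\<omega>. \<omega> \<in> Poly_Mapping.keys f \<Longrightarrow> d \<le> weight k \<omega>"
    and a: "a \<in> affine_points (UNIV \<times> {1..l})" and z: "\<And>i j. j < k i \<Longrightarrow> a (i, j) = 0"
  shows "a \<in> arc_set f l \<longleftrightarrow> d \<le> l \<and>
    (\<forall>r<l - d. coeff (scaled_eval f k d (arc_factor k l a)) r = 0) \<and>
    coeff (scaled_eval f k d (arc_factor k l a)) (l - d) \<noteq> 0"
proof -
  let ?p = "scaled_eval f k d (arc_factor k l a)"
  have "trunc_arc l a = (\<lambda>i. monom 1 (k i) * arc_factor k l a i)"
    using trunc_arc_factor[OF a z] by blast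
  then have "mpoly_eval_in (\<lambda>c. [:c:]) f (trunc_arc l a) = monom 1 d * ?p"
    using mpoly_eval_scaled[OF d] by simp
  then have 1: "a \<in> arc_set f l \<longleftrightarrow> (\<forall>j<l. coeff (monom 1 d * ?p) j = 0) \<and> coeff (monom 1 d * ?p) l \<noteq> 0"
    using a order_0_eq_iff[of "monom 1 d * ?p" l] by (simp add: arc_set_def)
  have 2: "(\<forall>j<l. coeff (monom 1 d * ?p) j = 0) \<and> coeff (monom 1 d * ?p) l \<noteq> 0 \<longleftrightarrow>
      (\<forall>j<l. d \<le> j \<longrightarrow> coeff ?p (j - d) = 0) \<and> d \<le> l \<and> coeff ?p (l - d) \<noteq> 0"
    by (auto simp: coeff_monom_mult not_less)
  have 3: "(\<forall>j<l. d \<le> j \<longrightarrow> coeff ?p (j - d) = 0) \<longleftrightarrow> (\<forall>r<l - d. coeff ?p r = 0)" if "d \<le> l"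
  proof (intro iffI allI impI)
    fix r assume "\<forall>j<l. d \<le> j \<longrightarrow> coeff ?p (j - d) = 0" "r < l - d"
    then show "coeff ?p r = 0"
      by (metis add_diff_cancel_right' le_add2 less_diff_conv)
  qed auto
  show ?thesis
    unfolding 1 2 using 3 by meson
qed

subsection \<open>Adding coordinates\<close>

text \<open>The projection forgetting the coordinates in \<open>C\<close>, realized inside one
  ambient space. The preimage of a set on which they vanish is its product with the affine space
  over \<open>C\<close>.\<close>

definition zero_on :: "'c set \<Rightarrow> ('c \<Rightarrow> complex) \<Rightarrow> 'c \<Rightarrow> complex" where
  "zero_on C y = (\<lambda>c. if c \<in> C then 0 else y c)"

lemma polyfun_zero_on: "polyfun (\<lambda>y. zero_on C y c)"
  by (cases "c \<in> C") (auto simp: zero_on_def intro: polyfun_const polyfun_coord)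

lemma zero_on_affine: "C \<subseteq> I \<Longrightarrow> zero_on C y \<in> affine_points I \<longleftrightarrow> y \<in> affine_points I"
  unfolding zero_on_def affine_points_def by auto

lemma zero_on_insert: "zero_on (insert c C) y = zero_on C (y(c := 0))"
  by (auto simp: zero_on_def)

lemma basic_set_cylinder:
  assumes "C \<subseteq> I" "basic_set I S"
  shows "basic_set I {y. zero_on C y \<in> S}"
proof -
  have "basic_set I {y \<in> affine_points I. zero_on C y \<in> S}"
    using assms by (intro basic_set_preimage[OF assms(2), where \<phi> = "zero_on C"] polyfun_zero_on) (simp add: zero_on_affine)
  moreover have "{y \<in> affine_points I. zero_on C y \<in> S} = {y. zero_on C y \<in> S}"
    using basic_set_subset[OF assms(2)] zero_on_affine[OF assms(1)] by blast
  ultimately show ?thesis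
    by simp
qed

lemma zero_on_singleton: "zero_on {j} y = y(j := 0)"
  by (auto simp: zero_on_def)

lemma basic_set_cylinder1: "j \<in> I \<Longrightarrow> basic_set I S \<Longrightarrow> basic_set I {y. y(j := 0) \<in> S}"
  using basic_set_cylinder[of "{j}" I S] by (simp add: zero_on_singleton)

lemma mot_class_free:
  assumes I: "finite I"
  shows "finite C \<Longrightarrow> C \<subseteq> I \<Longrightarrow> basic_set I S \<Longrightarrow> (\<And>x c. x \<in> S \<Longrightarrow> c \<in> C \<Longrightarrow> x c = 0) \<Longrightarrow>
    mot_class I {y. zero_on C y \<in> S} = LL ^ card C * mot_class I S"
proof (induction C rule: finite_induct)
  case empty
  then show ?case
    by (simp add: zero_on_def)
next
  case (insert c C)
  let ?S = "{y. zero_on C y \<in> S}"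
  have "mot_class I {y. y(c := 0) \<in> ?S} = LL * mot_class I ?S"
  proof (rule mot_class_cylinder[OF I])
    show "c \<in> I" "basic_set I ?S"
      using insert.prems by (auto intro: basic_set_cylinder)
    fix x assume "x \<in> ?S"
    then have "zero_on C x c = 0"
      using insert.prems(3) by auto
    then show "x c = 0"
      using insert.hyps by (simp add: zero_on_def)
  qed
  then show ?case
    using insert by (simp add: zero_on_insert mult.assoc)
qed

text \<open>On each fibre, a line, \<open>p\<close> has exactly one zero. The zero locus is
  therefore a graph over \<open>S\<close>, and the rest is the cylinder minus this graph.\<close>

lemma mot_class_cylinder_split:
  assumes I: "finite I" "j \<in> I" and S: "basic_set I S" "\<And>x. x \<in> S \<Longrightarrow> x j = 0" and p: "polyfun p"
    and \<gamma>: "regfun S \<gamma>" and graph: "\<And>y. y(j := 0) \<in> S \<Longrightarrow> p y = 0 \<longleftrightarrow> y j = \<gamma> (y(j := 0))"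
  shows "mot_class I {y. y(j := 0) \<in> S \<and> p y = 0} = mot_class I S"
    "mot_class I {y. y(j := 0) \<in> S \<and> p y \<noteq> 0} = (LL - 1) * mot_class I S"
proof -
  have "{y. y(j := 0) \<in> S \<and> p y = 0} = {y. y(j := 0) \<in> S \<and> y j = \<gamma> (y(j := 0))}"
    using graph by blast
  moreover have "mot_class I {y. y(j := 0) \<in> S \<and> y j = \<gamma> (y(j := 0))} = mot_class I S"
    by (rule mot_class_graph[where \<gamma> = \<gamma>]) (use I(2) basic_set_subset[OF S(1)] S(2) \<gamma> in auto)
  ultimately show 1: "mot_class I {y. y(j := 0) \<in> S \<and> p y = 0} = mot_class I S"
    by simp
  have scissor: "mot_class I {y. y(j := 0) \<in> S} =
      mot_class I {y \<in> {y. y(j := 0) \<in> S}. p y \<noteq> 0} + mot_class I {y \<in> {y. y(j := 0) \<in> S}. p y = 0}"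
    by (intro mot_class_scissor I basic_set_cylinder1 S p)
  have "mot_class I {y. y(j := 0) \<in> S \<and> p y \<noteq> 0} + mot_class I S = LL * mot_class I S"
  proof -
    have "mot_class I {y. y(j := 0) \<in> S} = LL * mot_class I S"
      by (rule mot_class_cylinder) (use I S in auto)
    with scissor 1 show ?thesis
      by simp
  qed
  then show "mot_class I {y. y(j := 0) \<in> S \<and> p y \<noteq> 0} = (LL - 1) * mot_class I S"
    by (simp add: left_diff_distrib eq_diff_eq)
qed

lemma basic_set_units:
  assumes "finite C" "C \<subseteq> I" "basic_set I S"
  shows "basic_set I {y. zero_on C y \<in> S \<and> (\<forall>c\<in>C. y c \<noteq> 0)}"
  using basic_set_all_nonzero[OF assms(1) basic_set_cylinder[OF assms(2,3)], of "\<lambda>c y. y c"]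
  by (simp add: polyfun_coord)

text \<open>One coordinate at a time, with the zero section as the graph to be removed.\<close>

lemma mot_class_units:
  assumes I: "finite I"
  shows "finite C \<Longrightarrow> C \<subseteq> I \<Longrightarrow> basic_set I S \<Longrightarrow> (\<And>x c. x \<in> S \<Longrightarrow> c \<in> C \<Longrightarrow> x c = 0) \<Longrightarrow>
    mot_class I {y. zero_on C y \<in> S \<and> (\<forall>c\<in>C. y c \<noteq> 0)} = (LL - 1) ^ card C * mot_class I S"
proof (induction C rule: finite_induct)
  case empty
  then show ?case
    by (simp add: zero_on_def)
next
  case (insert c C)
  let ?S = "{y. zero_on C y \<in> S \<and> (\<forall>c\<in>C. y c \<noteq> 0)}"
  have "mot_class I {y. y(c := 0) \<in> ?S \<and> y c \<noteq> 0} = (LL - 1) * mot_class I ?S"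
  proof (rule mot_class_cylinder_split(2)[OF I, where \<gamma> = "\<lambda>_. 0"])
    show "c \<in> I" "basic_set I ?S"
      using insert.prems insert.hyps by (auto intro: basic_set_units)
    fix x assume "x \<in> ?S"
    then have "zero_on C x c = 0"
      using insert.prems(3) by auto
    then show "x c = 0"
      using insert.hyps by (simp add: zero_on_def)
  qed (auto intro: polyfun_coord regfun_const)
  moreover have "{y. y(c := 0) \<in> ?S \<and> y c \<noteq> 0} =
      {y. zero_on (insert c C) y \<in> S \<and> (\<forall>c\<in>insert c C. y c \<noteq> 0)}"
    using insert.hyps by (auto simp: zero_on_insert)
  ultimately show ?case
    using insert by (simp add: mult.assoc)
qed

subsection \<open>The class of the arcs with given orders\<close>

text \<open>
  The orders of the components of the arcs are \<open>k i\<close>, except for \<open>i \<in> Q\<close>, where \<open>k i\<close> is only a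
  lower bound.  The polynomial \<open>h\<close> is the part of \<open>f\<close> of weight \<open>d\<close>; it does not involve the
  variables in \<open>P\<close>.
\<close>

locale arc_piece =
  fixes f :: "'n::finite cpoly" and k :: "'n \<Rightarrow> nat" and l d :: nat and P Q :: "'n set" and h :: "'n cpoly"
  assumes weight_ge: "\<And>\<omega>. \<omega> \<in> Poly_Mapping.keys f \<Longrightarrow> d \<le> weight k \<omega>"
    and h_def: "h = restrict_poly f {\<omega> \<in> Poly_Mapping.keys f. weight k \<omega> = d}"
    and h_P: "\<And>\<omega> i. \<omega> \<in> Poly_Mapping.keys h \<Longrightarrow> i \<in> P \<Longrightarrow> Poly_Mapping.lookup \<omega> i = 0"
    and nondeg: "\<And>x. (\<forall>i. x i \<noteq> 0) \<Longrightarrow> mpoly_eval h x = 0 \<Longrightarrow> \<exists>i. mpoly_eval (partial_deriv i h) x \<noteq> 0"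
    and k_pos: "\<And>i. 1 \<le> k i" and QP: "Q \<subseteq> P" and k_le_d: "\<And>i. i \<notin> P \<Longrightarrow> k i \<le> d"
    and k_le: "\<And>i. i \<notin> Q \<Longrightarrow> k i \<le> l" and k_le_Suc: "\<And>i. k i \<le> Suc l" and d_le: "d \<le> l"
begin

abbreviation (input) I :: "('n \<times> nat) set" where "I \<equiv> UNIV \<times> {1..l}"

definition u :: "('n \<times> nat \<Rightarrow> complex) \<Rightarrow> 'n \<Rightarrow> complex" where "u a = (\<lambda>i. a (i, k i))"

definition g :: "nat \<Rightarrow> ('n \<times> nat \<Rightarrow> complex) \<Rightarrow> complex" where
  "g r a = coeff (scaled_eval f k d (arc_factor k l a)) r"

definition dh :: "'n \<Rightarrow> ('n \<times> nat \<Rightarrow> complex) \<Rightarrow> complex" where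
  "dh i a = mpoly_eval (partial_deriv i h) (u a)"

definition lead :: "('n \<times> nat \<Rightarrow> complex) \<Rightarrow> 'n \<times> nat \<Rightarrow> complex" where
  "lead a = (\<lambda>(i, j). if j = k i then a (i, j) else 0)"

definition A :: "('n \<times> nat \<Rightarrow> complex) set" where
  "A = {a \<in> affine_points I. (\<forall>i j. j < k i \<longrightarrow> a (i, j) = 0) \<and> (\<forall>i. i \<notin> Q \<longrightarrow> a (i, k i) \<noteq> 0)}"

text \<open>The base of the fibrations: arcs reduced to their leading coefficients. For i in
  \<open>Q\<close> that coefficient may be zero, and its coordinate is absent if k_i = l +
  1.\<close>

definition A0 :: "('n \<times> nat \<Rightarrow> complex) set" where
  "A0 = {a \<in> A. \<forall>i j. j \<noteq> k i \<longrightarrow> a (i, j) = 0}"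

lemma finite_I: "finite I"
  by simp

lemma polyfun_g: "polyfun (g r)"
proof -
  have "coeff_polyfun (\<lambda>a. scaled_eval f k d (arc_factor k l a))"
    by (rule coeff_polyfun_scaled_eval) (rule coeff_polyfun_arc_factor)
  then show ?thesis
    by (simp add: coeff_polyfun_def g_def[abs_def])
qed

lemma polyfun_hu: "polyfun (\<lambda>a. mpoly_eval p (u a))"
  by (rule polyfun_mpoly_eval_compose) (simp add: u_def polyfun_coord)

lemma polyfun_dh: "polyfun (dh i)"
  unfolding dh_def[abs_def] by (rule polyfun_hu)

lemma g_0: "g 0 a = mpoly_eval h (u a)"
  unfolding g_def h_def by (subst coeff_0_scaled_eval[OF weight_ge]) (auto simp: coeff_arc_factor u_def)

lemma g_cong:
  assumes "\<And>i s. s \<le> r \<Longrightarrow> a (i, k i + s) = b (i, k i + s)"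
  shows "g r a = g r b"
  unfolding g_def using assms
  by (intro coeff_agree_scaled_eval) (auto simp: coeff_agree_def coeff_arc_factor)

lemma u_lead: "u (lead a) = u a"
  by (simp add: u_def lead_def)

text \<open>Coefficient \<open>r\<close> of the scaled value is affine in the coordinate (i, k_i +
  r) with slope \<open>dh i\<close>. For r >= 1 the slope involves leading coefficients only, so
  erasing this coordinate leaves it unchanged.\<close>

lemma g_perturb:
  assumes r: "1 \<le> r" "k i + r \<le> l"
  shows "g r y = g r (y((i, k i + r) := 0)) + y (i, k i + r) * dh i y"
proof -
  let ?x = "y((i, k i + r) := 0)"
  have eq: "arc_factor k l y = (arc_factor k l ?x)(i := arc_factor k l ?x i + monom (y (i, k i + r)) r)"
  proof
    fix j
    show "arc_factor k l y j = ((arc_factor k l ?x)(i := arc_factor k l ?x i + monom (y (i, k i + r)) r)) j"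
      using r by (intro poly_eqI) (auto simp: coeff_arc_factor coeff_monom)
  qed
  have u: "(\<lambda>j. coeff (arc_factor k l ?x j) 0) = u y"
    by (rule ext) (use r in \<open>auto simp: coeff_arc_factor u_def\<close>)
  have "g r y = g r ?x + y (i, k i + r) * mpoly_eval (partial_deriv i h) (\<lambda>j. coeff (arc_factor k l ?x j) 0)"
    unfolding g_def h_def by (subst eq, rule coeff_scaled_eval_perturb[OF weight_ge]) (use r in auto)
  then show ?thesis
    unfolding u dh_def .
qed

lemma h_cong:
  assumes "\<And>i. i \<notin> P \<Longrightarrow> x i = y i"
  shows "mpoly_eval h x = mpoly_eval h y"
  unfolding mpoly_eval_in_UNIV
proof (intro sum.cong refl arg_cong2[where f = "(*)"] prod.cong)
  fix \<omega> i assume "\<omega> \<in> Poly_Mapping.keys h"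
  then show "x i ^ Poly_Mapping.lookup \<omega> i = y i ^ Poly_Mapping.lookup \<omega> i"
    using assms h_P by (cases "i \<in> P") auto
qed

lemma partial_h_P: "i \<in> P \<Longrightarrow> mpoly_eval (partial_deriv i h) x = 0"
  unfolding mpoly_eval_partial_deriv by (intro sum.neutral) (simp add: h_P)

lemma partial_h_cong:
  assumes "\<And>i. i \<notin> P \<Longrightarrow> x i = y i"
  shows "mpoly_eval (partial_deriv i h) x = mpoly_eval (partial_deriv i h) y"
proof (cases "i \<in> P")
  case False
  have "(\<Prod>j\<in>UNIV - {i}. x j ^ Poly_Mapping.lookup \<omega> j) = (\<Prod>j\<in>UNIV - {i}. y j ^ Poly_Mapping.lookup \<omega> j)"
    if "\<omega> \<in> Poly_Mapping.keys h" for \<omega>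
  proof (intro prod.cong refl)
    fix j
    show "x j ^ Poly_Mapping.lookup \<omega> j = y j ^ Poly_Mapping.lookup \<omega> j"
      using assms h_P[OF that] by (cases "j \<in> P") auto
  qed
  then show ?thesis
    using assms[OF False] unfolding mpoly_eval_partial_deriv by (intro sum.cong) auto
qed (simp add: partial_h_P)

text \<open>Non-degeneracy concerns torus points, but leading coefficients with index in
  \<open>Q\<close> may vanish. As \<open>h\<close> and its derivatives do not see the variables in
  \<open>P\<close>, these are replaced by 1; derivatives in the directions of \<open>P\<close> are
  zero, so the index found lies outside \<open>P\<close>.\<close>

lemma partial_nonzero:
  assumes a: "a \<in> A" and z: "mpoly_eval h (u a) = 0"
  shows "\<exists>i. i \<notin> P \<and> dh i a \<noteq> 0"
proof -
  let ?x = "\<lambda>i. if i \<in> P then 1 else u a i"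
  have "mpoly_eval h ?x = mpoly_eval h (u a)"
    by (rule h_cong) auto
  moreover have "\<forall>i. ?x i \<noteq> 0"
    using a QP by (auto simp: A_def u_def)
  ultimately obtain i where "mpoly_eval (partial_deriv i h) ?x \<noteq> 0"
    using nondeg[of ?x] z by auto
  moreover have "mpoly_eval (partial_deriv i h) ?x = mpoly_eval (partial_deriv i h) (u a)"
    by (rule partial_h_cong) auto
  ultimately show ?thesis
    using partial_h_P by (auto simp: dh_def)
qed

lemma coord_in_I: "k i \<le> j \<Longrightarrow> j \<le> l \<Longrightarrow> (i, j) \<in> I"
  using k_pos[of i] by auto

section \<open>Lifting the equations one layer of coefficients at a time\<close>

definition C :: "nat \<Rightarrow> ('n \<times> nat) set" where "C r = {c \<in> I. snd c = k (fst c) + r}"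
definition B :: "nat \<Rightarrow> ('n \<times> nat) set" where "B s = {c \<in> I. k (fst c) < snd c \<and> snd c \<le> k (fst c) + s}"

text \<open>Stage \<open>s\<close> of a tower over \<open>T\<close>. The equation of order 0 is left
  out because it concerns only the leading coefficients, which \<open>T\<close> controls.\<close>

definition E :: "('n \<times> nat \<Rightarrow> complex) set \<Rightarrow> nat \<Rightarrow> ('n \<times> nat \<Rightarrow> complex) set" where
  "E T s = {a \<in> affine_points I. (\<forall>i j. j < k i \<longrightarrow> a (i, j) = 0) \<and> (\<forall>i j. k i + s < j \<longrightarrow> a (i, j) = 0) \<and>
     lead a \<in> T \<and> (\<forall>r. 1 \<le> r \<and> r \<le> s \<longrightarrow> g r a = 0)}"

lemma C_subset: "C r \<subseteq> I" and B_subset: "B s \<subseteq> I"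
  by (auto simp: C_def B_def)

lemma finite_C: "finite (C r)" and finite_B: "finite (B s)"
  using finite_subset[OF C_subset finite_I] finite_subset[OF B_subset finite_I] by auto

lemma card_B_Suc: "card (B (Suc s)) = card (B s) + card (C (Suc s))"
proof -
  have "B (Suc s) = B s \<union> C (Suc s)"
    by (auto simp: B_def C_def)
  moreover have "B s \<inter> C (Suc s) = {}"
    by (auto simp: B_def C_def)
  ultimately show ?thesis
    using finite_B finite_C by (simp add: card_Un_disjoint)
qed

lemma E_0:
  assumes "T \<subseteq> A0"
  shows "E T 0 = T"
proof (intro set_eqI iffI)
  fix a assume a: "a \<in> E T 0"
  have "lead a = a"
  proof
    fix c show "lead a c = a c"
      using a by (cases c; cases "snd c" "k (fst c)" rule: linorder_cases) (auto simp: lead_def E_def)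
  qed
  then show "a \<in> T"
    using a by (simp add: E_def)
next
  fix a assume a: "a \<in> T"
  then have "a \<in> A0"
    using assms by blast
  moreover from this have "lead a = a"
    by (auto simp: lead_def A0_def)
  ultimately show "a \<in> E T 0"
    using a by (auto simp: E_def A0_def A_def)
qed

text \<open>By \<open>g_cong\<close>, the equations of order at most \<open>s\<close> do not involve
  layer s + 1. Erasing that layer maps stage s + 1 to stage \<open>s\<close>, with a single equation
  left on the fibre.\<close>

lemma E_Suc: "E T (Suc s) = {y. zero_on (C (Suc s)) y \<in> E T s \<and> g (Suc s) y = 0}"
proof (intro set_eqI iffI)
  have zc: "zero_on (C (Suc s)) y (i, j) = (if j = k i + Suc s then 0 else y (i, j))" if "y \<in> affine_points I" for y i j
    using that k_pos[of i] by (auto simp: zero_on_def C_def affine_points_def)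
  have gq: "g q (zero_on (C (Suc s)) y) = g q y" if "y \<in> affine_points I" "q \<le> s" for y q
    using that by (intro g_cong) (auto simp: zc)
  have ld: "lead (zero_on (C (Suc s)) y) = lead y" if "y \<in> affine_points I" for y
    using that by (auto simp: lead_def zc fun_eq_iff)
  have aff: "zero_on (C (Suc s)) y \<in> affine_points I \<longleftrightarrow> y \<in> affine_points I" for y
    using C_subset by (rule zero_on_affine)
  show "y \<in> {y. zero_on (C (Suc s)) y \<in> E T s \<and> g (Suc s) y = 0}" if y: "y \<in> E T (Suc s)" for y
  proof -
    have ya: "y \<in> affine_points I"
      using y by (simp add: E_def)
    have "g r y = 0" if "1 \<le> r" "r \<le> Suc s" for r
      using y that by (simp add: E_def)
    then show ?thesis
      using y ya by (auto simp: E_def aff ld gq zc simp del: One_nat_def)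
  qed
  show "y \<in> E T (Suc s)" if y: "y \<in> {y. zero_on (C (Suc s)) y \<in> E T s \<and> g (Suc s) y = 0}" for y
  proof -
    have ya: "y \<in> affine_points I"
      using y aff by (simp add: E_def del: One_nat_def)
    have "g r y = 0" if "1 \<le> r" "r \<le> Suc s" for r
      using y that gq[OF ya, of r] by (cases "r = Suc s") (auto simp: E_def simp del: One_nat_def)
    moreover have "y (i, j) = 0" if "k i + Suc s < j" for i j
    proof -
      have "zero_on (C (Suc s)) y (i, j) = 0"
        using y that by (auto simp: E_def)
      then show ?thesis
        using that by (simp add: zc[OF ya])
    qed
    moreover have "y (i, j) = 0" if "j < k i" for i j
    proof -
      have "zero_on (C (Suc s)) y (i, j) = 0"
        using y that by (auto simp: E_def)
      then show ?thesis
        using that by (simp add: zc[OF ya])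
    qed
    ultimately show ?thesis
      using y ya by (auto simp: E_def ld simp del: One_nat_def)
  qed
qed

text \<open>For d < l and \<open>T\<close> inside the zeros of \<open>h\<close>, these are the arcs
  over \<open>T\<close> along which f has order exactly \<open>l\<close>.\<close>

definition FT :: "('n \<times> nat \<Rightarrow> complex) set \<Rightarrow> ('n \<times> nat \<Rightarrow> complex) set" where
  "FT T = {a \<in> affine_points I. (\<forall>i j. j < k i \<longrightarrow> a (i, j) = 0) \<and> lead a \<in> T \<and>
    (\<forall>r. 1 \<le> r \<and> r < l - d \<longrightarrow> g r a = 0) \<and> g (l - d) a \<noteq> 0}"

definition R :: "nat \<Rightarrow> ('n \<times> nat) set" where "R s = {c \<in> I. k (fst c) + s < snd c}"

context
  fixes T :: "('n \<times> nat \<Rightarrow> complex) set" and i0 :: 'n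
  assumes T: "basic_set I T" "T \<subseteq> A0" and i0: "i0 \<notin> P" and dh0: "\<And>a. a \<in> T \<Longrightarrow> dh i0 a \<noteq> 0"
begin

lemma basic_set_E: "basic_set I (E T s)"
proof (induction s)
  case 0
  then show ?case
    using T by (simp add: E_0)
next
  case (Suc s)
  have "basic_set I {y \<in> {y. zero_on (C (Suc s)) y \<in> E T s}. g (Suc s) y = 0}"
    by (intro basic_set_zero basic_set_cylinder Suc C_subset polyfun_g)
  then show ?case
    by (simp add: E_Suc)
qed

text \<open>The equation of order s + 1 is solved for the coordinate of \<open>i0\<close> in the new
  layer, and the rest of the layer is free. This coordinate lies within the truncation because
  \<open>i0\<close> is outside \<open>P\<close>, so that k_i0 <= d. The factor \<open>LL\<close> on
  the left avoids an exponent reduced by one.\<close>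

lemma mot_class_E_step:
  assumes s: "Suc s \<le> l - d"
  shows "LL * mot_class I {y. zero_on (C (Suc s)) y \<in> E T s \<and> g (Suc s) y = 0} = LL ^ card (C (Suc s)) * mot_class I (E T s)"
    "LL * mot_class I {y. zero_on (C (Suc s)) y \<in> E T s \<and> g (Suc s) y \<noteq> 0} =
      (LL - 1) * (LL ^ card (C (Suc s)) * mot_class I (E T s))"
proof -
  let ?r = "Suc s"
  let ?j = "(i0, k i0 + ?r)"
  have kl: "k i0 + ?r \<le> l"
    using k_le_d[OF i0] s by simp
  then have jC: "?j \<in> C ?r"
    using coord_in_I by (auto simp: C_def)
  let ?C = "C ?r - {?j}"
  let ?S = "{y. zero_on ?C y \<in> E T s}"
  have CI: "?C \<subseteq> I" "finite ?C"
    using C_subset finite_C by auto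
  have Sb: "basic_set I ?S"
    by (intro basic_set_cylinder CI basic_set_E)
  have van: "x c = 0" if "x \<in> E T s" "c \<in> C ?r" for x c
    using that by (cases c) (auto simp: E_def C_def)
  have S: "mot_class I ?S = LL ^ card ?C * mot_class I (E T s)"
    using van by (intro mot_class_free finite_I CI basic_set_E) auto
  have cC: "card (C ?r) = Suc (card ?C)"
    using jC finite_C by (metis card.remove)
  have cyl: "y(?j := 0) \<in> ?S \<longleftrightarrow> zero_on (C ?r) y \<in> E T s" for y
  proof -
    have "zero_on ?C (y(?j := 0)) = zero_on (C ?r) y"
      using jC by (auto simp: zero_on_def)
    then show ?thesis
      by simp
  qed
  have vanS: "x ?j = 0" if "x \<in> ?S" for x
  proof -
    have "zero_on ?C x ?j = 0"
      using that van jC by blast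
    then show ?thesis
      by (simp add: zero_on_def)
  qed
  have uS: "dh i0 y \<noteq> 0" if "zero_on (C ?r) y \<in> E T s" for y
  proof -
    have "lead (zero_on (C ?r) y) \<in> T"
      using that by (simp add: E_def)
    moreover have "u (lead (zero_on (C ?r) y)) = u y"
      unfolding u_lead by (auto simp: u_def zero_on_def C_def)
    ultimately show ?thesis
      using dh0 by (metis dh_def)
  qed
  have dhS: "dh i0 x \<noteq> 0" if "x \<in> ?S" for x
  proof -
    have "x(?j := 0) = x"
      using vanS[OF that] by (metis fun_upd_triv)
    then show ?thesis
      using uS[of x] cyl[of x] that by simp
  qed
  \<comment> \<open>The unique zero of the affine function of the chosen coordinate;
    \<open>0 -\<close> keeps the numerator a difference of polynomial functions.\<close>
  define \<gamma> where "\<gamma> = (\<lambda>x. (0 - g ?r x) / dh i0 x)"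
  have \<gamma>: "regfun ?S \<gamma>"
    unfolding \<gamma>_def using dhS
    by (intro regfun_divide regfun_polyfun polyfun_minus polyfun_const polyfun_g polyfun_dh) auto
  have graph: "g ?r y = 0 \<longleftrightarrow> y ?j = \<gamma> (y(?j := 0))" if "y(?j := 0) \<in> ?S" for y
  proof -
    have "u (y(?j := 0)) = u y"
      by (rule ext) (auto simp: u_def)
    then have dd: "dh i0 (y(?j := 0)) = dh i0 y"
      by (simp add: dh_def)
    have key: "a + b * c = 0 \<longleftrightarrow> b = (0 - a) / c" if "c \<noteq> 0" for a b c :: complex
    proof -
      have "b = (0 - a) / c \<longleftrightarrow> b * c = 0 - a"
        using that by (rule nonzero_eq_divide_eq)
      then show ?thesis
        by (auto simp: add_eq_0_iff)
    qed
    have nz: "dh i0 y \<noteq> 0"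
      using dhS[OF that] unfolding dd .
    have "g ?r y = g ?r (y(?j := 0)) + y ?j * dh i0 y"
      using kl by (intro g_perturb) auto
    then show ?thesis
      unfolding \<gamma>_def dd using key[OF nz] by (simp only:)
  qed
  have jI: "?j \<in> I"
    using jC C_subset by blast
  have split: "mot_class I {y. y(?j := 0) \<in> ?S \<and> g ?r y = 0} = mot_class I ?S"
    "mot_class I {y. y(?j := 0) \<in> ?S \<and> g ?r y \<noteq> 0} = (LL - 1) * mot_class I ?S"
    by (rule mot_class_cylinder_split[where \<gamma> = \<gamma>, OF finite_I jI Sb _ polyfun_g \<gamma>];
        (rule vanS graph; assumption))+
  show "LL * mot_class I {y. zero_on (C ?r) y \<in> E T s \<and> g ?r y = 0} = LL ^ card (C ?r) * mot_class I (E T s)"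
    using split(1) unfolding cyl cC by (simp only: S power_Suc mult.assoc)
  have "mot_class I {y. zero_on (C ?r) y \<in> E T s \<and> g ?r y \<noteq> 0} =
      (LL - 1) * (LL ^ card ?C * mot_class I (E T s))"
    using split(2) unfolding cyl by (simp only: S)
  then show "LL * mot_class I {y. zero_on (C ?r) y \<in> E T s \<and> g ?r y \<noteq> 0} =
      (LL - 1) * (LL ^ card (C ?r) * mot_class I (E T s))"
    by (simp only: cC power_Suc mult.assoc mult.left_commute[of LL])
qed

lemma mot_class_E: "s \<le> l - d \<Longrightarrow> LL ^ s * mot_class I (E T s) = LL ^ card (B s) * mot_class I T"
proof (induction s)
  case 0
  have "B 0 = {}"
    by (auto simp: B_def)
  then show ?case
    using T by (simp add: E_0)
next
  case (Suc s)
  have "LL ^ Suc s * mot_class I (E T (Suc s)) = LL ^ s * (LL * mot_class I (E T (Suc s)))"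
    by (simp add: ac_simps)
  also have "\<dots> = LL ^ card (C (Suc s)) * (LL ^ s * mot_class I (E T s))"
    using mot_class_E_step(1)[OF Suc.prems] by (simp add: E_Suc ac_simps)
  also have "\<dots> = LL ^ card (B (Suc s)) * mot_class I T"
    using Suc by (simp add: card_B_Suc power_add ac_simps)
  finally show ?case .
qed

text \<open>The inequation has order l - d = s + 1, so coefficients beyond layer s + 1 enter neither
  the equations nor the inequation.\<close>

lemma FT_eq:
  assumes s: "l - d = Suc s"
  shows "FT T = {y. zero_on (R (Suc s)) y \<in> {y. zero_on (C (Suc s)) y \<in> E T s \<and> g (Suc s) y \<noteq> 0}}"
proof (intro set_eqI)
  fix y
  let ?y = "zero_on (R (Suc s)) y" and ?z = "zero_on (C (Suc s)) (zero_on (R (Suc s)) y)"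
  have aff: "?y \<in> affine_points I \<longleftrightarrow> y \<in> affine_points I" "?z \<in> affine_points I \<longleftrightarrow> y \<in> affine_points I"
    using C_subset by (auto simp: zero_on_affine R_def)
  show "y \<in> FT T \<longleftrightarrow> y \<in> {y. zero_on (R (Suc s)) y \<in> {y. zero_on (C (Suc s)) y \<in> E T s \<and> g (Suc s) y \<noteq> 0}}"
  proof (cases "y \<in> affine_points I")
    case False
    then show ?thesis
      by (simp add: FT_def E_def aff del: One_nat_def)
  next
    case True
    have yz: "?y (i, j) = (if k i + Suc s < j then 0 else y (i, j))"
       "?z (i, j) = (if k i + s < j then 0 else y (i, j))" for i j
      using True k_pos[of i] by (auto simp: zero_on_def R_def C_def affine_points_def)
    have "g (Suc s) ?y = g (Suc s) y"
      by (intro g_cong) (simp add: yz)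
    moreover have "g r ?z = g r y" if "r \<le> s" for r
      using that by (intro g_cong) (simp add: yz)
    moreover have "lead ?z = lead y"
      by (auto simp: lead_def yz fun_eq_iff)
    moreover have "(\<forall>i j. j < k i \<longrightarrow> ?z (i, j) = 0) \<longleftrightarrow> (\<forall>i j. j < k i \<longrightarrow> y (i, j) = 0)"
      by (auto simp: yz)
    moreover have "\<forall>i j. k i + s < j \<longrightarrow> ?z (i, j) = 0"
      by (simp add: yz)
    ultimately show ?thesis
      using True by (auto simp: FT_def E_def aff s less_Suc_eq_le simp del: One_nat_def)
  qed
qed

lemma basic_set_FT:
  assumes s: "l - d = Suc s"
  shows "basic_set I (FT T)"
proof -
  have "basic_set I {y \<in> {y. zero_on (C (Suc s)) y \<in> E T s}. g (Suc s) y \<noteq> 0}"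
    by (intro basic_set_nonzero basic_set_cylinder basic_set_E C_subset polyfun_g)
  then show ?thesis
    unfolding FT_eq[OF s] by (intro basic_set_cylinder) (auto simp: R_def)
qed

text \<open>Of the coordinates above the leading ones, each equation uses up a factor
  \<open>LL\<close>, and the final inequation replaces one \<open>LL\<close> by
  \<open>LL - 1\<close>.\<close>

lemma mot_class_FT:
  assumes s: "l - d = Suc s"
  shows "LL ^ (l - d) * mot_class I (FT T) = (LL - 1) * (LL ^ card (R 0) * mot_class I T)"
proof -
  let ?F = "{y. zero_on (C (Suc s)) y \<in> E T s \<and> g (Suc s) y \<noteq> 0}"
  have Fb: "basic_set I ?F"
  proof -
    have "basic_set I {y \<in> {y. zero_on (C (Suc s)) y \<in> E T s}. g (Suc s) y \<noteq> 0}"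
      by (intro basic_set_nonzero basic_set_cylinder basic_set_E C_subset polyfun_g)
    then show ?thesis
      by simp
  qed
  have fR: "finite (R q)" for q
    by (rule finite_subset[OF _ finite_I]) (auto simp: R_def)
  have cR: "card (R 0) = card (R (Suc s)) + card (B s) + card (C (Suc s))"
  proof -
    have "R 0 = R (Suc s) \<union> B (Suc s)"
      by (auto simp: R_def B_def)
    moreover have "R (Suc s) \<inter> B (Suc s) = {}"
      by (auto simp: R_def B_def)
    ultimately show ?thesis
      using fR finite_B by (simp add: card_Un_disjoint card_B_Suc)
  qed
  have "mot_class I (FT T) = LL ^ card (R (Suc s)) * mot_class I ?F"
    unfolding FT_eq[OF s]
  proof (rule mot_class_free[OF finite_I fR _ Fb])
    show "R (Suc s) \<subseteq> I"
      by (auto simp: R_def)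
    fix x c assume x: "x \<in> ?F" and c: "c \<in> R (Suc s)"
    have "zero_on (C (Suc s)) x c = 0"
      using x c by (cases c) (auto simp: E_def R_def)
    then show "x c = 0"
      using c by (auto simp: zero_on_def C_def R_def)
  qed
  then have "LL ^ (l - d) * mot_class I (FT T) = LL ^ card (R (Suc s)) * (LL ^ s * (LL * mot_class I ?F))"
    by (simp add: s ac_simps)
  also have "LL * mot_class I ?F = (LL - 1) * (LL ^ card (C (Suc s)) * mot_class I (E T s))"
    using s by (intro mot_class_E_step(2)) simp
  also have "LL ^ card (R (Suc s)) * (LL ^ s * \<dots>) =
      (LL - 1) * (LL ^ card (R (Suc s)) * (LL ^ card (C (Suc s)) * (LL ^ s * mot_class I (E T s))))"
    by (simp only: ac_simps)
  also have "LL ^ s * mot_class I (E T s) = LL ^ card (B s) * mot_class I T"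
    using s by (intro mot_class_E) simp
  finally show ?thesis
    by (simp only: cR power_add ac_simps)
qed

end

end

section \<open>From classes to coefficients of the formula\<close>

lemma Linv_power_LL: "\<L>\<^sup>-\<^sup>1 ^ (a + b) * LL ^ b = \<L>\<^sup>-\<^sup>1 ^ a"
proof -
  have "\<L>\<^sup>-\<^sup>1 ^ b * LL ^ b = 1"
    by (simp add: power_mult_distrib[symmetric] Linv_LL)
  then show ?thesis
    by (simp add: power_add mult.assoc)
qed

lemma Linv_power_units: "\<L>\<^sup>-\<^sup>1 ^ a * (LL - 1) ^ a = (1 - \<L>\<^sup>-\<^sup>1) ^ a"
proof -
  have "\<L>\<^sup>-\<^sup>1 * (LL - 1) = 1 - \<L>\<^sup>-\<^sup>1"
    by (simp add: right_diff_distrib Linv_LL)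
  then show ?thesis
    by (simp add: power_mult_distrib[symmetric])
qed

text \<open>\<open>j\<close> stands for the excess of the order over m(k), \<open>X\<close> for the
  class of the torus zeros, \<open>b\<close> for the number of free coordinates. For j = 0 the
  coefficient counts units minus zeros. For j > 0 the coefficient of the series contributes L^-(j-1)
  - L^-j, which is L^-j (L - 1), the proportion found by the lifting.\<close>

lemma mot_coefficient_identity:
  assumes exps: "N = s + (np + pq) + b"
    and j: "j = 0 \<Longrightarrow> M = LL ^ b * ((LL - 1) ^ pq * ((LL - 1) ^ np - X))"
    and j': "0 < j \<Longrightarrow> LL ^ j * M = (LL - 1) * (LL ^ b * ((LL - 1) ^ pq * X))"
  shows "\<L>\<^sup>-\<^sup>1 ^ N * M = (1 - \<L>\<^sup>-\<^sup>1) ^ pq * (\<L>\<^sup>-\<^sup>1 ^ s *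
    fps_nth (fps_const ((1 - \<L>\<^sup>-\<^sup>1) ^ np) - fps_const (\<L>\<^sup>-\<^sup>1 ^ np * X) *
       ((1 - fps_X) * geom (fps_const \<L>\<^sup>-\<^sup>1 * fps_X))) j)"
proof -
  let ?v = "\<L>\<^sup>-\<^sup>1"
  have nth: "fps_nth (fps_const ((1 - ?v) ^ np) - fps_const (?v ^ np * X) *
       ((1 - fps_X) * geom (fps_const ?v * fps_X))) j =
     (if j = 0 then (1 - ?v) ^ np - ?v ^ np * X else - (?v ^ np * X * (?v ^ j - ?v ^ (j - 1))))"
    unfolding fps_sub_nth fps_mult_left_const_nth one_minus_X_geom_nth by simp
  have pw: "?v ^ N * (LL ^ b * ((LL - 1) ^ pq * Y)) = (1 - ?v) ^ pq * (?v ^ s * (?v ^ np * Y))" for Y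
  proof -
    have "?v ^ N * (LL ^ b * ((LL - 1) ^ pq * Y)) = (?v ^ (s + (np + pq) + b) * LL ^ b) * ((LL - 1) ^ pq * Y)"
      unfolding exps by (simp only: mult.assoc)
    also have "\<dots> = ?v ^ s * (?v ^ np * ((?v ^ pq * (LL - 1) ^ pq) * Y))"
      by (simp only: Linv_power_LL) (simp only: power_add mult.assoc)
    also have "\<dots> = (1 - ?v) ^ pq * (?v ^ s * (?v ^ np * Y))"
      unfolding Linv_power_units by (simp only: mult.left_commute)
    finally show ?thesis .
  qed
  show ?thesis
  proof (cases "j = 0")
    case True
    have "?v ^ np * ((LL - 1) ^ np - X) = (1 - ?v) ^ np - ?v ^ np * X"
      by (simp add: right_diff_distrib Linv_power_units)
    then show ?thesis
      unfolding j[OF True] pw nth using True by simp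
  next
    case False
    then obtain i where i: "j = Suc i"
      by (cases j) auto
    have "M = ?v ^ (0 + j) * LL ^ j * M"
      unfolding Linv_power_LL by simp
    also have "\<dots> = ?v ^ j * (LL - 1) * (LL ^ b * ((LL - 1) ^ pq * X))"
      using j' False by (simp add: mult.assoc)
    also have "?v ^ j * (LL - 1) = ?v ^ i - ?v ^ j"
    proof -
      have "?v ^ j * LL = ?v ^ i"
        using Linv_power_LL[of i 1] by (simp add: i)
      then show ?thesis
        by (simp add: right_diff_distrib)
    qed
    finally have "?v ^ N * M = (?v ^ i - ?v ^ j) * (?v ^ N * (LL ^ b * ((LL - 1) ^ pq * X)))"
      by (simp add: mult.left_commute)
    also have "\<dots> = (1 - ?v) ^ pq * (?v ^ s * - (?v ^ np * X * (?v ^ j - ?v ^ i)))"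
      unfolding pw by (simp add: algebra_simps)
    finally show ?thesis
      unfolding nth using i by simp
  qed
qed

section \<open>The class of one stratum\<close>

context arc_piece
begin

lemma basic_set_leads: "basic_set I {x \<in> affine_points I. (\<forall>c\<in>Z \<inter> I. x c = 0) \<and> (\<forall>i\<in>-Q. x (i, k i) \<noteq> 0)}"
proof -
  have "basic_set I {x \<in> {x \<in> affine_points I. \<forall>c\<in>Z \<inter> I. x c = 0}. \<forall>i\<in>-Q. x (i, k i) \<noteq> 0}"
    by (intro basic_set_all_nonzero basic_set_all_zero basic_set_affine polyfun_coord) auto
  then show ?thesis
    by (rule back_subst[of "basic_set I"]) auto
qed

lemma affine_out: "a \<in> affine_points I \<Longrightarrow> c \<notin> I \<Longrightarrow> a c = 0"
  unfolding affine_points_def by blast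

lemma basic_set_A0: "basic_set I A0"
proof (rule back_subst[of "basic_set I", OF basic_set_leads[of "{c. snd c \<noteq> k (fst c)}"]])
  show "{x \<in> affine_points I. (\<forall>c\<in>{c. snd c \<noteq> k (fst c)} \<inter> I. x c = 0) \<and> (\<forall>i\<in>-Q. x (i, k i) \<noteq> 0)} = A0"
  proof (intro set_eqI iffI)
    fix a assume a: "a \<in> {x \<in> affine_points I. (\<forall>c\<in>{c. snd c \<noteq> k (fst c)} \<inter> I. x c = 0) \<and> (\<forall>i\<in>-Q. x (i, k i) \<noteq> 0)}"
    have "a (i, j) = 0" if "j \<noteq> k i" for i j
      using a that affine_out[of a "(i, j)"] by (cases "(i, j) \<in> I") auto
    with a show "a \<in> A0"
      by (auto simp: A0_def A_def)
  qed (auto simp: A0_def A_def)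
qed

lemma basic_set_A: "basic_set I A"
proof (rule back_subst[of "basic_set I", OF basic_set_leads[of "{c. snd c < k (fst c)}"]])
  show "{x \<in> affine_points I. (\<forall>c\<in>{c. snd c < k (fst c)} \<inter> I. x c = 0) \<and> (\<forall>i\<in>-Q. x (i, k i) \<noteq> 0)} = A"
  proof (intro set_eqI iffI)
    fix a assume a: "a \<in> {x \<in> affine_points I. (\<forall>c\<in>{c. snd c < k (fst c)} \<inter> I. x c = 0) \<and> (\<forall>i\<in>-Q. x (i, k i) \<noteq> 0)}"
    have "a (i, j) = 0" if "j < k i" for i j
      using a that affine_out[of a "(i, j)"] by (cases "(i, j) \<in> I") auto
    with a show "a \<in> A"
      by (auto simp: A_def)
  qed (auto simp: A_def)
qed

lemma lead_A0:
  assumes "a \<in> affine_points I" "\<And>i j. j < k i \<Longrightarrow> a (i, j) = 0"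
  shows "lead a \<in> A0 \<longleftrightarrow> a \<in> A"
proof -
  have "lead a \<in> affine_points I"
    using assms(1) by (auto simp: affine_points_def lead_def)
  then show ?thesis
    using assms by (auto simp: A0_def A_def lead_def)
qed

lemma A_arc_set: "a \<in> A \<Longrightarrow> a \<in> arc_set f l \<longleftrightarrow> (\<forall>r<l - d. g r a = 0) \<and> g (l - d) a \<noteq> 0"
  unfolding g_def using arc_set_iff[of f d k a l] weight_ge d_le by (auto simp: A_def)

definition X0 :: "('n \<times> nat \<Rightarrow> complex) set" where "X0 = {a \<in> A0. mpoly_eval h (u a) = 0}"

lemma basic_set_X0: "basic_set I X0"
  unfolding X0_def by (intro basic_set_zero basic_set_A0 polyfun_hu)

lemma basic_set_arcs: "basic_set I (A \<inter> arc_set f l)"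
proof -
  have "basic_set I {a \<in> {a \<in> A. \<forall>r\<in>{..<l - d}. g r a = 0}. g (l - d) a \<noteq> 0}"
    by (intro basic_set_nonzero basic_set_all_zero basic_set_A polyfun_g) auto
  then show ?thesis
    by (rule back_subst[of "basic_set I"]) (auto simp: A_arc_set)
qed

text \<open>Which partial derivative is non-zero varies over the zeros of \<open>h\<close>, so these
  are split by the first such index in an enumeration \<open>e\<close>. On each part a single index
  supplies the coordinates that solve all the equations.\<close>

lemma mot_class_arcs_less:
  assumes s: "l - d = Suc s"
  shows "LL ^ (l - d) * mot_class I (A \<inter> arc_set f l) = (LL - 1) * (LL ^ card (R 0) * mot_class I X0)"
proof -
  obtain e :: "'n \<Rightarrow> nat" where e: "inj e"
    using finite_imp_inj_to_nat_seg[of "UNIV :: 'n set"] by auto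
  define T where "T = (\<lambda>i. {a \<in> X0. dh i a \<noteq> 0 \<and> (\<forall>j\<in>{j. e j < e i}. dh j a = 0)})"
  have Tb: "basic_set I (T i)" for i
  proof -
    have "basic_set I {a \<in> {a \<in> X0. dh i a \<noteq> 0}. \<forall>j\<in>{j. e j < e i}. dh j a = 0}"
      by (intro basic_set_all_zero basic_set_nonzero basic_set_X0 polyfun_dh) auto
    then show ?thesis
      by (rule back_subst[of "basic_set I"]) (auto simp: T_def)
  qed
  have TA: "T i \<subseteq> A0" for i
    by (auto simp: T_def X0_def)
  have Tdh: "dh i a \<noteq> 0" if "a \<in> T i" for i a
    using that by (simp add: T_def)
  have uniq: "i = j" if "a \<in> T i" "a \<in> T j" for a i j
  proof -
    have "\<not> e i < e j" "\<not> e j < e i"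
      using that by (auto simp: T_def)
    then show ?thesis
      using e by (metis injD linorder_neqE_nat)
  qed
  have ex: "\<exists>i\<in>-P. a \<in> T i" if a: "a \<in> X0" for a
  proof -
    obtain i where "dh i a \<noteq> 0"
      using partial_nonzero[of a] a by (auto simp: X0_def A0_def)
    from ex_has_least_nat[where P = "\<lambda>i. dh i a \<noteq> 0" and m = e, OF this]
    obtain i where i: "dh i a \<noteq> 0" "\<And>j. dh j a \<noteq> 0 \<Longrightarrow> e i \<le> e j"
      by blast
    have "i \<notin> P"
      using i(1) partial_h_P by (auto simp: dh_def)
    moreover have "a \<in> T i"
      using a i by (auto simp: T_def not_le[symmetric])
    ultimately show ?thesis
      by blast
  qed
  have X0T: "X0 = (\<Union>i\<in>-P. T i)"
    using ex by (auto simp: T_def)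
  have AT: "A \<inter> arc_set f l = (\<Union>i\<in>-P. FT (T i))"
  proof (intro set_eqI iffI)
    fix a assume a: "a \<in> A \<inter> arc_set f l"
    then have aa: "a \<in> affine_points I" "\<And>i j. j < k i \<Longrightarrow> a (i, j) = 0"
      by (auto simp: A_def)
    have g: "\<forall>r<l - d. g r a = 0" "g (l - d) a \<noteq> 0"
      using a A_arc_set by auto
    have "mpoly_eval h (u (lead a)) = 0"
      using g(1) s g_0[of a] by (simp add: u_lead)
    then have "lead a \<in> X0"
      using lead_A0[OF aa] a by (simp add: X0_def)
    then obtain i where "i \<in> -P" "lead a \<in> T i"
      using ex by blast
    then show "a \<in> (\<Union>i\<in>-P. FT (T i))"
      using aa g by (intro UN_I[of i]) (auto simp: FT_def simp del: One_nat_def)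
  next
    fix a assume "a \<in> (\<Union>i\<in>-P. FT (T i))"
    then obtain i where i: "a \<in> FT (T i)"
      by blast
    then have aa: "a \<in> affine_points I" "\<And>i j. j < k i \<Longrightarrow> a (i, j) = 0" and la: "lead a \<in> T i"
      by (auto simp: FT_def simp del: One_nat_def)
    then have aA: "a \<in> A"
      using lead_A0[OF aa] TA by blast
    have "g 0 a = 0"
      using la by (simp add: g_0 T_def X0_def u_lead)
    then have "g r a = 0" if "r < l - d" for r
      using i that by (cases "r = 0") (auto simp: FT_def)
    then show "a \<in> A \<inter> arc_set f l"
      using aA i by (auto simp: A_arc_set FT_def)
  qed
  have "mot_class I (A \<inter> arc_set f l) = (\<Sum>i\<in>-P. mot_class I (FT (T i)))"
    unfolding AT
  proof (rule mot_class_partition[OF finite_I])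
    show "basic_set I (\<Union>i\<in>-P. FT (T i))"
      using basic_set_arcs AT by simp
    show "basic_set I (FT (T i))" if "i \<in> -P" for i
      using that by (intro basic_set_FT[OF Tb TA _ _ s, of i]) (use Tdh in auto)
    show "i = j" if "x \<in> FT (T i)" "x \<in> FT (T j)" for i j x
      using that uniq by (auto simp: FT_def)
  qed simp
  moreover have "mot_class I X0 = (\<Sum>i\<in>-P. mot_class I (T i))"
    unfolding X0T
  proof (rule mot_class_partition[OF finite_I])
    show "basic_set I (\<Union>i\<in>-P. T i)"
      using basic_set_X0 X0T by simp
  qed (use Tb uniq in auto)
  moreover have "LL ^ (l - d) * mot_class I (FT (T i)) = (LL - 1) * (LL ^ card (R 0) * mot_class I (T i))"
    if "i \<in> -P" for i
    using that by (intro mot_class_FT[OF Tb TA _ _ s, of i]) (use Tdh in auto)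
  ultimately show ?thesis
    by (simp only: sum_distrib_left cong: sum.cong)
qed

text \<open>No equation is left when l = d: only the value of \<open>h\<close> at the leading
  coefficients must be non-zero, and everything above them is free.\<close>

lemma mot_class_arcs_eq:
  assumes "l = d"
  shows "mot_class I (A \<inter> arc_set f l) = LL ^ card (R 0) * (mot_class I A0 - mot_class I X0)"
proof -
  let ?T = "{a \<in> A0. mpoly_eval h (u a) \<noteq> 0}"
  have l0: "l - d = 0"
    using assms by simp
  have RI: "R 0 \<subseteq> I" "finite (R 0)"
    by (auto simp: R_def intro: finite_subset[OF _ finite_I])
  have eq: "A \<inter> arc_set f l = {y. zero_on (R 0) y \<in> ?T}"
  proof (intro set_eqI)
    fix y
    have aff: "zero_on (R 0) y \<in> affine_points I \<longleftrightarrow> y \<in> affine_points I"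
      by (rule zero_on_affine[OF RI(1)])
    show "y \<in> A \<inter> arc_set f l \<longleftrightarrow> y \<in> {y. zero_on (R 0) y \<in> ?T}"
    proof (cases "y \<in> affine_points I")
      case False
      then show ?thesis
        using aff by (auto simp: A0_def A_def)
    next
      case True
      have z: "zero_on (R 0) y (i, j) = (if k i < j then 0 else y (i, j))" for i j
        using True k_pos[of i] by (auto simp: zero_on_def R_def affine_points_def)
      have "zero_on (R 0) y \<in> A0 \<longleftrightarrow> y \<in> A"
        unfolding A0_def A_def using True aff
        by (auto simp: z simp del: One_nat_def)
      moreover have "u (zero_on (R 0) y) = u y"
        by (simp add: u_def z)
      ultimately show ?thesis
        using A_arc_set[of y] l0 by (auto simp: g_0)
    qed
  qed
  have Tb: "basic_set I ?T"
    by (intro basic_set_nonzero basic_set_A0 polyfun_hu)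
  have "mot_class I (A \<inter> arc_set f l) = LL ^ card (R 0) * mot_class I ?T"
    unfolding eq
  proof (rule mot_class_free[OF finite_I RI(2,1) Tb])
    fix x c assume "x \<in> ?T" "c \<in> R 0"
    then show "x c = 0"
      by (cases c) (auto simp: A0_def R_def)
  qed
  moreover have "mot_class I A0 = mot_class I ?T + mot_class I X0"
    unfolding X0_def by (rule mot_class_scissor[OF finite_I basic_set_A0 polyfun_hu])
  ultimately show ?thesis
    by simp
qed

text \<open>The leading coordinates by role: \<open>Kb\<close> carries the torus on which
  \<open>h\<close> lives, \<open>K1\<close> consists of units not seen by \<open>h\<close>, and
  \<open>K2\<close> is unconstrained. An index in \<open>Q\<close> with k_i = l + 1 has no
  coordinate.\<close>

definition Kb :: "('n \<times> nat) set" where "Kb = (\<lambda>i. (i, k i)) ` (- P)"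
definition K1 :: "('n \<times> nat) set" where "K1 = (\<lambda>i. (i, k i)) ` (P - Q)"
definition K2 :: "('n \<times> nat) set" where "K2 = (\<lambda>i. (i, k i)) ` {i \<in> Q. k i \<le> l}"

lemma inj_lead: "inj_on (\<lambda>i. (i, k i)) M"
  by (auto simp: inj_on_def)

lemma K_subset: "Kb \<subseteq> I" "K1 \<subseteq> I" "K2 \<subseteq> I"
proof -
  have "(i, k i) \<in> I" if "k i \<le> l" for i
    using that by (intro coord_in_I) auto
  then show "Kb \<subseteq> I" "K1 \<subseteq> I" "K2 \<subseteq> I"
    using k_le QP unfolding Kb_def K1_def K2_def by blast+
qed

lemma finite_K: "finite Kb" "finite K1" "finite K2"
  by (simp_all add: Kb_def K1_def K2_def)

definition Y0 :: "('n \<times> nat \<Rightarrow> complex) set" where "Y0 = {a \<in> affine_points Kb. \<forall>c\<in>Kb. a c \<noteq> 0}"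

lemma Y0_eq: "Y0 = {y. zero_on Kb y \<in> {\<lambda>_. 0} \<and> (\<forall>c\<in>Kb. y c \<noteq> 0)}"
  by (auto simp: Y0_def zero_on_def affine_points_def fun_eq_iff)

lemma basic_set_origin: "basic_set I {\<lambda>_. 0}"
proof -
  have "basic_set I {x \<in> affine_points I. \<forall>c\<in>I. x c = 0}"
    by (intro basic_set_all_zero finite_I basic_set_affine polyfun_coord)
  moreover have "x = (\<lambda>_. 0)" if "x \<in> affine_points I" "\<forall>c\<in>I. x c = 0" for x
    using that affine_out[OF that(1)] by (intro ext) blast
  then have "{x \<in> affine_points I. \<forall>c\<in>I. x c = 0} = {\<lambda>_. 0}"
    by (auto simp: affine_points_def)
  ultimately show ?thesis
    by simp
qed

lemma basic_set_Y0: "basic_set I Y0"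
  unfolding Y0_eq by (intro basic_set_units finite_K K_subset basic_set_origin)

lemma mot_class_Y0: "mot_class I Y0 = (LL - 1) ^ (CARD('n) - card P)"
proof -
  have "mot_class I Y0 = (LL - 1) ^ card Kb * mot_class I {\<lambda>_. 0}"
    unfolding Y0_eq by (rule mot_class_units[OF finite_I finite_K(1) K_subset(1) basic_set_origin]) auto
  moreover have "card Kb = CARD('n) - card P"
    by (simp add: Kb_def card_image[OF inj_lead] Compl_eq_Diff_UNIV card_Diff_subset)
  ultimately show ?thesis
    by (simp only: mot_class_point mult_1_right)
qed

text \<open>A function depending only on leading coefficients outside \<open>P\<close> imposes
  nothing on \<open>K1\<close> and \<open>K2\<close>, so the set is the product of its part over
  \<open>Kb\<close> with a torus and an affine space.\<close>

lemma mot_class_base: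
  assumes p: "polyfun p" and dep: "\<And>a b. (\<And>i. i \<notin> P \<Longrightarrow> u a i = u b i) \<Longrightarrow> p a = p b"
  shows "mot_class I {a \<in> A0. p a = 0} = LL ^ card K2 * ((LL - 1) ^ card K1 * mot_class I {a \<in> Y0. p a = 0})"
proof -
  let ?Y = "{a \<in> Y0. p a = 0}"
  let ?M = "{y. zero_on K1 y \<in> ?Y \<and> (\<forall>c\<in>K1. y c \<noteq> 0)}"
  have Yb: "basic_set I ?Y"
    by (intro basic_set_zero basic_set_Y0 p)
  have Mb: "basic_set I ?M"
    by (intro basic_set_units finite_K K_subset Yb)
  have Yv: "x c = 0" if "x \<in> Y0" "c \<notin> Kb" for x c
    using that unfolding Y0_def affine_points_def by blast
  have disj: "Kb \<inter> K1 = {}" "Kb \<inter> K2 = {}" "K1 \<inter> K2 = {}"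
    using QP by (auto simp: Kb_def K1_def K2_def)
  have eq: "{a \<in> A0. p a = 0} = {y. zero_on K2 y \<in> ?M}"
  proof (intro set_eqI iffI)
    fix a assume a: "a \<in> {a \<in> A0. p a = 0}"
    let ?z = "zero_on K1 (zero_on K2 a)"
    have aI: "a c = 0" if "c \<notin> I" for c
      using a that affine_out by (auto simp: A0_def A_def)
    have ak: "a (i, j) = 0" if "j \<noteq> k i" for i j
      using a that by (auto simp: A0_def)
    have nz: "a (i, k i) \<noteq> 0" if "i \<notin> Q" for i
      using a that by (auto simp: A0_def A_def)
    have "?z c = 0" if "c \<notin> Kb" for c
    proof (cases "c \<in> K1 \<or> c \<in> K2")
      case False
      obtain i j where c: "c = (i, j)"
        by (cases c)
      have "j \<noteq> k i \<or> (i \<in> Q \<and> l < k i)"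
        using that False unfolding c Kb_def K1_def K2_def by force
      then have "a c = 0"
        using ak[of j i] aI[of c] c by (cases "j = k i") auto
      then show ?thesis
        by (auto simp: zero_on_def)
    qed (auto simp: zero_on_def)
    moreover have "?z c \<noteq> 0" if c: "c \<in> Kb" for c
    proof -
      obtain i where i: "i \<notin> P" "c = (i, k i)"
        using c by (auto simp: Kb_def)
      then have "i \<notin> Q"
        using QP by blast
      then have "c \<notin> K1" "c \<notin> K2" "a c \<noteq> 0"
        using c disj nz i(2) by auto
      then show ?thesis
        by (simp add: zero_on_def)
    qed
    moreover have "p ?z = p a"
    proof (rule dep)
      fix i assume "i \<notin> P"
      then have "(i, k i) \<notin> K1" "(i, k i) \<notin> K2"
        using QP by (auto simp: K1_def K2_def)
      then show "u ?z i = u a i"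
        by (simp add: u_def zero_on_def)
    qed
    moreover have "zero_on K2 a c \<noteq> 0" if c: "c \<in> K1" for c
    proof -
      obtain i where i: "i \<notin> Q" "c = (i, k i)"
        using c by (auto simp: K1_def)
      then have "c \<notin> K2" "a c \<noteq> 0"
        using c disj nz by auto
      then show ?thesis
        by (simp add: zero_on_def)
    qed
    ultimately show "a \<in> {y. zero_on K2 y \<in> ?M}"
      using a by (auto simp: Y0_def affine_points_def)
  next
    fix a assume "a \<in> {y. zero_on K2 y \<in> ?M}"
    then have z: "zero_on K1 (zero_on K2 a) \<in> Y0" "p (zero_on K1 (zero_on K2 a)) = 0"
      and n1: "\<And>c. c \<in> K1 \<Longrightarrow> zero_on K2 a c \<noteq> 0"
      by auto
    have a0: "a c = 0" if "c \<notin> Kb" "c \<notin> K1" "c \<notin> K2" for c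
      using Yv[OF z(1) that(1)] that by (simp add: zero_on_def)
    have aK: "a c \<noteq> 0" if "c \<in> Kb" for c
    proof -
      have "zero_on K1 (zero_on K2 a) c \<noteq> 0"
        using z(1) that by (simp add: Y0_def)
      then show ?thesis
        by (auto simp: zero_on_def split: if_splits)
    qed
    have aff: "a \<in> affine_points I"
      using a0 K_subset unfolding affine_points_def by blast
    have ak: "a (i, j) = 0" if "j \<noteq> k i" for i j
      using that by (intro a0) (auto simp: Kb_def K1_def K2_def)
    have "a (i, k i) \<noteq> 0" if "i \<notin> Q" for i
    proof (cases "i \<in> P")
      case True
      then have "(i, k i) \<in> K1"
        using that by (auto simp: K1_def)
      from n1[OF this] show ?thesis
        by (auto simp: zero_on_def split: if_splits)
    qed (auto intro!: aK simp: Kb_def)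
    moreover have "p (zero_on K1 (zero_on K2 a)) = p a"
    proof (rule dep)
      fix i assume "i \<notin> P"
      then have "(i, k i) \<notin> K1" "(i, k i) \<notin> K2"
        using QP by (auto simp: K1_def K2_def)
      then show "u (zero_on K1 (zero_on K2 a)) i = u a i"
        by (simp add: u_def zero_on_def)
    qed
    moreover have "a (i, j) = 0" if "j < k i" for i j
      using ak that by simp
    ultimately show "a \<in> {a \<in> A0. p a = 0}"
      using aff ak z(2) by (auto simp: A0_def A_def)
  qed
  have "mot_class I {a \<in> A0. p a = 0} = LL ^ card K2 * mot_class I ?M"
    unfolding eq
  proof (rule mot_class_free[OF finite_I finite_K(3) K_subset(3) Mb])
    fix x c assume x: "x \<in> ?M" and c: "c \<in> K2"
    have "c \<notin> Kb" "c \<notin> K1"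
      using c disj by auto
    then have "zero_on K1 x c = 0"
      using x Yv by blast
    then show "x c = 0"
      using \<open>c \<notin> K1\<close> by (simp add: zero_on_def)
  qed
  also have "mot_class I ?M = (LL - 1) ^ card K1 * mot_class I ?Y"
  proof (rule mot_class_units[OF finite_I finite_K(2) K_subset(2) Yb])
    fix x c assume "x \<in> ?Y" "c \<in> K1"
    then show "x c = 0"
      using Yv[of x c] disj by auto
  qed
  finally show ?thesis .
qed

text \<open>On \<open>Y0\<close> only the coordinates (i, k_i) with i outside \<open>P\<close> are
  non-zero; renaming them to i is regular in both directions.\<close>

lemma mot_class_torus_zeros:
  "mot_class I {a \<in> Y0. mpoly_eval h (u a) = 0} = mot_class (- P) (torus_zeros (- P) h)"
proof (rule mot_class_iso[where \<phi> = "\<lambda>a i. if i \<in> P then 0 else a (i, k i)" and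
      \<psi> = "\<lambda>x c. if fst c \<in> P \<or> snd c \<noteq> k (fst c) then 0 else x (fst c)"])
  let ?\<phi> = "\<lambda>a i. if i \<in> P then 0 else a (i, k i)"
  let ?\<psi> = "\<lambda>x c. if fst c \<in> P \<or> snd c \<noteq> k (fst c) then 0 else x (fst c)"
  show "{a \<in> Y0. mpoly_eval h (u a) = 0} \<subseteq> affine_points I"
    using basic_set_subset[OF basic_set_Y0] by blast
  show "torus_zeros (- P) h \<subseteq> affine_points (- P)"
    by (auto simp: torus_zeros_def)
  show "?\<phi> a \<in> torus_zeros (- P) h" if "a \<in> {a \<in> Y0. mpoly_eval h (u a) = 0}" for a
  proof -
    have "mpoly_eval h (?\<phi> a) = mpoly_eval h (u a)"
      by (rule h_cong) (simp add: u_def)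
    then show ?thesis
      using that by (auto simp: torus_zeros_def affine_points_def Y0_def Kb_def)
  qed
  show "?\<psi> x \<in> {a \<in> Y0. mpoly_eval h (u a) = 0}" if "x \<in> torus_zeros (- P) h" for x
  proof -
    have "mpoly_eval h (u (?\<psi> x)) = mpoly_eval h x"
      by (rule h_cong) (simp add: u_def)
    then show ?thesis
      using that by (auto simp: torus_zeros_def affine_points_def Y0_def Kb_def image_iff)
  qed
  show "regfun {a \<in> Y0. mpoly_eval h (u a) = 0} (\<lambda>a. ?\<phi> a i)" for i
    by (cases "i \<in> P") (auto intro: regfun_const regfun_coord)
  show "regfun (torus_zeros (- P) h) (\<lambda>x. ?\<psi> x c)" for c
    by (cases "fst c \<in> P \<or> snd c \<noteq> k (fst c)") (auto intro: regfun_const regfun_coord)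
  show "?\<psi> (?\<phi> a) = a" if "a \<in> {a \<in> Y0. mpoly_eval h (u a) = 0}" for a
  proof
    fix c
    show "?\<psi> (?\<phi> a) c = a c"
      using that by (cases c) (auto simp: Y0_def affine_points_def Kb_def image_iff)
  qed
  show "?\<phi> (?\<psi> x) = x" if "x \<in> torus_zeros (- P) h" for x
    using that by (auto simp: torus_zeros_def affine_points_def fun_eq_iff)
qed

text \<open>The identity holds for each index separately. If k_i <= l, the truncated difference is a
  true one. If k_i = l + 1, which happens only in \<open>Q\<close>, that difference is 0 and the
  summand for \<open>Q\<close> on the left makes up for the missing unit.\<close>

lemma card_count: "CARD('n) * l + card Q = (\<Sum>i\<in>UNIV. k i) + card (R 0) + card K2"
proof -
  have "R 0 = (SIGMA i:UNIV. {k i<..l})"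
    using k_pos by (auto simp: R_def intro: Suc_leI order_trans)
  then have R: "card (R 0) = (\<Sum>i\<in>UNIV. l - k i)"
    by simp
  have ind: "card M = (\<Sum>i\<in>UNIV. if i \<in> M then 1 else 0)" for M :: "'n set"
    by (simp add: sum.If_cases)
  have K2: "card K2 = card {i \<in> Q. k i \<le> l}"
    unfolding K2_def by (rule card_image[OF inj_lead])
  have "CARD('n) * l + card Q = (\<Sum>i\<in>UNIV. l + (if i \<in> Q then 1 else 0))"
    unfolding ind[of Q] sum.distrib by simp
  also have "\<dots> = (\<Sum>i\<in>UNIV. k i + (l - k i) + (if i \<in> {i \<in> Q. k i \<le> l} then 1 else 0))"
  proof (rule sum.cong[OF refl])
    fix i
    show "l + (if i \<in> Q then 1 else 0) = k i + (l - k i) + (if i \<in> {i \<in> Q. k i \<le> l} then 1 else 0)"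
      using k_le[of i] k_le_Suc[of i] by auto
  qed
  also have "\<dots> = (\<Sum>i\<in>UNIV. k i) + card (R 0) + card K2"
    unfolding R K2 ind[of "{i \<in> Q. k i \<le> l}"] sum.distrib ..
  finally show ?thesis .
qed

lemma piece_class:
  "\<L>\<^sup>-\<^sup>1 ^ CARD('n) * (mot_class I (A \<inter> arc_set f l) * (\<L>\<^sup>-\<^sup>1 ^ CARD('n)) ^ l) =
    (1 - \<L>\<^sup>-\<^sup>1) ^ (card P - card Q) * (\<L>\<^sup>-\<^sup>1 ^ (\<Sum>i\<in>UNIV. k i) *
     fps_nth (fps_const ((1 - \<L>\<^sup>-\<^sup>1) ^ (CARD('n) - card P)) -
       fps_const (\<L>\<^sup>-\<^sup>1 ^ (CARD('n) - card P) * mot_class (- P) (torus_zeros (- P) h)) *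
       ((1 - fps_X) * geom (fps_const \<L>\<^sup>-\<^sup>1 * fps_X))) (l - d))"
proof -
  let ?M = "mot_class I (A \<inter> arc_set f l)" and ?n = "CARD('n)"
  let ?X = "mot_class (- P) (torus_zeros (- P) h)"
  have PQ: "card Q \<le> card P" "card P \<le> ?n"
    using QP by (auto intro: card_mono)
  have K1: "card K1 = card P - card Q"
    unfolding K1_def by (simp add: card_image[OF inj_lead] card_Diff_subset QP)
  have X0: "mot_class I X0 = LL ^ card K2 * ((LL - 1) ^ (card P - card Q) * ?X)"
    unfolding X0_def K1[symmetric] mot_class_torus_zeros[symmetric]
    by (rule mot_class_base[OF polyfun_hu h_cong])
  have A0: "mot_class I A0 = LL ^ card K2 * ((LL - 1) ^ (card P - card Q) * (LL - 1) ^ (?n - card P))"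
    using mot_class_base[OF polyfun_const[of 0]] by (simp add: K1 mot_class_Y0 del: One_nat_def)
  have "\<L>\<^sup>-\<^sup>1 ^ ?n * (?M * (\<L>\<^sup>-\<^sup>1 ^ ?n) ^ l) = \<L>\<^sup>-\<^sup>1 ^ (?n + ?n * l) * ?M"
    by (simp only: power_add power_mult mult.assoc mult.commute[of ?M])
  also have "\<dots> = (1 - \<L>\<^sup>-\<^sup>1) ^ (card P - card Q) * (\<L>\<^sup>-\<^sup>1 ^ (\<Sum>i\<in>UNIV. k i) *
     fps_nth (fps_const ((1 - \<L>\<^sup>-\<^sup>1) ^ (?n - card P)) - fps_const (\<L>\<^sup>-\<^sup>1 ^ (?n - card P) * ?X) *
       ((1 - fps_X) * geom (fps_const \<L>\<^sup>-\<^sup>1 * fps_X))) (l - d))"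
  proof (rule mot_coefficient_identity[where b = "card (R 0) + card K2"])
    show "?n + ?n * l = (\<Sum>i\<in>UNIV. k i) + (?n - card P + (card P - card Q)) + (card (R 0) + card K2)"
      using card_count PQ by simp
    show "?M = LL ^ (card (R 0) + card K2) * ((LL - 1) ^ (card P - card Q) * ((LL - 1) ^ (?n - card P) - ?X))"
      if "l - d = 0"
    proof -
      have "l = d"
        using that d_le by simp
      from mot_class_arcs_eq[OF this] show ?thesis
        unfolding A0 X0 by (simp only: power_add right_diff_distrib mult.assoc)
    qed
    show "LL ^ (l - d) * ?M = (LL - 1) * (LL ^ (card (R 0) + card K2) * ((LL - 1) ^ (card P - card Q) * ?X))"
      if pos: "0 < l - d"
    proof -
      obtain s where "l - d = Suc s"
        using gr0_implies_Suc[OF pos] by blast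
      from mot_class_arcs_less[OF this] show ?thesis
        unfolding X0 by (simp only: power_add mult.assoc)
    qed
  qed
  finally show ?thesis .
qed

end

subsection \<open>Orders of arcs and truncated cones\<close>

context newton
begin

text \<open>Positive entries of \<open>k\<close> bound coordinate i on \<open>F k\<close> by m(k) /
  k_i.\<close>

lemma positive_locus_compact:
  assumes k: "k \<in> nonneg_orthant" and pos: "\<And>i. 0 < (k :: real ^ 'n) $ i"
  shows "F k \<in> compact_faces f"
proof -
  have "F k = \<Gamma> \<inter> {x. k \<bullet> x = m k}"
    by (auto simp: in_first_meet_locus)
  then have "closed (F k)"
    using polyhedron_imp_closed[OF polyhedron_newton] by (simp add: closed_Int closed_hyperplane)
  moreover have "bounded (F k)"
  proof (rule bounded_subset[OF bounded_cbox])
    show "F k \<subseteq> cbox 0 (\<chi> i. m k / k $ i)"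
    proof
      fix x assume x: "x \<in> F k"
      then have xo: "x \<in> nonneg_orthant"
        using polyhedron_orthant by (auto simp: in_first_meet_locus)
      have "k $ i * x $ i \<le> k \<bullet> x" for i
        unfolding inner_vec_def inner_real_def using k xo
        by (intro member_le_sum) (auto simp: nonneg_orthant_def)
      then have "x $ i \<le> m k / k $ i" for i
        using x pos[of i] by (simp add: in_first_meet_locus pos_le_divide_eq mult.commute)
      then show "x \<in> cbox 0 (\<chi> i. m k / k $ i)"
        using xo by (simp add: mem_box_cart nonneg_orthant_def)
    qed
  qed
  ultimately show ?thesis
    using first_meet_locus_exposed[OF k] first_meet_locus_nonempty[OF k]
    by (auto simp: compact_faces_def newton_faces_def compact_eq_bounded_closed)
qed

definition coords :: "real ^ 'n \<Rightarrow> 'n \<Rightarrow> nat" where "coords k i = nat \<lfloor>k $ i\<rfloor>"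

lemma coords:
  assumes "k \<in> nonneg_orthant" "k \<in> integer_points"
  shows "real (coords k i) = k $ i"
proof -
  have "0 \<le> k $ i" "k $ i \<in> \<int>"
    using assms by (auto simp: nonneg_orthant_def integer_points_def)
  then show ?thesis
    by (simp add: coords_def of_nat_nat)
qed

lemma weight_coords:
  assumes "k \<in> nonneg_orthant" "k \<in> integer_points"
  shows "real (weight (coords k) \<omega>) = k \<bullet> exponent_vec \<omega>"
  by (simp add: weight_def inner_vec_def exponent_vec_def coords[OF assms])

lemma s_nat_coords:
  assumes "k \<in> nonneg_orthant" "k \<in> integer_points"
  shows "s_nat k = (\<Sum>i\<in>UNIV. coords k i)"
proof -
  have "real (s_nat k) = real (\<Sum>i\<in>UNIV. coords k i)"
    by (simp add: s_nat[OF assms] sigma_sum_def coords[OF assms])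
  then show ?thesis
    by linarith
qed

lemma m_nat_le_weight:
  assumes "k \<in> nonneg_orthant" "k \<in> integer_points" "\<omega> \<in> Poly_Mapping.keys f"
  shows "m_nat k \<le> weight (coords k) \<omega>"
proof -
  have "real (m_nat k) \<le> real (weight (coords k) \<omega>)"
    using newton_m_attained(2)[OF assms(1) exponent_in[OF assms(3)]]
    by (simp add: m_nat[OF assms(1,2)] weight_coords[OF assms(1,2)])
  then show ?thesis
    by simp
qed

lemma face_poly_eq:
  assumes k: "k \<in> face_cone f \<tau>" "k \<in> integer_points"
  shows "face_poly f \<tau> = restrict_poly f {\<omega> \<in> Poly_Mapping.keys f. weight (coords k) \<omega> = m_nat k}"
proof -
  have ko: "k \<in> nonneg_orthant" and Fk: "F k = \<tau>"
    using k(1) by (auto dest: face_coneD)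
  have "exponent_vec \<omega> \<in> \<tau> \<longleftrightarrow> weight (coords k) \<omega> = m_nat k" if "\<omega> \<in> Poly_Mapping.keys f" for \<omega>
  proof -
    have "exponent_vec \<omega> \<in> \<tau> \<longleftrightarrow> real (weight (coords k) \<omega>) = real (m_nat k)"
      using exponent_in[OF that] unfolding Fk[symmetric] in_first_meet_locus weight_coords[OF ko k(2)] m_nat[OF ko k(2)]
      by simp
    then show ?thesis
      by simp
  qed
  then show ?thesis
    unfolding face_poly_def restrict_poly_def by (intro sum.cong) auto
qed

lemma face_poly_zero_coords:
  assumes "\<omega> \<in> Poly_Mapping.keys (face_poly f \<tau>)" "i \<in> zero_coords \<tau>"
  shows "Poly_Mapping.lookup \<omega> i = 0"
proof -
  have "face_poly f \<tau> = restrict_poly f {\<omega> \<in> Poly_Mapping.keys f. exponent_vec \<omega> \<in> \<tau>}"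
    by (simp add: face_poly_def restrict_poly_def)
  then have "exponent_vec \<omega> \<in> \<tau>"
    using assms(1) by (simp add: keys_restrict_poly)
  then have "exponent_vec \<omega> $ i = 0"
    using assms(2) by (simp add: zero_coords_def)
  then show ?thesis
    by (simp add: exponent_vec_def)
qed

lemma locally_finite_bounded:
  assumes "\<And>k. k \<in> A \<Longrightarrow> k \<in> nonneg_orthant" "\<And>k i. k \<in> A \<Longrightarrow> k $ i \<le> m k + 1"
  shows "locally_finite (integer_points \<inter> A)"
  unfolding locally_finite_def
proof
  fix n
  have "{k \<in> integer_points \<inter> A. m_nat k = n} \<subseteq> {k \<in> integer_points. \<forall>i. 0 \<le> k $ i \<and> k $ i \<le> real n + 1}"
  proof
    fix k assume k: "k \<in> {k \<in> integer_points \<inter> A. m_nat k = n}"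
    then have "m k = real n"
      using m_nat[of k] assms(1)[of k] by auto
    then show "k \<in> {k \<in> integer_points. \<forall>i. 0 \<le> k $ i \<and> k $ i \<le> real n + 1}"
      using k assms by (auto simp: nonneg_orthant_def) (metis)
  qed
  then show "finite {k \<in> integer_points \<inter> A. m_nat k = n}"
    by (rule finite_subset[OF _ finite_bounded_integer_points])
qed

lemma fps_nth_times_lattice_sum:
  assumes A: "locally_finite A"
  shows "fps_nth (H * infsum (lattice_term f) A) l =
    (\<Sum>k\<in>{k \<in> A. m_nat k \<le> l}. \<L>\<^sup>-\<^sup>1 ^ s_nat k * fps_nth H (l - m_nat k))"
proof -
  have "{k \<in> A. m_nat k \<le> l} = (\<Union>i\<le>l. {k \<in> A. m_nat k = i})"
    by auto
  then have fin: "finite {k \<in> A. m_nat k \<le> l}"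
    using A by (simp add: locally_finite_def)
  have "fps_nth (H * infsum (lattice_term f) A) l = fps_nth (infsum (lattice_term f) A * H) l"
    by (simp only: mult.commute)
  also have "\<dots> = (\<Sum>i=0..l. \<Sum>k\<in>{k \<in> A. m_nat k = i}. \<L>\<^sup>-\<^sup>1 ^ s_nat k * fps_nth H (l - m_nat k))"
    unfolding fps_mult_nth lattice_sum_nth[OF A] sum_distrib_right by (intro sum.cong refl) auto
  also have "\<dots> = (\<Sum>i=0..l. \<Sum>k\<in>{k \<in> {k \<in> A. m_nat k \<le> l}. m_nat k = i}. \<L>\<^sup>-\<^sup>1 ^ s_nat k * fps_nth H (l - m_nat k))"
    by (intro sum.cong refl) auto
  also have "\<dots> = (\<Sum>k\<in>{k \<in> A. m_nat k \<le> l}. \<L>\<^sup>-\<^sup>1 ^ s_nat k * fps_nth H (l - m_nat k))"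
    using fin by (intro sum.group) auto
  finally show ?thesis .
qed

section \<open>Reduction of lattice points along the unit generators\<close>

definition Qset :: "(real ^ 'n) set \<Rightarrow> (real ^ 'n) set \<Rightarrow> 'n set" where
  "Qset \<tau> G = {\<rho> \<in> zero_coords \<tau>. axis \<rho> 1 \<in> G}"

lemma unit_gens_Int: "G \<inter> unit_gens \<tau> = (\<lambda>\<rho>. axis \<rho> 1) ` Qset \<tau> G"
  by (auto simp: unit_gens_def Qset_def)

lemma inj_axis: "inj_on (\<lambda>\<rho>. axis \<rho> (1::real) :: real ^ 'n) M"
  by (auto simp: inj_on_def axis_eq_axis)

lemma card_Qset: "card (G \<inter> unit_gens \<tau>) = card (Qset \<tau> G)"
  unfolding unit_gens_Int by (rule card_image[OF inj_axis])

text \<open>The coefficient of e_\<rho> is r \<bullet> e_\<rho>, that is r_\<rho>. Written as a sum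
  over all of \<open>G\<close>, the vector can be added to other combinations of \<open>G\<close>
  coefficient by coefficient.\<close>

lemma unit_gens_sum:
  fixes r :: "real ^ 'n"
  assumes G: "finite G" and r: "\<And>i. i \<notin> Qset \<tau> G \<Longrightarrow> r $ i = 0"
  shows "(\<Sum>v\<in>G. (if v \<in> unit_gens \<tau> then r \<bullet> v else 0) *\<^sub>R v) = r"
proof -
  have "(\<Sum>v\<in>G. (if v \<in> unit_gens \<tau> then r \<bullet> v else 0) *\<^sub>R v) = (\<Sum>v\<in>G \<inter> unit_gens \<tau>. (r \<bullet> v) *\<^sub>R v)"
    using G by (intro sum.mono_neutral_cong_right) auto
  also have "\<dots> = (\<Sum>\<rho>\<in>Qset \<tau> G. r $ \<rho> *\<^sub>R axis \<rho> 1)"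
    unfolding unit_gens_Int by (simp add: sum.reindex[OF inj_axis] inner_axis_one)
  also have "\<dots> = (\<Sum>\<rho>\<in>UNIV. r $ \<rho> *\<^sub>R axis \<rho> 1)"
    using r by (intro sum.mono_neutral_left) auto
  also have "\<dots> = r"
    using basis_expansion[of r] by (simp add: scalar_mult_eq_scaleR)
  finally show ?thesis .
qed

context
  fixes \<tau> G :: "(real ^ 'n) set"
  assumes \<tau>: "\<tau> \<in> compact_faces f" and G: "G \<subseteq> facet_normals f \<tau>" "independent G"
    and cone: "spos_span G \<subseteq> face_cone f \<tau>"
begin

lemmas \<tau>' = compact_face_nonempty[OF \<tau>] compact_face_subset[OF \<tau>]

lemma simplex_cone_subset: "simplex_cone G J \<subseteq> face_cone f \<tau>"
  using cone simplex_cone_mono[of "J \<inter> G" G G] unfolding spos_span_eq simplex_cone_def by blast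

lemma truncated_simplex_cone_eq: "truncated_simplex_cone \<tau> G = simplex_cone G (G - unit_gens \<tau>)"
  unfolding truncated_simplex_cone_def by (rule truncated_cone_eq[OF G_finite[OF \<tau>' G]])

lemma non_unit_gen_m: "v \<in> G - unit_gens \<tau> \<Longrightarrow> 1 \<le> m v" "v \<in> G - unit_gens \<tau> \<Longrightarrow> m v \<in> \<int>"
proof -
  assume v: "v \<in> G - unit_gens \<tau>"
  then show Z: "m v \<in> \<int>"
    using G_normal[OF \<tau>' G] newton_m_Int by blast
  have "0 < m v"
    using v G(1) facet_normal_le(2) by blast
  then show "1 \<le> m v"
    using Z by (auto elim!: Ints_cases)
qed

text \<open>Generators outside \<open>unit_gens \<tau>\<close> satisfy v_i <= m(v). A unit generator
  has m = 0 and a coefficient at most 1, and it affects coordinate i only if it is e_i.\<close>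

lemma truncated_bound:
  assumes k: "k \<in> simplex_cone G (G - unit_gens \<tau>)"
  shows "k $ i \<le> m k + (if i \<in> Qset \<tau> G then 1 else 0)"
proof -
  obtain c where c: "k = (\<Sum>v\<in>G. c v *\<^sub>R v)" "\<And>v. v \<in> G \<Longrightarrow> 0 < c v"
      "\<And>v. v \<in> G \<Longrightarrow> v \<notin> G - unit_gens \<tau> \<Longrightarrow> c v \<le> 1"
    using k by (rule simplex_coneE) blast
  have mk: "m k = (\<Sum>v\<in>G. c v * m v)"
    unfolding c(1) using c(2) by (intro G_comb(2)[OF \<tau>' G]) (simp add: less_imp_le)
  have "c v * v $ i \<le> c v * m v + (if v = axis i 1 then if i \<in> Qset \<tau> G then 1 else 0 else 0)" if v: "v \<in> G" for v
  proof (cases "v \<in> unit_gens \<tau>")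
    case True
    then obtain \<rho> where \<rho>: "\<rho> \<in> zero_coords \<tau>" "v = axis \<rho> 1"
      by (auto simp: unit_gens_def)
    then have "m v = 0"
      using axis_in_facet_normals(2)[OF \<tau>'] by simp
    moreover have "c v \<le> 1"
      using c(3) v True by simp
    ultimately show ?thesis
      using \<rho> v by (cases "\<rho> = i") (auto simp: Qset_def axis_def axis_eq_axis)
  next
    case False
    then have "c v * v $ i \<le> c v * m v"
      using v G(1) c(2)[OF v] facet_normal_le(1)[of v \<tau> i] by (intro mult_left_mono) auto
    then show ?thesis
      by auto
  qed
  then have "(\<Sum>v\<in>G. c v * v $ i) \<le> (\<Sum>v\<in>G. c v * m v + (if v = axis i 1 then if i \<in> Qset \<tau> G then 1 else 0 else 0))"
    by (rule sum_mono)
  also have "\<dots> \<le> m k + (if i \<in> Qset \<tau> G then 1 else 0)"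
    unfolding sum.distrib mk[symmetric] using G_finite[OF \<tau>' G] by (simp add: sum.delta)
  finally show ?thesis
    unfolding c(1) by simp
qed

lemma locally_finite_truncated: "locally_finite (integer_points \<inter> simplex_cone G (G - unit_gens \<tau>))"
proof (rule locally_finite_bounded)
  fix k and i assume k: "k \<in> simplex_cone G (G - unit_gens \<tau>)"
  show "k \<in> nonneg_orthant"
    by (rule simplex_cone_orthant[OF \<tau>' G k])
  show "k $ i \<le> m k + 1"
    using truncated_bound[OF k, of i] by (auto split: if_splits)
qed

lemma truncated_sum:
  "infsum (lattice_term f) (integer_points \<inter> simplex_cone G (G - unit_gens \<tau>)) =
    Sigma_box f G * (\<Prod>v\<in>G - unit_gens \<tau>. geom (lattice_term f v))"
  using G_finite[OF \<tau>' G] non_unit_gen_m(1) by (intro lattice_sum_simplex_cone[OF \<tau>' G]) auto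

text \<open>\<open>m\<close> is additive on the cone and zero on the unit generators, whereas it is
  positive on the cone of a compact face.\<close>

lemma non_unit_gen_exists: "G - unit_gens \<tau> \<noteq> {}"
proof
  assume *: "G - unit_gens \<tau> = {}"
  define k where "k = (\<Sum>v\<in>G. 1 *\<^sub>R v)"
  have "k \<in> spos_span G"
    unfolding k_def spos_span_def by (intro CollectI exI[of _ "\<lambda>_. 1"]) auto
  then have k: "k \<in> face_cone f \<tau>"
    using cone by blast
  then have "0 < m k"
    using face_cone_pos[OF k \<tau>] by (intro newton_m_pos face_coneD(1)[OF k]) auto
  moreover have "m v = 0" if "v \<in> G" for v
    using that * axis_in_facet_normals(2)[OF \<tau>'] by (auto simp: unit_gens_def)
  then have "m k = 0"
    unfolding k_def using G_comb(2)[OF \<tau>' G, of "\<lambda>_. 1"] by simp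
  ultimately show False
    by simp
qed

lemma spos_span_shift:
  assumes k: "k \<in> simplex_cone G J" and r: "\<And>i. 0 \<le> (r :: real ^ 'n) $ i" "\<And>i. i \<notin> Qset \<tau> G \<Longrightarrow> r $ i = 0"
  shows "k + r \<in> spos_span G"
proof -
  obtain c where c: "k = (\<Sum>v\<in>G. c v *\<^sub>R v)" "\<And>v. v \<in> G \<Longrightarrow> 0 < c v"
    using k by (rule simplex_coneE) blast
  let ?d = "\<lambda>v. if v \<in> unit_gens \<tau> then r \<bullet> v else 0"
  have d0: "0 \<le> ?d v" for v
    using r(1) by (auto simp: unit_gens_def inner_axis_one)
  have "k + r = (\<Sum>v\<in>G. (c v + ?d v) *\<^sub>R v)"
    using unit_gens_sum[OF G_finite[OF \<tau>' G] r(2)] by (simp add: c(1) scaleR_add_left sum.distrib)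
  then show ?thesis
    unfolding spos_span_def
    by (intro CollectI exI[of _ "\<lambda>v. c v + ?d v"] conjI ballI add_pos_nonneg[OF c(2) d0])
qed

text \<open>The two coefficients of a unit generator differ by an integer and both lie in (0, 1];
  the remaining coefficients agree by independence.\<close>

lemma reduction_unique:
  assumes k: "k \<in> integer_points \<inter> simplex_cone G (G - unit_gens \<tau>)"
    and k': "k' \<in> integer_points \<inter> simplex_cone G (G - unit_gens \<tau>)"
    and eq: "\<And>i. i \<notin> Qset \<tau> G \<Longrightarrow> k $ i = k' $ i"
  shows "k = k'"
proof -
  obtain c where c: "k = (\<Sum>v\<in>G. c v *\<^sub>R v)" "\<And>v. v \<in> G \<Longrightarrow> 0 < c v"
      "\<And>v. v \<in> G \<Longrightarrow> v \<notin> G - unit_gens \<tau> \<Longrightarrow> c v \<le> 1"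
    using k by (auto elim: simplex_coneE)
  obtain d where d: "k' = (\<Sum>v\<in>G. d v *\<^sub>R v)" "\<And>v. v \<in> G \<Longrightarrow> 0 < d v"
      "\<And>v. v \<in> G \<Longrightarrow> v \<notin> G - unit_gens \<tau> \<Longrightarrow> d v \<le> 1"
    using k' by (auto elim: simplex_coneE)
  let ?r = "k - k'"
  let ?e = "\<lambda>v. if v \<in> unit_gens \<tau> then ?r \<bullet> v else 0"
  have "(\<Sum>v\<in>G. ?e v *\<^sub>R v) = ?r"
    using eq by (intro unit_gens_sum[OF G_finite[OF \<tau>' G]]) simp
  then have "(\<Sum>v\<in>G. c v *\<^sub>R v) = (\<Sum>v\<in>G. (d v + ?e v) *\<^sub>R v)"
    by (simp add: scaleR_add_left sum.distrib c(1)[symmetric] d(1)[symmetric])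
  then have cd: "c v = d v + ?e v" if "v \<in> G" for v
    using that by (rule independent_coefficients[OF G(2) G_finite[OF \<tau>' G]])
  have "c v = d v" if v: "v \<in> G" for v
  proof (cases "v \<in> unit_gens \<tau>")
    case True
    then obtain \<rho> where "v = axis \<rho> 1"
      by (auto simp: unit_gens_def)
    then have "?e v \<in> \<int>"
      using True k k' by (auto simp: inner_axis_one integer_points_def)
    then obtain z where z: "?e v = of_int z"
      by (auto elim: Ints_cases)
    have "c v \<le> 1" "d v \<le> 1" "0 < c v" "0 < d v"
      using c d v True by auto
    then have "\<bar>of_int z :: real\<bar> < 1"
      using cd[OF v] z by linarith
    then have "z = 0"
      by linarith
    then show ?thesis
      using cd[OF v] z by simp
  qed (use cd[OF v] in simp)
  then show ?thesis
    unfolding c(1) d(1) by (intro sum.cong) auto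
qed

text \<open>Subtracting integral multiples of the unit generators moves their coefficients into (0,
  1]; \<open>face_cone_shift\<close> shows that \<open>m\<close> is unchanged.\<close>

lemma reduction_exists:
  assumes k: "k \<in> integer_points" "k \<in> spos_span G"
  shows "\<exists>k'\<in>integer_points \<inter> simplex_cone G (G - unit_gens \<tau>). m k' = m k \<and>
    (\<forall>i. k' $ i \<le> k $ i) \<and> (\<forall>i. i \<notin> Qset \<tau> G \<longrightarrow> k' $ i = k $ i)"
proof -
  obtain c where c: "k = (\<Sum>v\<in>G. c v *\<^sub>R v)" "\<And>v. v \<in> G \<Longrightarrow> 0 < c v"
    using k(2) by (auto simp: spos_span_def)
  \<comment> \<open>Rounding up and subtracting 1, rather than rounding down, fits an interval open
    at 0: an integral coefficient is reduced to 1.\<close>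
  define r :: "real ^ 'n" where "r = (\<chi> i. if i \<in> Qset \<tau> G then of_int \<lceil>c (axis i 1)\<rceil> - 1 else 0)"
  let ?e = "\<lambda>v. if v \<in> unit_gens \<tau> then r \<bullet> v else 0"
  have r0: "r $ i = 0" if "i \<notin> Qset \<tau> G" for i
    using that by (simp add: r_def)
  have rn: "0 \<le> r $ i" for i
  proof (cases "i \<in> Qset \<tau> G")
    case True
    then have "0 < \<lceil>c (axis i 1)\<rceil>"
      using c(2) by (auto simp: Qset_def)
    then show ?thesis
      using True by (simp add: r_def)
  qed (simp add: r_def)
  have ro: "r \<in> nonneg_orthant" "r \<in> integer_points"
    using rn by (auto simp: nonneg_orthant_def integer_points_def r_def)
  have kr: "k - r = (\<Sum>v\<in>G. (c v - ?e v) *\<^sub>R v)"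
    using unit_gens_sum[OF G_finite[OF \<tau>' G] r0] by (simp add: c(1) scaleR_diff_left sum_subtractf)
  have bounds: "0 < c v - ?e v" "v \<in> unit_gens \<tau> \<Longrightarrow> c v - ?e v \<le> 1" if v: "v \<in> G" for v
  proof -
    have "0 < c v - ?e v \<and> (v \<in> unit_gens \<tau> \<longrightarrow> c v - ?e v \<le> 1)"
    proof (cases "v \<in> unit_gens \<tau>")
      case True
      then obtain \<rho> where \<rho>: "v = axis \<rho> 1" "\<rho> \<in> Qset \<tau> G"
        using v by (auto simp: unit_gens_def Qset_def)
      then have "?e v = of_int \<lceil>c v\<rceil> - 1"
        using True by (simp add: inner_axis_one r_def)
      then show ?thesis
        by linarith
    qed (use c(2)[OF v] in simp)
    then show "0 < c v - ?e v" "v \<in> unit_gens \<tau> \<Longrightarrow> c v - ?e v \<le> 1"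
      by auto
  qed
  have sc: "k - r \<in> simplex_cone G (G - unit_gens \<tau>)"
    unfolding kr simplex_cone_def using bounds by (intro CollectI exI[of _ "\<lambda>v. c v - ?e v"] conjI refl ballI) auto
  have "m (k - r + r) = m (k - r)"
    using sc simplex_cone_subset r0 by (intro face_cone_shift(2)[OF _ ro(1)]) (auto simp: Qset_def)
  then show ?thesis
    using sc k(1) ro rn r0 by (intro bexI[of _ "k - r"]) (auto intro: integer_points_diff)
qed

end

end

subsection \<open>Stratifying the arcs\<close>

text \<open>The default l + 1 for a component that vanishes modulo t^(l+1) is the largest order a
  point of a stratum can prescribe, so the lower bounds on orders remain valid.\<close>

definition arc_order :: "nat \<Rightarrow> ('n \<times> nat \<Rightarrow> complex) \<Rightarrow> 'n \<Rightarrow> nat" where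
  "arc_order l a i = (if \<exists>j. a (i, j) \<noteq> 0 then LEAST j. a (i, j) \<noteq> 0 else Suc l)"

lemma arc_order_zero: "j < arc_order l a i \<Longrightarrow> a (i, j) = 0"
  by (auto simp: arc_order_def dest: not_less_Least split: if_splits)

lemma arc_order_bounds:
  assumes a: "a \<in> affine_points (UNIV \<times> {1..l})"
  shows "1 \<le> arc_order l a i" "arc_order l a i \<le> Suc l"
    "arc_order l a i \<le> l \<Longrightarrow> a (i, arc_order l a i) \<noteq> 0"
proof -
  have out: "a (i, j) = 0" if "j = 0 \<or> l < j" for j
    using a that by (auto simp: affine_points_def)
  have ex: "a (i, LEAST j. a (i, j) \<noteq> 0) \<noteq> 0" if "\<exists>j. a (i, j) \<noteq> 0"
    using LeastI_ex[OF that] .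
  then have ex': "0 < (LEAST j. a (i, j) \<noteq> 0) \<and> (LEAST j. a (i, j) \<noteq> 0) \<le> l" if "\<exists>j. a (i, j) \<noteq> 0"
    using that out[of "LEAST j. a (i, j) \<noteq> 0"] by (metis neq0_conv not_le)
  show "1 \<le> arc_order l a i" "arc_order l a i \<le> Suc l"
  proof -
    have "1 \<le> arc_order l a i \<and> arc_order l a i \<le> Suc l"
    proof (cases "\<exists>j. a (i, j) \<noteq> 0")
      case True
      then show ?thesis
        using ex'[OF True] by (simp add: arc_order_def)
    next
      case False
      then have "arc_order l a i = Suc l"
        by (simp add: arc_order_def)
      then show ?thesis
        by simp
    qed
    then show "1 \<le> arc_order l a i" "arc_order l a i \<le> Suc l"
      by auto
  qed
  show "a (i, arc_order l a i) \<noteq> 0" if "arc_order l a i \<le> l"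
    using that ex by (auto simp: arc_order_def split: if_splits)
qed

lemma arc_order_eq:
  assumes "\<And>j. j < b \<Longrightarrow> a (i, j) = 0"
  shows "a (i, b) \<noteq> 0 \<Longrightarrow> arc_order l a i = b" "b \<le> Suc l \<Longrightarrow> b \<le> arc_order l a i"
proof -
  have le: "b \<le> j" if "a (i, j) \<noteq> 0" for j
    using assms[of j] that by (metis not_le)
  show "arc_order l a i = b" if "a (i, b) \<noteq> 0"
    using that le by (auto simp: arc_order_def intro!: Least_equality)
  show "b \<le> arc_order l a i" if "b \<le> Suc l"
  proof (cases "\<exists>j. a (i, j) \<noteq> 0")
    case True
    from le[OF LeastI_ex[OF this]] True show ?thesis
      by (simp add: arc_order_def)
  qed (use that in \<open>simp add: arc_order_def\<close>)
qed

lemma basic_set_arc_set: "basic_set (UNIV \<times> {1..l}) (arc_set (f :: 'n::finite cpoly) l)"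
proof -
  let ?p = "\<lambda>a. mpoly_eval_in (\<lambda>c. [:c:]) f (trunc_arc l a)"
  have "coeff_polyfun ?p"
    unfolding mpoly_eval_in_def trunc_arc_def
    by (intro coeff_polyfun_sum coeff_polyfun_mult coeff_polyfun_const coeff_polyfun_prod
        coeff_polyfun_power coeff_polyfun_monom polyfun_coord)
  then have p: "polyfun (\<lambda>a. coeff (?p a) j)" for j
    by (simp add: coeff_polyfun_def)
  have "basic_set (UNIV \<times> {1..l}) {a \<in> {a \<in> affine_points (UNIV \<times> {1..l}). \<forall>j\<in>{..<l}. coeff (?p a) j = 0}.
     coeff (?p a) l \<noteq> 0}"
    by (intro basic_set_nonzero basic_set_all_zero basic_set_affine p) auto
  then show ?thesis
    by (rule back_subst[of "basic_set (UNIV \<times> {1..l})"]) (auto simp: arc_set_def order_0_eq_iff)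
qed

context newton
begin

text \<open>
  The faces not contained in a coordinate hyperplane are treated with the undecomposed cone, whose
  generating set is then represented by \<open>{}\<close>.
\<close>

definition gen_sets :: "((real ^ 'n) set \<Rightarrow> (real ^ 'n) set set) \<Rightarrow> (real ^ 'n) set \<Rightarrow> (real ^ 'n) set set" where
  "gen_sets D \<tau> = (if zero_coords \<tau> = {} then {{}} else D \<tau>)"

definition cone_points :: "(real ^ 'n) set \<Rightarrow> (real ^ 'n) set \<Rightarrow> (real ^ 'n) set" where
  "cone_points \<tau> G = integer_points \<inter>
     (if zero_coords \<tau> = {} then face_cone f \<tau> else simplex_cone G (G - unit_gens \<tau>))"

definition pieces :: "((real ^ 'n) set \<Rightarrow> (real ^ 'n) set set) \<Rightarrow> nat \<Rightarrow>
    ((real ^ 'n) set \<times> (real ^ 'n) set \<times> (real ^ 'n)) set" where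
  "pieces D l = (SIGMA \<tau>:compact_faces f. SIGMA G:gen_sets D \<tau>. {k \<in> cone_points \<tau> G. m_nat k \<le> l})"

lemma face_cone_locally_finite:
  assumes "zero_coords \<tau> = {}"
  shows "locally_finite (integer_points \<inter> face_cone f \<tau>)"
proof (rule locally_finite_bounded)
  fix k :: "real ^ 'n" and i assume k: "k \<in> face_cone f \<tau>"
  then show "k \<in> nonneg_orthant"
    by (rule face_coneD)
  have "\<not> m k < k $ i"
    using face_cone_coordinate[OF k] assms by blast
  then show "k $ i \<le> m k + 1"
    by simp
qed

lemma decompositionD:
  assumes "simplicial_decomposition f \<tau> \<D>"
  shows "finite \<D>" "(\<Union>G\<in>\<D>. spos_span G) = face_cone f \<tau>"
    "G \<in> \<D> \<Longrightarrow> H \<in> \<D> \<Longrightarrow> G \<noteq> H \<Longrightarrow> spos_span G \<inter> spos_span H = {}"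
  using assms by (simp_all add: simplicial_decomposition_def)

lemma decomposition_gensD:
  assumes D: "simplicial_decomposition f \<tau> \<D>" and G: "G \<in> \<D>"
  shows "G \<subseteq> facet_normals f \<tau>" "independent G" "spos_span G \<subseteq> face_cone f \<tau>"
proof -
  show "G \<subseteq> facet_normals f \<tau>" "independent G"
    using D G by (simp_all add: simplicial_decomposition_def)
  show "spos_span G \<subseteq> face_cone f \<tau>"
    unfolding decompositionD(2)[OF D, symmetric] using G by (rule UN_upper)
qed

text \<open>No unit generators occur here, so \<open>m\<close> is positive on all generators and
  each open cone can be summed in full. The union is split coefficientwise, where the sums are
  finite.\<close>

lemma S_cone_decomposition:
  assumes \<tau>: "\<tau> \<in> compact_faces f" and P: "zero_coords \<tau> = {}" and D: "simplicial_decomposition f \<tau> \<D>"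
  shows "S_cone f \<tau> = (\<Sum>G\<in>\<D>. Sigma_box f G * (\<Prod>v\<in>G. geom (lattice_term f v)))"
proof -
  have U: "G - unit_gens \<tau> = G" for G
    using P by (simp add: unit_gens_def)
  have fin: "finite \<D>" and disj: "\<And>G H. G \<in> \<D> \<Longrightarrow> H \<in> \<D> \<Longrightarrow> G \<noteq> H \<Longrightarrow> spos_span G \<inter> spos_span H = {}"
    and un: "face_cone f \<tau> = (\<Union>G\<in>\<D>. spos_span G)"
    using decompositionD[OF D] by auto
  have lf: "locally_finite (integer_points \<inter> face_cone f \<tau>)"
    using P by (rule face_cone_locally_finite)
  have lfG: "locally_finite (integer_points \<inter> spos_span G)" if "G \<in> \<D>" for G
    using un that by (intro locally_finite_subset[OF lf]) auto
  have "S_cone f \<tau> = (\<Sum>G\<in>\<D>. infsum (lattice_term f) (integer_points \<inter> spos_span G))"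
  proof (rule fps_ext)
    fix n
    have "fps_nth (S_cone f \<tau>) n = (\<Sum>k\<in>{k \<in> integer_points \<inter> face_cone f \<tau>. m_nat k = n}. \<L>\<^sup>-\<^sup>1 ^ s_nat k)"
      unfolding S_cone_def by (rule lattice_sum_nth[OF lf])
    also have "{k \<in> integer_points \<inter> face_cone f \<tau>. m_nat k = n} =
       (\<Union>G\<in>\<D>. {k \<in> integer_points \<inter> spos_span G. m_nat k = n})"
      unfolding un by auto
    also have "(\<Sum>k\<in>\<dots>. \<L>\<^sup>-\<^sup>1 ^ s_nat k) = (\<Sum>G\<in>\<D>. \<Sum>k\<in>{k \<in> integer_points \<inter> spos_span G. m_nat k = n}. \<L>\<^sup>-\<^sup>1 ^ s_nat k)"
    proof (rule sum.UNION_disjoint[OF fin])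
      show "\<forall>G\<in>\<D>. finite {k \<in> integer_points \<inter> spos_span G. m_nat k = n}"
        using lfG by (simp add: locally_finite_def)
      show "\<forall>G\<in>\<D>. \<forall>H\<in>\<D>. G \<noteq> H \<longrightarrow> {k \<in> integer_points \<inter> spos_span G. m_nat k = n} \<inter>
          {k \<in> integer_points \<inter> spos_span H. m_nat k = n} = {}"
        using disj by blast
    qed
    also have "\<dots> = fps_nth (\<Sum>G\<in>\<D>. infsum (lattice_term f) (integer_points \<inter> spos_span G)) n"
      unfolding fps_sum_nth using lfG by (intro sum.cong refl) (simp add: lattice_sum_nth)
    finally show "fps_nth (S_cone f \<tau>) n = fps_nth (\<Sum>G\<in>\<D>. infsum (lattice_term f) (integer_points \<inter> spos_span G)) n" .
  qed
  also have "\<dots> = (\<Sum>G\<in>\<D>. Sigma_box f G * (\<Prod>v\<in>G. geom (lattice_term f v)))"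
    using truncated_sum[OF \<tau> decomposition_gensD[OF D]] unfolding U spos_span_eq by (intro sum.cong) auto
  finally show ?thesis .
qed

lemma L_term_eq: "zero_coords \<tau> = {} \<Longrightarrow> L_term f \<tau> = L_term' f \<tau>"
  by (simp add: L_term_def L_term'_def Compl_eq_Diff_UNIV)

context
  fixes D :: "(real ^ 'n) set \<Rightarrow> (real ^ 'n) set set"
  assumes nondeg: "nondegenerate f"
    and D: "\<And>\<tau>. \<tau> \<in> compact_faces f \<Longrightarrow> zero_coords \<tau> \<noteq> {} \<Longrightarrow> simplicial_decomposition f \<tau> (D \<tau>)"
begin

lemma gen_set_cases:
  assumes "\<tau> \<in> compact_faces f" "G \<in> gen_sets D \<tau>"
  obtains "zero_coords \<tau> = {}" "G = {}" "Qset \<tau> G = {}" "cone_points \<tau> G = integer_points \<inter> face_cone f \<tau>"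
  | "zero_coords \<tau> \<noteq> {}" "G \<in> D \<tau>" "G \<subseteq> facet_normals f \<tau>" "independent G" "spos_span G \<subseteq> face_cone f \<tau>"
    "cone_points \<tau> G = integer_points \<inter> simplex_cone G (G - unit_gens \<tau>)"
proof (cases "zero_coords \<tau> = {}")
  case True
  then show thesis
    using assms by (intro that(1)) (auto simp: gen_sets_def cone_points_def Qset_def)
next
  case False
  then show thesis
    using assms decomposition_gensD[OF D[OF assms(1) False], of G]
    by (intro that(2)) (auto simp: gen_sets_def cone_points_def)
qed

lemma cone_pointsD:
  assumes "\<tau> \<in> compact_faces f" "G \<in> gen_sets D \<tau>" "k \<in> cone_points \<tau> G"
  shows "k \<in> integer_points" "k \<in> face_cone f \<tau>" "k $ i \<le> m k + (if i \<in> Qset \<tau> G then 1 else 0)"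
proof -
  have "k \<in> integer_points \<and> k \<in> face_cone f \<tau> \<and> k $ i \<le> m k + (if i \<in> Qset \<tau> G then 1 else 0)"
    using assms(1,2)
  proof (cases rule: gen_set_cases)
    case 1
    then have k: "k \<in> integer_points" "k \<in> face_cone f \<tau>"
      using assms(3) by auto
    then have "\<not> m k < k $ i"
      using face_cone_coordinate[OF k(2)] 1(1) by blast
    with k show ?thesis
      by simp
  next
    case 2
    then have k: "k \<in> integer_points" "k \<in> simplex_cone G (G - unit_gens \<tau>)"
      using assms(3) by auto
    then show ?thesis
      using truncated_bound[OF assms(1) 2(3-5) k(2), of i] simplex_cone_subset[OF assms(1) 2(3-5)] by auto
  qed
  then show "k \<in> integer_points" "k \<in> face_cone f \<tau>" "k $ i \<le> m k + (if i \<in> Qset \<tau> G then 1 else 0)"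
    by auto
qed

lemma cone_points_locally_finite:
  assumes "\<tau> \<in> compact_faces f" "G \<in> gen_sets D \<tau>"
  shows "locally_finite (cone_points \<tau> G)"
  using assms
proof (cases rule: gen_set_cases)
  case 1
  then show ?thesis
    using face_cone_locally_finite by simp
next
  case 2
  then show ?thesis
    using locally_finite_truncated[OF assms(1) 2(3-5)] by simp
qed

lemma finite_gen_sets: "\<tau> \<in> compact_faces f \<Longrightarrow> finite (gen_sets D \<tau>)"
  using decompositionD(1)[OF D] by (simp add: gen_sets_def)

lemma finite_cone_points:
  assumes "\<tau> \<in> compact_faces f" "G \<in> gen_sets D \<tau>"
  shows "finite {k \<in> cone_points \<tau> G. m_nat k \<le> l}"
proof -
  have "{k \<in> cone_points \<tau> G. m_nat k \<le> l} = (\<Union>n\<le>l. {k \<in> cone_points \<tau> G. m_nat k = n})"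
    by auto
  then show ?thesis
    using cone_points_locally_finite[OF assms] by (simp add: locally_finite_def)
qed

lemma finite_pieces: "finite (pieces D l)"
  unfolding pieces_def
  by (intro finite_SigmaI finite_compact_faces finite_gen_sets finite_cone_points)

text \<open>The bound in \<open>cone_pointsD\<close> makes the orders fit the truncation: at most
  \<open>l\<close> outside \<open>Qset \<tau> G\<close> and at most l + 1 inside.\<close>

lemma arc_piece_cone_point:
  assumes \<tau>: "\<tau> \<in> compact_faces f" and G: "G \<in> gen_sets D \<tau>" and k: "k \<in> cone_points \<tau> G" and l: "m_nat k \<le> l"
  shows "arc_piece f (coords k) l (m_nat k) (zero_coords \<tau>) (Qset \<tau> G) (face_poly f \<tau>)"
proof
  have kz: "k \<in> integer_points" and kc: "k \<in> face_cone f \<tau>"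
    using cone_pointsD[OF \<tau> G k] by auto
  have ko: "k \<in> nonneg_orthant"
    using kc by (rule face_coneD)
  note c = coords[OF ko kz] and mk = m_nat[OF ko kz]
  have b: "real (coords k i) \<le> real (m_nat k) + (if i \<in> Qset \<tau> G then 1 else 0)" for i
    using cone_pointsD(3)[OF \<tau> G k] by (simp add: c mk)
  show "m_nat k \<le> weight (coords k) \<omega>" if "\<omega> \<in> Poly_Mapping.keys f" for \<omega>
    by (rule m_nat_le_weight[OF ko kz that])
  show "face_poly f \<tau> = restrict_poly f {\<omega> \<in> Poly_Mapping.keys f. weight (coords k) \<omega> = m_nat k}"
    by (rule face_poly_eq[OF kc kz])
  show "Poly_Mapping.lookup \<omega> i = 0" if "\<omega> \<in> Poly_Mapping.keys (face_poly f \<tau>)" "i \<in> zero_coords \<tau>" for \<omega> i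
    using that by (rule face_poly_zero_coords)
  show "\<exists>i. mpoly_eval (partial_deriv i (face_poly f \<tau>)) x \<noteq> 0"
    if "\<forall>i. x i \<noteq> 0" "mpoly_eval (face_poly f \<tau>) x = 0" for x
    using nondeg \<tau> that unfolding nondegenerate_def by blast
  show "1 \<le> coords k i" for i
    using face_cone_pos[OF kc \<tau>, of i] c[of i] by simp
  show "Qset \<tau> G \<subseteq> zero_coords \<tau>"
    by (auto simp: Qset_def)
  show "coords k i \<le> m_nat k" if "i \<notin> zero_coords \<tau>" for i
  proof -
    have "\<not> m k < k $ i"
      using face_cone_coordinate[OF kc] that by blast
    then have "real (coords k i) \<le> real (m_nat k)"
      by (simp add: c mk)
    then show ?thesis
      by simp
  qed
  show "coords k i \<le> l" if "i \<notin> Qset \<tau> G" for i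
    using b[of i] that l by simp
  show "coords k i \<le> Suc l" for i
    using b[of i] l by (auto split: if_splits)
  show "m_nat k \<le> l"
    by (rule l)
qed

abbreviation piece_arcs where
  "piece_arcs l \<equiv> \<lambda>(\<tau>, G, k). arc_piece.A (coords k) l (Qset \<tau> G) \<inter> arc_set f l"

lemma piece_arc_order:
  assumes \<tau>: "\<tau> \<in> compact_faces f" and G: "G \<in> gen_sets D \<tau>" and k: "k \<in> cone_points \<tau> G" "m_nat k \<le> l"
    and a: "a \<in> arc_piece.A (coords k) l (Qset \<tau> G)"
  shows "i \<notin> Qset \<tau> G \<Longrightarrow> (\<chi> i. real (arc_order l a i)) $ i = k $ i" "k $ i \<le> (\<chi> i. real (arc_order l a i)) $ i"
proof -
  interpret arc_piece f "coords k" l "m_nat k" "zero_coords \<tau>" "Qset \<tau> G" "face_poly f \<tau>"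
    by (rule arc_piece_cone_point[OF \<tau> G k])
  have c: "real (coords k i) = k $ i"
    using cone_pointsD[OF \<tau> G k(1)] face_coneD(1) coords by blast
  have z: "a (i, j) = 0" if "j < coords k i" for j
    using a that by (simp add: A_def)
  show "(\<chi> i. real (arc_order l a i)) $ i = k $ i" if "i \<notin> Qset \<tau> G"
    using arc_order_eq(1)[of "coords k i" a i l, OF z] a that c by (simp add: A_def)
  show "k $ i \<le> (\<chi> i. real (arc_order l a i)) $ i"
    using arc_order_eq(2)[of "coords k i" a i l, OF z] k_le_Suc[of i] c by simp
qed

text \<open>The order vector of the arc recovers the stratum. It arises from \<open>k\<close> by a
  shift along unit generators, so it lies in the cone of \<tau> and, if there are zero coordinates,
  in the span of \<open>G\<close>. Disjointness of these sets determines \<tau> and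
  \<open>G\<close>, and \<open>reduction_unique\<close> determines \<open>k\<close>.\<close>

lemma piece_unique:
  assumes "(\<tau>, G, k) \<in> pieces D l" "(\<tau>', G', k') \<in> pieces D l"
    and "a \<in> piece_arcs l (\<tau>, G, k)" "a \<in> piece_arcs l (\<tau>', G', k')"
  shows "(\<tau>, G, k) = (\<tau>', G', k')"
proof -
  let ?o = "\<chi> i. real (arc_order l a i)"
  have main: "?o \<in> face_cone f \<tau> \<and> (zero_coords \<tau> \<noteq> {} \<longrightarrow> ?o \<in> spos_span G)"
    if p: "(\<tau>, G, k) \<in> pieces D l" "a \<in> piece_arcs l (\<tau>, G, k)" for \<tau> G k
  proof -
    have \<tau>: "\<tau> \<in> compact_faces f" and G: "G \<in> gen_sets D \<tau>" and k: "k \<in> cone_points \<tau> G" "m_nat k \<le> l"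
      and a: "a \<in> arc_piece.A (coords k) l (Qset \<tau> G)"
      using p by (auto simp: pieces_def)
    note o = piece_arc_order[OF \<tau> G k a]
    define r where "r = ?o - k"
    have r: "0 \<le> r $ i" "i \<notin> Qset \<tau> G \<Longrightarrow> r $ i = 0" for i
      using o[of i] by (auto simp: r_def)
    have ok: "?o = k + r"
      by (simp add: r_def)
    have "k + r \<in> face_cone f \<tau>"
      using r by (intro face_cone_shift(1)[OF cone_pointsD(2)[OF \<tau> G k(1)]])
        (auto simp: nonneg_orthant_def Qset_def)
    moreover have "k + r \<in> spos_span G" if "zero_coords \<tau> \<noteq> {}"
      using \<tau> G
    proof (cases rule: gen_set_cases)
      case 2
      have "k \<in> simplex_cone G (G - unit_gens \<tau>)"
        using k(1) 2(6) by simp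
      then show ?thesis
        using r by (rule spos_span_shift[OF \<tau> 2(3-5)])
    qed (use that in simp)
    ultimately show ?thesis
      unfolding ok by blast
  qed
  have \<tau>: "\<tau> \<in> compact_faces f" "G \<in> gen_sets D \<tau>" "k \<in> cone_points \<tau> G" "m_nat k \<le> l"
      "a \<in> arc_piece.A (coords k) l (Qset \<tau> G)"
    and \<tau>': "\<tau>' \<in> compact_faces f" "G' \<in> gen_sets D \<tau>'" "k' \<in> cone_points \<tau>' G'" "m_nat k' \<le> l"
      "a \<in> arc_piece.A (coords k') l (Qset \<tau>' G')"
    using assms by (auto simp: pieces_def)
  note m1 = main[OF assms(1,3)] and m2 = main[OF assms(2,4)]
  have \<tau>\<tau>: "\<tau> = \<tau>'"
    using m1 m2 face_coneD(2) by metis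
  note o1 = piece_arc_order(1)[OF \<tau>] and o2 = piece_arc_order(1)[OF \<tau>']
  show ?thesis
    using \<tau>(1,2)
  proof (cases rule: gen_set_cases)
    case 1
    then have "G' = {}"
      using \<tau>'(2) \<tau>\<tau> by (simp add: gen_sets_def)
    moreover have "k $ i = k' $ i" for i
      using o1[of i] o2[of i] 1(2,3) \<open>G' = {}\<close> \<tau>\<tau> by simp
    then have "k = k'"
      by (simp add: vec_eq_iff)
    ultimately show ?thesis
      using 1 \<tau>\<tau> by simp
  next
    case 2
    have "G' \<in> D \<tau>"
      using \<tau>'(2) 2(1) \<tau>\<tau> by (simp add: gen_sets_def)
    moreover have "?o \<in> spos_span G \<inter> spos_span G'"
      using m1 m2 2(1) \<tau>\<tau> by simp
    ultimately have GG: "G = G'"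
      using decompositionD(3)[OF D[OF \<tau>(1) 2(1)] 2(2)] by blast
    have "k = k'"
    proof (rule reduction_unique[OF \<tau>(1) 2(3-5)])
      show "k \<in> integer_points \<inter> simplex_cone G (G - unit_gens \<tau>)"
        "k' \<in> integer_points \<inter> simplex_cone G (G - unit_gens \<tau>)"
        using \<tau>(3) \<tau>'(3) 2(6) GG \<tau>\<tau> by simp_all
      show "k $ i = k' $ i" if "i \<notin> Qset \<tau> G" for i
        using o1[of i] o2[of i] that GG \<tau>\<tau> by simp
    qed
    then show ?thesis
      using GG \<tau>\<tau> by simp
  qed
qed

text \<open>The order vector is positive, so its first meet locus is a compact face. If that face
  has zero coordinates, reducing the vector along the unit generators of the simplicial cone
  containing it gives the stratum.\<close>

lemma piece_exists:
  assumes a: "a \<in> arc_set f l"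
  shows "\<exists>p\<in>pieces D l. a \<in> piece_arcs l p"
proof -
  have aff: "a \<in> affine_points (UNIV \<times> {1..l})"
    using a by (simp add: arc_set_def)
  define k :: "real ^ 'n" where "k = (\<chi> i. real (arc_order l a i))"
  have kz: "k \<in> integer_points" and ko: "k \<in> nonneg_orthant"
    by (auto simp: k_def integer_points_def nonneg_orthant_def)
  have kp: "0 < k $ i" for i
    using arc_order_bounds(1)[OF aff, of i] by (simp add: k_def)
  have ck: "coords k = arc_order l a"
    by (auto simp: coords_def k_def)
  define \<tau> where "\<tau> = F k"
  have \<tau>: "\<tau> \<in> compact_faces f"
    unfolding \<tau>_def by (rule positive_locus_compact[OF ko kp])
  have kc: "k \<in> face_cone f \<tau>"
    using ko by (simp add: face_cone_def \<tau>_def)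
  have z: "a (i, j) = 0" if "j < arc_order l a i" for i j
    using that by (rule arc_order_zero)
  \<comment> \<open>Every monomial of f becomes divisible by t^m(k) along the arc, so order
    \<open>l\<close> forces m(k) <= l.\<close>
  have "a \<in> arc_set f l \<longleftrightarrow> m_nat k \<le> l \<and>
    (\<forall>r<l - m_nat k. coeff (scaled_eval f (arc_order l a) (m_nat k) (arc_factor (arc_order l a) l a)) r = 0) \<and>
    coeff (scaled_eval f (arc_order l a) (m_nat k) (arc_factor (arc_order l a) l a)) (l - m_nat k) \<noteq> 0"
    using m_nat_le_weight[OF ko kz] unfolding ck by (rule arc_set_iff[OF _ aff z])
  then have ml: "m_nat k \<le> l"
    using a by blast
  \<comment> \<open>An order bounded by m(k) is at most \<open>l\<close>, so the default l + 1 is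
    excluded and the leading coefficient is a true one.\<close>
  have nz: "a (i, arc_order l a i) \<noteq> 0" if "k $ i \<le> m k" for i
  proof -
    have "real (arc_order l a i) \<le> real (m_nat k)"
      using that m_nat[OF ko kz] by (simp add: k_def)
    then show ?thesis
      using ml by (intro arc_order_bounds(3)[OF aff]) simp
  qed
  obtain G k' where G: "G \<in> gen_sets D \<tau>" and k': "k' \<in> cone_points \<tau> G" "m k' = m k"
    "\<And>i. k' $ i \<le> k $ i" "\<And>i. i \<notin> Qset \<tau> G \<Longrightarrow> k' $ i = k $ i"
  proof (cases "zero_coords \<tau> = {}")
    case True
    then show thesis
      using kz kc by (intro that[of "{}" k]) (auto simp: gen_sets_def cone_points_def)
  next
    case False
    obtain G where G: "G \<in> D \<tau>" "k \<in> spos_span G"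
      using decompositionD(2)[OF D[OF \<tau> False]] kc by blast
    from reduction_exists[OF \<tau> decomposition_gensD[OF D[OF \<tau> False] G(1)] kz G(2)] show thesis
      using False G(1) by (auto intro!: that[of G] simp: gen_sets_def cone_points_def)
  qed
  have k'z: "k' \<in> integer_points" and k'o: "k' \<in> nonneg_orthant"
    using cone_pointsD[OF \<tau> G k'(1)] face_coneD(1) by blast+
  have "m_nat k' = m_nat k"
    by (simp add: m_nat_def k'(2))
  then have ml': "m_nat k' \<le> l"
    using ml by simp
  interpret arc_piece f "coords k'" l "m_nat k'" "zero_coords \<tau>" "Qset \<tau> G" "face_poly f \<tau>"
    by (rule arc_piece_cone_point[OF \<tau> G k'(1) ml'])
  have le: "coords k' i \<le> arc_order l a i" for i
    using k'(3)[of i] coords[OF k'o k'z, of i] by (simp add: k_def)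
  have "a (i, coords k' i) \<noteq> 0" if i: "i \<notin> Qset \<tau> G" for i
  proof -
    have "real (coords k' i) = real (arc_order l a i)"
      using k'(4)[OF i] coords[OF k'o k'z, of i] by (simp add: k_def)
    moreover have "k $ i \<le> m k"
      using cone_pointsD(3)[OF \<tau> G k'(1), of i] i k'(2,4) by simp
    ultimately show ?thesis
      using nz[of i] by simp
  qed
  moreover have "a (i, j) = 0" if "j < coords k' i" for i j
    using that le[of i] by (intro arc_order_zero[of j l a i]) simp
  ultimately have "a \<in> A"
    using aff by (simp add: A_def)
  then have "a \<in> piece_arcs l (\<tau>, G, k')"
    using a by simp
  moreover have "(\<tau>, G, k') \<in> pieces D l"
    using \<tau> G k'(1) ml' by (simp add: pieces_def)
  ultimately show ?thesis
    by blast
qed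

section \<open>Comparison of the coefficients of both sides\<close>

lemma zeta_coefficient:
  "\<L>\<^sup>-\<^sup>1 ^ CARD('n) * (mot_class (UNIV \<times> {1..l}) (arc_set f l) * (\<L>\<^sup>-\<^sup>1 ^ CARD('n)) ^ l) =
    (\<Sum>\<tau>\<in>compact_faces f. \<Sum>G\<in>gen_sets D \<tau>. \<Sum>k\<in>{k \<in> cone_points \<tau> G. m_nat k \<le> l}.
      (1 - \<L>\<^sup>-\<^sup>1) ^ (card (zero_coords \<tau>) - card (Qset \<tau> G)) *
        (\<L>\<^sup>-\<^sup>1 ^ s_nat k * fps_nth (L_term' f \<tau>) (l - m_nat k)))" (is "?lhs = ?rhs")
proof -
  let ?I = "UNIV \<times> {1..l} :: ('n \<times> nat) set"
  let ?h = "\<lambda>x. \<L>\<^sup>-\<^sup>1 ^ CARD('n) * (x * (\<L>\<^sup>-\<^sup>1 ^ CARD('n)) ^ l)"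
  have U: "arc_set f l = (\<Union>p\<in>pieces D l. piece_arcs l p)"
    using piece_exists by fastforce
  have piece: "arc_piece f (coords k) l (m_nat k) (zero_coords \<tau>) (Qset \<tau> G) (face_poly f \<tau>)"
    if "(\<tau>, G, k) \<in> pieces D l" for \<tau> G k
    using that by (intro arc_piece_cone_point) (auto simp: pieces_def)
  have "mot_class ?I (\<Union>p\<in>pieces D l. piece_arcs l p) = (\<Sum>p\<in>pieces D l. mot_class ?I (piece_arcs l p))"
  proof (rule mot_class_partition[OF _ finite_pieces])
    show "basic_set ?I (piece_arcs l p)" if "p \<in> pieces D l" for p
      using that arc_piece.basic_set_arcs[OF piece] by (cases p) simp
    show "basic_set ?I (\<Union>p\<in>pieces D l. piece_arcs l p)"
      using basic_set_arc_set U by metis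
    show "p = q" if "p \<in> pieces D l" "q \<in> pieces D l" "x \<in> piece_arcs l p" "x \<in> piece_arcs l q" for p q x
      using that piece_unique by (cases p, cases q) blast
  qed simp
  then have "?lhs = (\<Sum>p\<in>pieces D l. ?h (mot_class ?I (piece_arcs l p)))"
    unfolding U[symmetric] by (simp only: sum_distrib_left sum_distrib_right)
  also have "\<dots> = (\<Sum>(\<tau>, G, k)\<in>pieces D l.
      (1 - \<L>\<^sup>-\<^sup>1) ^ (card (zero_coords \<tau>) - card (Qset \<tau> G)) *
        (\<L>\<^sup>-\<^sup>1 ^ s_nat k * fps_nth (L_term' f \<tau>) (l - m_nat k)))"
  proof (rule sum.cong[OF refl])
    fix p assume p: "p \<in> pieces D l"
    obtain \<tau> G k where pk: "p = (\<tau>, G, k)"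
      by (cases p)
    have "k \<in> integer_points" "k \<in> nonneg_orthant"
      using p cone_pointsD[of \<tau> G k] face_coneD(1) unfolding pk by (auto simp: pieces_def)
    then have s: "s_nat k = (\<Sum>i\<in>UNIV. coords k i)"
      by (intro s_nat_coords)
    show "?h (mot_class ?I (piece_arcs l p)) = (case p of (\<tau>, G, k) \<Rightarrow>
      (1 - \<L>\<^sup>-\<^sup>1) ^ (card (zero_coords \<tau>) - card (Qset \<tau> G)) *
        (\<L>\<^sup>-\<^sup>1 ^ s_nat k * fps_nth (L_term' f \<tau>) (l - m_nat k)))"
      using arc_piece.piece_class[OF piece[OF p[unfolded pk]]] unfolding pk prod.case s L_term'_def .
  qed
  also have "\<dots> = ?rhs"
    unfolding pieces_def using finite_compact_faces finite_gen_sets finite_cone_points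
    by (subst sum.Sigma[symmetric], simp, simp, intro sum.cong refl, subst sum.Sigma) auto
  finally show ?thesis .
qed

text \<open>Both kinds of faces are brought into one form: without zero coordinates,
  \<open>gen_sets\<close> has a single member, the power of 1 - L^-1 has exponent 0, and
  \<open>L_term\<close> equals \<open>L_term'\<close>.\<close>

lemma formula_coefficient:
  "fps_nth ((\<Sum>\<tau> | \<tau> \<in> compact_faces f \<and> zero_coords \<tau> = {}. L_term f \<tau> * S_cone f \<tau>) +
      (\<Sum>\<tau> | \<tau> \<in> compact_faces f \<and> zero_coords \<tau> \<noteq> {}. L_term' f \<tau> * S_cone' f \<tau> (D \<tau>))) l =
    (\<Sum>\<tau>\<in>compact_faces f. \<Sum>G\<in>gen_sets D \<tau>. \<Sum>k\<in>{k \<in> cone_points \<tau> G. m_nat k \<le> l}.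
      (1 - \<L>\<^sup>-\<^sup>1) ^ (card (zero_coords \<tau>) - card (Qset \<tau> G)) *
        (\<L>\<^sup>-\<^sup>1 ^ s_nat k * fps_nth (L_term' f \<tau>) (l - m_nat k)))" (is "_ = (\<Sum>\<tau>\<in>_. ?t \<tau>)")
proof -
  have 1: "fps_nth (L_term f \<tau> * S_cone f \<tau>) l = ?t \<tau>" if "\<tau> \<in> compact_faces f" "zero_coords \<tau> = {}" for \<tau>
    using that fps_nth_times_lattice_sum[OF face_cone_locally_finite[OF that(2)]]
    by (simp add: S_cone_def L_term_eq gen_sets_def cone_points_def)
  have 2: "fps_nth (L_term' f \<tau> * S_cone' f \<tau> (D \<tau>)) l = ?t \<tau>"
    if \<tau>: "\<tau> \<in> compact_faces f" and P: "zero_coords \<tau> \<noteq> {}" for \<tau>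
  proof -
    have g: "gen_sets D \<tau> = D \<tau>"
      using P by (simp add: gen_sets_def)
    let ?c = "\<lambda>G. (1 - \<L>\<^sup>-\<^sup>1) ^ (card (zero_coords \<tau>) - card (Qset \<tau> G))"
    have tr: "integer_points \<inter> truncated_simplex_cone \<tau> G = cone_points \<tau> G" if "G \<in> D \<tau>" for G
      using truncated_simplex_cone_eq[OF \<tau> decomposition_gensD[OF D[OF \<tau> P] that]] P by (simp add: cone_points_def)
    have "S_cone' f \<tau> (D \<tau>) = (\<Sum>G\<in>D \<tau>. fps_const (?c G) * infsum (lattice_term f) (cone_points \<tau> G))"
      unfolding S_cone'_def card_Qset by (intro sum.cong refl) (simp only: tr)
    then have "L_term' f \<tau> * S_cone' f \<tau> (D \<tau>) =
        (\<Sum>G\<in>D \<tau>. fps_const (?c G) * (L_term' f \<tau> * infsum (lattice_term f) (cone_points \<tau> G)))"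
      by (simp only: sum_distrib_left mult.left_commute)
    also have "fps_nth \<dots> l = ?t \<tau>"
      unfolding fps_sum_nth g
    proof (rule sum.cong[OF refl])
      fix G assume "G \<in> D \<tau>"
      then have "locally_finite (cone_points \<tau> G)"
        using cone_points_locally_finite[OF \<tau>] g by blast
      then show "fps_nth (fps_const (?c G) * (L_term' f \<tau> * infsum (lattice_term f) (cone_points \<tau> G))) l =
          (\<Sum>k\<in>{k \<in> cone_points \<tau> G. m_nat k \<le> l}. ?c G * (\<L>\<^sup>-\<^sup>1 ^ s_nat k * fps_nth (L_term' f \<tau>) (l - m_nat k)))"
        unfolding fps_mult_left_const_nth by (simp only: fps_nth_times_lattice_sum sum_distrib_left)
    qed
    finally show ?thesis .
  qed
  have "(\<Sum>\<tau>\<in>compact_faces f. ?t \<tau>) =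
      (\<Sum>\<tau> | \<tau> \<in> compact_faces f \<and> zero_coords \<tau> = {}. ?t \<tau>) + (\<Sum>\<tau> | \<tau> \<in> compact_faces f \<and> zero_coords \<tau> \<noteq> {}. ?t \<tau>)"
    using finite_compact_faces by (subst sum.union_disjoint[symmetric]) (auto intro!: sum.cong)
  then show ?thesis
    using 1 2 by (simp add: fps_sum_nth)
qed

lemma zeta_mot_formula:
  "zeta_mot f = (\<Sum>\<tau> | \<tau> \<in> compact_faces f \<and> zero_coords \<tau> = {}. L_term f \<tau> * S_cone f \<tau>) +
      (\<Sum>\<tau> | \<tau> \<in> compact_faces f \<and> zero_coords \<tau> \<noteq> {}. L_term' f \<tau> * S_cone' f \<tau> (D \<tau>))"
proof (rule fps_ext)
  fix l
  show "fps_nth (zeta_mot f) l = fps_nth ((\<Sum>\<tau> | \<tau> \<in> compact_faces f \<and> zero_coords \<tau> = {}. L_term f \<tau> * S_cone f \<tau>) +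
      (\<Sum>\<tau> | \<tau> \<in> compact_faces f \<and> zero_coords \<tau> \<noteq> {}. L_term' f \<tau> * S_cone' f \<tau> (D \<tau>))) l"
  proof (cases "l = 0")
    case True
    \<comment> \<open>\<open>zeta_mot\<close> has no constant term; on the other side m(k) is
      positive at every lattice point of the cones.\<close>
    have empty: "{k \<in> cone_points \<tau> G. m_nat k \<le> l} = {}" if "\<tau> \<in> compact_faces f" "G \<in> gen_sets D \<tau>" for \<tau> G
    proof -
      have "m_nat k \<noteq> 0" if "k \<in> cone_points \<tau> G" for k
      proof -
        have k: "k \<in> integer_points" "k \<in> face_cone f \<tau>"
          using cone_pointsD[OF \<open>\<tau> \<in> compact_faces f\<close> \<open>G \<in> gen_sets D \<tau>\<close> that] by auto
        then have "0 < m k"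
          using face_cone_pos[OF k(2)] \<open>\<tau> \<in> compact_faces f\<close> by (intro newton_m_pos face_coneD(1)[OF k(2)]) auto
        then show ?thesis
          using m_nat[OF face_coneD(1)[OF k(2)] k(1)] by auto
      qed
      then show ?thesis
        using True by auto
    qed
    have "fps_nth ((\<Sum>\<tau> | \<tau> \<in> compact_faces f \<and> zero_coords \<tau> = {}. L_term f \<tau> * S_cone f \<tau>) +
        (\<Sum>\<tau> | \<tau> \<in> compact_faces f \<and> zero_coords \<tau> \<noteq> {}. L_term' f \<tau> * S_cone' f \<tau> (D \<tau>))) l = 0"
      unfolding formula_coefficient by (intro sum.neutral ballI) (use empty in blast)
    then show ?thesis
      using True by (simp add: zeta_mot_def)
  next
    case False
    then show ?thesis
      unfolding formula_coefficient zeta_coefficient[symmetric] zeta_mot_def by simp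
  qed
qed

end

end

text \<open>Every non-constant monomial vanishes at the origin, so the value there is the constant
  coefficient.\<close>

lemma zero_notin_keys:
  assumes "mpoly_eval f (\<lambda>_. 0) = 0"
  shows "0 \<notin> Poly_Mapping.keys f"
proof
  assume 0: "0 \<in> Poly_Mapping.keys f"
  have "(\<Prod>i\<in>Poly_Mapping.keys \<omega>. (0 :: complex) ^ Poly_Mapping.lookup \<omega> i) = 0"
    if \<omega>: "\<omega> \<noteq> 0" for \<omega> :: "'a \<Rightarrow>\<^sub>0 nat"
  proof -
    obtain i where i: "i \<in> Poly_Mapping.keys \<omega>"
      using \<omega> by (metis keys_eq_empty ex_in_conv)
    show ?thesis
      using i by (intro prod_zero bexI[OF _ i]) (auto simp: in_keys_iff)
  qed
  then have "mpoly_eval f (\<lambda>_. 0) =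
      (\<Sum>\<omega>\<in>Poly_Mapping.keys f. if \<omega> = 0 then Poly_Mapping.lookup f 0 else 0)"
    unfolding mpoly_eval_in_def by (intro sum.cong) auto
  also have "\<dots> = Poly_Mapping.lookup f 0"
    using 0 by simp
  finally show False
    using assms 0 by (simp add: in_keys_iff)
qed

section \<open>Decompositions and cones of compact faces\<close>

context newton
begin

lemma simplicial_decomposition_facts:
  assumes \<tau>: "\<tau> \<in> compact_faces f" and P: "zero_coords \<tau> = {}" and D: "simplicial_decomposition f \<tau> \<D>"
    and G: "G \<in> \<D>"
  shows "finite (integer_points \<inter> half_open_box G)"
    and "v \<in> G \<Longrightarrow> m v \<in> \<int> \<and> 0 < m v"
proof -
  note g = decomposition_gensD[OF D G]
  show "finite (integer_points \<inter> half_open_box G)"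
    by (rule finite_half_open_box[OF compact_face_nonempty[OF \<tau>] compact_face_subset[OF \<tau>] g(1,2)])
  assume "v \<in> G"
  then have "v \<in> G - unit_gens \<tau>"
    using P by (simp add: unit_gens_def)
  then show "m v \<in> \<int> \<and> 0 < m v"
    using non_unit_gen_m[OF \<tau> g, of v] by auto
qed

lemma decomposition_facts:
  assumes \<tau>: "\<tau> \<in> compact_faces f" and P: "zero_coords \<tau> \<noteq> {}" and D: "simplicial_decomposition f \<tau> \<D>"
    and G: "G \<in> \<D>"
  shows "G - unit_gens \<tau> \<noteq> {}"
    and "truncated_simplex_cone \<tau> G \<subseteq> spos_span G"
    and "lattice_term f summable_on (integer_points \<inter> truncated_simplex_cone \<tau> G)"
    and "finite (integer_points \<inter> half_open_box G)"
    and "v \<in> G - unit_gens \<tau> \<Longrightarrow> m v \<in> \<int> \<and> 0 < m v"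
    and "infsum (lattice_term f) (integer_points \<inter> truncated_simplex_cone \<tau> G) =
      Sigma_box f G * (\<Prod>v\<in>G - unit_gens \<tau>. geom (lattice_term f v))"
proof -
  note g = decomposition_gensD[OF D G]
  note eq = truncated_simplex_cone_eq[OF \<tau> g]
  show "G - unit_gens \<tau> \<noteq> {}"
    by (rule non_unit_gen_exists[OF \<tau> g])
  show "truncated_simplex_cone \<tau> G \<subseteq> spos_span G"
    unfolding eq spos_span_eq by (rule simplex_cone_mono) blast
  show "lattice_term f summable_on (integer_points \<inter> truncated_simplex_cone \<tau> G)"
    unfolding eq by (rule lattice_sum_summable[OF locally_finite_truncated[OF \<tau> g]])
  show "finite (integer_points \<inter> half_open_box G)"
    by (rule finite_half_open_box[OF compact_face_nonempty[OF \<tau>] compact_face_subset[OF \<tau>] g(1,2)])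
  show "m v \<in> \<int> \<and> 0 < m v" if "v \<in> G - unit_gens \<tau>"
    using non_unit_gen_m[OF \<tau> g that] by simp
  show "infsum (lattice_term f) (integer_points \<inter> truncated_simplex_cone \<tau> G) =
      Sigma_box f G * (\<Prod>v\<in>G - unit_gens \<tau>. geom (lattice_term f v))"
    unfolding eq by (rule truncated_sum[OF \<tau> g])
qed

lemma compact_face_cone:
  assumes \<tau>: "\<tau> \<in> compact_faces f"
  shows "face_cone f \<tau> = spos_span (facet_normals f \<tau>)"
    and "face_cone f \<tau> \<noteq> {}"
proof -
  obtain k where k: "k \<in> nonneg_orthant" "\<tau> = F k"
    using \<tau> by (rule compact_faceE)
  show "face_cone f \<tau> = spos_span (facet_normals f \<tau>)"
    unfolding k(2) by (rule face_cone_eq_spos_span[OF k(1)])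
  have "k \<in> face_cone f \<tau>"
    using k by (simp add: face_cone_def)
  then show "face_cone f \<tau> \<noteq> {}"
    by blast
qed

text \<open>The cone is non-empty, so the decomposition has a member, and that member has a
  generator outside \<open>unit_gens \<tau>\<close>.\<close>

lemma unit_gens_psubset:
  assumes \<tau>: "\<tau> \<in> compact_faces f" and P: "zero_coords \<tau> \<noteq> {}" and D: "simplicial_decomposition f \<tau> \<D>"
  shows "unit_gens \<tau> \<subset> facet_normals f \<tau>"
proof -
  have "\<D> \<noteq> {}"
    using decompositionD(2)[OF D] compact_face_cone(2)[OF \<tau>] by auto
  then obtain G where G: "G \<in> \<D>"
    by blast
  then show ?thesis
    using unit_gens_subset[OF \<tau>] decomposition_facts(1)[OF \<tau> P D G] decomposition_gensD(1)[OF D G] by blast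
qed

end

theorem theorem10p5:
  fixes f :: "'n::finite cpoly"
    and D :: "(real ^ 'n) set \<Rightarrow> (real ^ 'n) set set"
  assumes "f \<noteq> 0"
    and "mpoly_eval f (\<lambda>_. 0) = 0"
    and "nondegenerate f"
    and "\<And>\<tau>. \<tau> \<in> compact_faces f \<Longrightarrow> zero_coords \<tau> \<noteq> {} \<Longrightarrow>
           simplicial_decomposition f \<tau> (D \<tau>)"
  shows "finite (compact_faces f) \<and>
    zeta_mot f =
      (\<Sum>\<tau> | \<tau> \<in> compact_faces f \<and> zero_coords \<tau> = {}. L_term f \<tau> * S_cone f \<tau>) +
      (\<Sum>\<tau> | \<tau> \<in> compact_faces f \<and> zero_coords \<tau> \<noteq> {}. L_term' f \<tau> * S_cone' f \<tau> (D \<tau>)) \<and>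
    (\<forall>\<tau>\<in>compact_faces f. zero_coords \<tau> = {} \<longrightarrow>
      lattice_term f summable_on (integer_points \<inter> face_cone f \<tau>) \<and>
      (\<forall>\<D>. simplicial_decomposition f \<tau> \<D> \<longrightarrow>
        (\<forall>G\<in>\<D>. finite (integer_points \<inter> half_open_box G)) \<and>
        (\<forall>G\<in>\<D>. \<forall>v\<in>G. newton_m f v \<in> \<int> \<and> 0 < newton_m f v) \<and>
        S_cone f \<tau> = (\<Sum>G\<in>\<D>. Sigma_box f G * (\<Prod>v\<in>G. geom (lattice_term f v))))) \<and>
    (\<forall>\<tau>\<in>compact_faces f. zero_coords \<tau> \<noteq> {} \<longrightarrow>
      (\<forall>\<omega>\<in>Poly_Mapping.keys (face_poly f \<tau>). Poly_Mapping.keys \<omega> \<inter> zero_coords \<tau> = {}) \<and>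
      finite (facet_normals f \<tau>) \<and>
      unit_gens \<tau> \<subset> facet_normals f \<tau> \<and>
      face_cone f \<tau> = spos_span (facet_normals f \<tau>) \<and>
      (\<forall>G\<in>D \<tau>.
        G - unit_gens \<tau> \<noteq> {} \<and>
        truncated_simplex_cone \<tau> G \<subseteq> spos_span G \<and>
        lattice_term f summable_on (integer_points \<inter> truncated_simplex_cone \<tau> G) \<and>
        finite (integer_points \<inter> half_open_box G) \<and>
        (\<forall>v\<in>G - unit_gens \<tau>. newton_m f v \<in> \<int> \<and> 0 < newton_m f v)) \<and>
      S_cone' f \<tau> (D \<tau>) =
        (\<Sum>G\<in>D \<tau>. fps_const ((1 - \<L>\<^sup>-\<^sup>1) ^ (card (zero_coords \<tau>) - card (G \<inter> unit_gens \<tau>))) *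
          (Sigma_box f G * (\<Prod>v\<in>G - unit_gens \<tau>. geom (lattice_term f v)))))"
proof -
  interpret newton f
    using assms(1) zero_notin_keys[OF assms(2)] by unfold_locales
  note D = assms(4)
  show ?thesis
  proof (intro conjI ballI impI allI)
    show "finite (compact_faces f)"
      by (rule finite_compact_faces)
    show "zeta_mot f =
        (\<Sum>\<tau> | \<tau> \<in> compact_faces f \<and> zero_coords \<tau> = {}. L_term f \<tau> * S_cone f \<tau>) +
        (\<Sum>\<tau> | \<tau> \<in> compact_faces f \<and> zero_coords \<tau> \<noteq> {}. L_term' f \<tau> * S_cone' f \<tau> (D \<tau>))"
      by (rule zeta_mot_formula[OF assms(3) D])
  next
    fix \<tau> assume \<tau>: "\<tau> \<in> compact_faces f" and P: "zero_coords \<tau> = {}"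
    show "lattice_term f summable_on (integer_points \<inter> face_cone f \<tau>)"
      by (rule lattice_sum_summable[OF face_cone_locally_finite[OF P]])
    fix \<D> assume \<D>: "simplicial_decomposition f \<tau> \<D>"
    note facts = simplicial_decomposition_facts[OF \<tau> P \<D>]
    show "finite (integer_points \<inter> half_open_box G)" if "G \<in> \<D>" for G
      using facts(1) that .
    show "newton_m f v \<in> \<int>" "0 < newton_m f v" if "G \<in> \<D>" "v \<in> G" for G v
      using facts(2)[OF that] by simp_all
    show "S_cone f \<tau> = (\<Sum>G\<in>\<D>. Sigma_box f G * (\<Prod>v\<in>G. geom (lattice_term f v)))"
      by (rule S_cone_decomposition[OF \<tau> P \<D>])
  next
    fix \<tau> assume \<tau>: "\<tau> \<in> compact_faces f" and P: "zero_coords \<tau> \<noteq> {}"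
    note facts = decomposition_facts[OF \<tau> P D[OF \<tau> P]]
    show "Poly_Mapping.keys \<omega> \<inter> zero_coords \<tau> = {}" if "\<omega> \<in> Poly_Mapping.keys (face_poly f \<tau>)" for \<omega>
      using face_poly_zero_coords[OF that] by (auto simp: in_keys_iff)
    show "finite (facet_normals f \<tau>)"
      by (rule finite_facet_normals)
    show "unit_gens \<tau> \<subset> facet_normals f \<tau>"
      by (rule unit_gens_psubset[OF \<tau> P D[OF \<tau> P]])
    show "face_cone f \<tau> = spos_span (facet_normals f \<tau>)"
      by (rule compact_face_cone(1)[OF \<tau>])
    show "S_cone' f \<tau> (D \<tau>) =
        (\<Sum>G\<in>D \<tau>. fps_const ((1 - \<L>\<^sup>-\<^sup>1) ^ (card (zero_coords \<tau>) - card (G \<inter> unit_gens \<tau>))) *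
          (Sigma_box f G * (\<Prod>v\<in>G - unit_gens \<tau>. geom (lattice_term f v))))"
      unfolding S_cone'_def using facts(6) by (intro sum.cong refl) simp
    fix G assume "G \<in> D \<tau>"
    note g = facts[OF this]
    show "G - unit_gens \<tau> \<noteq> {}" "truncated_simplex_cone \<tau> G \<subseteq> spos_span G"
        "lattice_term f summable_on (integer_points \<inter> truncated_simplex_cone \<tau> G)"
        "finite (integer_points \<inter> half_open_box G)"
      by (fact g)+
    show "newton_m f v \<in> \<int>" "0 < newton_m f v" if "v \<in> G - unit_gens \<tau>" for v
      using g(5)[OF that] by simp_all
  qed
qed

end
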